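(* Let $\Bbbk$ be a field and let $Q$ be a finite quiver such that for any two different vertices $v,w$ of $Q$ there exist four different arrows $\alpha_1,\alpha_2,\beta_1,\beta_2$ of $Q$ with $s(\alpha_1)=s(\alpha_2)=v$, $s(\beta_1)=s(\beta_2)=w$, $t(\alpha_1)=t(\beta_1)$ and $t(\alpha_2)=t(\beta_2)$. Assume moreover that at least one of the following holds: (a) every vertex of $Q$ has outdegree at least $6$; (b) every vertex of $Q$ has outdegree at least $4$ and is the start of a double arrow (two different arrows with the same start and the same target). Then the radical square zero algebra $A=\Bbbk Q/J^2$ has no gaps.
   Context: $s(\alpha)$ and $t(\alpha)$ denote the start and target of an arrow $\alpha$; the outdegree of a vertex is the number of arrows starting at it; $J$ is the ideal of the path algebra $\Bbbk Q$ generated by the arrows. $\operatorname{mod}A$ is the category of finitely generated right $A$-modules, with the convention that for the simple module $S_i$ at vertex $i$ one has $\Omega(S_i)=\bigoplus_{\alpha:i\to j}S_j$. $K_0(A)$ denotes the abelian group generated by all symbols $[M]$, $M\in\operatorname{mod}A$, modulo the relations $[M]-[M']-[M'']$ whenever $M\cong M'\oplus M''$, and $[P]$ for each projective $P$. Let $\Omega(M)$ be the syzygy of $M$ (kernel of a projective cover), and let $\bar\Omega:K_0(A)\to K_0(A)$ be the induced group endomorphism, $\bar\Omega([M])=[\Omega(M)]$. For $M\in\operatorname{mod}A$, $\langle\operatorname{add}M\rangle$ is the subgroup of $K_0(A)$ generated by the classes of the indecomposable direct summands of $M$. The Igusa-Todorov function is $$\phi(M)=\min\{l\ge 0:\ \bar\Omega|_{\bar\Omega^{l+s}\langle\operatorname{add}M\rangle}\text{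 is a monomorphism for all integers } s\ge 0\},$$ and $\phi\dim(A)=\sup\{\phi(M):M\in\operatorname{mod}A\}$. A gap of $A$ is a natural number $t\le\phi\dim(A)$ such that there is no $M\in\operatorname{mod}A$ with $\phi(M)=t$. *)

theory Defs
  imports
    "HOL-Algebra.Algebra"
    "HOL-Library.Extended_Nat"
    "Graph_Theory.Graph_Theory"
begin

section \<open>Finitely generated right modules over a ring\<close>

text \<open>
  The \<^typ>\<open>('a, 'b) module\<close> record of HOL-Algebra is reused for right modules over a
  ring that need not be commutative: \<open>r \<odot>\<^bsub>M\<^esub> x\<close> stands for the right action \<open>x \<cdot> r\<close>, so that
  \<open>(x \<cdot> r) \<cdot> s = x \<cdot> (r s)\<close> becomes the axiom \<open>smult_assoc\<close> below.  The fields \<open>mult\<close> and \<open>one\<close>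
  of the record play no role.
\<close>

locale right_module = R?: ring R + M?: abelian_group M
  for R :: "('a, 'c) ring_scheme" (structure) and M :: "('a, 'b) module" (structure) +
  assumes smult_closed [simp, intro]:
      "\<lbrakk>r \<in> carrier R; x \<in> carrier M\<rbrakk> \<Longrightarrow> r \<odot>\<^bsub>M\<^esub> x \<in> carrier M"
    and smult_l_distr:
      "\<lbrakk>r \<in> carrier R; s \<in> carrier R; x \<in> carrier M\<rbrakk> \<Longrightarrow>
        (r \<oplus>\<^bsub>R\<^esub> s) \<odot>\<^bsub>M\<^esub> x = r \<odot>\<^bsub>M\<^esub> x \<oplus>\<^bsub>M\<^esub> s \<odot>\<^bsub>M\<^esub> x"
    and smult_r_distr:
      "\<lbrakk>r \<in> carrier R; x \<in> carrier M; y \<in> carrier M\<rbrakk> \<Longrightarrow>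
        r \<odot>\<^bsub>M\<^esub> (x \<oplus>\<^bsub>M\<^esub> y) = r \<odot>\<^bsub>M\<^esub> x \<oplus>\<^bsub>M\<^esub> r \<odot>\<^bsub>M\<^esub> y"
    and smult_assoc:
      "\<lbrakk>r \<in> carrier R; s \<in> carrier R; x \<in> carrier M\<rbrakk> \<Longrightarrow>
        (r \<otimes>\<^bsub>R\<^esub> s) \<odot>\<^bsub>M\<^esub> x = s \<odot>\<^bsub>M\<^esub> (r \<odot>\<^bsub>M\<^esub> x)"
    and smult_one [simp]:
      "x \<in> carrier M \<Longrightarrow> \<one>\<^bsub>R\<^esub> \<odot>\<^bsub>M\<^esub> x = x"

definition fin_gen :: "('a, 'c) ring_scheme \<Rightarrow> ('a, 'b) module \<Rightarrow> bool" where
  "fin_gen R M \<longleftrightarrow>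
     (\<exists>S. finite S \<and> S \<subseteq> carrier M \<and>
        (\<forall>x\<in>carrier M. \<exists>r\<in>S \<rightarrow> carrier R. x = (\<Oplus>\<^bsub>M\<^esub>s\<in>S. r s \<odot>\<^bsub>M\<^esub> s)))"

definition mod_hom ::
  "('a, 'c) ring_scheme \<Rightarrow> ('a, 'b) module \<Rightarrow> ('a, 'd) module \<Rightarrow> ('b \<Rightarrow> 'd) set" where
  "mod_hom R M N = {f \<in> carrier M \<rightarrow> carrier N.
     (\<forall>x\<in>carrier M. \<forall>y\<in>carrier M. f (x \<oplus>\<^bsub>M\<^esub> y) = f x \<oplus>\<^bsub>N\<^esub> f y) \<and>
     (\<forall>r\<in>carrier R. \<forall>x\<in>carrier M. f (r \<odot>\<^bsub>M\<^esub> x) = r \<odot>\<^bsub>N\<^esub> f x)}"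

definition mod_iso ::
  "('a, 'c) ring_scheme \<Rightarrow> ('a, 'b) module \<Rightarrow> ('a, 'd) module \<Rightarrow> bool" where
  "mod_iso R M N \<longleftrightarrow> (\<exists>f\<in>mod_hom R M N. bij_betw f (carrier M) (carrier N))"

definition direct_sum :: "('a, 'b) module \<Rightarrow> ('a, 'd) module \<Rightarrow> ('a, 'b \<times> 'd) module" where
  "direct_sum M N =
     \<lparr>carrier = carrier M \<times> carrier N, monoid.mult = undefined, one = undefined,
      ring.zero = (\<zero>\<^bsub>M\<^esub>, \<zero>\<^bsub>N\<^esub>),
      ring.add = (\<lambda>(x, y) (x', y'). (x \<oplus>\<^bsub>M\<^esub> x', y \<oplus>\<^bsub>N\<^esub> y')),
      smult = (\<lambda>r (x, y). (r \<odot>\<^bsub>M\<^esub> x, r \<odot>\<^bsub>N\<^esub> y))\<rparr>"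

text \<open>
  Finitely generated modules over a ring with elements of type \<^typ>\<open>'a\<close> are represented on
  carriers inside \<^typ>\<open>nat \<Rightarrow> 'a\<close>.  Up to isomorphism nothing is lost, see \<open>fg_modules_universe\<close>
  below.
\<close>

type_synonym 'a umodule = "('a, nat \<Rightarrow> 'a) module"

definition fg_modules :: "('a, 'c) ring_scheme \<Rightarrow> 'a umodule set" where
  "fg_modules R = {M. right_module R M \<and> fin_gen R M}"

lemma fg_modules_universe:
  fixes R :: "('a, 'c) ring_scheme" and M :: "('a, 'b) module"
  assumes M: "right_module R M" and fg: "fin_gen R M"
  shows "\<exists>N\<in>fg_modules R. mod_iso R M N"
proof -
  interpret M: right_module R M by (rule M)
  from fg obtain S where S: "finite S" "S \<subseteq> carrier M"
    and "\<forall>x\<in>carrier M. \<exists>r\<in>S \<rightarrow> carrier R. x = (\<Oplus>\<^bsub>M\<^esub>s\<in>S. r s \<odot>\<^bsub>M\<^esub> s)"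
    unfolding fin_gen_def by blast
  then obtain c where c: "\<And>x. x \<in> carrier M \<Longrightarrow> c x \<in> S \<rightarrow> carrier R"
    "\<And>x. x \<in> carrier M \<Longrightarrow> x = (\<Oplus>\<^bsub>M\<^esub>s\<in>S. c x s \<odot>\<^bsub>M\<^esub> s)"
    by metis
  obtain e where e: "bij_betw e {0..<card S} S"
    using ex_bij_betw_nat_finite[OF S(1)] by blast
  define j :: "'b \<Rightarrow> nat \<Rightarrow> 'a" where "j x i = (if i < card S then c x (e i) else \<zero>\<^bsub>R\<^esub>)" for x i
  have j: "inj_on j (carrier M)"
  proof (rule inj_onI)
    fix x y assume xy: "x \<in> carrier M" "y \<in> carrier M" "j x = j y"
    have "c x s = c y s" if s: "s \<in> S" for s
    proof -
      have "s \<in> e ` {0..<card S}" using s e by (simp add: bij_betw_def)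
      then obtain i where "i < card S" "s = e i" by auto
      then show ?thesis using fun_cong[OF xy(3), of i] by (simp add: j_def)
    qed
    then have "(\<Oplus>\<^bsub>M\<^esub>s\<in>S. c x s \<odot>\<^bsub>M\<^esub> s) = (\<Oplus>\<^bsub>M\<^esub>s\<in>S. c y s \<odot>\<^bsub>M\<^esub> s)"
      using c(1)[OF xy(2)] S(2) by (intro M.M.finsum_cong') auto
    then show "x = y" using c(2)[OF xy(1)] c(2)[OF xy(2)] by simp
  qed
  define k where "k = inv_into (carrier M) j"
  have kj [simp]: "k (j x) = x" if "x \<in> carrier M" for x
    using j that by (simp add: k_def)
  define N :: "'a umodule" where
    "N = \<lparr>carrier = j ` carrier M, monoid.mult = undefined, one = undefined, ring.zero = j \<zero>\<^bsub>M\<^esub>,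
          ring.add = (\<lambda>a b. j (k a \<oplus>\<^bsub>M\<^esub> k b)), smult = (\<lambda>r a. j (r \<odot>\<^bsub>M\<^esub> k a))\<rparr>"
  have N [simp]: "carrier N = j ` carrier M" "\<zero>\<^bsub>N\<^esub> = j \<zero>\<^bsub>M\<^esub>"
    "a \<oplus>\<^bsub>N\<^esub> b = j (k a \<oplus>\<^bsub>M\<^esub> k b)" "r \<odot>\<^bsub>N\<^esub> a = j (r \<odot>\<^bsub>M\<^esub> k a)" for a b r
    by (simp_all add: N_def)
  have "abelian_group N"
  proof (rule abelian_groupI)
    fix x assume "x \<in> carrier N"
    then obtain z where z: "z \<in> carrier M" "x = j z" by auto
    then show "\<exists>y\<in>carrier N. y \<oplus>\<^bsub>N\<^esub> x = \<zero>\<^bsub>N\<^esub>"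
      by (intro bexI[of _ "j (\<ominus>\<^bsub>M\<^esub> z)"]) (auto simp: M.M.l_neg)
  qed (auto simp: M.M.a_ac)
  then interpret N: right_module R N
    by (intro right_module.intro right_module_axioms.intro M.R.ring_axioms)
       (auto simp: M.smult_l_distr M.smult_r_distr M.smult_assoc)
  have sum: "j (\<Oplus>\<^bsub>M\<^esub>s\<in>T. r s \<odot>\<^bsub>M\<^esub> s) = (\<Oplus>\<^bsub>N\<^esub>s\<in>j ` T. r (k s) \<odot>\<^bsub>N\<^esub> s)"
    if "T \<subseteq> S" "r \<in> S \<rightarrow> carrier R" for T r
  proof -
    have "finite T" using that S(1) finite_subset by blast
    then show ?thesis using that(1)
    proof (induction T)
      case (insert t T)
      have t: "t \<in> carrier M" "r t \<in> carrier R" using insert.prems S(2) that(2) by auto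
      have T: "T \<subseteq> carrier M" "\<And>s. s \<in> T \<Longrightarrow> r s \<in> carrier R"
        using insert.prems S(2) that(2) by auto
      have "j t \<notin> j ` T" using insert.hyps(2) T(1) t(1) j by (auto simp: inj_on_def subset_iff)
      then have "(\<Oplus>\<^bsub>N\<^esub>s\<in>j ` insert t T. r (k s) \<odot>\<^bsub>N\<^esub> s) =
          r (k (j t)) \<odot>\<^bsub>N\<^esub> j t \<oplus>\<^bsub>N\<^esub> (\<Oplus>\<^bsub>N\<^esub>s\<in>j ` T. r (k s) \<odot>\<^bsub>N\<^esub> s)"
        unfolding image_insert using insert.hyps(1) t T
        by (intro N.M.finsum_insert) (auto dest: subsetD)
      also have "\<dots> = j (r t \<odot>\<^bsub>M\<^esub> t) \<oplus>\<^bsub>N\<^esub> j (\<Oplus>\<^bsub>M\<^esub>s\<in>T. r s \<odot>\<^bsub>M\<^esub> s)"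
        using insert t by simp
      also have "\<dots> = j (\<Oplus>\<^bsub>M\<^esub>s\<in>insert t T. r s \<odot>\<^bsub>M\<^esub> s)"
        using insert.hyps t T M.M.finsum_closed[of "\<lambda>s. r s \<odot>\<^bsub>M\<^esub> s" T]
        by (subst M.M.finsum_insert) (auto simp: subset_iff)
      finally show ?case by simp
    qed simp
  qed
  have "fin_gen R N" unfolding fin_gen_def
  proof (intro exI[of _ "j ` S"] conjI ballI)
    fix x assume "x \<in> carrier N"
    then obtain z where z: "z \<in> carrier M" "x = j z" by auto
    have "x = (\<Oplus>\<^bsub>N\<^esub>s\<in>j ` S. c z (k s) \<odot>\<^bsub>N\<^esub> s)"
      using sum[OF subset_refl c(1)[OF z(1)]] c(2)[OF z(1)] z(2) by simp
    then show "\<exists>r\<in>j ` S \<rightarrow> carrier R. x = (\<Oplus>\<^bsub>N\<^esub>s\<in>j ` S. r s \<odot>\<^bsub>N\<^esub> s)"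
      using c(1)[OF z(1)] S(2) by (intro bexI[of _ "\<lambda>s. c z (k s)"]) (auto simp: subset_iff)
  qed (use S in auto)
  moreover have "j \<in> mod_hom R M N" by (auto simp: mod_hom_def)
  ultimately show ?thesis
    using j N.right_module_axioms
    by (auto simp: fg_modules_def mod_iso_def bij_betw_def intro!: bexI[of _ N] bexI[of _ j])
qed

text \<open>
  The lifting property is tested against modules on \<^typ>\<open>nat \<Rightarrow> 'a\<close>; for finitely generated \<open>P\<close>
  this is projectivity, since the finitely generated free modules occur there.
\<close>

definition projective :: "('a, 'c) ring_scheme \<Rightarrow> 'a umodule \<Rightarrow> bool" where
  "projective R P \<longleftrightarrow> right_module R P \<and>
     (\<forall>(N :: 'a umodule) (L :: 'a umodule) g f.
        right_module R N \<and> right_module R L \<and>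
        g \<in> mod_hom R N L \<and> g ` carrier N = carrier L \<and> f \<in> mod_hom R P L \<longrightarrow>
        (\<exists>h\<in>mod_hom R P N. \<forall>x\<in>carrier P. g (h x) = f x))"

definition mod_ker :: "('a, 'b) module \<Rightarrow> ('a, 'd) module \<Rightarrow> ('b \<Rightarrow> 'd) \<Rightarrow> 'b set" where
  "mod_ker M N f = {x \<in> carrier M. f x = \<zero>\<^bsub>N\<^esub>}"

definition projective_cover ::
  "('a, 'c) ring_scheme \<Rightarrow> 'a umodule \<Rightarrow> ((nat \<Rightarrow> 'a) \<Rightarrow> (nat \<Rightarrow> 'a)) \<Rightarrow> 'a umodule \<Rightarrow> bool" where
  "projective_cover R P f M \<longleftrightarrow>
     P \<in> fg_modules R \<and> projective R P \<and>
     f \<in> mod_hom R P M \<and> f ` carrier P = carrier M \<and>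
     (\<forall>H. submodule H R P \<and> H <+>\<^bsub>P\<^esub> mod_ker P M f = carrier P \<longrightarrow> H = carrier P)"

definition indecomposable :: "('a, 'c) ring_scheme \<Rightarrow> 'a umodule \<Rightarrow> bool" where
  "indecomposable R M \<longleftrightarrow> right_module R M \<and> carrier M \<noteq> {\<zero>\<^bsub>M\<^esub>} \<and>
     (\<forall>(N :: 'a umodule) (N' :: 'a umodule).
        right_module R N \<and> right_module R N' \<and> mod_iso R M (direct_sum N N') \<longrightarrow>
        carrier N = {\<zero>\<^bsub>N\<^esub>} \<or> carrier N' = {\<zero>\<^bsub>N'\<^esub>})"


section \<open>The group \<open>K\<^sub>0\<close> and the Igusa-Todorov function\<close>

text \<open>
  \<open>syzygy R M\<close> is the kernel of a chosen projective cover; it is well defined up to isomorphism,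
  and it is meaningful when \<open>R\<close> is a finite-dimensional algebra, where projective covers exist.
\<close>

definition syzygy :: "('a, 'c) ring_scheme \<Rightarrow> 'a umodule \<Rightarrow> 'a umodule" where
  "syzygy R M =
     (SOME K. \<exists>P f. projective_cover R P f M \<and> K = P\<lparr>carrier := mod_ker P M f\<rparr>)"

abbreviation free_K0 :: "('a, 'c) ring_scheme \<Rightarrow> ('a umodule \<Rightarrow>\<^sub>0 int) monoid" where
  "free_K0 R \<equiv> free_Abelian_group (fg_modules R)"

definition K0_rels :: "('a, 'c) ring_scheme \<Rightarrow> ('a umodule \<Rightarrow>\<^sub>0 int) set" where
  "K0_rels R = generate (free_K0 R)
     ({frag_of M - frag_of M' - frag_of M'' | M M' M''.
         M \<in> fg_modules R \<and> M' \<in> fg_modules R \<and> M'' \<in> fg_modules R \<and>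
         mod_iso R M (direct_sum M' M'')} \<union>
      {frag_of P | P. P \<in> fg_modules R \<and> projective R P})"

definition K0 :: "('a, 'c) ring_scheme \<Rightarrow> ('a umodule \<Rightarrow>\<^sub>0 int) set monoid" where
  "K0 R = free_K0 R Mod K0_rels R"

definition K0_class :: "('a, 'c) ring_scheme \<Rightarrow> 'a umodule \<Rightarrow> ('a umodule \<Rightarrow>\<^sub>0 int) set" where
  "K0_class R M = K0_rels R #>\<^bsub>free_K0 R\<^esub> frag_of M"

text \<open>
  The endomorphism of \<open>K0 R\<close> induced by \<open>[M] \<mapsto> [\<Omega>(M)]\<close>: the linear extension of
  \<open>M \<mapsto> [\<Omega>(M)]\<close> to the free abelian group is constant on each coset \<open>c\<close>.
\<close>

definition Omega_bar ::
  "('a, 'c) ring_scheme \<Rightarrow> ('a umodule \<Rightarrow>\<^sub>0 int) set \<Rightarrow> ('a umodule \<Rightarrow>\<^sub>0 int) set" where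
  "Omega_bar R c =
     the_elem ((\<lambda>p. K0_rels R #>\<^bsub>free_K0 R\<^esub> frag_extend (\<lambda>M. frag_of (syzygy R M)) p) ` c)"

definition add_span :: "('a, 'c) ring_scheme \<Rightarrow> 'a umodule \<Rightarrow> ('a umodule \<Rightarrow>\<^sub>0 int) set set" where
  "add_span R M = generate (K0 R)
     {K0_class R N | N. N \<in> fg_modules R \<and> indecomposable R N \<and>
        (\<exists>N'\<in>fg_modules R. mod_iso R M (direct_sum N N'))}"

definition phi :: "('a, 'c) ring_scheme \<Rightarrow> 'a umodule \<Rightarrow> nat" where
  "phi R M = (LEAST l. \<forall>s. inj_on (Omega_bar R) ((Omega_bar R ^^ (l + s)) ` add_span R M))"

definition phi_dim :: "('a, 'c) ring_scheme \<Rightarrow> enat" where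
  "phi_dim R = (SUP M\<in>fg_modules R. enat (phi R M))"

definition is_gap :: "('a, 'c) ring_scheme \<Rightarrow> nat \<Rightarrow> bool" where
  "is_gap R t \<longleftrightarrow> enat t \<le> phi_dim R \<and> \<not> (\<exists>M\<in>fg_modules R. phi R M = t)"


section \<open>Radical square zero algebras of quivers\<close>

text \<open>
  A finite quiver is a \<^locale>\<open>fin_digraph\<close>, with \<^const>\<open>tail\<close> the start and \<^const>\<open>head\<close> the
  target of an arrow.  A path is given by its start vertex and its list of arrows, in the order
  in which they are traversed; the path with start \<open>u\<close> and no arrows is the trivial path at \<open>u\<close>.
\<close>

definition quiver_paths :: "('v, 'e) pre_digraph \<Rightarrow> ('v \<times> 'e list) set" where
  "quiver_paths Q = {(u, p). \<exists>v. pre_digraph.awalk Q u p v}"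

text \<open>
  Elements are finitely supported coefficient functions on paths.  The product \<open>\<alpha>\<beta>\<close> of two arrows
  is ``first \<open>\<alpha>\<close>, then \<open>\<beta>\<close>''; hence the right module generated by the trivial path at \<open>i\<close> is
  spanned by the paths starting at \<open>i\<close>, in accordance with
  \<open>\<Omega>(S\<^sub>i) = \<Oplus>\<^bsub>\<alpha>: i \<rightarrow> j\<^esub> S\<^sub>j\<close> for right modules.
\<close>

definition path_algebra :: "('v, 'e) pre_digraph \<Rightarrow> ('v \<times> 'e list \<Rightarrow> 'k::field) ring" where
  "path_algebra Q =
     \<lparr>carrier = {f. finite {\<pi>. f \<pi> \<noteq> 0} \<and> {\<pi>. f \<pi> \<noteq> 0} \<subseteq> quiver_paths Q},
      monoid.mult = (\<lambda>f g (u, p). \<Sum>i\<le>length p.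
                f (u, take i p) * g (pre_digraph.awlast Q u (take i p), drop i p)),
      one = (\<lambda>(u, p). if u \<in> verts Q \<and> p = [] then 1 else 0),
      ring.zero = (\<lambda>_. 0),
      ring.add = (\<lambda>f g \<pi>. f \<pi> + g \<pi>)\<rparr>"

lemma ring_path_algebra:
  assumes "fin_digraph Q"
  shows "ring (path_algebra Q :: ('v \<times> 'e list \<Rightarrow> 'k::field) ring)" (is "ring ?R")
proof -
  interpret fin_digraph Q by (rule assms)
  have path_iff: "(u, p) \<in> quiver_paths Q \<longleftrightarrow>
      u \<in> verts Q \<and> set p \<subseteq> arcs Q \<and> cas u p (awlast u p)" for u p
    by (auto simp: quiver_paths_def awalk_def awlast_if_cas)
  have cas_app: "cas u (p @ q) w \<longleftrightarrow> (\<exists>v. cas u p v \<and> cas v q w)" for u p q w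
    by (induction p arbitrary: u) auto
  have path_app: "(u, p @ q) \<in> quiver_paths Q"
    if "(u, p) \<in> quiver_paths Q" "(awlast u p, q) \<in> quiver_paths Q" for u p q
  proof -
    have "cas u p (awlast u p)" "cas (awlast u p) q (awlast (awlast u p) q)"
      using that by (simp_all add: path_iff)
    then have "cas u (p @ q) (awlast (awlast u p) q)" by (auto simp: cas_app)
    moreover have "awlast u (p @ q) = awlast (awlast u p) q" by (simp add: awalk_verts_conv)
    ultimately show ?thesis using that by (simp add: path_iff)
  qed
  have awl: "awlast (awlast u (take i p)) (take l (drop i p)) = awlast u (take (i + l) p)" for u i l p
  proof -
    have "awlast (awlast u q) r = awlast u (q @ r)" for q r by (simp add: awalk_verts_conv)
    then show ?thesis by (simp add: take_add)
  qed
  have end_vert: "awlast u p \<in> verts Q" if "(u, p) \<in> quiver_paths Q" for u p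
    using that by (auto simp: path_iff awalk_verts_conv subset_iff intro!: head_in_verts)
  have closed: "f \<otimes>\<^bsub>?R\<^esub> g \<in> carrier ?R" if f: "f \<in> carrier ?R" and g: "g \<in> carrier ?R" for f g
  proof -
    let ?h = "f \<otimes>\<^bsub>?R\<^esub> g" and ?c = "\<lambda>((u, p), (v, q)). (u, p @ q)"
    let ?F = "{\<pi>. f \<pi> \<noteq> 0}" and ?G = "{\<pi>. g \<pi> \<noteq> 0}"
    have *: "\<exists>p q. f (u, p) \<noteq> 0 \<and> g (awlast u p, q) \<noteq> 0 \<and> r = p @ q" if "?h (u, r) \<noteq> 0" for u r
    proof -
      from that obtain i where "f (u, take i r) * g (awlast u (take i r), drop i r) \<noteq> 0"
        by (auto simp: path_algebra_def elim!: sum.not_neutral_contains_not_neutral)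
      then show ?thesis by (intro exI[of _ "take i r"] exI[of _ "drop i r"]) auto
    qed
    have "{\<pi>. ?h \<pi> \<noteq> 0} \<subseteq> ?c ` (?F \<times> ?G)"
      using * by (fastforce simp: image_iff)
    moreover have "finite ?F" "finite ?G" using f g by (auto simp: path_algebra_def)
    ultimately have "finite {\<pi>. ?h \<pi> \<noteq> 0}" by (meson finite_SigmaI finite_imageI finite_subset)
    moreover have "{\<pi>. ?h \<pi> \<noteq> 0} \<subseteq> quiver_paths Q"
    proof clarify
      fix u r assume "?h (u, r) \<noteq> 0"
      from *[OF this] obtain p q where "f (u, p) \<noteq> 0" "g (awlast u p, q) \<noteq> 0" "r = p @ q" by blast
      then show "(u, r) \<in> quiver_paths Q" using f g by (auto simp: path_algebra_def intro!: path_app)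
    qed
    ultimately show ?thesis by (simp add: path_algebra_def)
  qed
  have assoc: "(f \<otimes>\<^bsub>?R\<^esub> g) \<otimes>\<^bsub>?R\<^esub> h = f \<otimes>\<^bsub>?R\<^esub> (g \<otimes>\<^bsub>?R\<^esub> h)" for f g h
  proof (rule ext, clarify)
    fix u p
    let ?n = "length (p :: 'e list)"
    let ?t = "\<lambda>i l. f (u, take i p) * (g (awlast u (take i p), take l (drop i p)) *
                h (awlast u (take (i + l) p), drop (i + l) p))"
    have "((f \<otimes>\<^bsub>?R\<^esub> g) \<otimes>\<^bsub>?R\<^esub> h) (u, p) = (\<Sum>m\<le>?n. \<Sum>i\<le>m. ?t i (m - i))"
      by (auto simp: path_algebra_def sum_distrib_right mult.assoc min_def drop_take
          intro!: sum.cong)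
    also have "\<dots> = (\<Sum>(i, l)\<in>{(i, l). i + l \<le> ?n}. ?t i l)"
      by (rule sum.triangle_reindex_eq[symmetric])
    also have "{(i, l). i + l \<le> ?n} = (SIGMA i:{..?n}. {..?n - i})" by auto
    also have "(\<Sum>(i, l)\<in>(SIGMA i:{..?n}. {..?n - i}). ?t i l) = (\<Sum>i\<le>?n. \<Sum>l\<le>?n - i. ?t i l)"
      by (subst sum.Sigma) auto
    also have "\<dots> = (f \<otimes>\<^bsub>?R\<^esub> (g \<otimes>\<^bsub>?R\<^esub> h)) (u, p)"
      by (auto simp: path_algebra_def sum_distrib_left awl add.commute intro!: sum.cong)
    finally show "((f \<otimes>\<^bsub>?R\<^esub> g) \<otimes>\<^bsub>?R\<^esub> h) (u, p) = (f \<otimes>\<^bsub>?R\<^esub> (g \<otimes>\<^bsub>?R\<^esub> h)) (u, p)" .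
  qed
  have one_closed: "\<one>\<^bsub>?R\<^esub> \<in> carrier ?R"
  proof -
    have "{\<pi>. \<one>\<^bsub>?R\<^esub> \<pi> \<noteq> 0} = (\<lambda>u. (u, [])) ` verts Q"
      by (auto simp: path_algebra_def split: if_splits)
    then show ?thesis by (auto simp: path_algebra_def path_iff)
  qed
  have mult_eq: "(f \<otimes>\<^bsub>?R\<^esub> g) (u, p) =
      (\<Sum>i\<le>length p. f (u, take i p) * g (awlast u (take i p), drop i p))" for f g u p
    by (simp add: path_algebra_def)
  have one_eq: "\<one>\<^bsub>?R\<^esub> (u, p) = (if u \<in> verts Q \<and> p = [] then 1 else 0)" for u p
    by (simp add: path_algebra_def)
  have l_one: "\<one>\<^bsub>?R\<^esub> \<otimes>\<^bsub>?R\<^esub> f = f" if "f \<in> carrier ?R" for f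
  proof (rule ext, clarify)
    fix u p
    have "(\<one>\<^bsub>?R\<^esub> \<otimes>\<^bsub>?R\<^esub> f) (u, p) =
        (\<Sum>i\<le>length p. if i = 0 then (if u \<in> verts Q then f (u, p) else 0) else 0)"
      unfolding mult_eq one_eq by (rule sum.cong) auto
    also have "\<dots> = f (u, p)" using that by (auto simp: path_algebra_def path_iff)
    finally show "(\<one>\<^bsub>?R\<^esub> \<otimes>\<^bsub>?R\<^esub> f) (u, p) = f (u, p)" .
  qed
  have r_one: "f \<otimes>\<^bsub>?R\<^esub> \<one>\<^bsub>?R\<^esub> = f" if "f \<in> carrier ?R" for f
  proof (rule ext, clarify)
    fix u p
    have "(f \<otimes>\<^bsub>?R\<^esub> \<one>\<^bsub>?R\<^esub>) (u, p) =
        (\<Sum>i\<le>length p. if i = length p then (if awlast u p \<in> verts Q then f (u, p) else 0) else 0)"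
      unfolding mult_eq one_eq by (rule sum.cong) auto
    also have "\<dots> = f (u, p)" using that end_vert[of u p] by (auto simp: path_algebra_def)
    finally show "(f \<otimes>\<^bsub>?R\<^esub> \<one>\<^bsub>?R\<^esub>) (u, p) = f (u, p)" .
  qed
  have add_closed: "f \<oplus>\<^bsub>?R\<^esub> g \<in> carrier ?R" if f: "f \<in> carrier ?R" and g: "g \<in> carrier ?R" for f g
  proof -
    have sub: "{\<pi>. f \<pi> + g \<pi> \<noteq> 0} \<subseteq> {\<pi>. f \<pi> \<noteq> 0} \<union> {\<pi>. g \<pi> \<noteq> 0}" by auto
    then have "finite {\<pi>. f \<pi> + g \<pi> \<noteq> 0}"
      using f g by (auto simp: path_algebra_def intro: finite_subset)
    moreover have "{\<pi>. f \<pi> + g \<pi> \<noteq> 0} \<subseteq> quiver_paths Q"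
      using sub f g by (fastforce simp: path_algebra_def)
    ultimately show ?thesis by (simp add: path_algebra_def)
  qed
  show ?thesis
  proof (rule ringI)
    show "abelian_group ?R"
    proof (rule abelian_groupI)
      fix f assume "f \<in> carrier ?R"
      then show "\<exists>g\<in>carrier ?R. g \<oplus>\<^bsub>?R\<^esub> f = \<zero>\<^bsub>?R\<^esub>"
        by (intro bexI[of _ "\<lambda>\<pi>. - f \<pi>"]) (auto simp: path_algebra_def)
    qed (use add_closed in \<open>auto simp: path_algebra_def add_ac\<close>)
    show "monoid ?R"
      by (rule monoidI) (use closed one_closed assoc l_one r_one in auto)
  qed (auto simp: path_algebra_def fun_eq_iff distrib_left distrib_right sum.distrib)
qed

definition arrow_elem :: "('v, 'e) pre_digraph \<Rightarrow> 'e \<Rightarrow> ('v \<times> 'e list \<Rightarrow> 'k::field)" where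
  "arrow_elem Q \<alpha> = (\<lambda>\<pi>. if \<pi> = (tail Q \<alpha>, [\<alpha>]) then 1 else 0)"

definition arrow_ideal :: "('v, 'e) pre_digraph \<Rightarrow> ('v \<times> 'e list \<Rightarrow> 'k::field) set" where
  "arrow_ideal Q = genideal (path_algebra Q) (arrow_elem Q ` arcs Q)"

definition rad_sq_zero_algebra ::
  "('v, 'e) pre_digraph \<Rightarrow> ('v \<times> 'e list \<Rightarrow> 'k::field) set ring" where
  "rad_sq_zero_algebra Q =
     path_algebra Q Quot (arrow_ideal Q \<cdot>\<^bsub>path_algebra Q\<^esub> arrow_ideal Q)"

end

theory Submission
  imports Defs "HOL-Library.Function_Algebras"
begin

text \<open>
  A syzygy over \<open>A\<close> is, up to projectives, semisimple, and \<open>\<Omega>(S\<^sub>v)\<close> is the sum of the simples at the targets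
  of the arrows leaving \<open>v\<close>.  Hence on the free group spanned by the classes of the simples \<open>\<Omega>\<close> is the
  adjacency operator \<open>T\<close>, and \<open>\<phi>(M) \<le> k + 1\<close> for all \<open>M\<close> as soon as \<open>ker T\<^sup>k\<^sup>+\<^sup>1 = ker T\<^sup>k\<close>.  Otherwise choose
  \<open>y = g - h\<close> with \<open>T\<^sup>k\<^sup>+\<^sup>1 y = 0 \<noteq> T\<^sup>k y\<close> and \<open>g, h \<ge> 0\<close>, and construct two indecomposable modules \<open>M(g)\<close> and
  \<open>M(h)\<close> whose classes differ by an element of which \<open>\<Omega>\<close> is \<open>T y\<close>, and whose classes already differ
  when \<open>y \<noteq> 0\<close>.  Then \<open>\<Omega>\<^sup>k\<close> separates the classes of \<open>M(g)\<close> and \<open>M(h)\<close> while \<open>\<Omega>\<^sup>k\<^sup>+\<^sup>1\<close> does not, and after that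
  only a subgroup of rank one on which \<open>T\<close> is injective remains; so \<open>\<phi>(M(g) \<oplus> M(h)) = k + 1\<close>, and no
  value is skipped.
\<close>

section \<open>Elements of the radical square zero algebra\<close>

text \<open>\<open>phi\<close> sees the whole span of the indecomposable summands, so in a sum of
  many simples further kernel vectors of T could raise the value. Packing g and h into two
  indecomposables leaves a span of rank at most two; once the difference has died, only multiples of
  one nonnegative nonzero vector remain, and T cannot kill it because there are no sinks. The
  multiplicities in y are unbounded, so the modules need arbitrarily many top elements. Two shared
  arrows tie these together by a shift; a third arrow at each vertex is wanted on which g stays
  visible. The first application of Omega carries a class into the span of the simples, and only the
  later ones act as T; hence the offset k + 1. For k = 0 the classes must be separated before any
  syzygy is taken, hence a second invariant. \<open>K0\<close> is never computed: integer functions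
  that are additive on direct sums and vanish on projectives descend to it, and two families of them
  suffice. Indecomposability and the list of summands are read off from endomorphism rings that are
  scalars modulo maps into the radical, which works over every field.\<close>

locale quiver_alg = fin_digraph Q for Q :: "('v, 'e) pre_digraph" +
  fixes R :: "('v \<times> 'e list \<Rightarrow> 'k::field) set ring"
  assumes R_def: "R = rad_sq_zero_algebra Q"
begin

abbreviation PA :: "('v \<times> 'e list \<Rightarrow> 'k) ring" where "PA \<equiv> path_algebra Q"
abbreviation J :: "('v \<times> 'e list \<Rightarrow> 'k) set" where "J \<equiv> arrow_ideal Q"
abbreviation J2 :: "('v \<times> 'e list \<Rightarrow> 'k) set" where "J2 \<equiv> J \<cdot>\<^bsub>PA\<^esub> J"

sublocale PA: ring PA
  by (rule ring_path_algebra) unfold_locales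

lemma PA_simps:
  "carrier PA = {f. finite {\<pi>. f \<pi> \<noteq> 0} \<and> {\<pi>. f \<pi> \<noteq> 0} \<subseteq> quiver_paths Q}"
  "(f \<oplus>\<^bsub>PA\<^esub> g) = (\<lambda>\<pi>. f \<pi> + g \<pi>)" "\<zero>\<^bsub>PA\<^esub> = (\<lambda>_. 0)"
  "(f \<otimes>\<^bsub>PA\<^esub> g) (u, p) = (\<Sum>i\<le>length p. f (u, take i p) * g (awlast u (take i p), drop i p))"
  "\<one>\<^bsub>PA\<^esub> (u, p) = (if u \<in> verts Q \<and> p = [] then 1 else 0)"
  by (simp_all add: path_algebra_def)

lemma PA_outside: "f \<in> carrier PA \<Longrightarrow> \<pi> \<notin> quiver_paths Q \<Longrightarrow> f \<pi> = 0"
  by (auto simp: PA_simps)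

lemma PA_uminus:
  assumes "f \<in> carrier PA" shows "\<ominus>\<^bsub>PA\<^esub> f = (\<lambda>\<pi>. - f \<pi>)"
proof -
  have *: "(\<lambda>\<pi>. - f \<pi>) \<in> carrier PA" using assms by (auto simp: PA_simps)
  show ?thesis
    by (rule PA.minus_equality[OF _ assms *]) (simp add: PA_simps)
qed

lemma nil_path [simp]: "(u, []) \<in> quiver_paths Q \<longleftrightarrow> u \<in> verts Q"
  by (auto simp: quiver_paths_def awalk_def)

lemma arrow_path [simp]: "(u, [\<alpha>]) \<in> quiver_paths Q \<longleftrightarrow> \<alpha> \<in> arcs Q \<and> u = tail Q \<alpha>"
  by (auto simp: quiver_paths_def awalk_def)

lemma Cons_path: "(u, \<alpha> # p) \<in> quiver_paths Q \<longleftrightarrow>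
    \<alpha> \<in> arcs Q \<and> u = tail Q \<alpha> \<and> (head Q \<alpha>, p) \<in> quiver_paths Q"
  by (auto simp: quiver_paths_def awalk_def)

lemma arrow_in_PA: "\<alpha> \<in> arcs Q \<Longrightarrow> arrow_elem Q \<alpha> \<in> carrier PA"
  by (auto simp: PA_simps arrow_elem_def)

lemma J_ideal: "ideal J PA"
  unfolding arrow_ideal_def by (rule PA.genideal_ideal) (auto intro: arrow_in_PA)

lemma J2_ideal: "ideal J2 PA"
  by (rule PA.ideal_prod_is_ideal[OF J_ideal J_ideal])

lemma vanish_ideal: "ideal {f \<in> carrier PA. \<forall>u. f (u, []) = 0} PA"
proof (rule idealI[OF PA.ring_axioms])
  show "subgroup {f \<in> carrier PA. \<forall>u. f (u, []) = 0} (add_monoid PA)"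
  proof (rule PA.add.subgroupI)
    show "{f \<in> carrier PA. \<forall>u. f (u, []) = 0} \<noteq> {}"
      using PA.zero_closed by (auto simp: PA_simps)
  next
    fix f assume "f \<in> {f \<in> carrier PA. \<forall>u. f (u, []) = 0}"
    then show "\<ominus>\<^bsub>PA\<^esub> f \<in> {f \<in> carrier PA. \<forall>u. f (u, []) = 0}"
      using PA.a_inv_closed[of f] PA_uminus[of f] by auto
  next
    fix f g assume "f \<in> {f \<in> carrier PA. \<forall>u. f (u, []) = 0}" "g \<in> {f \<in> carrier PA. \<forall>u. f (u, []) = 0}"
    then show "f \<oplus>\<^bsub>PA\<^esub> g \<in> {f \<in> carrier PA. \<forall>u. f (u, []) = 0}"
      using PA.a_closed[of f g] by (simp add: PA_simps(2))
  qed auto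
next
  fix f g assume "f \<in> {f \<in> carrier PA. \<forall>u. f (u, []) = 0}" "g \<in> carrier PA"
  then show "g \<otimes>\<^bsub>PA\<^esub> f \<in> {f \<in> carrier PA. \<forall>u. f (u, []) = 0}"
    and "f \<otimes>\<^bsub>PA\<^esub> g \<in> {f \<in> carrier PA. \<forall>u. f (u, []) = 0}"
    using PA.m_closed[of f g] PA.m_closed[of g f] by (simp_all add: PA_simps(4))
qed

lemma J_vanish: "f \<in> J \<Longrightarrow> f (u, []) = 0"
proof -
  have "J \<subseteq> {f \<in> carrier PA. \<forall>u. f (u, []) = 0}"
    unfolding arrow_ideal_def
    by (rule PA.genideal_minimal[OF vanish_ideal]) (auto simp: arrow_in_PA, simp add: arrow_elem_def)
  then show "f \<in> J \<Longrightarrow> f (u, []) = 0" by auto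
qed

text \<open>A path of length at most one splits only with a trivial path on one side, and there
  elements of \<open>J\<close> vanish.\<close>

lemma J2_vanish: "f \<in> J2 \<Longrightarrow> length p \<le> 1 \<Longrightarrow> f (u, p) = 0"
proof (induction rule: ideal_prod.induct)
  case (prod i j)
  then show ?case
    by (cases p) (auto simp: PA_simps(4) J_vanish)
qed (simp add: PA_simps(2))

definition single :: "'v \<times> 'e list \<Rightarrow> 'k \<Rightarrow> ('v \<times> 'e list \<Rightarrow> 'k)" where
  "single \<pi> c = (\<lambda>\<pi>'. if \<pi>' = \<pi> then c else 0)"

lemma single_in_PA: "\<pi> \<in> quiver_paths Q \<Longrightarrow> single \<pi> c \<in> carrier PA"
  by (auto simp: PA_simps single_def intro: finite_subset[of _ "{\<pi>}"])

lemma arrow_times_single: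
  "arrow_elem Q \<alpha> \<otimes>\<^bsub>PA\<^esub> single (head Q \<alpha>, q) c = single (tail Q \<alpha>, \<alpha> # q) c"
proof (rule ext, clarify)
  fix u p
  have "(arrow_elem Q \<alpha> \<otimes>\<^bsub>PA\<^esub> single (head Q \<alpha>, q) c) (u, p) =
      (\<Sum>i\<le>length p. if i = 1 then single (tail Q \<alpha>, \<alpha> # q) c (u, p) else 0)"
    unfolding PA_simps(4)
  proof (rule sum.cong[OF refl])
    fix i assume i: "i \<in> {..length p}"
    show "(arrow_elem Q \<alpha> (u, take i p) :: 'k) * single (head Q \<alpha>, q) c (awlast u (take i p), drop i p) =
        (if i = 1 then single (tail Q \<alpha>, \<alpha> # q) c (u, p) else 0)"
    proof (cases "i = 1")
      case True
      with i obtain x r where "p = x # r" by (cases p) auto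
      with True show ?thesis by (auto simp: arrow_elem_def single_def)
    next
      case False
      then have "take i p \<noteq> [\<alpha>]" using i by (auto dest!: arg_cong[where f = length])
      with False show ?thesis by (simp add: arrow_elem_def)
    qed
  qed
  also have "\<dots> = single (tail Q \<alpha>, \<alpha> # q) c (u, p)"
    by (cases p) (auto simp: single_def Suc_le_eq)
  finally show "(arrow_elem Q \<alpha> \<otimes>\<^bsub>PA\<^esub> single (head Q \<alpha>, q) c) (u, p) = single (tail Q \<alpha>, \<alpha> # q) c (u, p)" .
qed

lemma arrow_in_J: "\<alpha> \<in> arcs Q \<Longrightarrow> arrow_elem Q \<alpha> \<in> J"
  unfolding arrow_ideal_def using PA.genideal_self[of "arrow_elem Q ` arcs Q"] arrow_in_PA by blast

lemma single_in_J2: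
  assumes "(u, p) \<in> quiver_paths Q" "1 < length p" shows "single (u, p) c \<in> J2"
proof -
  obtain \<alpha> \<beta> q where p: "p = \<alpha> # \<beta> # q" using assms(2)
    by (cases p; cases "tl p") auto
  have *: "\<alpha> \<in> arcs Q" "\<beta> \<in> arcs Q" "u = tail Q \<alpha>" "head Q \<alpha> = tail Q \<beta>" "(head Q \<beta>, q) \<in> quiver_paths Q"
    using assms(1) by (auto simp: p Cons_path)
  have "single (head Q \<alpha>, \<beta> # q) c \<in> J"
    using arrow_times_single[of \<beta> q c] ideal.I_r_closed[OF J_ideal arrow_in_J[OF *(2)] single_in_PA[OF *(5)], of c] *(4)
    by simp
  then show ?thesis
    using ideal_prod.prod[OF arrow_in_J[OF *(1)], of "single (head Q \<alpha>, \<beta> # q) c" J PA]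
    by (simp add: arrow_times_single *(3) p)
qed

text \<open>Membership in \<open>J2\<close> becomes a condition on coefficients. Products of
  elements of \<open>J\<close> have no short paths; conversely, a finitely supported function is a
  sum of multiples of single paths, and a path of length at least two is its first arrow times a
  rest in \<open>J\<close>. This gives the quotient explicit coordinates.\<close>

lemma J2_eq: "J2 = {f \<in> carrier PA. \<forall>u p. length p \<le> 1 \<longrightarrow> f (u, p) = 0}"
proof (intro equalityI subsetI CollectI conjI allI impI)
  fix f assume f: "f \<in> J2"
  then show "f \<in> carrier PA" using PA.ideal_prod_in_carrier[OF J_ideal J_ideal] by blast
  show "f (u, p) = 0" if "length p \<le> 1" for u p using J2_vanish[OF f that] .
next
  interpret J2: ideal J2 PA by (rule J2_ideal)
  \<comment> \<open>Induction on a finite set containing the support, splitting off one path at a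
    time.\<close>
  have "\<forall>f. f \<in> carrier PA \<longrightarrow> {\<pi>. f \<pi> \<noteq> 0} \<subseteq> S \<longrightarrow> f \<in> J2"
    if "finite S" "S \<subseteq> {(u, p). 1 < length p}" for S
    using that
  proof (induction S)
    case empty
    have "f = \<zero>\<^bsub>PA\<^esub>" if "{\<pi>. f \<pi> \<noteq> 0} \<subseteq> {}" for f :: "'v \<times> 'e list \<Rightarrow> 'k"
      using that by (auto simp: PA_simps(3) fun_eq_iff)
    then show ?case using J2.zero_closed by metis
  next
    case (insert \<pi> S)
    show ?case
    proof (intro allI impI)
      fix f assume f: "f \<in> carrier PA" "{\<pi>. f \<pi> \<noteq> 0} \<subseteq> insert \<pi> S"
      show "f \<in> J2"
      proof (cases "f \<pi> = 0")
        case True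
        then show ?thesis using f insert by blast
      next
        case False
        then have \<pi>: "\<pi> \<in> quiver_paths Q" using f PA_outside by blast
        have "f(\<pi> := 0) \<in> carrier PA" using f(1)
          by (auto simp: PA_simps elim!: finite_subset[rotated])
        moreover have "{\<pi>'. (f(\<pi> := 0)) \<pi>' \<noteq> 0} \<subseteq> S" using f(2) by (auto simp: fun_upd_def)
        ultimately have "f(\<pi> := 0) \<in> J2" using insert by blast
        moreover have "single \<pi> (f \<pi>) \<in> J2"
          using single_in_J2[of "fst \<pi>" "snd \<pi>"] \<pi> insert.prems by (auto simp: case_prod_beta)
        moreover have "f = f(\<pi> := 0) \<oplus>\<^bsub>PA\<^esub> single \<pi> (f \<pi>)"
          by (auto simp: PA_simps(2) single_def)
        ultimately show ?thesis using J2.a_closed by metis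
      qed
    qed
  qed
  moreover fix f assume "f \<in> {f \<in> carrier PA. \<forall>u p. length p \<le> 1 \<longrightarrow> f (u, p) = 0}"
  then have "f \<in> carrier PA" "finite {\<pi>. f \<pi> \<noteq> 0}" "{\<pi>. f \<pi> \<noteq> 0} \<subseteq> {(u, p). 1 < length p}"
    by (auto simp: PA_simps(1)) (meson not_le_imp_less)
  ultimately show "f \<in> J2" by blast
qed

definition cls :: "('v \<times> 'e list \<Rightarrow> 'k) \<Rightarrow> ('v \<times> 'e list \<Rightarrow> 'k) set" where
  "cls f = J2 +>\<^bsub>PA\<^esub> f"

lemma R_ring: "ring R"
  unfolding R_def rad_sq_zero_algebra_def by (rule ideal.quotient_is_ring[OF J2_ideal])

sublocale R: ring R by (rule R_ring)

lemma cls_hom: "ring_hom_ring PA R cls"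
  using ideal.rcos_ring_hom_ring[OF J2_ideal]
  unfolding R_def rad_sq_zero_algebra_def cls_def[abs_def] .

lemma cls_surj: "a \<in> carrier R \<Longrightarrow> \<exists>f\<in>carrier PA. a = cls f"
  by (auto simp: R_def rad_sq_zero_algebra_def FactRing_def A_RCOSETS_def' cls_def)

lemma cls_eq_iff:
  assumes f: "f \<in> carrier PA" and g: "g \<in> carrier PA"
  shows "cls f = cls g \<longleftrightarrow> (\<forall>u p. length p \<le> 1 \<longrightarrow> f (u, p) = g (u, p))"
proof -
  interpret J2: ideal J2 PA by (rule J2_ideal)
  have "cls f = cls g \<longleftrightarrow> f \<in> J2 +>\<^bsub>PA\<^esub> g"
    unfolding cls_def using J2.a_repr_independence'[of f g] J2.a_rcos_self[OF f] f g by auto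
  also have "\<dots> \<longleftrightarrow> f \<ominus>\<^bsub>PA\<^esub> g \<in> J2" using J2.a_rcos_module_minus[OF PA.ring_axioms] f g by blast
  also have "\<dots> \<longleftrightarrow> (\<forall>u p. length p \<le> 1 \<longrightarrow> f (u, p) = g (u, p))"
  proof -
    have "f \<ominus>\<^bsub>PA\<^esub> g = (\<lambda>\<pi>. f \<pi> - g \<pi>)"
      unfolding a_minus_def PA_uminus[OF g] PA_simps(2) by simp
    then show ?thesis using PA.minus_closed[OF f g] unfolding J2_eq by auto
  qed
  finally show ?thesis .
qed

lemma length_le_1: "length p \<le> Suc 0 \<longleftrightarrow> p = [] \<or> (\<exists>\<alpha>. p = [\<alpha>])"
  by (cases p) (auto simp: length_Suc_conv)

lemma cls_eq_iff':
  assumes "f \<in> carrier PA" "g \<in> carrier PA"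
  shows "cls f = cls g \<longleftrightarrow> (\<forall>u. f (u, []) = g (u, [])) \<and> (\<forall>u \<alpha>. f (u, [\<alpha>]) = g (u, [\<alpha>]))"
proof -
  have "(\<forall>u p. length p \<le> 1 \<longrightarrow> f (u, p) = g (u, p)) \<longleftrightarrow>
      (\<forall>u. f (u, []) = g (u, [])) \<and> (\<forall>u \<alpha>. f (u, [\<alpha>]) = g (u, [\<alpha>]))" (is "?l = ?r")
  proof
    show ?r if ?l using that by simp
    show ?l if ?r
    proof (intro allI impI)
      fix u :: 'v and p :: "'e list" assume "length p \<le> 1"
      then consider "p = []" | \<alpha> where "p = [\<alpha>]" by (auto simp: length_le_1)
      then show "f (u, p) = g (u, p)" using that by cases simp_all
    qed
  qed
  with cls_eq_iff[OF assms] show ?thesis by (rule trans)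
qed

text \<open>The canonical representative of a residue class. Values outside the quiver are forced to
  zero, so that \<open>g\<close> and \<open>h\<close> may be arbitrary functions.\<close>

definition short :: "('v \<Rightarrow> 'k) \<Rightarrow> ('e \<Rightarrow> 'k) \<Rightarrow> ('v \<times> 'e list \<Rightarrow> 'k)" where
  "short g h = (\<lambda>(u, p). if p = [] then (if u \<in> verts Q then g u else 0)
     else if length p = 1 \<and> hd p \<in> arcs Q \<and> u = tail Q (hd p) then h (hd p) else 0)"

lemma short_simps [simp]:
  "short g h (u, []) = (if u \<in> verts Q then g u else 0)"
  "short g h (u, [\<alpha>]) = (if \<alpha> \<in> arcs Q \<and> u = tail Q \<alpha> then h \<alpha> else 0)"
  by (simp_all add: short_def)

lemma short_in_PA [simp]: "short g h \<in> carrier PA"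
proof -
  have "{\<pi>. short g h \<pi> \<noteq> 0} \<subseteq> (\<lambda>u. (u, [])) ` verts Q \<union> (\<lambda>\<alpha>. (tail Q \<alpha>, [\<alpha>])) ` arcs Q"
    by (auto simp: short_def length_Suc_conv split: if_splits)
  moreover have "finite \<dots>" by auto
  ultimately have "finite {\<pi>. short g h \<pi> \<noteq> 0}" by (rule finite_subset)
  moreover have "{\<pi>. short g h \<pi> \<noteq> 0} \<subseteq> quiver_paths Q"
    by (auto simp: short_def length_Suc_conv split: if_splits)
  ultimately show ?thesis by (simp add: PA_simps)
qed

lemma cls_eq_short:
  assumes "f \<in> carrier PA"
  shows "cls f = cls (short (\<lambda>v. f (v, [])) (\<lambda>\<alpha>. f (tail Q \<alpha>, [\<alpha>])))"
proof -
  have "f (u, []) = 0" if "u \<notin> verts Q" for u using PA_outside[OF assms, of "(u, [])"] that by simp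
  moreover have "f (u, [\<alpha>]) = 0" if "\<alpha> \<notin> arcs Q \<or> u \<noteq> tail Q \<alpha>" for u \<alpha>
    using PA_outside[OF assms, of "(u, [\<alpha>])"] that by simp
  ultimately show ?thesis unfolding cls_eq_iff'[OF assms short_in_PA]
    by auto
qed

definition el :: "('v \<Rightarrow> 'k) \<Rightarrow> ('e \<Rightarrow> 'k) \<Rightarrow> ('v \<times> 'e list \<Rightarrow> 'k) set" where
  "el g h = cls (short g h)"

lemma el_closed [simp, intro]: "el g h \<in> carrier R"
proof -
  interpret h: ring_hom_ring PA R cls by (rule cls_hom)
  show ?thesis by (simp add: el_def)
qed

lemma el_exhaust: assumes "a \<in> carrier R" obtains g h where "a = el g h"
proof -
  from cls_surj[OF assms] obtain f where f: "f \<in> carrier PA" "a = cls f" by blast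
  show thesis
    by (rule that[of "\<lambda>v. f (v, [])" "\<lambda>\<alpha>. f (tail Q \<alpha>, [\<alpha>])"])
      (use cls_eq_short[OF f(1)] f(2) in \<open>simp only: el_def\<close>)
qed

lemma el_eq_iff: "el g h = el g' h' \<longleftrightarrow> (\<forall>v\<in>verts Q. g v = g' v) \<and> (\<forall>\<alpha>\<in>arcs Q. h \<alpha> = h' \<alpha>)"
proof -
  show ?thesis unfolding el_def cls_eq_iff'[OF short_in_PA short_in_PA] by auto
qed

lemma el_cong: "(\<And>v. v \<in> verts Q \<Longrightarrow> g v = g' v) \<Longrightarrow> (\<And>\<alpha>. \<alpha> \<in> arcs Q \<Longrightarrow> h \<alpha> = h' \<alpha>) \<Longrightarrow> el g h = el g' h'"
  by (simp add: el_eq_iff)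

lemma el_add: "el g h \<oplus>\<^bsub>R\<^esub> el g' h' = el (g + g') (h + h')"
proof -
  interpret h: ring_hom_ring PA R cls by (rule cls_hom)
  have "short g h \<oplus>\<^bsub>PA\<^esub> short g' h' \<in> carrier PA" by simp
  then have "cls (short g h \<oplus>\<^bsub>PA\<^esub> short g' h') = cls (short (g + g') (h + h'))"
    by (subst cls_eq_iff') (auto simp: PA_simps(2))
  then show ?thesis unfolding el_def h.hom_add[OF short_in_PA short_in_PA] .
qed

lemma el_mult: "el g h \<otimes>\<^bsub>R\<^esub> el g' h' =
   el (\<lambda>v. g v * g' v) (\<lambda>\<alpha>. g (tail Q \<alpha>) * h' \<alpha> + h \<alpha> * g' (head Q \<alpha>))"
proof -
  interpret h: ring_hom_ring PA R cls by (rule cls_hom)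
  let ?s = "short (\<lambda>v. g v * g' v) (\<lambda>\<alpha>. g (tail Q \<alpha>) * h' \<alpha> + h \<alpha> * g' (head Q \<alpha>))"
  have c: "short g h \<otimes>\<^bsub>PA\<^esub> short g' h' \<in> carrier PA" by simp
  have 1: "(short g h \<otimes>\<^bsub>PA\<^esub> short g' h') (u, []) = ?s (u, [])" for u
    unfolding PA_simps(4) by simp
  have "awlast u [\<alpha>] = head Q \<alpha>" for u \<alpha> by simp
  then have 2: "(short g h \<otimes>\<^bsub>PA\<^esub> short g' h') (u, [\<alpha>]) = ?s (u, [\<alpha>])" for u \<alpha>
    unfolding PA_simps(4) by (cases "\<alpha> \<in> arcs Q") simp_all
  have "cls (short g h \<otimes>\<^bsub>PA\<^esub> short g' h') = cls ?s"
    unfolding cls_eq_iff'[OF c short_in_PA] using 1 2 by blast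
  then show ?thesis unfolding el_def h.hom_mult[OF short_in_PA short_in_PA] .
qed

lemma el_one: "\<one>\<^bsub>R\<^esub> = el 1 0"
proof -
  interpret h: ring_hom_ring PA R cls by (rule cls_hom)
  have "cls \<one>\<^bsub>PA\<^esub> = cls (short 1 0)"
    by (subst cls_eq_iff') (auto simp: PA_simps(5))
  then show ?thesis by (simp add: el_def)
qed

lemma el_zero: "\<zero>\<^bsub>R\<^esub> = el 0 0"
proof -
  interpret h: ring_hom_ring PA R cls by (rule cls_hom)
  have "cls \<zero>\<^bsub>PA\<^esub> = cls (short 0 0)"
    by (subst cls_eq_iff'[OF PA.zero_closed short_in_PA]) (auto simp: PA_simps(3))
  then show ?thesis by (simp add: el_def)
qed

text \<open>\<open>sc c\<close> is the central copy of a field element. The modules carry no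
  separate scalar multiplication, so their vector space structure is recovered from these
  elements.\<close>

definition sc :: "'k \<Rightarrow> ('v \<times> 'e list \<Rightarrow> 'k) set" where "sc c = el (\<lambda>_. c) 0"
definition ev :: "'v \<Rightarrow> ('v \<times> 'e list \<Rightarrow> 'k) set" where "ev v = el (\<lambda>u. if u = v then 1 else 0) 0"
definition ar :: "'e \<Rightarrow> ('v \<times> 'e list \<Rightarrow> 'k) set" where "ar \<alpha> = el 0 (\<lambda>\<beta>. if \<beta> = \<alpha> then 1 else 0)"

lemma gens_closed [simp, intro]: "sc c \<in> carrier R" "ev v \<in> carrier R" "ar \<alpha> \<in> carrier R"
  by (auto simp: sc_def ev_def ar_def)

text \<open>The coordinates of an element of \<open>R\<close> with respect to the trivial paths and the arrows.\<close>

definition coef :: "('v \<times> 'e list \<Rightarrow> 'k) set \<Rightarrow> ('v \<Rightarrow> 'k) \<times> ('e \<Rightarrow> 'k)" where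
  "coef a = (SOME gh. a = el (fst gh) (snd gh))"
abbreviation "cv a \<equiv> fst (coef a)"
abbreviation "ca a \<equiv> snd (coef a)"

lemma el_coef: assumes "a \<in> carrier R" shows "el (cv a) (ca a) = a"
proof -
  have "\<exists>gh. a = el (fst gh) (snd gh)" using el_exhaust[OF assms] by (metis fst_conv snd_conv)
  then have "a = el (fst (coef a)) (snd (coef a))" unfolding coef_def by (rule someI_ex)
  then show ?thesis by (rule sym)
qed

lemma coef_el [simp]: "v \<in> verts Q \<Longrightarrow> cv (el g h) v = g v" "\<alpha> \<in> arcs Q \<Longrightarrow> ca (el g h) \<alpha> = h \<alpha>"
  using el_coef[OF el_closed, of g h] unfolding el_eq_iff by auto

end

section \<open>Linear algebra in spaces of functions into the field\<close>

definition fs :: "'k::field \<Rightarrow> ('x \<Rightarrow> 'k) \<Rightarrow> 'x \<Rightarrow> 'k" where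
  "fs c f = (\<lambda>x. c * f x)"

lemma fs_apply: "fs c f x = c * f x"
  by (simp add: fs_def)

global_interpretation fv: vector_space "fs :: 'k::field \<Rightarrow> ('x \<Rightarrow> 'k) \<Rightarrow> 'x \<Rightarrow> 'k"
  by unfold_locales (auto simp: fs_def algebra_simps)

global_interpretation fp: vector_space_pair
  "fs :: 'k::field \<Rightarrow> ('x \<Rightarrow> 'k) \<Rightarrow> 'x \<Rightarrow> 'k" "fs :: 'k::field \<Rightarrow> ('y \<Rightarrow> 'k) \<Rightarrow> 'y \<Rightarrow> 'k"
  by unfold_locales

abbreviation flin :: "(('x \<Rightarrow> 'k::field) \<Rightarrow> ('y \<Rightarrow> 'k)) \<Rightarrow> bool" where
  "flin \<equiv> Vector_Spaces.linear fs fs"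

lemma flinI: "(\<And>x y. f (x + y) = f x + f y) \<Longrightarrow> (\<And>c x. f (fs c x) = fs c (f x)) \<Longrightarrow> flin f"
  by (simp add: Vector_Spaces.linear_iff fv.vector_space_axioms)

lemma flinD:
  assumes "flin f"
  shows "f (x + y) = f x + f y" "f (fs c x) = fs c (f x)" "f 0 = 0" "f (sum g S) = (\<Sum>s\<in>S. f (g s))"
    "f (x - y) = f x - f y"
  by (fact fp.linear_add[OF assms] fp.linear_scale[OF assms] fp.linear_0[OF assms]
      fp.linear_sum[OF assms] fp.linear_diff[OF assms])+

text \<open>The ambient function space may have infinite dimension, while the cardinality behind
  \<open>fv.dim\<close> is informative for finite bases only; finiteness is therefore carried along
  as a property of subsets.\<close>

definition fin_dim :: "('x \<Rightarrow> 'k::field) set \<Rightarrow> bool" where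
  "fin_dim V \<longleftrightarrow> (\<exists>B. finite B \<and> V \<subseteq> fv.span B)"

lemma fin_dim_subset: "fin_dim V \<Longrightarrow> U \<subseteq> V \<Longrightarrow> fin_dim U"
  unfolding fin_dim_def by blast

lemma fin_dim_span: "fin_dim V \<Longrightarrow> fin_dim (fv.span V)"
  unfolding fin_dim_def by (meson fv.span_minimal fv.subspace_span)

lemma fin_dim_independent_finite:
  assumes "fin_dim V" "fv.independent B" "B \<subseteq> V" shows "finite B"
proof -
  obtain C where "finite C" "V \<subseteq> fv.span C" using assms(1) by (auto simp: fin_dim_def)
  then show ?thesis using fv.independent_span_bound[of C B] assms by auto
qed

lemma fin_dim_image:
  assumes "flin f" "fin_dim V" shows "fin_dim (f ` V)"
proof -
  obtain C where "finite C" "V \<subseteq> fv.span C" using assms(2) by (auto simp: fin_dim_def)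
  then have "finite (f ` C)" "f ` V \<subseteq> fv.span (f ` C)"
    using fp.linear_span_image[OF assms(1), of C] by auto
  then show ?thesis unfolding fin_dim_def by blast
qed

lemma finite_basis:
  assumes "fv.subspace V" "fin_dim V"
  obtains B where "finite B" "B \<subseteq> V" "fv.independent B" "V = fv.span B" "card B = fv.dim V"
proof -
  obtain B where B: "B \<subseteq> V" "fv.independent B" "V \<subseteq> fv.span B" "card B = fv.dim V"
    by (rule fv.basis_exists)
  then have "V = fv.span B" using fv.span_minimal[OF B(1) assms(1)] by blast
  then show thesis using that B fin_dim_independent_finite[OF assms(2) B(2,1)] by blast
qed

text \<open>The coordinate space on \<open>B\<close>; for finite \<open>B\<close> the functions
  \<open>unitf b\<close> form its basis.\<close>

definition fspace :: "'x set \<Rightarrow> ('x \<Rightarrow> 'k::field) set" where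
  "fspace B = {f. \<forall>x. x \<notin> B \<longrightarrow> f x = 0}"

definition unitf :: "'x \<Rightarrow> 'x \<Rightarrow> 'k::field" where
  "unitf b = (\<lambda>x. if x = b then 1 else 0)"

lemma fspaceD: "f \<in> fspace B \<Longrightarrow> x \<notin> B \<Longrightarrow> f x = 0"
  by (simp add: fspace_def)

lemma subspace_fspace [simp]: "fv.subspace (fspace B)"
  by (auto simp: fv.subspace_def fspace_def fs_apply)

lemma unitf_in [simp]: "unitf b \<in> fspace B \<longleftrightarrow> b \<in> B"
  by (auto simp: fspace_def unitf_def)

lemma unitf_inj: "inj_on unitf B"
  by (rule inj_onI) (metis unitf_def zero_neq_one)

lemma sum_apply: "(\<Sum>s\<in>S. g s) x = (\<Sum>s\<in>S. g s x)" for g :: "'s \<Rightarrow> 'x \<Rightarrow> 'k::field"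
  by (induction S rule: infinite_finite_induct) auto

lemma fspace_expand:
  assumes "finite B" "f \<in> fspace B" shows "f = (\<Sum>b\<in>B. fs (f b) (unitf b))"
proof
  fix x
  have "(\<Sum>b\<in>B. fs (f b) (unitf b)) x = (\<Sum>b\<in>B. if x = b then f b else 0)"
    unfolding sum_apply by (rule sum.cong) (auto simp: unitf_def fs_apply)
  also have "\<dots> = f x" using assms by (simp add: fspace_def)
  finally show "f x = (\<Sum>b\<in>B. fs (f b) (unitf b)) x" by simp
qed

lemma span_unitf:
  assumes "finite B" shows "fv.span (unitf ` B) = (fspace B :: ('x \<Rightarrow> 'k::field) set)"
proof
  show "fv.span (unitf ` B) \<subseteq> (fspace B :: ('x \<Rightarrow> 'k) set)"
    by (rule fv.span_minimal) auto
  show "(fspace B :: ('x \<Rightarrow> 'k) set) \<subseteq> fv.span (unitf ` B)"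
  proof
    fix f :: "'x \<Rightarrow> 'k" assume "f \<in> fspace B"
    then have "f = (\<Sum>b\<in>B. fs (f b) (unitf b))" by (rule fspace_expand[OF assms])
    also have "\<dots> \<in> fv.span (unitf ` B)"
      by (intro fv.span_sum fv.span_scale fv.span_base) auto
    finally show "f \<in> fv.span (unitf ` B)" .
  qed
qed

lemma independent_unitf:
  assumes "finite B" shows "fv.independent (unitf ` B :: ('x \<Rightarrow> 'k::field) set)"
proof (rule fv.independent_if_scalars_zero)
  show "finite (unitf ` B :: ('x \<Rightarrow> 'k) set)" using assms by simp
next
  fix g :: "('x \<Rightarrow> 'k) \<Rightarrow> 'k" and y :: "'x \<Rightarrow> 'k"
  assume g: "(\<Sum>x\<in>unitf ` B. fs (g x) x) = 0" and y: "y \<in> unitf ` B"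
  obtain b where b: "b \<in> B" "y = unitf b" using y by blast
  have "0 = (\<Sum>x\<in>unitf ` B. fs (g x) x) b" using g by simp
  also have "\<dots> = (\<Sum>a\<in>B. fs (g (unitf a)) (unitf a)) b"
    by (subst sum.reindex[OF unitf_inj]) simp
  also have "\<dots> = (\<Sum>a\<in>B. if b = a then g (unitf a) else 0)"
    unfolding sum_apply by (rule sum.cong) (auto simp: unitf_def fs_apply)
  also have "\<dots> = g y" using assms b by simp
  finally show "g y = 0" by simp
qed

lemma dim_fspace: assumes "finite B" shows "fv.dim (fspace B :: ('x \<Rightarrow> 'k::field) set) = card B"
proof -
  have "fv.dim (fspace B :: ('x \<Rightarrow> 'k) set) = card (unitf ` B :: ('x \<Rightarrow> 'k) set)"
    unfolding span_unitf[OF assms, symmetric]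
    by (rule fv.dim_span_eq_card_independent[OF independent_unitf[OF assms]])
  then show ?thesis by (simp add: card_image[OF unitf_inj])
qed

lemma fin_dim_fspace [simp]: "finite B \<Longrightarrow> fin_dim (fspace B)"
  unfolding fin_dim_def by (rule exI[of _ "unitf ` B"]) (simp add: span_unitf)

lemma dim_flin_image:
  assumes f: "flin f" and inj: "inj_on f (fv.span S)"
  shows "fv.dim (f ` S) = fv.dim S"
proof -
  obtain B where B: "B \<subseteq> S" "fv.independent B" "S \<subseteq> fv.span B" "card B = fv.dim S"
    by (rule fv.basis_exists)
  have sp: "fv.span B = fv.span S" using B by (meson fv.span_mono fv.span_minimal fv.subspace_span subset_antisym)
  have "fv.independent (f ` B)"
    by (rule fp.linear_independent_injective_image[OF f B(2)]) (simp add: sp inj)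
  moreover have "fv.span (f ` B) = fv.span (f ` S)"
    unfolding fp.linear_span_image[OF f] sp ..
  ultimately have "fv.dim (f ` S) = card (f ` B)" by (intro fv.dim_eq_card)
  also have "\<dots> = card B"
    by (rule card_image) (use inj sp fv.span_superset inj_on_subset in metis)
  finally show ?thesis using B by simp
qed

text \<open>A module homomorphism is constrained on its carrier only, whereas the linear algebra
  concerns globally linear maps. \<open>lin_on\<close> is what a homomorphism provides, and
  \<open>lin_on_extend\<close> passes to a global map through a basis.\<close>

definition lin_on :: "('x \<Rightarrow> 'k::field) set \<Rightarrow> (('x \<Rightarrow> 'k) \<Rightarrow> ('y \<Rightarrow> 'k)) \<Rightarrow> bool" where
  "lin_on V f \<longleftrightarrow> (\<forall>x\<in>V. \<forall>y\<in>V. f (x + y) = f x + f y) \<and> (\<forall>c. \<forall>x\<in>V. f (fs c x) = fs c (f x))"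

lemma lin_on_extend:
  assumes V: "fv.subspace V" and f: "lin_on V f"
  obtains g where "flin g" "\<And>x. x \<in> V \<Longrightarrow> g x = f x"
proof -
  obtain B where B: "B \<subseteq> V" "fv.independent B" "V \<subseteq> fv.span B" "card B = fv.dim V"
    by (rule fv.basis_exists)
  define g where "g = fp.construct B f"
  have g: "flin g" unfolding g_def by (rule fp.linear_construct[OF B(2)])
  have "fv.subspace {x \<in> V. g x = f x}"
  proof (rule fv.subspaceI)
    have "f 0 = 0" using f fv.subspace_0[OF V] unfolding lin_on_def by (metis fv.scale_zero_left)
    then show "0 \<in> {x \<in> V. g x = f x}" using fv.subspace_0[OF V] by (simp add: flinD[OF g])
  qed (use V f g in \<open>auto simp: flinD[OF g] lin_on_def fv.subspace_add fv.subspace_scale\<close>)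
  moreover have "B \<subseteq> {x \<in> V. g x = f x}"
    using B by (auto simp: g_def fp.construct_basis)
  ultimately have "fv.span B \<subseteq> {x \<in> V. g x = f x}" by (rule fv.span_minimal[rotated])
  with B(3) g that show thesis by blast
qed

lemma dim_lin_on_image:
  assumes V: "fv.subspace V" and f: "lin_on V f" "inj_on f V" and S: "S \<subseteq> V"
  shows "fv.dim (f ` S) = fv.dim S"
proof -
  obtain g where g: "flin g" "\<And>x. x \<in> V \<Longrightarrow> g x = f x" using lin_on_extend[OF V f(1)] by blast
  have sp: "fv.span S \<subseteq> V" by (rule fv.span_minimal[OF S V])
  have "inj_on g (fv.span S)" using f(2) g(2) sp by (auto simp: inj_on_def subset_iff)
  from dim_flin_image[OF g(1) this] show ?thesis using g(2) S by (metis image_cong subsetD)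
qed

text \<open>Formulated for arbitrary sets, whose dimension is that of their span, since the radical
  will be given by a spanning set. A basis of the first span is added to one of the second, vector
  by vector.\<close>

lemma dim_Un_disjoint:
  assumes fd: "fin_dim S" "fin_dim S'" and int: "fv.span S \<inter> fv.span S' \<subseteq> {0}"
  shows "fv.dim (S \<union> S') = fv.dim S + fv.dim S'"
proof -
  obtain B where B: "finite B" "B \<subseteq> fv.span S" "fv.independent B" "fv.span S = fv.span B" "card B = fv.dim (fv.span S)"
    using finite_basis[OF fv.subspace_span fin_dim_span[OF fd(1)]] by metis
  obtain B' where B': "finite B'" "B' \<subseteq> fv.span S'" "fv.independent B'" "fv.span S' = fv.span B'" "card B' = fv.dim (fv.span S')"
    using finite_basis[OF fv.subspace_span fin_dim_span[OF fd(2)]] by metis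
  have "fv.independent (C \<union> B') \<and> C \<inter> B' = {}" if "finite C" "C \<subseteq> B" for C
    using that
  proof (induction C)
    case empty
    then show ?case using B' by simp
  next
    case (insert b C)
    have b: "b \<notin> fv.span (C \<union> B')"
    proof
      assume "b \<in> fv.span (C \<union> B')"
      then obtain u v where uv: "b = u + v" "u \<in> fv.span C" "v \<in> fv.span B'"
        unfolding fv.span_Un by blast
      have "v = b - u" using uv by simp
      moreover have "b \<in> fv.span B" "u \<in> fv.span B" using insert.prems uv(2) fv.span_mono[of C B]
        by (auto intro: fv.span_base)
      ultimately have "v = 0" using uv(3) int B(4) B'(4) fv.span_diff[of b B u] by auto
      then have "b \<in> fv.span C" using uv by simp
      then have "b \<in> fv.span (B - {b})" using insert fv.span_mono[of C "B - {b}"] by auto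
      then show False using B(3) insert.prems fv.dependent_def by auto
    qed
    then have "b \<notin> B'" using fv.span_base[of b "C \<union> B'"] by auto
    then show ?case using insert b fv.independent_insertI[OF b] by auto
  qed
  from this[OF B(1) subset_refl] have ind: "fv.independent (B \<union> B')" "B \<inter> B' = {}" by auto
  have "fv.span (B \<union> B') = fv.span (S \<union> S')"
    unfolding fv.span_Un B(4) B'(4) ..
  then have "fv.dim (S \<union> S') = card (B \<union> B')" using ind by (intro fv.dim_eq_card)
  then show ?thesis using B(1,5) B'(1,5) ind(2) by (simp only: card_Un_disjoint fv.dim_span)
qed

text \<open>A linear right inverse on the image embeds the image of \<open>V\<close> as a complement
  of the kernel.\<close>

lemma rank_nullity:
  assumes f: "flin f" and V: "fv.subspace V" "fin_dim V"
  shows "fv.dim V = fv.dim {x \<in> V. f x = 0} + fv.dim (f ` V)"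
proof -
  obtain g where g: "range g \<subseteq> V" "flin g" "\<And>v. v \<in> f ` V \<Longrightarrow> f (g v) = v"
    using fp.linear_exists_right_inverse_on[OF f V(1)] by blast
  let ?K = "{x \<in> V. f x = 0}" and ?I = "g ` (f ` V)"
  have fV: "fv.subspace (f ` V)" by (rule fp.linear_subspace_image[OF f V(1)])
  have K: "fv.subspace ?K"
    using V(1) by (auto intro!: fv.subspaceI simp: flinD[OF f] fv.subspace_add fv.subspace_scale fv.subspace_0)
  have I: "fv.subspace ?I" by (rule fp.linear_subspace_image[OF g(2) fV])
  have inj: "inj_on g (f ` V)" by (rule inj_on_inverseI[of _ f]) (rule g(3))
  have int: "?K \<inter> ?I \<subseteq> {0}"
  proof clarify
    fix x assume x: "x \<in> V" "f (g (f x)) = 0"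
    then have "f x = 0" using g(3)[of "f x"] by auto
    then show "g (f x) = 0" by (simp add: flinD(3)[OF g(2)])
  qed
  have "?I \<subseteq> V" using g(1) by auto
  then have "fin_dim ?K" "fin_dim ?I" using fin_dim_subset[OF V(2)] by auto
  moreover have sp: "fv.span ?K = ?K" "fv.span ?I = ?I" using K I by (simp_all only: fv.span_eq_iff)
  ultimately have "fv.dim (?K \<union> ?I) = fv.dim ?K + fv.dim ?I"
    by (intro dim_Un_disjoint) (simp_all only: sp int)
  moreover have "fv.span (?K \<union> ?I) = V"
  proof
    show "fv.span (?K \<union> ?I) \<subseteq> V" by (rule fv.span_minimal) (use \<open>?I \<subseteq> V\<close> V in auto)
    show "V \<subseteq> fv.span (?K \<union> ?I)"
    proof
      fix x assume x: "x \<in> V"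
      have "g (f x) \<in> V" using g(1) by auto
      then have "x - g (f x) \<in> V" using x by (intro fv.subspace_diff[OF V(1)])
      then have "x - g (f x) \<in> ?K" using x by (simp add: flinD[OF f] g(3))
      moreover have "g (f x) \<in> ?I" using x by auto
      ultimately have "x - g (f x) + g (f x) \<in> fv.span (?K \<union> ?I)"
        by (intro fv.span_add fv.span_base) auto
      then show "x \<in> fv.span (?K \<union> ?I)" by simp
    qed
  qed
  ultimately have "fv.dim V = fv.dim ?K + fv.dim ?I" by (metis fv.dim_span)
  then show ?thesis using dim_lin_on_image[OF fV _ inj subset_refl] g(2)
    by (simp add: lin_on_def flinD[OF g(2)])
qed

text \<open>A basis of \<open>U\<close> is extended to one of \<open>V\<close>; \<open>C\<close>
  consists of the added vectors.\<close>

lemma complement_basis: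
  assumes V: "fv.subspace V" "fin_dim V" and U: "U \<subseteq> V" "fv.subspace U"
  obtains C where "finite C" "C \<subseteq> V" "fv.independent C" "fv.dim V = fv.dim U + card C"
    "V = fv.span (U \<union> C)" "U \<inter> fv.span C \<subseteq> {0}"
proof -
  obtain B where B: "finite B" "B \<subseteq> U" "fv.independent B" "U = fv.span B" "card B = fv.dim U"
    using finite_basis[OF U(2) fin_dim_subset[OF V(2) U(1)]] by metis
  obtain D where D: "B \<subseteq> D" "D \<subseteq> V" "fv.independent D" "V \<subseteq> fv.span D"
    by (rule fv.maximal_independent_subset_extend[of B V]) (use B U in auto)
  have fD: "finite D" by (rule fin_dim_independent_finite[OF V(2) D(3,2)])
  have DV: "fv.span D = V" using D(4) fv.span_minimal[OF D(2) V(1)] by blast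
  define C where "C = D - B"
  have "fv.dim V = card D" using fv.dim_eq_card[of D V] D DV fv.span_eq_iff V(1) by metis
  then have dim: "fv.dim V = fv.dim U + card C"
    using B(1,5) D(1) fD by (simp add: C_def card_Diff_subset) (metis B(5) card_mono le_add_diff_inverse)
  have "fv.span (U \<union> C) = fv.span (B \<union> C)" unfolding fv.span_Un B(4) fv.span_span ..
  also have "\<dots> = V" using DV D(1) by (simp add: C_def Un_absorb1)
  finally have sp: "V = fv.span (U \<union> C)" ..
  have "U \<inter> fv.span C \<subseteq> {0}"
  proof
    fix x assume x: "x \<in> U \<inter> fv.span C"
    \<comment> \<open>A vector in both spans has a representation supported in \<open>B\<close> and
      in \<open>C\<close>, hence an empty one.\<close>
    have "fv.representation D x = fv.representation B x"
      by (rule fv.representation_extend[OF D(3) _ D(1)]) (use x B(4) in auto)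
    moreover have "fv.representation D x = fv.representation C x"
      by (rule fv.representation_extend[OF D(3)]) (use x in \<open>auto simp: C_def\<close>)
    ultimately have z: "fv.representation D x b = 0" for b
      using fv.representation_ne_zero[of B x b] fv.representation_ne_zero[of C x b] by (auto simp: C_def)
    have "(\<Sum>b | fv.representation D x b \<noteq> 0. fs (fv.representation D x b) b) = x"
      by (rule fv.sum_nonzero_representation_eq[OF D(3)]) (use x U DV in auto)
    then show "x \<in> {0}" by (simp add: z)
  qed
  moreover have "fv.independent C" using D(3) fv.independent_mono[of D C] by (auto simp: C_def)
  moreover have "finite C" "C \<subseteq> V" using fD D(2) by (auto simp: C_def)
  ultimately show thesis using that[of C] dim sp by blast
qed

section \<open>Homomorphisms of right modules\<close>

lemma mod_homD:
  assumes "f \<in> mod_hom R M N"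
  shows "x \<in> carrier M \<Longrightarrow> f x \<in> carrier N"
    "x \<in> carrier M \<Longrightarrow> y \<in> carrier M \<Longrightarrow> f (x \<oplus>\<^bsub>M\<^esub> y) = f x \<oplus>\<^bsub>N\<^esub> f y"
    "r \<in> carrier R \<Longrightarrow> x \<in> carrier M \<Longrightarrow> f (r \<odot>\<^bsub>M\<^esub> x) = r \<odot>\<^bsub>N\<^esub> f x"
  using assms by (auto simp: mod_hom_def)

lemma mod_hom_comp:
  assumes "f \<in> mod_hom R M N" "g \<in> mod_hom R N L" shows "(\<lambda>x. g (f x)) \<in> mod_hom R M L"
  using assms by (auto simp: mod_hom_def Pi_iff)

lemma mod_hom_id: "(\<lambda>x. x) \<in> mod_hom R M M"
  by (auto simp: mod_hom_def)

lemma mod_hom_zero: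
  assumes "right_module R M" "right_module R N" "f \<in> mod_hom R M N" shows "f \<zero>\<^bsub>M\<^esub> = \<zero>\<^bsub>N\<^esub>"
proof -
  interpret M: right_module R M by fact
  interpret N: right_module R N by fact
  have "f \<zero>\<^bsub>M\<^esub> \<oplus>\<^bsub>N\<^esub> f \<zero>\<^bsub>M\<^esub> = f \<zero>\<^bsub>M\<^esub>"
    using mod_homD(2)[OF assms(3), of "\<zero>\<^bsub>M\<^esub>" "\<zero>\<^bsub>M\<^esub>"] by simp
  then show ?thesis using mod_homD(1)[OF assms(3) M.M.zero_closed] by simp
qed

lemma mod_hom_inv:
  assumes M: "right_module R M" and f: "f \<in> mod_hom R M N" "bij_betw f (carrier M) (carrier N)"
  shows "inv_into (carrier M) f \<in> mod_hom R N M"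
proof -
  interpret M: right_module R M by fact
  let ?g = "inv_into (carrier M) f"
  have g: "?g y \<in> carrier M" "f (?g y) = y" if "y \<in> carrier N" for y
    using f(2) that by (auto simp: bij_betw_def inv_into_into f_inv_into_f)
  have eq: "x = y" if "x \<in> carrier M" "y \<in> carrier M" "f x = f y" for x y
    using f(2) that by (auto simp: bij_betw_def inj_on_def)
  have c: "f x \<in> carrier N" if "x \<in> carrier M" for x using mod_homD(1)[OF f(1) that] .
  have "?g (y \<oplus>\<^bsub>N\<^esub> z) = ?g y \<oplus>\<^bsub>M\<^esub> ?g z" if "y \<in> carrier N" "z \<in> carrier N" for y z
  proof -
    have *: "f (?g y \<oplus>\<^bsub>M\<^esub> ?g z) = y \<oplus>\<^bsub>N\<^esub> z" using that g by (simp add: mod_homD(2)[OF f(1)])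
    then have "y \<oplus>\<^bsub>N\<^esub> z \<in> carrier N" using c g that M.M.a_closed by metis
    then show ?thesis using that g * by (intro eq) auto
  qed
  moreover have "?g (r \<odot>\<^bsub>N\<^esub> y) = r \<odot>\<^bsub>M\<^esub> ?g y" if "r \<in> carrier R" "y \<in> carrier N" for r y
  proof -
    have *: "f (r \<odot>\<^bsub>M\<^esub> ?g y) = r \<odot>\<^bsub>N\<^esub> y" using that g by (simp add: mod_homD(3)[OF f(1)])
    then have "r \<odot>\<^bsub>N\<^esub> y \<in> carrier N" using c g that M.smult_closed by metis
    then show ?thesis using that g * by (intro eq) auto
  qed
  ultimately show ?thesis using g by (auto simp: mod_hom_def)
qed

lemma mod_iso_sym: "right_module R M \<Longrightarrow> mod_iso R M N \<Longrightarrow> mod_iso R N M"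
  unfolding mod_iso_def using mod_hom_inv bij_betw_inv_into by blast

lemma mod_iso_trans: "mod_iso R M N \<Longrightarrow> mod_iso R N L \<Longrightarrow> mod_iso R M L"
  unfolding mod_iso_def using mod_hom_comp bij_betw_trans[unfolded comp_def] by blast

context right_module
begin

lemma smult_r_null [simp]: "r \<in> carrier R \<Longrightarrow> r \<odot>\<^bsub>M\<^esub> \<zero>\<^bsub>M\<^esub> = \<zero>\<^bsub>M\<^esub>"
  using smult_r_distr[of r "\<zero>\<^bsub>M\<^esub>" "\<zero>\<^bsub>M\<^esub>"] by simp

lemma smult_l_null [simp]: "x \<in> carrier M \<Longrightarrow> \<zero>\<^bsub>R\<^esub> \<odot>\<^bsub>M\<^esub> x = \<zero>\<^bsub>M\<^esub>"
  using smult_l_distr[of "\<zero>\<^bsub>R\<^esub>" "\<zero>\<^bsub>R\<^esub>" x] by simp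

lemma smult_r_finsum:
  assumes "r \<in> carrier R" "g \<in> A \<rightarrow> carrier M"
  shows "r \<odot>\<^bsub>M\<^esub> (\<Oplus>\<^bsub>M\<^esub>a\<in>A. g a) = (\<Oplus>\<^bsub>M\<^esub>a\<in>A. r \<odot>\<^bsub>M\<^esub> g a)"
  using assms(2)
proof (induction A rule: infinite_finite_induct)
  case (insert a A)
  then show ?case using assms(1) by (simp add: M.finsum_insert Pi_iff smult_r_distr)
qed (use assms(1) in \<open>simp_all add: M.finsum_infinite\<close>)

end

lemma mod_hom_finsum:
  assumes "right_module R M" "right_module R N" "f \<in> mod_hom R M N" "g \<in> A \<rightarrow> carrier M"
  shows "f (\<Oplus>\<^bsub>M\<^esub>a\<in>A. g a) = (\<Oplus>\<^bsub>N\<^esub>a\<in>A. f (g a))"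
proof -
  interpret M: right_module R M by fact
  interpret N: right_module R N by fact
  show ?thesis using assms(4)
  proof (induction A rule: infinite_finite_induct)
    case (insert a A)
    then show ?case using mod_homD[OF assms(3)]
      by (simp add: M.M.finsum_insert N.M.finsum_insert Pi_iff)
  qed (use mod_hom_zero[OF assms(1-3)] in \<open>simp_all add: M.M.finsum_infinite N.M.finsum_infinite\<close>)
qed

definition fun_module :: "('x \<Rightarrow> 'k::field) set \<Rightarrow> ('a \<Rightarrow> ('x \<Rightarrow> 'k) \<Rightarrow> 'x \<Rightarrow> 'k) \<Rightarrow> ('a, 'x \<Rightarrow> 'k) module" where
  "fun_module V act = \<lparr>carrier = V, monoid.mult = undefined, one = undefined, ring.zero = 0,
     ring.add = (+), smult = act\<rparr>"

section \<open>Generators of the algebra and modules given by linear operators\<close>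

context quiver_alg
begin

lemma sc_ev: "sc c \<otimes>\<^bsub>R\<^esub> ev v = el (\<lambda>u. if u = v then c else 0) 0"
  and ev_sc: "ev v \<otimes>\<^bsub>R\<^esub> sc c = el (\<lambda>u. if u = v then c else 0) 0"
  and sc_ar: "sc c \<otimes>\<^bsub>R\<^esub> ar \<alpha> = el 0 (\<lambda>\<beta>. if \<beta> = \<alpha> then c else 0)"
  and ar_sc: "ar \<alpha> \<otimes>\<^bsub>R\<^esub> sc c = el 0 (\<lambda>\<beta>. if \<beta> = \<alpha> then c else 0)"
  unfolding sc_def ev_def ar_def el_mult by (auto intro!: el_cong)

lemma sc_add: "sc (c + d) = sc c \<oplus>\<^bsub>R\<^esub> sc d"
  and sc_mult: "sc c \<otimes>\<^bsub>R\<^esub> sc d = sc (c * d)"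
  and sc_0: "sc 0 = \<zero>\<^bsub>R\<^esub>" and sc_1: "sc 1 = \<one>\<^bsub>R\<^esub>"
  unfolding sc_def el_mult el_add el_zero el_one by (auto intro!: el_cong)

lemma ev_ev: "ev u \<otimes>\<^bsub>R\<^esub> ev v = (if u = v then ev v else \<zero>\<^bsub>R\<^esub>)"
  unfolding ev_def el_mult el_zero by (auto intro!: el_cong)

lemma ev_ar: "\<alpha> \<in> arcs Q \<Longrightarrow> ev u \<otimes>\<^bsub>R\<^esub> ar \<alpha> = (if u = tail Q \<alpha> then ar \<alpha> else \<zero>\<^bsub>R\<^esub>)"
  and ar_ev: "\<alpha> \<in> arcs Q \<Longrightarrow> ar \<alpha> \<otimes>\<^bsub>R\<^esub> ev u = (if u = head Q \<alpha> then ar \<alpha> else \<zero>\<^bsub>R\<^esub>)"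
  unfolding ev_def ar_def el_mult el_zero by (auto intro!: el_cong)

lemma ar_ar: "ar \<alpha> \<otimes>\<^bsub>R\<^esub> ar \<beta> = \<zero>\<^bsub>R\<^esub>"
  unfolding ar_def el_mult el_zero by (auto intro!: el_cong)

text \<open>Scalar multiples of trivial paths and of arrows generate \<open>R\<close> additively. No
  closure under products is asked for, so the rule suits properties that are merely additive in the
  ring element.\<close>

lemma R_add_induct [consumes 1, case_names zero vert arc add]:
  assumes a: "a \<in> carrier R"
    and zero: "P \<zero>\<^bsub>R\<^esub>"
    and vert: "\<And>v c. v \<in> verts Q \<Longrightarrow> P (sc c \<otimes>\<^bsub>R\<^esub> ev v)"
    and arc: "\<And>\<alpha> c. \<alpha> \<in> arcs Q \<Longrightarrow> P (sc c \<otimes>\<^bsub>R\<^esub> ar \<alpha>)"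
    and add: "\<And>a b. a \<in> carrier R \<Longrightarrow> b \<in> carrier R \<Longrightarrow> P a \<Longrightarrow> P b \<Longrightarrow> P (a \<oplus>\<^bsub>R\<^esub> b)"
  shows "P a"
proof -
  obtain g h where gh: "a = el g h" using a by (rule el_exhaust)
  have 1: "P (el (\<lambda>u. if u \<in> F then g u else 0) 0)" if "finite F" "F \<subseteq> verts Q" for F
    using that
  proof (induction F)
    case empty
    have "el (\<lambda>u. if u \<in> {} then g u else 0) 0 = \<zero>\<^bsub>R\<^esub>"
      unfolding el_zero by (rule el_cong) auto
    with zero show ?case by (simp only:)
  next
    case (insert v F)
    have *: "el (\<lambda>u. if u \<in> insert v F then g u else 0) 0 =
        (sc (g v) \<otimes>\<^bsub>R\<^esub> ev v) \<oplus>\<^bsub>R\<^esub> el (\<lambda>u. if u \<in> F then g u else 0) 0"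
      unfolding sc_ev el_add using insert.hyps by (intro el_cong) auto
    show ?case unfolding * using insert.prems by (intro add vert insert.IH) auto
  qed
  have 2: "P (el 0 (\<lambda>u. if u \<in> F then h u else 0))" if "finite F" "F \<subseteq> arcs Q" for F
    using that
  proof (induction F)
    case empty
    have "el 0 (\<lambda>u. if u \<in> {} then h u else 0) = \<zero>\<^bsub>R\<^esub>"
      unfolding el_zero by (rule el_cong) auto
    with zero show ?case by (simp only:)
  next
    case (insert v F)
    have *: "el 0 (\<lambda>u. if u \<in> insert v F then h u else 0) =
        (sc (h v) \<otimes>\<^bsub>R\<^esub> ar v) \<oplus>\<^bsub>R\<^esub> el 0 (\<lambda>u. if u \<in> F then h u else 0)"
      unfolding sc_ar el_add using insert.hyps by (intro el_cong) auto
    show ?case unfolding * using insert.prems by (intro add arc insert.IH) auto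
  qed
  have *: "a = el (\<lambda>u. if u \<in> verts Q then g u else 0) 0 \<oplus>\<^bsub>R\<^esub> el 0 (\<lambda>u. if u \<in> arcs Q then h u else 0)"
    unfolding gh el_add by (rule el_cong) auto
  show ?thesis unfolding * by (intro add 1 2) auto
qed

text \<open>By additive induction over the ring it is enough to commute with scalars, vertices and
  arrows; homomorphisms between concrete modules are verified in this form.\<close>

lemma mod_homI_gens:
  assumes M: "right_module R M" and N: "right_module R N"
    and f: "f \<in> carrier M \<rightarrow> carrier N"
    and add: "\<And>x y. x \<in> carrier M \<Longrightarrow> y \<in> carrier M \<Longrightarrow> f (x \<oplus>\<^bsub>M\<^esub> y) = f x \<oplus>\<^bsub>N\<^esub> f y"
    and sc: "\<And>c x. x \<in> carrier M \<Longrightarrow> f (sc c \<odot>\<^bsub>M\<^esub> x) = sc c \<odot>\<^bsub>N\<^esub> f x"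
    and ev: "\<And>v x. v \<in> verts Q \<Longrightarrow> x \<in> carrier M \<Longrightarrow> f (ev v \<odot>\<^bsub>M\<^esub> x) = ev v \<odot>\<^bsub>N\<^esub> f x"
    and ar: "\<And>\<alpha> x. \<alpha> \<in> arcs Q \<Longrightarrow> x \<in> carrier M \<Longrightarrow> f (ar \<alpha> \<odot>\<^bsub>M\<^esub> x) = ar \<alpha> \<odot>\<^bsub>N\<^esub> f x"
  shows "f \<in> mod_hom R M N"
proof -
  interpret M: right_module R M by fact
  interpret N: right_module R N by fact
  have fc: "f x \<in> carrier N" if "x \<in> carrier M" for x using f that by auto
  have "\<forall>x\<in>carrier M. f (r \<odot>\<^bsub>M\<^esub> x) = r \<odot>\<^bsub>N\<^esub> f x" if "r \<in> carrier R" for r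
    using that
  proof (induction rule: R_add_induct)
    case zero
    have "f \<zero>\<^bsub>M\<^esub> \<oplus>\<^bsub>N\<^esub> f \<zero>\<^bsub>M\<^esub> = f \<zero>\<^bsub>M\<^esub>" using add[of "\<zero>\<^bsub>M\<^esub>" "\<zero>\<^bsub>M\<^esub>"] by simp
    then have "f \<zero>\<^bsub>M\<^esub> = \<zero>\<^bsub>N\<^esub>" using fc[OF M.M.zero_closed] by simp
    then show ?case using fc by simp
  next
    case (vert v c)
    then show ?case using fc by (simp add: M.smult_assoc N.smult_assoc sc ev)
  next
    case (arc \<alpha> c)
    then show ?case using fc by (simp add: M.smult_assoc N.smult_assoc sc ar)
  next
    case (add a b)
    then show ?case using fc by (simp add: M.smult_l_distr N.smult_l_distr assms(4))
  qed
  then show ?thesis using f add by (simp add: mod_hom_def)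
qed

definition rmod :: "('x \<Rightarrow> 'k) set \<Rightarrow> ('v \<Rightarrow> ('x \<Rightarrow> 'k) \<Rightarrow> ('x \<Rightarrow> 'k)) \<Rightarrow>
    ('e \<Rightarrow> ('x \<Rightarrow> 'k) \<Rightarrow> ('x \<Rightarrow> 'k)) \<Rightarrow> (('v \<times> 'e list \<Rightarrow> 'k) set, 'x \<Rightarrow> 'k) module" where
  "rmod V E Y = fun_module V
     (\<lambda>a x. (\<Sum>v\<in>verts Q. fs (cv a v) (E v x)) + (\<Sum>\<alpha>\<in>arcs Q. fs (ca a \<alpha>) (Y \<alpha> x)))"

lemma rmod_simps [simp]:
  "carrier (rmod V E Y) = V" "\<zero>\<^bsub>rmod V E Y\<^esub> = 0" "x \<oplus>\<^bsub>rmod V E Y\<^esub> y = x + y"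
  by (simp_all add: rmod_def fun_module_def)

lemma rmod_el: "el g h \<odot>\<^bsub>rmod V E Y\<^esub> x =
    (\<Sum>v\<in>verts Q. fs (g v) (E v x)) + (\<Sum>\<alpha>\<in>arcs Q. fs (h \<alpha>) (Y \<alpha> x))"
  by (simp add: rmod_def fun_module_def cong: sum.cong)

section \<open>Modules as quiver representations\<close>

text \<open>A representation of the quiver with relations on a finite-dimensional space of functions;
  \<open>E v\<close> is the projection onto the component at the vertex \<open>v\<close>.\<close>

definition rep :: "('x \<Rightarrow> 'k) set \<Rightarrow> ('v \<Rightarrow> ('x \<Rightarrow> 'k) \<Rightarrow> ('x \<Rightarrow> 'k)) \<Rightarrow>
    ('e \<Rightarrow> ('x \<Rightarrow> 'k) \<Rightarrow> ('x \<Rightarrow> 'k)) \<Rightarrow> bool" where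
  "rep V E Y \<longleftrightarrow> fv.subspace V \<and> fin_dim V \<and>
     (\<forall>v\<in>verts Q. flin (E v) \<and> E v ` V \<subseteq> V) \<and> (\<forall>\<alpha>\<in>arcs Q. flin (Y \<alpha>) \<and> Y \<alpha> ` V \<subseteq> V) \<and>
     (\<forall>x\<in>V. (\<Sum>v\<in>verts Q. E v x) = x) \<and>
     (\<forall>u\<in>verts Q. \<forall>v\<in>verts Q. \<forall>x\<in>V. E u (E v x) = (if u = v then E v x else 0)) \<and>
     (\<forall>\<alpha>\<in>arcs Q. \<forall>u\<in>verts Q. \<forall>x\<in>V. Y \<alpha> (E u x) = (if u = tail Q \<alpha> then Y \<alpha> x else 0) \<and>
        E u (Y \<alpha> x) = (if u = head Q \<alpha> then Y \<alpha> x else 0)) \<and>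
     (\<forall>\<alpha>\<in>arcs Q. \<forall>\<beta>\<in>arcs Q. \<forall>x\<in>V. Y \<alpha> (Y \<beta> x) = 0)"

lemma repD:
  assumes "rep V E Y"
  shows "fv.subspace V" "fin_dim V"
    "\<And>v. v \<in> verts Q \<Longrightarrow> flin (E v)" "\<And>v x. v \<in> verts Q \<Longrightarrow> x \<in> V \<Longrightarrow> E v x \<in> V"
    "\<And>\<alpha>. \<alpha> \<in> arcs Q \<Longrightarrow> flin (Y \<alpha>)" "\<And>\<alpha> x. \<alpha> \<in> arcs Q \<Longrightarrow> x \<in> V \<Longrightarrow> Y \<alpha> x \<in> V"
    "\<And>x. x \<in> V \<Longrightarrow> (\<Sum>v\<in>verts Q. E v x) = x"
    "\<And>u v x. u \<in> verts Q \<Longrightarrow> v \<in> verts Q \<Longrightarrow> x \<in> V \<Longrightarrow> E u (E v x) = (if u = v then E v x else 0)"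
    "\<And>\<alpha> u x. \<alpha> \<in> arcs Q \<Longrightarrow> u \<in> verts Q \<Longrightarrow> x \<in> V \<Longrightarrow> Y \<alpha> (E u x) = (if u = tail Q \<alpha> then Y \<alpha> x else 0)"
    "\<And>\<alpha> u x. \<alpha> \<in> arcs Q \<Longrightarrow> u \<in> verts Q \<Longrightarrow> x \<in> V \<Longrightarrow> E u (Y \<alpha> x) = (if u = head Q \<alpha> then Y \<alpha> x else 0)"
    "\<And>\<alpha> \<beta> x. \<alpha> \<in> arcs Q \<Longrightarrow> \<beta> \<in> arcs Q \<Longrightarrow> x \<in> V \<Longrightarrow> Y \<alpha> (Y \<beta> x) = 0"
  using assms unfolding rep_def by (blast, blast, blast, blast, blast, blast, blast, blast, blast, blast, blast)

lemma rmod_sc: assumes "rep V E Y" "x \<in> V" shows "sc c \<odot>\<^bsub>rmod V E Y\<^esub> x = fs c x"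
proof -
  have "fs c x = fs c (\<Sum>v\<in>verts Q. E v x)" using repD(7)[OF assms] by simp
  then show ?thesis unfolding sc_def rmod_el by (simp add: fv.scale_sum_right)
qed

lemma rmod_ev: assumes "v \<in> verts Q" shows "ev v \<odot>\<^bsub>rmod V E Y\<^esub> x = E v x"
proof -
  have "(\<Sum>u\<in>verts Q. fs (if u = v then 1 else 0) (E u x)) = (\<Sum>u\<in>verts Q. if u = v then E u x else 0)"
    by (rule sum.cong) auto
  then show ?thesis unfolding ev_def rmod_el using assms by simp
qed

lemma rmod_ar: assumes "\<alpha> \<in> arcs Q" shows "ar \<alpha> \<odot>\<^bsub>rmod V E Y\<^esub> x = Y \<alpha> x"
proof -
  have "(\<Sum>u\<in>arcs Q. fs (if u = \<alpha> then 1 else 0) (Y u x)) = (\<Sum>u\<in>arcs Q. if u = \<alpha> then Y u x else 0)"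
    by (rule sum.cong) auto
  then show ?thesis unfolding ar_def rmod_el using assms by simp
qed

lemma right_module_rmod:
  assumes r: "rep V E Y" shows "right_module R (rmod V E Y)"
proof -
  note V = fv.subspace_add[OF repD(1)[OF r]] fv.subspace_scale[OF repD(1)[OF r]]
    fv.subspace_sum[OF repD(1)[OF r]] fv.subspace_0[OF repD(1)[OF r]] fv.subspace_neg[OF repD(1)[OF r]]
  note E = flinD[OF repD(3)[OF r]] and Y = flinD[OF repD(5)[OF r]]
  define sm where "sm g h x = (\<Sum>v\<in>verts Q. fs (g v) (E v x)) + (\<Sum>\<alpha>\<in>arcs Q. fs (h \<alpha>) (Y \<alpha> x))"
    for g h and x
  have el: "el g h \<odot>\<^bsub>rmod V E Y\<^esub> x = sm g h x" for g h x by (simp add: rmod_el sm_def)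
  have sm_closed: "sm g h x \<in> V" if "x \<in> V" for g h x
    unfolding sm_def using that by (intro V repD[OF r])
  have Esm: "E u (sm g h x) = fs (g u) (E u x) + (\<Sum>\<alpha>\<in>arcs Q. if u = head Q \<alpha> then fs (h \<alpha>) (Y \<alpha> x) else 0)"
    if u: "u \<in> verts Q" and x: "x \<in> V" for g h x u
  proof -
    have "E u (sm g h x) = (\<Sum>v\<in>verts Q. fs (g v) (E u (E v x))) + (\<Sum>\<alpha>\<in>arcs Q. fs (h \<alpha>) (E u (Y \<alpha> x)))"
      using u by (simp add: sm_def E)
    moreover have "(\<Sum>v\<in>verts Q. fs (g v) (E u (E v x))) = (\<Sum>v\<in>verts Q. if u = v then fs (g v) (E v x) else 0)"
      by (rule sum.cong) (use u x in \<open>auto simp: repD(8)[OF r]\<close>)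
    moreover have "(\<Sum>\<alpha>\<in>arcs Q. fs (h \<alpha>) (E u (Y \<alpha> x))) = (\<Sum>\<alpha>\<in>arcs Q. if u = head Q \<alpha> then fs (h \<alpha>) (Y \<alpha> x) else 0)"
      by (rule sum.cong) (use u x in \<open>auto simp: repD(10)[OF r]\<close>)
    ultimately show ?thesis using u by simp
  qed
  have Ysm: "Y \<beta> (sm g h x) = fs (g (tail Q \<beta>)) (Y \<beta> x)" if b: "\<beta> \<in> arcs Q" and x: "x \<in> V" for g h x \<beta>
  proof -
    have "Y \<beta> (sm g h x) = (\<Sum>v\<in>verts Q. fs (g v) (Y \<beta> (E v x))) + (\<Sum>\<alpha>\<in>arcs Q. fs (h \<alpha>) (Y \<beta> (Y \<alpha> x)))"
      using b by (simp add: sm_def Y)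
    moreover have "(\<Sum>v\<in>verts Q. fs (g v) (Y \<beta> (E v x))) = (\<Sum>v\<in>verts Q. if tail Q \<beta> = v then fs (g v) (Y \<beta> x) else 0)"
      by (rule sum.cong) (use b x in \<open>auto simp: repD(9)[OF r]\<close>)
    moreover have "(\<Sum>\<alpha>\<in>arcs Q. fs (h \<alpha>) (Y \<beta> (Y \<alpha> x))) = 0"
      by (rule sum.neutral) (use b x in \<open>auto simp: repD(11)[OF r]\<close>)
    ultimately show ?thesis using b by simp
  qed
  \<comment> \<open>The mixed term comes from the arrow part of the first factor meeting the vertex
    part of the second: in the double sum over vertices and arrows only the head of each arrow
    survives.\<close>
  have assoc: "sm (\<lambda>v. g v * g' v) (\<lambda>\<alpha>. g (tail Q \<alpha>) * h' \<alpha> + h \<alpha> * g' (head Q \<alpha>)) x = sm g' h' (sm g h x)"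
    if x: "x \<in> V" for g h g' h' x
  proof -
    have "(\<Sum>u\<in>verts Q. \<Sum>\<alpha>\<in>arcs Q. if u = head Q \<alpha> then fs (g' u) (fs (h \<alpha>) (Y \<alpha> x)) else 0) =
        (\<Sum>\<alpha>\<in>arcs Q. \<Sum>u\<in>verts Q. if u = head Q \<alpha> then fs (g' u) (fs (h \<alpha>) (Y \<alpha> x)) else 0)"
      by (rule sum.swap)
    also have "\<dots> = (\<Sum>\<alpha>\<in>arcs Q. fs (g' (head Q \<alpha>)) (fs (h \<alpha>) (Y \<alpha> x)))"
      by (rule sum.cong) auto
    finally have 1: "(\<Sum>u\<in>verts Q. \<Sum>\<alpha>\<in>arcs Q. if u = head Q \<alpha> then fs (g' u) (fs (h \<alpha>) (Y \<alpha> x)) else 0) =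
      (\<Sum>\<alpha>\<in>arcs Q. fs (g' (head Q \<alpha>)) (fs (h \<alpha>) (Y \<alpha> x)))" .
    have "sm g' h' (sm g h x) = (\<Sum>u\<in>verts Q. fs (g' u) (fs (g u) (E u x) +
        (\<Sum>\<alpha>\<in>arcs Q. if u = head Q \<alpha> then fs (h \<alpha>) (Y \<alpha> x) else 0))) +
        (\<Sum>\<beta>\<in>arcs Q. fs (h' \<beta>) (fs (g (tail Q \<beta>)) (Y \<beta> x)))"
      unfolding sm_def[of g' h'] using x by (simp add: Esm Ysm cong: sum.cong)
    also have "\<dots> = (\<Sum>u\<in>verts Q. fs (g' u) (fs (g u) (E u x))) +
        (\<Sum>u\<in>verts Q. \<Sum>\<alpha>\<in>arcs Q. if u = head Q \<alpha> then fs (g' u) (fs (h \<alpha>) (Y \<alpha> x)) else 0) +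
        (\<Sum>\<beta>\<in>arcs Q. fs (h' \<beta>) (fs (g (tail Q \<beta>)) (Y \<beta> x)))"
      by (simp add: fv.scale_right_distrib fv.scale_sum_right sum.distrib if_distrib cong: if_cong)
    also have "\<dots> = sm (\<lambda>v. g v * g' v) (\<lambda>\<alpha>. g (tail Q \<alpha>) * h' \<alpha> + h \<alpha> * g' (head Q \<alpha>)) x"
      unfolding 1 sm_def by (simp add: fv.scale_left_distrib sum.distrib mult.commute add.assoc add.commute)
    finally show ?thesis ..
  qed
  have ag: "abelian_group (rmod V E Y)"
  proof (rule abelian_groupI)
    fix x assume "x \<in> carrier (rmod V E Y)"
    then show "\<exists>y\<in>carrier (rmod V E Y). y \<oplus>\<^bsub>rmod V E Y\<^esub> x = \<zero>\<^bsub>rmod V E Y\<^esub>"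
      using V(5) by (intro bexI[of _ "- x"]) simp_all
  qed (use V in \<open>auto simp: add_ac\<close>)
  have c1: "a \<odot>\<^bsub>rmod V E Y\<^esub> x \<in> carrier (rmod V E Y)"
    if "a \<in> carrier R" "x \<in> carrier (rmod V E Y)" for a x
    using that by (cases rule: el_exhaust[OF that(1)]) (simp add: el sm_closed)
  have c2: "(a \<oplus>\<^bsub>R\<^esub> b) \<odot>\<^bsub>rmod V E Y\<^esub> x = a \<odot>\<^bsub>rmod V E Y\<^esub> x \<oplus>\<^bsub>rmod V E Y\<^esub> b \<odot>\<^bsub>rmod V E Y\<^esub> x"
    if ab: "a \<in> carrier R" "b \<in> carrier R" for a b x
  proof -
    obtain g h where gh: "a = el g h" using ab(1) by (rule el_exhaust)
    obtain g' h' where gh': "b = el g' h'" using ab(2) by (rule el_exhaust)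
    show ?thesis unfolding gh gh' el_add el by (simp add: sm_def fv.scale_left_distrib sum.distrib)
  qed
  have c3: "a \<odot>\<^bsub>rmod V E Y\<^esub> (x \<oplus>\<^bsub>rmod V E Y\<^esub> y) = a \<odot>\<^bsub>rmod V E Y\<^esub> x \<oplus>\<^bsub>rmod V E Y\<^esub> a \<odot>\<^bsub>rmod V E Y\<^esub> y"
    if a: "a \<in> carrier R" for a x y
  proof -
    obtain g h where gh: "a = el g h" using a by (rule el_exhaust)
    show ?thesis unfolding gh el by (simp add: sm_def E Y fv.scale_right_distrib sum.distrib)
  qed
  have c4: "(a \<otimes>\<^bsub>R\<^esub> b) \<odot>\<^bsub>rmod V E Y\<^esub> x = b \<odot>\<^bsub>rmod V E Y\<^esub> (a \<odot>\<^bsub>rmod V E Y\<^esub> x)"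
    if ab: "a \<in> carrier R" "b \<in> carrier R" "x \<in> carrier (rmod V E Y)" for a b x
  proof -
    obtain g h where gh: "a = el g h" using ab(1) by (rule el_exhaust)
    obtain g' h' where gh': "b = el g' h'" using ab(2) by (rule el_exhaust)
    show ?thesis unfolding gh gh' el_mult el by (rule assoc) (use ab(3) in simp)
  qed
  have c5: "\<one>\<^bsub>R\<^esub> \<odot>\<^bsub>rmod V E Y\<^esub> x = x" if "x \<in> carrier (rmod V E Y)" for x
    unfolding el_one el using repD(7)[OF r, of x] that by (simp add: sm_def)
  have ax: "right_module_axioms R (rmod V E Y)"
    by (rule right_module_axioms.intro) (rule c1 c2 c3 c4 c5; assumption)+
  show ?thesis by (rule right_module.intro[OF R_ring ag ax])
qed

lemma fin_gen_rmod:
  assumes r: "rep V E Y" shows "fin_gen R (rmod V E Y)"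
proof -
  interpret M: right_module R "rmod V E Y" by (rule right_module_rmod[OF r])
  obtain B where B: "finite B" "B \<subseteq> V" "fv.independent B" "V = fv.span B" "card B = fv.dim V"
    using finite_basis[OF repD(1,2)[OF r]] .
  have fsum: "(\<Oplus>\<^bsub>rmod V E Y\<^esub>s\<in>C. g s) = (\<Sum>s\<in>C. g s)" if "finite C" "g \<in> C \<rightarrow> V" for g :: "_ \<Rightarrow> 'a \<Rightarrow> 'k" and C :: "('a \<Rightarrow> 'k) set"
    using that by (induction C) (simp_all add: Pi_iff)
  show ?thesis unfolding fin_gen_def
  proof (intro exI[of _ B] conjI ballI)
    fix x assume "x \<in> carrier (rmod V E Y)"
    then have "x \<in> fv.span B" using B(4) by simp
    then obtain u where u: "x = (\<Sum>v\<in>B. fs (u v) v)" unfolding fv.span_finite[OF B(1)] by blast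
    have "(\<Oplus>\<^bsub>rmod V E Y\<^esub>s\<in>B. sc (u s) \<odot>\<^bsub>rmod V E Y\<^esub> s) = (\<Sum>v\<in>B. sc (u v) \<odot>\<^bsub>rmod V E Y\<^esub> v)"
      by (rule fsum[OF B(1)]) (use B(2) M.smult_closed in auto)
    also have "\<dots> = x" unfolding u by (rule sum.cong) (use B(2) in \<open>auto simp: rmod_sc[OF r]\<close>)
    finally show "\<exists>ra\<in>B \<rightarrow> carrier R. x = (\<Oplus>\<^bsub>rmod V E Y\<^esub>s\<in>B. ra s \<odot>\<^bsub>rmod V E Y\<^esub> s)"
      by (intro bexI[of _ "\<lambda>s. sc (u s)"]) auto
  qed (use B in auto)
qed

end

section \<open>Direct sums and additive dimension counts\<close>

lemma direct_sum_simps [simp]: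
  "carrier (direct_sum M N) = carrier M \<times> carrier N"
  "\<zero>\<^bsub>direct_sum M N\<^esub> = (\<zero>\<^bsub>M\<^esub>, \<zero>\<^bsub>N\<^esub>)"
  "(x, y) \<oplus>\<^bsub>direct_sum M N\<^esub> (x', y') = (x \<oplus>\<^bsub>M\<^esub> x', y \<oplus>\<^bsub>N\<^esub> y')"
  "r \<odot>\<^bsub>direct_sum M N\<^esub> (x, y) = (r \<odot>\<^bsub>M\<^esub> x, r \<odot>\<^bsub>N\<^esub> y)"
  by (simp_all add: direct_sum_def)

lemma direct_sum_cong:
  assumes "mod_iso R M N" "mod_iso R M' N'"
  shows "mod_iso R (direct_sum M M') (direct_sum N N')"
proof -
  obtain f where f: "f \<in> mod_hom R M N" "bij_betw f (carrier M) (carrier N)"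
    using assms(1) by (auto simp: mod_iso_def)
  obtain g where g: "g \<in> mod_hom R M' N'" "bij_betw g (carrier M') (carrier N')"
    using assms(2) by (auto simp: mod_iso_def)
  have "map_prod f g \<in> mod_hom R (direct_sum M M') (direct_sum N N')"
    using f(1) g(1) by (auto simp: mod_hom_def Pi_iff)
  moreover have "bij_betw (map_prod f g) (carrier M \<times> carrier M') (carrier N \<times> carrier N')"
    using f(2) g(2) by (rule bij_betw_map_prod)
  ultimately show ?thesis by (auto simp: mod_iso_def)
qed

lemma right_module_direct_sum:
  assumes "right_module R M" "right_module R N" shows "right_module R (direct_sum M N)"
proof -
  interpret M: right_module R M by fact
  interpret N: right_module R N by fact
  have "abelian_group (direct_sum M N)"
  proof (rule abelian_groupI)
    fix x assume "x \<in> carrier (direct_sum M N)"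
    then show "\<exists>y\<in>carrier (direct_sum M N). y \<oplus>\<^bsub>direct_sum M N\<^esub> x = \<zero>\<^bsub>direct_sum M N\<^esub>"
      by (intro bexI[of _ "(\<ominus>\<^bsub>M\<^esub> fst x, \<ominus>\<^bsub>N\<^esub> snd x)"]) (auto simp: M.M.l_neg N.M.l_neg)
  qed (auto simp: M.M.a_ac N.M.a_ac)
  then show ?thesis
    by (intro right_module.intro right_module_axioms.intro M.R.ring_axioms)
      (auto simp: M.smult_l_distr N.smult_l_distr M.smult_r_distr N.smult_r_distr M.smult_assoc N.smult_assoc)
qed

text \<open>\<open>T\<close> need only lie between the union of the two images and the set of all
  sums, which already determines its span. This generality is meant for \<open>Sr\<close>, a
  spanning set that need not be closed under addition.\<close>

lemma dim_direct_sum_lin: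
  assumes V: "fv.subspace V" "fv.subspace V'" and fd: "fin_dim V" "fin_dim V'"
    and i: "lin_on V i" "inj_on i V" and j: "lin_on V' j" "inj_on j V'"
    and int: "\<And>a b. a \<in> V \<Longrightarrow> b \<in> V' \<Longrightarrow> i a = j b \<Longrightarrow> i a = 0"
    and S: "S \<subseteq> V" "S' \<subseteq> V'" and T: "i ` S \<union> j ` S' \<subseteq> T" "T \<subseteq> {i a + j b |a b. a \<in> S \<and> b \<in> S'}"
  shows "fv.dim T = fv.dim S + fv.dim S'"
proof -
  obtain f where f: "flin f" "\<And>x. x \<in> V \<Longrightarrow> f x = i x" using lin_on_extend[OF V(1) i(1)] by blast
  obtain g where g: "flin g" "\<And>x. x \<in> V' \<Longrightarrow> g x = j x" using lin_on_extend[OF V(2) j(1)] by blast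
  have fS: "f ` S = i ` S" "g ` S' = j ` S'" using S f(2) g(2) by (auto simp: image_def subset_iff)
  have spS: "fv.span S \<subseteq> V" "fv.span S' \<subseteq> V'" using V S by (auto intro: fv.span_minimal[THEN subsetD])
  have span: "fv.span (i ` S \<union> j ` S') = fv.span T"
  proof
    show "fv.span (i ` S \<union> j ` S') \<subseteq> fv.span T" by (rule fv.span_mono[OF T(1)])
    have "T \<subseteq> fv.span (i ` S \<union> j ` S')"
    proof
      fix x assume "x \<in> T"
      then obtain a b where "x = i a + j b" "a \<in> S" "b \<in> S'" using T(2) by blast
      then show "x \<in> fv.span (i ` S \<union> j ` S')" by (auto intro: fv.span_add fv.span_base)
    qed
    then show "fv.span T \<subseteq> fv.span (i ` S \<union> j ` S')" by (rule fv.span_minimal) (rule fv.subspace_span)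
  qed
  have "fv.span (i ` S) \<inter> fv.span (j ` S') \<subseteq> {0}"
  proof
    fix x assume "x \<in> fv.span (i ` S) \<inter> fv.span (j ` S')"
    then have "x \<in> f ` fv.span S" "x \<in> g ` fv.span S'"
      unfolding fS[symmetric] fp.linear_span_image[OF f(1)] fp.linear_span_image[OF g(1)] by auto
    then obtain a b where "a \<in> V" "b \<in> V'" "x = f a" "x = g b" using spS by blast
    then show "x \<in> {0}" using int[of a b] f(2) g(2) by simp
  qed
  moreover have "fin_dim (i ` S)" "fin_dim (j ` S')"
    unfolding fS[symmetric] using fin_dim_subset[OF fd(1) S(1)] fin_dim_subset[OF fd(2) S(2)]
    by (auto intro: fin_dim_image f(1) g(1))
  ultimately have "fv.dim (i ` S \<union> j ` S') = fv.dim (i ` S) + fv.dim (j ` S')"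
    by (intro dim_Un_disjoint)
  moreover have "fv.dim T = fv.dim (i ` S \<union> j ` S')" using span by (metis fv.dim_span)
  ultimately show ?thesis
    using dim_lin_on_image[OF V(1) i S(1)] dim_lin_on_image[OF V(2) j S(2)] by simp
qed

context quiver_alg
begin

lemma rmod_homD:
  assumes r: "rep V E Y" "rep V' E' Y'" and f: "f \<in> mod_hom R (rmod V E Y) (rmod V' E' Y')"
  shows "lin_on V f" "f ` V \<subseteq> V'"
    "\<And>v x. v \<in> verts Q \<Longrightarrow> x \<in> V \<Longrightarrow> f (E v x) = E' v (f x)"
    "\<And>\<alpha> x. \<alpha> \<in> arcs Q \<Longrightarrow> x \<in> V \<Longrightarrow> f (Y \<alpha> x) = Y' \<alpha> (f x)"
proof -
  show V': "f ` V \<subseteq> V'" using mod_homD(1)[OF f] by auto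
  show "lin_on V f" unfolding lin_on_def
  proof (intro conjI ballI allI)
    show "f (x + y) = f x + f y" if "x \<in> V" "y \<in> V" for x y
      using mod_homD(2)[OF f, of x y] that by simp
    show "f (fs c x) = fs c (f x)" if "x \<in> V" for c x
    proof -
      have "f x \<in> V'" using V' that by auto
      then show ?thesis using mod_homD(3)[OF f gens_closed(1), of x c] that
        by (simp add: rmod_sc[OF r(1)] rmod_sc[OF r(2)])
    qed
  qed
  show "f (E v x) = E' v (f x)" if "v \<in> verts Q" "x \<in> V" for v x
    using mod_homD(3)[OF f gens_closed(2), of x v] that by (simp add: rmod_ev)
  show "f (Y \<alpha> x) = Y' \<alpha> (f x)" if "\<alpha> \<in> arcs Q" "x \<in> V" for \<alpha> x
    using mod_homD(3)[OF f gens_closed(3), of x \<alpha>] that by (simp add: rmod_ar)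
qed

lemma rmod_homI:
  assumes r: "rep V E Y" "rep V' E' Y'" and f: "lin_on V f" "f ` V \<subseteq> V'"
    "\<And>v x. v \<in> verts Q \<Longrightarrow> x \<in> V \<Longrightarrow> f (E v x) = E' v (f x)"
    "\<And>\<alpha> x. \<alpha> \<in> arcs Q \<Longrightarrow> x \<in> V \<Longrightarrow> f (Y \<alpha> x) = Y' \<alpha> (f x)"
  shows "f \<in> mod_hom R (rmod V E Y) (rmod V' E' Y')"
  using f
  by (intro mod_homI_gens right_module_rmod r)
    (auto simp: rmod_sc[OF r(1)] rmod_sc[OF r(2)] rmod_ev rmod_ar lin_on_def image_subset_iff)

text \<open>\<open>Sd\<close> is the component of the representation at p. \<open>Sr\<close>
  collects the values of single arrows ending at p; it need not be a subspace, but its span is the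
  radical at p, and only the span enters its dimension.\<close>

definition Sd :: "'v \<Rightarrow> ('x \<Rightarrow> 'k) set \<Rightarrow> ('v \<Rightarrow> ('x \<Rightarrow> 'k) \<Rightarrow> ('x \<Rightarrow> 'k)) \<Rightarrow> ('x \<Rightarrow> 'k) set" where
  "Sd p V E = {x \<in> V. E p x = x}"
definition Sr :: "'v \<Rightarrow> ('x \<Rightarrow> 'k) set \<Rightarrow> ('e \<Rightarrow> ('x \<Rightarrow> 'k) \<Rightarrow> ('x \<Rightarrow> 'k)) \<Rightarrow> ('x \<Rightarrow> 'k) set" where
  "Sr p V Y = {Y \<alpha> x |\<alpha> x. \<alpha> \<in> arcs Q \<and> head Q \<alpha> = p \<and> x \<in> V}"
definition Sn :: "'v \<Rightarrow> 'e set \<Rightarrow> ('x \<Rightarrow> 'k) set \<Rightarrow> ('v \<Rightarrow> ('x \<Rightarrow> 'k) \<Rightarrow> ('x \<Rightarrow> 'k)) \<Rightarrow>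
    ('e \<Rightarrow> ('x \<Rightarrow> 'k) \<Rightarrow> ('x \<Rightarrow> 'k)) \<Rightarrow> ('x \<Rightarrow> 'k) set" where
  "Sn p C V E Y = {x \<in> V. E p x = x \<and> (\<forall>\<gamma>\<in>C. Y \<gamma> x = 0)}"

text \<open>Both invariants are additive on direct sums and vanish on projectives, the second one if \<open>C\<close> contains
  an arrow starting at \<open>p\<close>; \<open>omr\<close> is the multiplicity of the simple module at \<open>p\<close> in the syzygy.\<close>

definition omr :: "('x \<Rightarrow> 'k) set \<Rightarrow> ('v \<Rightarrow> ('x \<Rightarrow> 'k) \<Rightarrow> ('x \<Rightarrow> 'k)) \<Rightarrow>
    ('e \<Rightarrow> ('x \<Rightarrow> 'k) \<Rightarrow> ('x \<Rightarrow> 'k)) \<Rightarrow> 'v \<Rightarrow> int" where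
  "omr V E Y p = (\<Sum>\<alpha>\<in>in_arcs Q p. int (fv.dim (Sd (tail Q \<alpha>) V E)) - int (fv.dim (Sr (tail Q \<alpha>) V Y)))
     - int (fv.dim (Sr p V Y))"
definition nur :: "'e set \<Rightarrow> ('x \<Rightarrow> 'k) set \<Rightarrow> ('v \<Rightarrow> ('x \<Rightarrow> 'k) \<Rightarrow> ('x \<Rightarrow> 'k)) \<Rightarrow>
    ('e \<Rightarrow> ('x \<Rightarrow> 'k) \<Rightarrow> ('x \<Rightarrow> 'k)) \<Rightarrow> 'v \<Rightarrow> int" where
  "nur C V E Y p = int (fv.dim (Sn p C V E Y)) - int (fv.dim (Sr p V Y))"

lemma inv_iso:
  assumes r: "rep V E Y" "rep V' E' Y'" and iso: "mod_iso R (rmod V E Y) (rmod V' E' Y')"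
  shows "p \<in> verts Q \<Longrightarrow> fv.dim (Sd p V E) = fv.dim (Sd p V' E')"
    "fv.dim (Sr p V Y) = fv.dim (Sr p V' Y')"
    "p \<in> verts Q \<Longrightarrow> C \<subseteq> arcs Q \<Longrightarrow> fv.dim (Sn p C V E Y) = fv.dim (Sn p C V' E' Y')"
proof -
  obtain f where f: "f \<in> mod_hom R (rmod V E Y) (rmod V' E' Y')" "bij_betw f V V'"
    using iso by (auto simp: mod_iso_def)
  note h = rmod_homD[OF r f(1)]
  have inj: "inj_on f V" and im: "f ` V = V'" using f(2) by (auto simp: bij_betw_def)
  have eq: "f x = f y \<longleftrightarrow> x = y" if "x \<in> V" "y \<in> V" for x y using inj that by (auto simp: inj_on_def)
  note dim = dim_lin_on_image[OF repD(1)[OF r(1)] h(1) inj]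
  have f0: "f 0 = 0" using h(1) fv.subspace_0[OF repD(1)[OF r(1)]] unfolding lin_on_def by (metis fv.scale_zero_left)
  have fixE: "E' p (f x) = f x \<longleftrightarrow> E p x = x" if "p \<in> verts Q" "x \<in> V" for p x
    using h(3)[OF that] eq[of "E p x" x] repD(4)[OF r(1) that] that by auto
  show "fv.dim (Sd p V E) = fv.dim (Sd p V' E')" if p: "p \<in> verts Q"
  proof -
    have "f ` Sd p V E = Sd p V' E'"
      unfolding Sd_def im[symmetric] using fixE[OF p] by (auto simp: image_iff)
    then show ?thesis using dim[of "Sd p V E"] by (auto simp: Sd_def)
  qed
  show "fv.dim (Sr p V Y) = fv.dim (Sr p V' Y')"
  proof -
    have "f ` Sr p V Y = Sr p V' Y'"
    proof
      show "f ` Sr p V Y \<subseteq> Sr p V' Y'" unfolding Sr_def im[symmetric] using h(4) by blast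
      show "Sr p V' Y' \<subseteq> f ` Sr p V Y" unfolding Sr_def im[symmetric]
      proof clarify
        fix \<alpha> x assume "\<alpha> \<in> arcs Q" "x \<in> V"
        then show "Y' \<alpha> (f x) \<in> f ` {Y \<alpha>' x |\<alpha>' x. \<alpha>' \<in> arcs Q \<and> head Q \<alpha>' = head Q \<alpha> \<and> x \<in> V}"
          using h(4)[of \<alpha> x] by (intro image_eqI[of _ _ "Y \<alpha> x"]) auto
      qed
    qed
    moreover have "Sr p V Y \<subseteq> V" using repD(6)[OF r(1)] by (auto simp: Sr_def)
    ultimately show ?thesis using dim[of "Sr p V Y"] by simp
  qed
  show "fv.dim (Sn p C V E Y) = fv.dim (Sn p C V' E' Y')" if p: "p \<in> verts Q" and C: "C \<subseteq> arcs Q"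
  proof -
    have "Y \<gamma> x = 0 \<longleftrightarrow> Y' \<gamma> (f x) = 0" if "\<gamma> \<in> C" "x \<in> V" for \<gamma> x
      using h(4)[of \<gamma> x] that C eq[of "Y \<gamma> x" 0] f0 repD(6)[OF r(1), of \<gamma> x] fv.subspace_0[OF repD(1)[OF r(1)]]
      by auto
    then have "f ` Sn p C V E Y = Sn p C V' E' Y'"
      unfolding Sn_def im[symmetric] using fixE[OF p] by (auto simp: image_iff)
    then show ?thesis using dim[of "Sn p C V E Y"] by (auto simp: Sn_def)
  qed
qed

text \<open>The isomorphism embeds the summands by \<open>i\<close> and \<open>j\<close> as
  complementary subspaces. Vertices and arrows act on the two parts separately, so every condition
  defining the three sets splits.\<close>

lemma inv_direct_sum:
  assumes r: "rep V E Y" "rep V' E' Y'" "rep V'' E'' Y''"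
    and iso: "mod_iso R (rmod V E Y) (direct_sum (rmod V' E' Y') (rmod V'' E'' Y''))"
  shows "p \<in> verts Q \<Longrightarrow> fv.dim (Sd p V E) = fv.dim (Sd p V' E') + fv.dim (Sd p V'' E'')"
    "fv.dim (Sr p V Y) = fv.dim (Sr p V' Y') + fv.dim (Sr p V'' Y'')"
    "p \<in> verts Q \<Longrightarrow> C \<subseteq> arcs Q \<Longrightarrow>
      fv.dim (Sn p C V E Y) = fv.dim (Sn p C V' E' Y') + fv.dim (Sn p C V'' E'' Y'')"
proof -
  let ?D = "direct_sum (rmod V' E' Y') (rmod V'' E'' Y'')"
  have D: "right_module R ?D" by (intro right_module_direct_sum right_module_rmod r)
  obtain f where f: "f \<in> mod_hom R ?D (rmod V E Y)" "bij_betw f (V' \<times> V'') V"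
    using mod_iso_sym[OF right_module_rmod[OF r(1)] iso] by (auto simp: mod_iso_def)
  note Z' = fv.subspace_0[OF repD(1)[OF r(2)]] and Z'' = fv.subspace_0[OF repD(1)[OF r(3)]]
  have f0: "f (0, 0) = 0" using mod_hom_zero[OF D right_module_rmod[OF r(1)] f(1)] by simp
  have i1: "(\<lambda>x. (x, 0)) \<in> mod_hom R (rmod V' E' Y') ?D"
    by (intro mod_homI_gens D right_module_rmod r)
      (use Z'' in \<open>auto simp: rmod_sc[OF r(2)] rmod_sc[OF r(3)] rmod_ev rmod_ar flinD[OF repD(3)[OF r(3)]] flinD[OF repD(5)[OF r(3)]]\<close>)
  have i2: "(\<lambda>x. (0, x)) \<in> mod_hom R (rmod V'' E'' Y'') ?D"
    by (intro mod_homI_gens D right_module_rmod r)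
      (use Z' in \<open>auto simp: rmod_sc[OF r(2)] rmod_sc[OF r(3)] rmod_ev rmod_ar flinD[OF repD(3)[OF r(2)]] flinD[OF repD(5)[OF r(2)]]\<close>)
  define i where "i x = f (x, 0)" for x
  define j where "j x = f (0, x)" for x
  have ih: "i \<in> mod_hom R (rmod V' E' Y') (rmod V E Y)" unfolding i_def using mod_hom_comp[OF i1 f(1)] .
  have jh: "j \<in> mod_hom R (rmod V'' E'' Y'') (rmod V E Y)" unfolding j_def using mod_hom_comp[OF i2 f(1)] .
  note I = rmod_homD[OF r(2,1) ih] and J = rmod_homD[OF r(3,1) jh]
  have inj: "x = y" if "f x = f y" "x \<in> V' \<times> V''" "y \<in> V' \<times> V''" for x y
    using f(2) that by (auto simp: bij_betw_def inj_on_def)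
  have ii: "inj_on i V'" by (rule inj_onI) (use inj Z'' in \<open>auto simp: i_def\<close>)
  have ji: "inj_on j V''" by (rule inj_onI) (use inj Z' in \<open>auto simp: j_def\<close>)
  have int: "i a = 0" if "a \<in> V'" "b \<in> V''" "i a = j b" for a b
    using inj[of "(a, 0)" "(0, b)"] that Z' Z'' f0 by (auto simp: i_def j_def)
  have split: "\<exists>a\<in>V'. \<exists>b\<in>V''. x = i a + j b" if x: "x \<in> V" for x
  proof -
    obtain a b where ab: "a \<in> V'" "b \<in> V''" "x = f (a, b)"
      using x f(2) unfolding bij_betw_def by blast
    have "f (a, b) = i a + j b"
      using mod_homD(2)[OF f(1), of "(a, 0)" "(0, b)"] ab Z' Z'' by (simp add: i_def j_def)
    with ab show ?thesis by blast
  qed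
  have uniq: "a = a' \<and> b = b'" if "i a + j b = i a' + j b'" "a \<in> V'" "a' \<in> V'" "b \<in> V''" "b' \<in> V''" for a b a' b'
  proof -
    have "f (a, b) = i a + j b" "f (a', b') = i a' + j b'"
      using mod_homD(2)[OF f(1), of "(a, 0)" "(0, b)"] mod_homD(2)[OF f(1), of "(a', 0)" "(0, b')"] that Z' Z''
      by (simp_all add: i_def j_def)
    then show ?thesis using inj[of "(a, b)" "(a', b')"] that by auto
  qed
  have i0: "i 0 = 0" "j 0 = 0" by (simp_all add: i_def j_def f0)
  note dim = dim_direct_sum_lin[OF repD(1)[OF r(2)] repD(1)[OF r(3)] repD(2)[OF r(2)] repD(2)[OF r(3)]
      I(1) ii J(1) ji int]
  show "fv.dim (Sr p V Y) = fv.dim (Sr p V' Y') + fv.dim (Sr p V'' Y'')"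
  proof (rule dim)
    show "Sr p V' Y' \<subseteq> V'" using repD(6)[OF r(2)] by (auto simp: Sr_def)
    show "Sr p V'' Y'' \<subseteq> V''" using repD(6)[OF r(3)] by (auto simp: Sr_def)
    have "i ` Sr p V' Y' \<subseteq> Sr p V Y"
    proof clarify
      fix z assume "z \<in> Sr p V' Y'"
      then obtain \<alpha> x where z: "z = Y' \<alpha> x" "\<alpha> \<in> arcs Q" "head Q \<alpha> = p" "x \<in> V'" by (auto simp: Sr_def)
      then show "i z \<in> Sr p V Y" using I(4)[of \<alpha> x] I(2) unfolding Sr_def by blast
    qed
    moreover have "j ` Sr p V'' Y'' \<subseteq> Sr p V Y"
    proof clarify
      fix z assume "z \<in> Sr p V'' Y''"
      then obtain \<alpha> x where z: "z = Y'' \<alpha> x" "\<alpha> \<in> arcs Q" "head Q \<alpha> = p" "x \<in> V''" by (auto simp: Sr_def)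
      then show "j z \<in> Sr p V Y" using J(4)[of \<alpha> x] J(2) unfolding Sr_def by blast
    qed
    ultimately show "i ` Sr p V' Y' \<union> j ` Sr p V'' Y'' \<subseteq> Sr p V Y" by blast
    show "Sr p V Y \<subseteq> {i a + j b |a b. a \<in> Sr p V' Y' \<and> b \<in> Sr p V'' Y''}"
    proof
      fix z assume "z \<in> Sr p V Y"
      then obtain \<alpha> x where z: "z = Y \<alpha> x" "\<alpha> \<in> arcs Q" "head Q \<alpha> = p" "x \<in> V" by (auto simp: Sr_def)
      obtain a b where ab: "a \<in> V'" "b \<in> V''" "x = i a + j b" using split[OF z(4)] by blast
      have "z = i (Y' \<alpha> a) + j (Y'' \<alpha> b)"
        using z ab I(4) J(4) by (simp add: flinD[OF repD(5)[OF r(1)]])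
      then show "z \<in> {i a + j b |a b. a \<in> Sr p V' Y' \<and> b \<in> Sr p V'' Y''}"
        using z ab unfolding Sr_def by blast
    qed
  qed
  have key: "E p (i a + j b) = i a + j b \<longleftrightarrow> E' p a = a \<and> E'' p b = b"
    if p: "p \<in> verts Q" and ab: "a \<in> V'" "b \<in> V''" for p a b
  proof -
    have "E p (i a + j b) = i (E' p a) + j (E'' p b)"
      using p ab I(3) J(3) by (simp add: flinD[OF repD(3)[OF r(1)]])
    then show ?thesis using uniq[of "E' p a" "E'' p b" a b] ab repD(4)[OF r(2) p] repD(4)[OF r(3) p] by auto
  qed
  have keyY: "Y \<gamma> (i a + j b) = 0 \<longleftrightarrow> Y' \<gamma> a = 0 \<and> Y'' \<gamma> b = 0"
    if p: "\<gamma> \<in> arcs Q" and ab: "a \<in> V'" "b \<in> V''" for \<gamma> a b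
  proof -
    have "Y \<gamma> (i a + j b) = i (Y' \<gamma> a) + j (Y'' \<gamma> b)"
      using p ab I(4) J(4) by (simp add: flinD[OF repD(5)[OF r(1)]])
    then show ?thesis using uniq[of "Y' \<gamma> a" "Y'' \<gamma> b" 0 0] ab repD(6)[OF r(2) p] repD(6)[OF r(3) p] Z' Z'' i0 by auto
  qed
  have sn: "fv.dim (Sn p C V E Y) = fv.dim (Sn p C V' E' Y') + fv.dim (Sn p C V'' E'' Y'')"
    if p: "p \<in> verts Q" and C: "C \<subseteq> arcs Q" for C
  proof (rule dim)
    have E0: "E' p 0 = 0" "E'' p 0 = 0" using flinD(3) repD(3)[OF r(2) p] repD(3)[OF r(3) p] by blast+
    have Y0: "Y' \<gamma> 0 = 0" "Y'' \<gamma> 0 = 0" if "\<gamma> \<in> C" for \<gamma>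
      using flinD(3) repD(5)[OF r(2), of \<gamma>] repD(5)[OF r(3), of \<gamma>] that C by blast+
    have "i a \<in> Sn p C V E Y" if "a \<in> Sn p C V' E' Y'" for a
    proof -
      have "a \<in> V'" using that by (simp add: Sn_def)
      then show ?thesis using that key[OF p, of a 0] keyY[of _ a 0] C E0 Y0 I(2) Z'' i0 by (auto simp: Sn_def)
    qed
    moreover have "j a \<in> Sn p C V E Y" if "a \<in> Sn p C V'' E'' Y''" for a
    proof -
      have "a \<in> V''" using that by (simp add: Sn_def)
      then show ?thesis using that key[OF p, of 0 a] keyY[of _ 0 a] C E0 Y0 J(2) Z' i0 by (auto simp: Sn_def)
    qed
    ultimately show "i ` Sn p C V' E' Y' \<union> j ` Sn p C V'' E'' Y'' \<subseteq> Sn p C V E Y" by blast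
    show "Sn p C V E Y \<subseteq> {i a + j b |a b. a \<in> Sn p C V' E' Y' \<and> b \<in> Sn p C V'' E'' Y''}"
    proof
      fix x assume x: "x \<in> Sn p C V E Y"
      then obtain a b where ab: "a \<in> V'" "b \<in> V''" "x = i a + j b" using split[of x] by (auto simp: Sn_def)
      then have "a \<in> Sn p C V' E' Y'" "b \<in> Sn p C V'' E'' Y''"
        using x key[OF p ab(1,2)] keyY[OF _ ab(1,2)] C by (auto simp: Sn_def)
      with ab show "x \<in> {i a + j b |a b. a \<in> Sn p C V' E' Y' \<and> b \<in> Sn p C V'' E'' Y''}" by blast
    qed
  qed (auto simp: Sn_def)
  then show "p \<in> verts Q \<Longrightarrow> C \<subseteq> arcs Q \<Longrightarrow>
      fv.dim (Sn p C V E Y) = fv.dim (Sn p C V' E' Y') + fv.dim (Sn p C V'' E'' Y'')" .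
  \<comment> \<open>The empty set of arrows turns \<open>Sn\<close> into \<open>Sd\<close>.\<close>
  show "p \<in> verts Q \<Longrightarrow> fv.dim (Sd p V E) = fv.dim (Sd p V' E') + fv.dim (Sd p V'' E'')"
    using sn[of "{}"] by (simp add: Sn_def Sd_def)
qed

text \<open>Vertex and arrow multiples of the generators form a finite set \<open>T\<close> spanning
  M over the field, so the map \<open>L\<close> taking linear combinations is onto from the
  coordinate space on \<open>T\<close>. A complement \<open>V\<close> of its kernel is in bijection
  with M, and the action is transported to \<open>V\<close>. As \<open>T\<close> consists of module
  elements, \<open>V\<close> lives in functions on the carrier type.\<close>

lemma normal_form:
  fixes M :: "(('v \<times> 'e list \<Rightarrow> 'k) set, 'b) module"
  assumes M: "right_module R M" and fg: "fin_gen R M"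
  obtains V :: "('b \<Rightarrow> 'k) set" and E Y where "rep V E Y" "mod_iso R (rmod V E Y) M"
proof -
  interpret M: right_module R M by (rule M)
  obtain S where S: "finite S" "S \<subseteq> carrier M"
    and gen: "\<And>x. x \<in> carrier M \<Longrightarrow> \<exists>r\<in>S \<rightarrow> carrier R. x = (\<Oplus>\<^bsub>M\<^esub>s\<in>S. r s \<odot>\<^bsub>M\<^esub> s)"
    using fg unfolding fin_gen_def by blast
  define T where "T = (\<lambda>(s, v). ev v \<odot>\<^bsub>M\<^esub> s) ` (S \<times> verts Q) \<union> (\<lambda>(s, \<alpha>). ar \<alpha> \<odot>\<^bsub>M\<^esub> s) ` (S \<times> arcs Q)"
  have T: "finite T" "T \<subseteq> carrier M" using S by (auto simp: T_def)
  define L where "L c = (\<Oplus>\<^bsub>M\<^esub>t\<in>T. sc (c t) \<odot>\<^bsub>M\<^esub> t)" for c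
  have Tc: "(\<lambda>t. sc (c t) \<odot>\<^bsub>M\<^esub> t) \<in> T \<rightarrow> carrier M" for c using T(2) by auto
  have Lc [simp]: "L c \<in> carrier M" for c unfolding L_def using Tc by (rule M.M.finsum_closed)
  have L_add: "L (c + d) = L c \<oplus>\<^bsub>M\<^esub> L d" for c d
  proof -
    have "L (c + d) = (\<Oplus>\<^bsub>M\<^esub>t\<in>T. sc (c t) \<odot>\<^bsub>M\<^esub> t \<oplus>\<^bsub>M\<^esub> sc (d t) \<odot>\<^bsub>M\<^esub> t)"
      unfolding L_def by (rule M.M.finsum_cong') (use T in \<open>auto simp: sc_add M.smult_l_distr\<close>)
    also have "\<dots> = L c \<oplus>\<^bsub>M\<^esub> L d" unfolding L_def by (rule M.M.finsum_addf[OF Tc Tc])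
    finally show ?thesis .
  qed
  have L_fs: "L (fs a c) = sc a \<odot>\<^bsub>M\<^esub> L c" for a c
  proof -
    have "sc a \<odot>\<^bsub>M\<^esub> L c = (\<Oplus>\<^bsub>M\<^esub>t\<in>T. sc a \<odot>\<^bsub>M\<^esub> (sc (c t) \<odot>\<^bsub>M\<^esub> t))"
      unfolding L_def by (rule M.smult_r_finsum[OF _ Tc]) simp
    also have "\<dots> = L (fs a c)" unfolding L_def
      by (rule M.M.finsum_cong') (use T in \<open>auto simp: fs_apply M.smult_assoc[symmetric] sc_mult mult.commute\<close>)
    finally show ?thesis by simp
  qed
  have L_unit: "L (unitf t) = t" if t: "t \<in> T" for t
  proof -
    have "L (unitf t) = (\<Oplus>\<^bsub>M\<^esub>s\<in>T. if t = s then s else \<zero>\<^bsub>M\<^esub>)"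
      unfolding L_def by (rule M.M.finsum_cong') (use T in \<open>auto simp: unitf_def sc_0 sc_1\<close>)
    also have "\<dots> = t" by (rule M.M.finsum_singleton[OF t T(1)]) (use T in auto)
    finally show ?thesis .
  qed
  let ?F = "fspace T :: ('b \<Rightarrow> 'k) set"
  have F: "fv.subspace ?F" "fin_dim ?F" using T by auto
  note F' = fv.subspace_add[OF F(1)] fv.subspace_scale[OF F(1)] fv.subspace_0[OF F(1)]
  have L0: "L 0 = \<zero>\<^bsub>M\<^esub>"
    using L_add[of 0 0] Lc[of 0] by (metis M.M.add.r_cancel_one' add_0)
  have surj: "carrier M = L ` ?F"
  proof
    have rs: "r \<odot>\<^bsub>M\<^esub> s \<in> L ` ?F" if r: "r \<in> carrier R" and s: "s \<in> S" for r s
      using r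
    proof (induction rule: R_add_induct)
      case zero
      have "\<zero>\<^bsub>R\<^esub> \<odot>\<^bsub>M\<^esub> s = L 0" unfolding L0 using s S(2) by auto
      then show ?case using F'(3) by (rule image_eqI)
    next
      case (vert v c)
      then have t: "ev v \<odot>\<^bsub>M\<^esub> s \<in> T" using s by (auto simp: T_def)
      have "(sc c \<otimes>\<^bsub>R\<^esub> ev v) \<odot>\<^bsub>M\<^esub> s = (ev v \<otimes>\<^bsub>R\<^esub> sc c) \<odot>\<^bsub>M\<^esub> s" by (simp add: sc_ev ev_sc)
      also have "\<dots> = L (fs c (unitf (ev v \<odot>\<^bsub>M\<^esub> s)))"
        using s S(2) t by (simp add: M.smult_assoc subset_iff L_fs L_unit)
      finally show ?case using t F' by auto
    next
      case (arc v c)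
      then have t: "ar v \<odot>\<^bsub>M\<^esub> s \<in> T" using s by (auto simp: T_def)
      have "(sc c \<otimes>\<^bsub>R\<^esub> ar v) \<odot>\<^bsub>M\<^esub> s = (ar v \<otimes>\<^bsub>R\<^esub> sc c) \<odot>\<^bsub>M\<^esub> s" by (simp add: sc_ar ar_sc)
      also have "\<dots> = L (fs c (unitf (ar v \<odot>\<^bsub>M\<^esub> s)))"
        using s S(2) t by (simp add: M.smult_assoc subset_iff L_fs L_unit)
      finally show ?case using t F' by auto
    next
      case (add a b)
      have "s \<in> carrier M" using s S by auto
      then show ?case using add F' by (auto simp: M.smult_l_distr L_add[symmetric])
    qed
    have fin: "(\<Oplus>\<^bsub>M\<^esub>s\<in>U. r s \<odot>\<^bsub>M\<^esub> s) \<in> L ` ?F" if "finite U" "U \<subseteq> S" "r \<in> S \<rightarrow> carrier R" for U r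
      using that
    proof (induction U)
      case empty
      have "(\<Oplus>\<^bsub>M\<^esub>s\<in>{}. r s \<odot>\<^bsub>M\<^esub> s) = L 0" unfolding L0 by simp
      then show ?case using F'(3) by (rule image_eqI)
    next
      case (insert s U)
      have "(\<Oplus>\<^bsub>M\<^esub>s\<in>insert s U. r s \<odot>\<^bsub>M\<^esub> s) = r s \<odot>\<^bsub>M\<^esub> s \<oplus>\<^bsub>M\<^esub> (\<Oplus>\<^bsub>M\<^esub>s\<in>U. r s \<odot>\<^bsub>M\<^esub> s)"
        using insert.hyps insert.prems S(2) by (intro M.M.finsum_insert) (auto simp: Pi_iff subset_iff)
      moreover have "r s \<odot>\<^bsub>M\<^esub> s \<in> L ` ?F" using rs insert.prems by auto
      moreover have "(\<Oplus>\<^bsub>M\<^esub>s\<in>U. r s \<odot>\<^bsub>M\<^esub> s) \<in> L ` ?F" using insert by auto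
      ultimately show ?case using F' by (auto simp: L_add[symmetric])
    qed
    show "carrier M \<subseteq> L ` ?F"
    proof
      fix x assume "x \<in> carrier M"
      then obtain r where "r \<in> S \<rightarrow> carrier R" "x = (\<Oplus>\<^bsub>M\<^esub>s\<in>S. r s \<odot>\<^bsub>M\<^esub> s)" using gen by blast
      then show "x \<in> L ` ?F" using fin[OF S(1) subset_refl] by simp
    qed
  qed auto
  define K where "K = {c \<in> ?F. L c = \<zero>\<^bsub>M\<^esub>}"
  have K: "fv.subspace K" unfolding K_def
    by (rule fv.subspaceI) (auto simp: F' L0 L_add L_fs)
  obtain C where C: "C \<subseteq> ?F" "?F = fv.span (K \<union> C)" "K \<inter> fv.span C \<subseteq> {0}"
    using complement_basis[OF F _ K] by (metis (no_types, lifting) K_def mem_Collect_eq subsetI)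
  define V where "V = fv.span C"
  have V: "fv.subspace V" "V \<subseteq> ?F" "fin_dim V"
    using C(1) F fv.span_minimal[OF C(1) F(1)] fin_dim_subset[OF F(2)] by (auto simp: V_def)
  note V' = fv.subspace_add[OF V(1)] fv.subspace_scale[OF V(1)] fv.subspace_0[OF V(1)]
  have inj: "x = y" if "L x = L y" "x \<in> V" "y \<in> V" for x y
  proof -
    have "x - y \<in> V" using that V(1) by (intro fv.subspace_diff)
    moreover have "L (x - y) \<oplus>\<^bsub>M\<^esub> L y = L y" using L_add[of "x - y" y] that by simp
    then have "L (x - y) = \<zero>\<^bsub>M\<^esub>" by simp
    ultimately have "x - y \<in> K \<inter> fv.span C" using V(2) by (auto simp: K_def V_def)
    then show ?thesis using C(3) by auto
  qed
  have bij: "bij_betw L V (carrier M)" unfolding bij_betw_def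
  proof
    show "inj_on L V" by (rule inj_onI) (use inj in blast)
    show "L ` V = carrier M"
    proof
      show "carrier M \<subseteq> L ` V"
      proof
        fix x assume "x \<in> carrier M"
        then obtain c where c: "c \<in> ?F" "x = L c" using surj by blast
        then obtain a b where ab: "c = a + b" "a \<in> fv.span K" "b \<in> V"
          using C(2) unfolding fv.span_Un V_def by blast
        have "a \<in> K" using ab(2) K by (metis fv.span_eq_iff)
        then have "x = L b" using c ab by (simp add: L_add K_def)
        then show "x \<in> L ` V" using ab by blast
      qed
    qed auto
  qed
  define \<psi> where "\<psi> = inv_into V L"
  have \<psi>: "\<psi> x \<in> V" "L (\<psi> x) = x" if "x \<in> carrier M" for x
    using bij that by (auto simp: \<psi>_def bij_betw_def inv_into_into f_inv_into_f)
  \<comment> \<open>\<open>rep\<close> asks for globally linear operators, so the transported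
    actions, linear on \<open>V\<close> only, are extended.\<close>
  have ex: "\<exists>g. flin g \<and> (\<forall>x\<in>V. g x = \<psi> (r \<odot>\<^bsub>M\<^esub> L x))" if r: "r = ev v \<or> r = ar \<alpha>" for r v \<alpha>
  proof -
    have rR: "r \<in> carrier R" using r by auto
    have comm: "sc c \<otimes>\<^bsub>R\<^esub> r = r \<otimes>\<^bsub>R\<^esub> sc c" for c using r by (auto simp: sc_ev ev_sc sc_ar ar_sc)
    have "lin_on V (\<lambda>x. \<psi> (r \<odot>\<^bsub>M\<^esub> L x))" unfolding lin_on_def
    proof (intro conjI ballI allI)
      fix x y assume "x \<in> V" "y \<in> V"
      then show "\<psi> (r \<odot>\<^bsub>M\<^esub> L (x + y)) = \<psi> (r \<odot>\<^bsub>M\<^esub> L x) + \<psi> (r \<odot>\<^bsub>M\<^esub> L y)"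
        by (intro inj) (auto simp: \<psi> L_add rR M.smult_r_distr V')
    next
      fix c x assume "x \<in> V"
      have "r \<odot>\<^bsub>M\<^esub> (sc c \<odot>\<^bsub>M\<^esub> L x) = sc c \<odot>\<^bsub>M\<^esub> (r \<odot>\<^bsub>M\<^esub> L x)"
        by (simp add: M.smult_assoc[symmetric] comm rR)
      then show "\<psi> (r \<odot>\<^bsub>M\<^esub> L (fs c x)) = fs c (\<psi> (r \<odot>\<^bsub>M\<^esub> L x))"
        by (intro inj) (auto simp: \<psi> L_fs rR V')
    qed
    then obtain g where "flin g" "\<And>x. x \<in> V \<Longrightarrow> g x = \<psi> (r \<odot>\<^bsub>M\<^esub> L x)"
      using lin_on_extend[OF V(1)] by blast
    then show ?thesis by blast
  qed
  have "\<forall>v. \<exists>g. flin g \<and> (\<forall>x\<in>V. g x = \<psi> (ev v \<odot>\<^bsub>M\<^esub> L x))" using ex by blast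
  then obtain E where E0: "\<forall>v. flin (E v) \<and> (\<forall>x\<in>V. E v x = \<psi> (ev v \<odot>\<^bsub>M\<^esub> L x))"
    by (rule exE[OF choice])
  then have E: "\<And>v. flin (E v)" "\<And>v x. x \<in> V \<Longrightarrow> E v x = \<psi> (ev v \<odot>\<^bsub>M\<^esub> L x)" by simp_all
  have "\<forall>v. \<exists>g. flin g \<and> (\<forall>x\<in>V. g x = \<psi> (ar v \<odot>\<^bsub>M\<^esub> L x))" using ex by blast
  then obtain Y where Y0: "\<forall>v. flin (Y v) \<and> (\<forall>x\<in>V. Y v x = \<psi> (ar v \<odot>\<^bsub>M\<^esub> L x))"
    by (rule exE[OF choice])
  then have Y: "\<And>v. flin (Y v)" "\<And>v x. x \<in> V \<Longrightarrow> Y v x = \<psi> (ar v \<odot>\<^bsub>M\<^esub> L x)" by simp_all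
  have EV: "E v x \<in> V" "L (E v x) = ev v \<odot>\<^bsub>M\<^esub> L x" if "x \<in> V" for v x
    using that by (simp_all add: E \<psi>)
  have YV: "Y v x \<in> V" "L (Y v x) = ar v \<odot>\<^bsub>M\<^esub> L x" if "x \<in> V" for v x
    using that by (simp_all add: Y \<psi>)
  \<comment> \<open>Partial sums of the vertex idempotents; taken over all vertices they act as the
    identity.\<close>
  have sumE: "L (\<Sum>v\<in>U. E v x) = el (\<lambda>u. if u \<in> U then 1 else 0) 0 \<odot>\<^bsub>M\<^esub> L x \<and> (\<Sum>v\<in>U. E v x) \<in> V"
    if "finite U" "x \<in> V" for U x
    using that(1)
  proof (induction U)
    case empty
    have "el (\<lambda>u. if u \<in> {} then 1 else 0) 0 = \<zero>\<^bsub>R\<^esub>" unfolding el_zero by (rule el_cong) auto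
    then have "el (\<lambda>u. if u \<in> {} then 1 else 0) 0 \<odot>\<^bsub>M\<^esub> L x = \<zero>\<^bsub>M\<^esub>" by (simp only: M.smult_l_null Lc)
    then show ?case using V'(3) L0 by (simp only: sum.empty)
  next
    case (insert v U)
    have "el (\<lambda>u. if u \<in> insert v U then 1 else 0) 0 = ev v \<oplus>\<^bsub>R\<^esub> el (\<lambda>u. if u \<in> U then 1 else 0) 0"
      unfolding ev_def el_add using insert.hyps by (intro el_cong) auto
    then have "el (\<lambda>u. if u \<in> insert v U then 1 else 0) 0 \<odot>\<^bsub>M\<^esub> L x =
        ev v \<odot>\<^bsub>M\<^esub> L x \<oplus>\<^bsub>M\<^esub> el (\<lambda>u. if u \<in> U then 1 else 0) 0 \<odot>\<^bsub>M\<^esub> L x"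
      by (simp only: M.smult_l_distr Lc el_closed gens_closed)
    then show ?case using insert.IH EV[OF that(2)] V'(1) by (simp only: sum.insert[OF insert.hyps] L_add)
  qed
  have L1: "L x = L y \<longleftrightarrow> x = y" if "x \<in> V" "y \<in> V" for x y using inj that by blast
  have "rep V E Y" unfolding rep_def
  proof (intro conjI ballI)
    show "(\<Sum>v\<in>verts Q. E v x) = x" if x: "x \<in> V" for x
    proof -
      have "el (\<lambda>u. if u \<in> verts Q then 1 else 0) 0 = \<one>\<^bsub>R\<^esub>" unfolding el_one by (rule el_cong) auto
      then have "L (\<Sum>v\<in>verts Q. E v x) = L x" using sumE[OF finite_verts x] by (simp only: M.smult_one Lc)
      then show ?thesis using sumE[OF finite_verts x] x by (intro inj) auto
    qed
    show "E u (E v x) = (if u = v then E v x else 0)" if x: "x \<in> V" for u v x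
    proof (rule inj)
      show "L (E u (E v x)) = L (if u = v then E v x else 0)"
        using x EV by (simp add: M.smult_assoc[symmetric] ev_ev L0)
    qed (use x EV V' in auto)
    show "Y \<alpha> (E u x) = (if u = tail Q \<alpha> then Y \<alpha> x else 0)" if x: "x \<in> V" "\<alpha> \<in> arcs Q" for u \<alpha> x
    proof (rule inj)
      show "L (Y \<alpha> (E u x)) = L (if u = tail Q \<alpha> then Y \<alpha> x else 0)"
        using x EV YV by (simp add: M.smult_assoc[symmetric] ev_ar L0)
    qed (use x EV YV V' in auto)
    show "E u (Y \<alpha> x) = (if u = head Q \<alpha> then Y \<alpha> x else 0)" if x: "x \<in> V" "\<alpha> \<in> arcs Q" for u \<alpha> x
    proof (rule inj)
      show "L (E u (Y \<alpha> x)) = L (if u = head Q \<alpha> then Y \<alpha> x else 0)"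
        using x EV YV by (simp add: M.smult_assoc[symmetric] ar_ev L0)
    qed (use x EV YV V' in auto)
    show "Y \<alpha> (Y \<beta> x) = 0" if x: "x \<in> V" for \<alpha> \<beta> x
    proof (rule inj)
      show "L (Y \<alpha> (Y \<beta> x)) = L 0"
        using x YV by (simp add: M.smult_assoc[symmetric] ar_ar L0)
    qed (use x YV V' in auto)
  qed (use V E(1) Y(1) EV YV in auto)
  moreover from this have "L \<in> mod_hom R (rmod V E Y) M"
    by (intro mod_homI_gens M right_module_rmod)
      (auto simp: L_add rmod_sc L_fs rmod_ev rmod_ar EV YV)
  then have "mod_iso R (rmod V E Y) M" using bij by (auto simp: mod_iso_def)
  ultimately show thesis by (rule that)
qed

end

text \<open>For projectives, syzygies and direct sums finite generation is visible only on an
  isomorphic representation.\<close>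

lemma fin_gen_iso:
  assumes M: "right_module R M" and N: "right_module R N" and iso: "mod_iso R M N" and fg: "fin_gen R M"
  shows "fin_gen R N"
proof -
  interpret M: right_module R M by fact
  interpret N: right_module R N by fact
  obtain f where f: "f \<in> mod_hom R M N" "bij_betw f (carrier M) (carrier N)"
    using iso by (auto simp: mod_iso_def)
  obtain S where S: "finite S" "S \<subseteq> carrier M"
    and gen: "\<And>x. x \<in> carrier M \<Longrightarrow> \<exists>r\<in>S \<rightarrow> carrier R. x = (\<Oplus>\<^bsub>M\<^esub>s\<in>S. r s \<odot>\<^bsub>M\<^esub> s)"
    using fg unfolding fin_gen_def by blast
  have inj: "inj_on f S" using f(2) S(2) by (auto simp: bij_betw_def intro: inj_on_subset)
  show ?thesis unfolding fin_gen_def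
  proof (intro exI[of _ "f ` S"] conjI ballI)
    show "f ` S \<subseteq> carrier N" using S(2) mod_homD(1)[OF f(1)] by auto
    fix y assume "y \<in> carrier N"
    then obtain x where x: "x \<in> carrier M" "y = f x" using f(2) by (auto simp: bij_betw_def)
    obtain r where r: "r \<in> S \<rightarrow> carrier R" "x = (\<Oplus>\<^bsub>M\<^esub>s\<in>S. r s \<odot>\<^bsub>M\<^esub> s)" using gen[OF x(1)] by blast
    have rS: "r s \<in> carrier R" "s \<in> carrier M" if "s \<in> S" for s using r(1) S(2) that by auto
    define r' where "r' t = r (inv_into S f t)" for t
    have r': "r' (f s) = r s" if "s \<in> S" for s using inj that by (simp add: r'_def)
    have "y = (\<Oplus>\<^bsub>N\<^esub>s\<in>S. f (r s \<odot>\<^bsub>M\<^esub> s))"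
      unfolding x(2) r(2) using r(1) S(2) by (intro mod_hom_finsum[OF M N f(1)]) auto
    also have "\<dots> = (\<Oplus>\<^bsub>N\<^esub>s\<in>S. r' (f s) \<odot>\<^bsub>N\<^esub> f s)"
      using rS mod_homD(1,3)[OF f(1)] r' by (intro N.M.finsum_cong') auto
    also have "\<dots> = (\<Oplus>\<^bsub>N\<^esub>t\<in>f ` S. r' t \<odot>\<^bsub>N\<^esub> t)"
      using rS mod_homD(1)[OF f(1)] r' inj by (intro N.M.finsum_reindex[symmetric]) auto
    finally show "\<exists>r\<in>f ` S \<rightarrow> carrier R. y = (\<Oplus>\<^bsub>N\<^esub>t\<in>f ` S. r t \<odot>\<^bsub>N\<^esub> t)"
      using r(1) r' by (intro bexI[of _ r']) auto
  qed (use S in auto)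
qed

section \<open>Projective modules and the radical\<close>

text \<open>The module \<open>\<Oplus>\<^bsub>k<n\<^esub> e\<^sub>kR\<close> for idempotents \<open>e\<^sub>k\<close>.\<close>

definition proj_mod :: "('a, 'c) ring_scheme \<Rightarrow> (nat \<Rightarrow> 'a) \<Rightarrow> nat \<Rightarrow> 'a umodule" where
  "proj_mod R e n =
     \<lparr>carrier = {g. \<forall>k. if k < n then g k \<in> carrier R \<and> e k \<otimes>\<^bsub>R\<^esub> g k = g k else g k = \<zero>\<^bsub>R\<^esub>},
      monoid.mult = undefined, one = undefined, ring.zero = (\<lambda>_. \<zero>\<^bsub>R\<^esub>),
      ring.add = (\<lambda>g h k. g k \<oplus>\<^bsub>R\<^esub> h k), smult = (\<lambda>r g k. g k \<otimes>\<^bsub>R\<^esub> r)\<rparr>"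

locale idempotents = R?: ring R for R :: "('a, 'c) ring_scheme" (structure) +
  fixes e :: "nat \<Rightarrow> 'a" and n :: nat
  assumes e_closed: "k < n \<Longrightarrow> e k \<in> carrier R" and e_idem: "k < n \<Longrightarrow> e k \<otimes> e k = e k"
begin

abbreviation P :: "'a umodule" where "P \<equiv> proj_mod R e n"

lemma P_simps:
  "g \<in> carrier P \<longleftrightarrow> (\<forall>k. if k < n then g k \<in> carrier R \<and> e k \<otimes> g k = g k else g k = \<zero>)"
  "\<zero>\<^bsub>P\<^esub> = (\<lambda>_. \<zero>)" "g \<oplus>\<^bsub>P\<^esub> h = (\<lambda>k. g k \<oplus> h k)" "r \<odot>\<^bsub>P\<^esub> g = (\<lambda>k. g k \<otimes> r)"
  by (simp_all add: proj_mod_def)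

lemma P_closed: "g \<in> carrier P \<Longrightarrow> g k \<in> carrier R"
  unfolding P_simps by (metis R.zero_closed)

lemma P_fix: "g \<in> carrier P \<Longrightarrow> k < n \<Longrightarrow> e k \<otimes> g k = g k"
  unfolding P_simps by metis

lemma P_out: "g \<in> carrier P \<Longrightarrow> \<not> k < n \<Longrightarrow> g k = \<zero>"
  unfolding P_simps by metis

lemma P_I: "(\<And>k. k < n \<Longrightarrow> g k \<in> carrier R) \<Longrightarrow> (\<And>k. k < n \<Longrightarrow> e k \<otimes> g k = g k) \<Longrightarrow>
    (\<And>k. \<not> k < n \<Longrightarrow> g k = \<zero>) \<Longrightarrow> g \<in> carrier P"
  unfolding P_simps by simp

lemma right_module_P: "right_module R P"
proof -
  have add: "(\<lambda>k. g k \<oplus> h k) \<in> carrier P" if "g \<in> carrier P" "h \<in> carrier P" for g h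
    using that by (intro P_I) (auto simp: P_closed R.r_distr e_closed P_fix P_out)
  have "abelian_group P"
  proof (rule abelian_groupI)
    fix g assume g: "g \<in> carrier P"
    have "(\<lambda>k. \<ominus> g k) \<in> carrier P"
      using g by (intro P_I) (auto simp: P_closed R.r_minus e_closed P_fix P_out)
    then show "\<exists>h\<in>carrier P. h \<oplus>\<^bsub>P\<^esub> g = \<zero>\<^bsub>P\<^esub>"
      using g by (intro bexI[of _ "\<lambda>k. \<ominus> g k"]) (auto simp: P_simps(2,3) P_closed R.l_neg)
  qed (use add in \<open>auto simp: P_simps(2,3) P_closed R.a_ac e_closed intro!: P_I\<close>)
  moreover have "(\<lambda>k. g k \<otimes> r) \<in> carrier P" if "g \<in> carrier P" "r \<in> carrier R" for g r
    using that by (intro P_I) (auto simp: P_closed e_closed P_fix P_out R.m_assoc[symmetric])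
  ultimately show ?thesis
    by (intro right_module.intro right_module_axioms.intro R.ring_axioms)
      (auto simp: P_simps(2-4) P_closed R.r_distr R.l_distr R.m_assoc)
qed

sublocale P: right_module R P by (rule right_module_P)

definition gen :: "nat \<Rightarrow> nat \<Rightarrow> 'a" where "gen k = (\<lambda>j. if j = k then e k else \<zero>)"

lemma gen_closed: "k < n \<Longrightarrow> gen k \<in> carrier P"
  by (intro P_I) (auto simp: gen_def e_closed e_idem)

lemma gen_fix: "k < n \<Longrightarrow> e k \<odot>\<^bsub>P\<^esub> gen k = gen k"
  by (auto simp: P_simps(4) gen_def e_closed e_idem)

lemma P_finsum: "finite S \<Longrightarrow> f \<in> S \<rightarrow> carrier P \<Longrightarrow> (\<Oplus>\<^bsub>P\<^esub>s\<in>S. f s) j = (\<Oplus>s\<in>S. f s j)"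
proof (induction S rule: finite_induct)
  case (insert s S)
  then show ?case by (simp add: P_simps(3) Pi_iff P_closed)
qed (simp add: P_simps)

lemma P_expand: assumes g: "g \<in> carrier P" shows "g = (\<Oplus>\<^bsub>P\<^esub>k\<in>{..<n}. g k \<odot>\<^bsub>P\<^esub> gen k)"
proof
  fix j
  have c: "(\<lambda>k. g k \<odot>\<^bsub>P\<^esub> gen k) \<in> {..<n} \<rightarrow> carrier P" using g by (auto simp: P_closed gen_closed)
  have eq: "(g k \<odot>\<^bsub>P\<^esub> gen k) j = (if j = k then g k else \<zero>)" if "k < n" for k
    using g that by (auto simp: P_simps(4) gen_def P_closed P_fix)
  have "(\<Oplus>\<^bsub>P\<^esub>k\<in>{..<n}. g k \<odot>\<^bsub>P\<^esub> gen k) j = (\<Oplus>k\<in>{..<n}. (g k \<odot>\<^bsub>P\<^esub> gen k) j)"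
    by (rule P_finsum[OF _ c]) simp
  also have "\<dots> = (\<Oplus>k\<in>{..<n}. if j = k then g k else \<zero>)"
    by (rule R.finsum_cong') (use g eq in \<open>auto simp: P_closed\<close>)
  also have "\<dots> = g j"
  proof (cases "j < n")
    case True
    then show ?thesis using g by (intro R.finsum_singleton) (auto simp: P_closed)
  next
    case False
    have "(\<Oplus>k\<in>{..<n}. if j = k then g k else \<zero>) = (\<Oplus>k\<in>{..<n}. \<zero>)"
      by (rule R.finsum_cong') (use False in auto)
    then show ?thesis using False g by (simp add: P_out)
  qed
  finally show "g j = (\<Oplus>\<^bsub>P\<^esub>k\<in>{..<n}. g k \<odot>\<^bsub>P\<^esub> gen k) j" by simp
qed

text \<open>The homomorphism that sends the k-th generator to \<open>e k\<close> applied to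
  \<open>x k\<close>, hence to \<open>x k\<close> itself when \<open>e k\<close> fixes it.\<close>

definition extend :: "('a, 'b) module \<Rightarrow> (nat \<Rightarrow> 'b) \<Rightarrow> (nat \<Rightarrow> 'a) \<Rightarrow> 'b" where
  "extend N x g = (\<Oplus>\<^bsub>N\<^esub>k\<in>{..<n}. g k \<odot>\<^bsub>N\<^esub> x k)"

lemma extend_cong:
  assumes N: "right_module R N" and x: "\<And>k. k < n \<Longrightarrow> x k = y k" "\<And>k. k < n \<Longrightarrow> y k \<in> carrier N"
    and g: "g \<in> carrier P"
  shows "extend N x g = extend N y g"
proof -
  interpret N: right_module R N by (rule N)
  show ?thesis unfolding extend_def
    using x g by (intro N.M.finsum_cong') (auto simp: P_closed)
qed

lemma extend_hom:
  assumes N: "right_module R N" and x: "\<And>k. k < n \<Longrightarrow> x k \<in> carrier N"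
  shows "extend N x \<in> mod_hom R P N"
proof -
  interpret N: right_module R N by (rule N)
  have c: "(\<lambda>k. g k \<odot>\<^bsub>N\<^esub> x k) \<in> {..<n} \<rightarrow> carrier N" if "g \<in> carrier P" for g
    using that x by (auto simp: P_closed)
  show ?thesis unfolding mod_hom_def
  proof (intro CollectI conjI ballI funcsetI)
    fix g assume g: "g \<in> carrier P"
    then show "extend N x g \<in> carrier N" unfolding extend_def by (intro N.M.finsum_closed c)
    {
      fix h assume h: "h \<in> carrier P"
      have "extend N x (g \<oplus>\<^bsub>P\<^esub> h) = (\<Oplus>\<^bsub>N\<^esub>k\<in>{..<n}. g k \<odot>\<^bsub>N\<^esub> x k \<oplus>\<^bsub>N\<^esub> h k \<odot>\<^bsub>N\<^esub> x k)"
        unfolding extend_def using g h x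
        by (intro N.M.finsum_cong') (auto simp: P_simps(3) P_closed N.smult_l_distr)
      also have "\<dots> = extend N x g \<oplus>\<^bsub>N\<^esub> extend N x h"
        unfolding extend_def by (rule N.M.finsum_addf[OF c[OF g] c[OF h]])
      finally show "extend N x (g \<oplus>\<^bsub>P\<^esub> h) = extend N x g \<oplus>\<^bsub>N\<^esub> extend N x h" .
    }
    fix r assume r: "r \<in> carrier R"
    have "extend N x (r \<odot>\<^bsub>P\<^esub> g) = (\<Oplus>\<^bsub>N\<^esub>k\<in>{..<n}. r \<odot>\<^bsub>N\<^esub> (g k \<odot>\<^bsub>N\<^esub> x k))"
      unfolding extend_def using g r x
      by (intro N.M.finsum_cong') (auto simp: P_simps(4) P_closed N.smult_assoc)
    also have "\<dots> = r \<odot>\<^bsub>N\<^esub> extend N x g"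
      unfolding extend_def using N.smult_r_finsum[OF r c[OF g]] by simp
    finally show "extend N x (r \<odot>\<^bsub>P\<^esub> g) = r \<odot>\<^bsub>N\<^esub> extend N x g" .
  qed
qed

lemma extend_gen:
  assumes N: "right_module R N" and x: "\<And>k. k < n \<Longrightarrow> x k \<in> carrier N" and k: "k < n" "e k \<odot>\<^bsub>N\<^esub> x k = x k"
  shows "extend N x (gen k) = x k"
proof -
  interpret N: right_module R N by (rule N)
  have "extend N x (gen k) = (\<Oplus>\<^bsub>N\<^esub>j\<in>{..<n}. if k = j then x j else \<zero>\<^bsub>N\<^esub>)"
    unfolding extend_def using x k by (intro N.M.finsum_cong') (auto simp: gen_def)
  also have "\<dots> = x k" using x k by (intro N.M.finsum_singleton) auto
  finally show ?thesis .
qed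

lemma hom_extend:
  assumes N: "right_module R N" and f: "f \<in> mod_hom R P N" and g: "g \<in> carrier P"
  shows "f g = extend N (\<lambda>k. f (gen k)) g"
proof -
  interpret N: right_module R N by (rule N)
  have "f g = f (\<Oplus>\<^bsub>P\<^esub>k\<in>{..<n}. g k \<odot>\<^bsub>P\<^esub> gen k)" using P_expand[OF g] by simp
  also have "\<dots> = (\<Oplus>\<^bsub>N\<^esub>k\<in>{..<n}. f (g k \<odot>\<^bsub>P\<^esub> gen k))"
    by (rule mod_hom_finsum[OF right_module_P N f]) (use g in \<open>auto simp: P_closed gen_closed\<close>)
  also have "\<dots> = extend N (\<lambda>k. f (gen k)) g"
    unfolding extend_def using g mod_homD(1)[OF f gen_closed] mod_homD(3)[OF f _ gen_closed]
    by (intro N.M.finsum_cong') (auto simp: P_closed)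
  finally show ?thesis .
qed

lemma projective_P: "projective R P"
  unfolding projective_def
proof (intro conjI right_module_P allI impI)
  fix N L :: "'a umodule" and g f
  assume a: "right_module R N \<and> right_module R L \<and> g \<in> mod_hom R N L \<and> g ` carrier N = carrier L \<and> f \<in> mod_hom R P L"
  then have N: "right_module R N" and L: "right_module R L" and g: "g \<in> mod_hom R N L"
    and surj: "g ` carrier N = carrier L" and f: "f \<in> mod_hom R P L" by auto
  interpret N: right_module R N by (rule N)
  interpret L: right_module R L by (rule L)
  have "\<exists>x. x \<in> carrier N \<and> g x = f (gen k)" if "k < n" for k
    using mod_homD(1)[OF f gen_closed[OF that]] surj by (metis imageE)
  then obtain y where y: "\<And>k. k < n \<Longrightarrow> y k \<in> carrier N" "\<And>k. k < n \<Longrightarrow> g (y k) = f (gen k)" by metis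
  \<comment> \<open>A preimage \<open>y k\<close> need not be fixed by \<open>e k\<close>.
    Multiplying it by \<open>e k\<close> repairs this and leaves its image alone, because
    \<open>gen k\<close> is fixed.\<close>
  let ?h = "extend N (\<lambda>k. e k \<odot>\<^bsub>N\<^esub> y k)"
  have h: "?h \<in> mod_hom R P N" using y e_closed by (intro extend_hom N) auto
  have gh: "g (?h (gen k)) = f (gen k)" if k: "k < n" for k
  proof -
    have "?h (gen k) = e k \<odot>\<^bsub>N\<^esub> y k"
      by (rule extend_gen[OF N]) (use k y e_closed e_idem in \<open>auto simp: N.smult_assoc[symmetric]\<close>)
    then have "g (?h (gen k)) = e k \<odot>\<^bsub>L\<^esub> f (gen k)"
      using mod_homD(3)[OF g e_closed[OF k] y(1)[OF k]] y(2)[OF k] by simp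
    also have "\<dots> = f (gen k)"
      using mod_homD(3)[OF f e_closed[OF k] gen_closed[OF k]] gen_fix[OF k] by simp
    finally show ?thesis .
  qed
  show "\<exists>h\<in>mod_hom R P N. \<forall>x\<in>carrier P. g (h x) = f x"
  proof (intro bexI[OF _ h] ballI)
    fix x assume x: "x \<in> carrier P"
    have "g (?h x) = extend L (\<lambda>k. g (?h (gen k))) x" by (rule hom_extend[OF L mod_hom_comp[OF h g] x])
    also have "\<dots> = extend L (\<lambda>k. f (gen k)) x"
      by (rule extend_cong[OF L _ _ x]) (use gh mod_homD(1)[OF f gen_closed] in auto)
    also have "\<dots> = f x" by (rule hom_extend[OF L f x, symmetric])
    finally show "g (?h x) = f x" .
  qed
qed

end

section \<open>The radical of a module\<close>

context quiver_alg
begin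

text \<open>Adding one arrow multiple at a time yields M times the radical of \<open>R\<close>, in a
  form suited to induction.\<close>

inductive_set jrad :: "(('v \<times> 'e list \<Rightarrow> 'k) set, 'b) module \<Rightarrow> 'b set"
  for M :: "(('v \<times> 'e list \<Rightarrow> 'k) set, 'b) module" where
  zero: "\<zero>\<^bsub>M\<^esub> \<in> jrad M"
| add: "z \<in> jrad M \<Longrightarrow> \<alpha> \<in> arcs Q \<Longrightarrow> x \<in> carrier M \<Longrightarrow> z \<oplus>\<^bsub>M\<^esub> (ar \<alpha> \<odot>\<^bsub>M\<^esub> x) \<in> jrad M"

lemma jrad_carrier: assumes "right_module R M" shows "z \<in> jrad M \<Longrightarrow> z \<in> carrier M"
proof -
  interpret M: right_module R M by fact
  show "z \<in> jrad M \<Longrightarrow> z \<in> carrier M" by (induction rule: jrad.induct) auto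
qed

lemma jrad_hom:
  assumes "right_module R M" "right_module R N" "f \<in> mod_hom R M N"
  shows "z \<in> jrad M \<Longrightarrow> f z \<in> jrad N"
proof (induction rule: jrad.induct)
  interpret M: right_module R M by fact
  {
    case zero
    then show ?case using mod_hom_zero[OF assms] by (simp add: jrad.zero)
  next
    case (add z \<alpha> x)
    then show ?case using jrad_carrier[OF assms(1), of z] mod_homD[OF assms(3)]
      by (simp add: jrad.add)
  }
qed

lemma jrad_add:
  assumes "right_module R M" and "y \<in> jrad M"
  shows "z \<in> jrad M \<Longrightarrow> y \<oplus>\<^bsub>M\<^esub> z \<in> jrad M"
proof (induction rule: jrad.induct)
  interpret M: right_module R M by fact
  {
    case zero
    then show ?case using assms(2) jrad_carrier[OF assms(1)] by simp
  next
    case (add z \<alpha> x)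
    then have "y \<oplus>\<^bsub>M\<^esub> (z \<oplus>\<^bsub>M\<^esub> ar \<alpha> \<odot>\<^bsub>M\<^esub> x) = (y \<oplus>\<^bsub>M\<^esub> z) \<oplus>\<^bsub>M\<^esub> ar \<alpha> \<odot>\<^bsub>M\<^esub> x"
      using jrad_carrier[OF assms(1)] assms(2) by (simp add: M.M.a_assoc)
    then show ?case using add by (simp add: jrad.add)
  }
qed

lemma jrad_arrow:
  assumes "right_module R M" "\<alpha> \<in> arcs Q" "x \<in> carrier M"
  shows "ar \<alpha> \<odot>\<^bsub>M\<^esub> x \<in> jrad M"
proof -
  interpret M: right_module R M by fact
  show ?thesis using jrad.add[OF jrad.zero assms(2,3)] assms(3) by simp
qed

text \<open>Since the square of the radical is zero, a morphism into the radical kills the radical.\<close>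

lemma jrad_annihilate:
  assumes M: "right_module R M" and N: "right_module R N" and f: "f \<in> mod_hom R M N"
    and im: "\<And>x. x \<in> carrier M \<Longrightarrow> f x \<in> jrad N"
  shows "z \<in> jrad M \<Longrightarrow> f z = \<zero>\<^bsub>N\<^esub>"
proof -
  interpret M: right_module R M by fact
  interpret N: right_module R N by fact
  have ann: "ar \<beta> \<odot>\<^bsub>N\<^esub> z = \<zero>\<^bsub>N\<^esub>" if "z \<in> jrad N" for z \<beta>
    using that
  proof (induction rule: jrad.induct)
    case (add z \<alpha> x)
    then show ?case using jrad_carrier[OF N, of z]
      by (simp add: N.smult_r_distr N.smult_assoc[symmetric] ar_ar)
  qed simp
  show "z \<in> jrad M \<Longrightarrow> f z = \<zero>\<^bsub>N\<^esub>"
  proof (induction rule: jrad.induct)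
    case zero
    then show ?case using mod_hom_zero[OF M N f] .
  next
    case (add z \<alpha> x)
    then show ?case using jrad_carrier[OF M, of z] mod_homD[OF f] ann[OF im] by simp
  qed
qed

text \<open>Nakayama's lemma for a nilpotent radical. In x = h + k the arrows kill k, so every arrow
  multiple of an element of M is one of an element of \<open>H\<close>; hence the radical, and
  \<open>K\<close> with it, lies in \<open>H\<close>.\<close>

lemma jrad_superfluous:
  assumes M: "right_module R M" and H: "submodule H R M" and K: "K \<subseteq> jrad M"
    and sum: "H <+>\<^bsub>M\<^esub> K = carrier M"
  shows "H = carrier M"
proof
  interpret M: right_module R M by fact
  interpret H: submodule H R M by fact
  have Hc: "H \<subseteq> carrier M" using H.subset by simp
  show "H \<subseteq> carrier M" by (rule Hc)
  have ann: "ar \<beta> \<odot>\<^bsub>M\<^esub> z = \<zero>\<^bsub>M\<^esub>" if "z \<in> jrad M" for z \<beta>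
    using that
  proof (induction rule: jrad.induct)
    case (add z \<alpha> x)
    then show ?case using jrad_carrier[OF M, of z]
      by (simp add: M.smult_r_distr M.smult_assoc[symmetric] ar_ar)
  qed simp
  have ex: "\<exists>h\<in>H. \<exists>k\<in>K. x = h \<oplus>\<^bsub>M\<^esub> k" if "x \<in> carrier M" for x
    using that unfolding sum[symmetric] set_add_def' by blast
  have Hadd: "a \<oplus>\<^bsub>M\<^esub> b \<in> H" if "a \<in> H" "b \<in> H" for a b using H.m_closed[OF that] by simp
  have jH: "z \<in> H" if "z \<in> jrad M" for z
    using that
  proof (induction rule: jrad.induct)
    case zero
    then show ?case using H.one_closed by simp
  next
    case (add z \<alpha> x)
    obtain h k where hk: "h \<in> H" "k \<in> K" "x = h \<oplus>\<^bsub>M\<^esub> k" using ex[OF add.hyps(3)] by blast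
    have "h \<in> carrier M" "k \<in> jrad M" "k \<in> carrier M" using hk Hc K jrad_carrier[OF M] by auto
    then have "ar \<alpha> \<odot>\<^bsub>M\<^esub> x = ar \<alpha> \<odot>\<^bsub>M\<^esub> h" unfolding hk(3) using ann
      by (simp add: M.smult_r_distr)
    moreover have "ar \<alpha> \<odot>\<^bsub>M\<^esub> h \<in> H" using H.smult_closed hk(1) by auto
    ultimately show ?case using add.IH Hadd by simp
  qed
  show "carrier M \<subseteq> H"
  proof
    fix x assume "x \<in> carrier M"
    then obtain h k where "h \<in> H" "k \<in> K" "x = h \<oplus>\<^bsub>M\<^esub> k" using ex by blast
    then show "x \<in> H" using jH K Hadd by auto
  qed
qed

section \<open>Modules with a basis on which arrows act by partial injections\<close>

definition mE :: "('b \<Rightarrow> 'v) \<Rightarrow> 'v \<Rightarrow> ('b \<Rightarrow> 'k) \<Rightarrow> 'b \<Rightarrow> 'k" where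
  "mE lab v x = (\<lambda>b. if lab b = v then x b else 0)"
text \<open>A coefficient function is pulled back along \<open>pre\<close>, so the unit vector of b'
  goes to that of b when \<open>pre \<alpha> b = Some b'\<close>. Recording the arrow backwards
  makes this a linear formula without sums.\<close>

definition mY :: "'b set \<Rightarrow> ('e \<Rightarrow> 'b \<Rightarrow> 'b option) \<Rightarrow> 'e \<Rightarrow> ('b \<Rightarrow> 'k) \<Rightarrow> 'b \<Rightarrow> 'k" where
  "mY B pre \<alpha> x = (\<lambda>b. if b \<in> B then (case pre \<alpha> b of None \<Rightarrow> 0 | Some b' \<Rightarrow> x b') else 0)"

text \<open>Combinatorial data for a module with basis \<open>B\<close> on which the arrows act by partial injections;
  \<open>pre \<alpha> b\<close> is the basis element that \<open>\<alpha>\<close> sends to \<open>b\<close>.\<close>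

definition mono_rep :: "'b set \<Rightarrow> ('b \<Rightarrow> 'v) \<Rightarrow> ('e \<Rightarrow> 'b \<Rightarrow> 'b option) \<Rightarrow> bool" where
  "mono_rep B lab pre \<longleftrightarrow> finite B \<and> lab ` B \<subseteq> verts Q \<and>
     (\<forall>\<alpha>\<in>arcs Q. \<forall>b\<in>B. \<forall>b'. pre \<alpha> b = Some b' \<longrightarrow>
        b' \<in> B \<and> lab b' = tail Q \<alpha> \<and> lab b = head Q \<alpha> \<and> (\<forall>\<beta>\<in>arcs Q. pre \<beta> b' = None) \<and>
        (\<forall>c\<in>B. pre \<alpha> c = Some b' \<longrightarrow> c = b))"

lemma mono_repD:
  assumes m: "mono_rep B lab pre"
  shows "finite B" "b \<in> B \<Longrightarrow> lab b \<in> verts Q"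
    "\<alpha> \<in> arcs Q \<Longrightarrow> b \<in> B \<Longrightarrow> pre \<alpha> b = Some b' \<Longrightarrow> b' \<in> B"
    "\<alpha> \<in> arcs Q \<Longrightarrow> b \<in> B \<Longrightarrow> pre \<alpha> b = Some b' \<Longrightarrow> lab b' = tail Q \<alpha>"
    "\<alpha> \<in> arcs Q \<Longrightarrow> b \<in> B \<Longrightarrow> pre \<alpha> b = Some b' \<Longrightarrow> lab b = head Q \<alpha>"
    "\<alpha> \<in> arcs Q \<Longrightarrow> b \<in> B \<Longrightarrow> pre \<alpha> b = Some b' \<Longrightarrow> \<beta> \<in> arcs Q \<Longrightarrow> pre \<beta> b' = None"
    "\<alpha> \<in> arcs Q \<Longrightarrow> b \<in> B \<Longrightarrow> pre \<alpha> b = Some b' \<Longrightarrow> c \<in> B \<Longrightarrow> pre \<alpha> c = Some b' \<Longrightarrow> c = b"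
proof -
  have 0: "\<forall>\<alpha>\<in>arcs Q. \<forall>b\<in>B. \<forall>b'. pre \<alpha> b = Some b' \<longrightarrow>
        b' \<in> B \<and> lab b' = tail Q \<alpha> \<and> lab b = head Q \<alpha> \<and> (\<forall>\<beta>\<in>arcs Q. pre \<beta> b' = None) \<and>
        (\<forall>c\<in>B. pre \<alpha> c = Some b' \<longrightarrow> c = b)"
    using m unfolding mono_rep_def by (elim conjE)
  show "finite B" "b \<in> B \<Longrightarrow> lab b \<in> verts Q" using m by (auto simp: mono_rep_def)
  assume a: "\<alpha> \<in> arcs Q" "b \<in> B" "pre \<alpha> b = Some b'"
  note c = 0[rule_format, OF a]
  show "b' \<in> B" using c by (elim conjE)
  show "lab b' = tail Q \<alpha>" using c by (elim conjE)
  show "lab b = head Q \<alpha>" using c by (elim conjE)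
  show "pre \<beta> b' = None" if "\<beta> \<in> arcs Q" using c that by (elim conjE) (erule bspec)
  show "c = b" if "c \<in> B" "pre \<alpha> c = Some b'" using c that by (elim conjE) (drule (1) bspec, erule mp)
qed

abbreviation mono :: "'b set \<Rightarrow> ('b \<Rightarrow> 'v) \<Rightarrow> ('e \<Rightarrow> 'b \<Rightarrow> 'b option) \<Rightarrow>
    (('v \<times> 'e list \<Rightarrow> 'k) set, 'b \<Rightarrow> 'k) module" where
  "mono B lab pre \<equiv> rmod (fspace B) (mE lab) (mY B pre)"

text \<open>These basis elements span the radical; the remaining ones represent a basis of the
  top.\<close>

definition bot :: "('e \<Rightarrow> 'b \<Rightarrow> 'b option) \<Rightarrow> 'b \<Rightarrow> bool" where
  "bot pre b \<longleftrightarrow> (\<exists>\<alpha>\<in>arcs Q. pre \<alpha> b \<noteq> None)"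

lemma mE_flin: "flin (mE lab v)"
  by (rule flinI) (auto simp: mE_def fs_def)

lemma mY_flin: "flin (mY B pre \<alpha>)"
  by (rule flinI) (auto simp: mY_def fs_def split: option.splits)

lemma rep_mono:
  fixes B :: "'b set"
  assumes m: "mono_rep B lab pre" shows "rep (fspace B) (mE lab) (mY B pre)"
  unfolding rep_def
proof (intro conjI ballI)
  show "fv.subspace (fspace B)" "fin_dim (fspace B)" using mono_repD(1)[OF m] by auto
  show "flin (mE lab v)" "flin (mY B pre \<alpha>)" for v \<alpha> by (rule mE_flin mY_flin)+
  show "mE lab v ` fspace B \<subseteq> fspace B" for v by (auto simp: mE_def fspace_def)
  show "mY B pre \<alpha> ` fspace B \<subseteq> fspace B" for \<alpha> by (auto simp: mY_def fspace_def)
  show "(\<Sum>v\<in>verts Q. mE lab v x) = x" if "x \<in> fspace B" for x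
  proof
    fix b
    have "lab b \<in> verts Q \<or> x b = 0" using mono_repD(2)[OF m] that by (auto simp: fspace_def)
    then show "(\<Sum>v\<in>verts Q. mE lab v x) b = x b" unfolding sum_apply by (auto simp: mE_def)
  qed
  fix x :: "'b \<Rightarrow> 'k"
  show "mE lab u (mE lab v x) = (if u = v then mE lab v x else 0)" for u v
    by (cases "u = v"; rule ext) (simp_all add: mE_def)
  fix \<alpha> assume \<alpha>: "\<alpha> \<in> arcs Q"
  have pre: "b' \<in> B" "lab b' = tail Q \<alpha>" "lab b = head Q \<alpha>" "\<beta> \<in> arcs Q \<Longrightarrow> pre \<beta> b' = None"
    if "b \<in> B" "pre \<alpha> b = Some b'" for b b' \<beta>
    using mono_repD(3-6)[OF m \<alpha>] that by blast+
  show "mY B pre \<alpha> (mE lab u x) = (if u = tail Q \<alpha> then mY B pre \<alpha> x else 0)" for u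
    by (cases "u = tail Q \<alpha>"; rule ext) (auto simp: mY_def mE_def pre(2) split: option.splits)
  show "mE lab u (mY B pre \<alpha> x) = (if u = head Q \<alpha> then mY B pre \<alpha> x else 0)" for u
    by (cases "u = head Q \<alpha>"; rule ext) (auto simp: mY_def mE_def pre(3) split: option.splits)
  show "mY B pre \<alpha> (mY B pre \<beta> x) = 0" if "\<beta> \<in> arcs Q" for \<beta>
    by (rule ext) (auto simp: mY_def pre(4)[OF _ _ that] split: option.splits)
qed

lemma mY_unit:
  assumes m: "mono_rep B lab pre" and "\<alpha> \<in> arcs Q" "b \<in> B" "pre \<alpha> b = Some b'"
  shows "mY B pre \<alpha> (unitf b') = unitf b"
proof
  fix c
  show "mY B pre \<alpha> (unitf b') c = unitf b c"
  proof (cases "c = b")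
    case True
    then show ?thesis using assms(3,4) by (simp add: mY_def unitf_def)
  next
    case False
    have "pre \<alpha> c \<noteq> Some b'" if "c \<in> B" using mono_repD(7)[OF m assms(2-4) that] False by blast
    then show ?thesis using False by (auto simp: mY_def unitf_def split: option.splits)
  qed
qed

lemma Sd_mono:
  fixes B :: "'b set"
  shows "Sd p (fspace B) (mE lab) = fspace {b \<in> B. lab b = p}"
proof -
  have "(if lab b = p then x b else 0) = x b \<longleftrightarrow> (lab b \<noteq> p \<longrightarrow> x b = 0)" for b and x :: "'b \<Rightarrow> 'k" by auto
  then show ?thesis by (auto simp: Sd_def mE_def fspace_def fun_eq_iff)
qed

lemma span_Sr_mono:
  assumes m: "mono_rep B lab pre"
  shows "fv.span (Sr p (fspace B) (mY B pre)) = fspace {b \<in> B. lab b = p \<and> bot pre b}"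
proof
  show "fv.span (Sr p (fspace B) (mY B pre)) \<subseteq> fspace {b \<in> B. lab b = p \<and> bot pre b}"
  proof (rule fv.span_minimal)
    show "Sr p (fspace B) (mY B pre) \<subseteq> fspace {b \<in> B. lab b = p \<and> bot pre b}"
    proof
      fix z assume "z \<in> Sr p (fspace B) (mY B pre)"
      then obtain \<alpha> x where z: "z = mY B pre \<alpha> x" "\<alpha> \<in> arcs Q" "head Q \<alpha> = p" by (auto simp: Sr_def)
      show "z \<in> fspace {b \<in> B. lab b = p \<and> bot pre b}" unfolding fspace_def
      proof (intro CollectI allI impI)
        fix b assume b: "b \<notin> {b \<in> B. lab b = p \<and> bot pre b}"
        show "z b = 0"
        proof (cases "b \<in> B \<and> pre \<alpha> b \<noteq> None")
          case True
          then have "lab b = p" "bot pre b" using mono_repD(5)[OF m z(2)] z(2,3) by (auto simp: bot_def)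
          then show ?thesis using b True by simp
        next
          case False
          then show ?thesis by (auto simp: z(1) mY_def)
        qed
      qed
    qed
  qed simp
  show "fspace {b \<in> B. lab b = p \<and> bot pre b} \<subseteq> fv.span (Sr p (fspace B) (mY B pre))"
  proof -
    have fin: "finite {b \<in> B. lab b = p \<and> bot pre b}" using mono_repD(1)[OF m] by simp
    show ?thesis unfolding span_unitf[OF fin, symmetric]
    proof (rule fv.span_mono, clarify)
      fix b assume b: "b \<in> B" "bot pre b" "p = lab b"
      then obtain \<alpha> b' where a: "\<alpha> \<in> arcs Q" "pre \<alpha> b = Some b'" by (auto simp: bot_def)
      then have "unitf b = mY B pre \<alpha> (unitf b')" "head Q \<alpha> = lab b" "b' \<in> B"
        using mY_unit[OF m a(1) b(1) a(2)] mono_repD(3,5)[OF m a(1) b(1) a(2)] by auto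
      then show "unitf b \<in> Sr (lab b) (fspace B) (mY B pre)" unfolding Sr_def using a(1) by fastforce
    qed
  qed
qed

lemma Sn_mono:
  fixes B :: "'b set"
  assumes m: "mono_rep B lab pre"
  shows "Sn p C (fspace B) (mE lab) (mY B pre) =
    fspace {b \<in> B. lab b = p \<and> (\<forall>\<gamma>\<in>C. \<forall>c\<in>B. pre \<gamma> c \<noteq> Some b)}"
proof -
  have 1: "(if lab b = p then x b else 0) = x b \<longleftrightarrow> (lab b \<noteq> p \<longrightarrow> x b = 0)" for b and x :: "'b \<Rightarrow> 'k" by auto
  have 2: "mY B pre \<gamma> x = 0 \<longleftrightarrow> (\<forall>c\<in>B. \<forall>b. pre \<gamma> c = Some b \<longrightarrow> x b = 0)" for \<gamma> and x :: "'b \<Rightarrow> 'k"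
    by (auto simp: mY_def fun_eq_iff split: option.splits)
  show ?thesis unfolding Sn_def 2 by (auto simp: mE_def fspace_def fun_eq_iff 1)
qed

lemma dim_mono:
  assumes m: "mono_rep B lab pre"
  shows "fv.dim (Sd p (fspace B) (mE lab)) = card {b \<in> B. lab b = p}"
    "fv.dim (Sr p (fspace B) (mY B pre)) = card {b \<in> B. lab b = p \<and> bot pre b}"
    "fv.dim (Sn p C (fspace B) (mE lab) (mY B pre)) =
       card {b \<in> B. lab b = p \<and> (\<forall>\<gamma>\<in>C. \<forall>c\<in>B. pre \<gamma> c \<noteq> Some b)}"
proof -
  have fin: "finite B" by (rule mono_repD(1)[OF m])
  show "fv.dim (Sd p (fspace B) (mE lab)) = card {b \<in> B. lab b = p}"
    unfolding Sd_mono by (rule dim_fspace) (use fin in simp)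
  show "fv.dim (Sr p (fspace B) (mY B pre)) = card {b \<in> B. lab b = p \<and> bot pre b}"
    unfolding fv.dim_span[of "Sr p (fspace B) (mY B pre)", symmetric] span_Sr_mono[OF m]
    by (rule dim_fspace) (use fin in simp)
  show "fv.dim (Sn p C (fspace B) (mE lab) (mY B pre)) =
       card {b \<in> B. lab b = p \<and> (\<forall>\<gamma>\<in>C. \<forall>c\<in>B. pre \<gamma> c \<noteq> Some b)}"
    unfolding Sn_mono[OF m] by (rule dim_fspace) (use fin in simp)
qed

text \<open>Top elements, counted once for each arrow leaving them towards p, give the radical of
  the projective cover at p; subtracting the bottom elements leaves the kernel of the cover.\<close>

lemma omr_mono:
  assumes m: "mono_rep B lab pre"
  shows "omr (fspace B) (mE lab) (mY B pre) p =
    (\<Sum>\<alpha>\<in>in_arcs Q p. int (card {b \<in> B. lab b = tail Q \<alpha> \<and> \<not> bot pre b})) -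
    int (card {b \<in> B. lab b = p \<and> bot pre b})"
proof -
  have fin: "finite B" by (rule mono_repD(1)[OF m])
  have "int (card {b \<in> B. lab b = q}) - int (card {b \<in> B. lab b = q \<and> bot pre b}) =
      int (card {b \<in> B. lab b = q \<and> \<not> bot pre b})" for q
  proof -
    have "{b \<in> B. lab b = q} = {b \<in> B. lab b = q \<and> bot pre b} \<union> {b \<in> B. lab b = q \<and> \<not> bot pre b}" by auto
    also have "card \<dots> = card {b \<in> B. lab b = q \<and> bot pre b} + card {b \<in> B. lab b = q \<and> \<not> bot pre b}"
      by (rule card_Un_disjoint) (use fin in auto)
    finally have "card {b \<in> B. lab b = q} = card {b \<in> B. lab b = q \<and> bot pre b} + card {b \<in> B. lab b = q \<and> \<not> bot pre b}" .
    then show ?thesis by simp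
  qed
  then show ?thesis unfolding omr_def dim_mono[OF m] by simp
qed

text \<open>Arrows kill the radical, so all bottom elements at p belong to \<open>Sn\<close> and
  cancel against \<open>Sr\<close>. What remains are the top elements killed by every arrow in
  \<open>C\<close>.\<close>

lemma nur_mono:
  assumes m: "mono_rep B lab pre" and C: "C \<subseteq> arcs Q"
  shows "nur C (fspace B) (mE lab) (mY B pre) p =
    int (card {b \<in> B. lab b = p \<and> \<not> bot pre b \<and> (\<forall>\<gamma>\<in>C. \<forall>c\<in>B. pre \<gamma> c \<noteq> Some b)})"
proof -
  have fin: "finite B" by (rule mono_repD(1)[OF m])
  let ?N = "{b \<in> B. lab b = p \<and> (\<forall>\<gamma>\<in>C. \<forall>c\<in>B. pre \<gamma> c \<noteq> Some b)}"
  let ?R = "{b \<in> B. lab b = p \<and> bot pre b}"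
  let ?T = "{b \<in> B. lab b = p \<and> \<not> bot pre b \<and> (\<forall>\<gamma>\<in>C. \<forall>c\<in>B. pre \<gamma> c \<noteq> Some b)}"
  have "pre \<gamma> c \<noteq> Some b" if "b \<in> ?R" "\<gamma> \<in> C" "c \<in> B" for b \<gamma> c
    using mono_repD(6)[OF m, of \<gamma> c b] that C unfolding bot_def by auto
  then have "?N = ?R \<union> ?T" by auto
  moreover have "card (?R \<union> ?T) = card ?R + card ?T"
    by (rule card_Un_disjoint) (use fin in auto)
  ultimately show ?thesis unfolding nur_def dim_mono[OF m] by simp
qed

lemma bottom_in_jrad:
  assumes m: "mono_rep B lab pre" and x: "x \<in> fspace {b \<in> B. bot pre b}"
  shows "x \<in> jrad (mono B lab pre)"
proof -
  have M: "right_module R (mono B lab pre)" by (rule right_module_rmod[OF rep_mono[OF m]])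
  have fin: "finite {b \<in> B. bot pre b}" using mono_repD(1)[OF m] by simp
  have "(\<Sum>b\<in>C. fs (x b) (unitf b)) \<in> jrad (mono B lab pre)" if "finite C" "C \<subseteq> {b \<in> B. bot pre b}" for C
    using that
  proof (induction C)
    case empty
    show ?case using jrad.zero[of "mono B lab pre"] unfolding sum.empty rmod_simps .
  next
    case (insert b C)
    then obtain \<alpha> b' where a: "\<alpha> \<in> arcs Q" "pre \<alpha> b = Some b'" and b: "b \<in> B" by (auto simp: bot_def)
    have b': "b' \<in> B" by (rule mono_repD(3)[OF m a(1) b a(2)])
    have "fs (x b) (unitf b) = ar \<alpha> \<odot>\<^bsub>mono B lab pre\<^esub> fs (x b) (unitf b')"
      using mY_unit[OF m a(1) b a(2)] by (simp add: rmod_ar[OF a(1)] flinD(2)[OF mY_flin])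
    moreover have "fs (x b) (unitf b') \<in> fspace B" using b' by (intro fv.subspace_scale) auto
    ultimately have "fs (x b) (unitf b) \<in> jrad (mono B lab pre)"
      using jrad_arrow[OF M a(1), of "fs (x b) (unitf b')"] by simp
    from jrad_add[OF M this insert.IH] insert.prems
    show ?case unfolding sum.insert[OF insert.hyps] rmod_simps by blast
  qed
  from this[OF fin subset_refl] show ?thesis using fspace_expand[OF fin x] by simp
qed

end

section \<open>Projective modules as basis modules\<close>

context quiver_alg
begin

lemma coef_add:
  assumes "a \<in> carrier R" "b \<in> carrier R"
  shows "v \<in> verts Q \<Longrightarrow> cv (a \<oplus>\<^bsub>R\<^esub> b) v = cv a v + cv b v"
    "\<alpha> \<in> arcs Q \<Longrightarrow> ca (a \<oplus>\<^bsub>R\<^esub> b) \<alpha> = ca a \<alpha> + ca b \<alpha>"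
proof -
  have "a \<oplus>\<^bsub>R\<^esub> b = el (cv a + cv b) (ca a + ca b)"
    using el_add[of "cv a" "ca a" "cv b" "ca b"] unfolding el_coef[OF assms(1)] el_coef[OF assms(2)] .
  then show "v \<in> verts Q \<Longrightarrow> cv (a \<oplus>\<^bsub>R\<^esub> b) v = cv a v + cv b v"
    "\<alpha> \<in> arcs Q \<Longrightarrow> ca (a \<oplus>\<^bsub>R\<^esub> b) \<alpha> = ca a \<alpha> + ca b \<alpha>" by simp_all
qed

lemma coef_mult:
  assumes "a \<in> carrier R" "b \<in> carrier R"
  shows "v \<in> verts Q \<Longrightarrow> cv (a \<otimes>\<^bsub>R\<^esub> b) v = cv a v * cv b v"
    "\<alpha> \<in> arcs Q \<Longrightarrow> ca (a \<otimes>\<^bsub>R\<^esub> b) \<alpha> = cv a (tail Q \<alpha>) * ca b \<alpha> + ca a \<alpha> * cv b (head Q \<alpha>)"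
proof -
  have "a \<otimes>\<^bsub>R\<^esub> b = el (\<lambda>v. cv a v * cv b v) (\<lambda>\<alpha>. cv a (tail Q \<alpha>) * ca b \<alpha> + ca a \<alpha> * cv b (head Q \<alpha>))"
    using el_mult[of "cv a" "ca a" "cv b" "ca b"] unfolding el_coef[OF assms(1)] el_coef[OF assms(2)] .
  then show "v \<in> verts Q \<Longrightarrow> cv (a \<otimes>\<^bsub>R\<^esub> b) v = cv a v * cv b v"
    "\<alpha> \<in> arcs Q \<Longrightarrow> ca (a \<otimes>\<^bsub>R\<^esub> b) \<alpha> = cv a (tail Q \<alpha>) * ca b \<alpha> + ca a \<alpha> * cv b (head Q \<alpha>)" by simp_all
qed

lemma coef_gens:
  "v \<in> verts Q \<Longrightarrow> cv (sc c) v = c" "\<alpha> \<in> arcs Q \<Longrightarrow> ca (sc c) \<alpha> = 0"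
  "v \<in> verts Q \<Longrightarrow> cv (ev u) v = (if v = u then 1 else 0)" "\<alpha> \<in> arcs Q \<Longrightarrow> ca (ev u) \<alpha> = 0"
  "v \<in> verts Q \<Longrightarrow> cv (ar \<beta>) v = 0" "\<alpha> \<in> arcs Q \<Longrightarrow> ca (ar \<beta>) \<alpha> = (if \<alpha> = \<beta> then 1 else 0)"
  by (simp_all add: sc_def ev_def ar_def)

lemma coef_ext:
  assumes "a \<in> carrier R" "b \<in> carrier R" "\<And>v. v \<in> verts Q \<Longrightarrow> cv a v = cv b v" "\<And>\<alpha>. \<alpha> \<in> arcs Q \<Longrightarrow> ca a \<alpha> = ca b \<alpha>"
  shows "a = b"
proof -
  have "el (cv a) (ca a) = el (cv b) (ca b)" by (rule el_cong) (use assms in auto)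
  then show ?thesis unfolding el_coef[OF assms(1)] el_coef[OF assms(2)] .
qed

abbreviation PI :: "(nat \<Rightarrow> 'v) \<Rightarrow> nat \<Rightarrow> (('v \<times> 'e list \<Rightarrow> 'k) set) umodule" where
  "PI I n \<equiv> proj_mod R (\<lambda>k. ev (I k)) n"

lemma idempotents_ev: "idempotents R (\<lambda>k. ev (I k)) n"
  by unfold_locales (auto simp: ev_ev)

text \<open>A basis of \<open>PI I n\<close>: \<open>(k, None)\<close> stands for the k-th generator
  and \<open>(k, Some \<alpha>)\<close> for its multiple by an arrow starting at
  \<open>I k\<close>.\<close>

definition BP :: "(nat \<Rightarrow> 'v) \<Rightarrow> nat \<Rightarrow> (nat \<times> 'e option) set" where
  "BP I n = {(k, b). k < n \<and> (case b of None \<Rightarrow> True | Some \<alpha> \<Rightarrow> \<alpha> \<in> arcs Q \<and> tail Q \<alpha> = I k)}"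
definition labP :: "(nat \<Rightarrow> 'v) \<Rightarrow> nat \<times> 'e option \<Rightarrow> 'v" where
  "labP I = (\<lambda>(k, b). case b of None \<Rightarrow> I k | Some \<alpha> \<Rightarrow> head Q \<alpha>)"
definition preP :: "'e \<Rightarrow> nat \<times> 'e option \<Rightarrow> (nat \<times> 'e option) option" where
  "preP \<alpha> = (\<lambda>(k, b). if b = Some \<alpha> then Some (k, None) else None)"

lemma BP_simps [simp]: "(k, None) \<in> BP I n \<longleftrightarrow> k < n"
  "(k, Some \<alpha>) \<in> BP I n \<longleftrightarrow> k < n \<and> \<alpha> \<in> arcs Q \<and> tail Q \<alpha> = I k"
  by (auto simp: BP_def)

lemma BP_cases: "b \<in> BP I n \<Longrightarrow> (\<And>k. b = (k, None) \<Longrightarrow> k < n \<Longrightarrow> thesis) \<Longrightarrow>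
    (\<And>k \<alpha>. b = (k, Some \<alpha>) \<Longrightarrow> k < n \<Longrightarrow> \<alpha> \<in> arcs Q \<Longrightarrow> tail Q \<alpha> = I k \<Longrightarrow> thesis) \<Longrightarrow> thesis"
  by (cases b; cases "snd b") auto

lemma mono_rep_P:
  assumes "\<And>k. k < n \<Longrightarrow> I k \<in> verts Q" shows "mono_rep (BP I n) (labP I) preP"
proof -
  have "BP I n \<subseteq> (\<lambda>k. (k, None)) ` {..<n} \<union> (\<lambda>(k, \<alpha>). (k, Some \<alpha>)) ` ({..<n} \<times> arcs Q)"
    by (auto elim!: BP_cases)
  then have "finite (BP I n)" by (rule finite_subset) auto
  then show ?thesis unfolding mono_rep_def
    using assms by (auto elim!: BP_cases simp: labP_def preP_def split: if_splits)
qed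

definition \<Psi> :: "(nat \<Rightarrow> 'v) \<Rightarrow> nat \<Rightarrow> (nat \<Rightarrow> ('v \<times> 'e list \<Rightarrow> 'k) set) \<Rightarrow> nat \<times> 'e option \<Rightarrow> 'k" where
  "\<Psi> I n g = (\<lambda>(k, b). if (k, b) \<in> BP I n then (case b of None \<Rightarrow> cv (g k) (I k) | Some \<alpha> \<Rightarrow> ca (g k) \<alpha>) else 0)"

lemma \<Psi>_simps:
  "\<Psi> I n g (k, None) = (if k < n then cv (g k) (I k) else 0)"
  "\<Psi> I n g (k, Some \<alpha>) = (if k < n \<and> \<alpha> \<in> arcs Q \<and> tail Q \<alpha> = I k then ca (g k) \<alpha> else 0)"
  by (simp_all add: \<Psi>_def)

lemma fun_pair_option_eqI:
  "(\<And>k. f (k, None) = g (k, None)) \<Longrightarrow> (\<And>k \<alpha>. f (k, Some \<alpha>) = g (k, Some \<alpha>)) \<Longrightarrow> f = g"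
  for f g :: "'x \<times> 'y option \<Rightarrow> 'z"
  by (rule ext) (metis option.exhaust surj_pair)

lemma mE_P: "mE (labP I) v c (k, None) = (if I k = v then c (k, None) else 0)"
  "mE (labP I) v c (k, Some \<alpha>) = (if head Q \<alpha> = v then c (k, Some \<alpha>) else 0)"
  by (simp_all add: mE_def labP_def)

lemma mY_P: "mY (BP I n) preP \<beta> c (k, None) = 0"
  "mY (BP I n) preP \<beta> c (k, Some \<alpha>) = (if k < n \<and> \<alpha> \<in> arcs Q \<and> tail Q \<alpha> = I k \<and> \<alpha> = \<beta> then c (k, None) else 0)"
  by (auto simp: mY_def preP_def)

lemma \<Psi>_iso:
  assumes I: "\<And>k. k < n \<Longrightarrow> I k \<in> verts Q"
  shows "\<Psi> I n \<in> mod_hom R (PI I n) (mono (BP I n) (labP I) preP)"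
    "bij_betw (\<Psi> I n) (carrier (PI I n)) (fspace (BP I n))"
proof -
  interpret P: idempotents R "\<lambda>k. ev (I k)" n by (rule idempotents_ev)
  have m: "mono_rep (BP I n) (labP I) preP" by (rule mono_rep_P) (rule I)
  note r = rep_mono[OF m]
  have in_W: "\<Psi> I n g \<in> fspace (BP I n)" for g by (auto simp: fspace_def \<Psi>_def)
  have tl: "tail Q \<alpha> \<in> verts Q" "head Q \<alpha> \<in> verts Q" if "\<alpha> \<in> arcs Q" for \<alpha> using that by auto
  show "\<Psi> I n \<in> mod_hom R (PI I n) (mono (BP I n) (labP I) preP)"
  proof (rule mod_homI_gens[OF P.right_module_P right_module_rmod[OF r]])
    show "\<Psi> I n \<in> carrier (PI I n) \<rightarrow> carrier (mono (BP I n) (labP I) preP)" using in_W by simp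
    fix g assume g: "g \<in> carrier (PI I n)"
    note gR = P.P_closed[OF g]
    show "\<Psi> I n (g \<oplus>\<^bsub>PI I n\<^esub> h) = \<Psi> I n g \<oplus>\<^bsub>mono (BP I n) (labP I) preP\<^esub> \<Psi> I n h"
      if h: "h \<in> carrier (PI I n)" for h
      unfolding rmod_simps P.P_simps(3)
      by (rule fun_pair_option_eqI) (use I in \<open>auto simp: \<Psi>_simps coef_add[OF gR P.P_closed[OF h]]\<close>)
    show "\<Psi> I n (sc c \<odot>\<^bsub>PI I n\<^esub> g) = sc c \<odot>\<^bsub>mono (BP I n) (labP I) preP\<^esub> \<Psi> I n g" for c
      unfolding rmod_sc[OF r in_W] P.P_simps(4)
      by (rule fun_pair_option_eqI)
        (use I in \<open>auto simp: \<Psi>_simps fs_apply coef_mult[OF gR gens_closed(1)] coef_gens tl\<close>)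
    show "\<Psi> I n (ev v \<odot>\<^bsub>PI I n\<^esub> g) = ev v \<odot>\<^bsub>mono (BP I n) (labP I) preP\<^esub> \<Psi> I n g" if "v \<in> verts Q" for v
      unfolding rmod_ev[OF that] P.P_simps(4)
      by (rule fun_pair_option_eqI)
        (use I in \<open>auto simp: \<Psi>_simps mE_P coef_mult[OF gR gens_closed(2)] coef_gens tl\<close>)
    show "\<Psi> I n (ar \<beta> \<odot>\<^bsub>PI I n\<^esub> g) = ar \<beta> \<odot>\<^bsub>mono (BP I n) (labP I) preP\<^esub> \<Psi> I n g" if "\<beta> \<in> arcs Q" for \<beta>
      unfolding rmod_ar[OF that] P.P_simps(4)
      by (rule fun_pair_option_eqI)
        (use I in \<open>auto simp: \<Psi>_simps mY_P coef_mult[OF gR gens_closed(3)] coef_gens tl\<close>)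
  qed
  show "bij_betw (\<Psi> I n) (carrier (PI I n)) (fspace (BP I n))"
    unfolding bij_betw_def
  proof
    \<comment> \<open>Being fixed by \<open>ev (I k)\<close> kills the coefficients at other
      vertices and at arrows starting elsewhere.\<close>
    have c: "cv (g k) v = (if v = I k then cv (g k) (I k) else 0)" "\<alpha> \<in> arcs Q \<Longrightarrow> tail Q \<alpha> \<noteq> I k \<Longrightarrow> ca (g k) \<alpha> = 0"
      if "g \<in> carrier (PI I n)" "k < n" "v \<in> verts Q" for g k v \<alpha>
    proof -
      have gk: "g k \<in> carrier R" "ev (I k) \<otimes>\<^bsub>R\<^esub> g k = g k" using P.P_closed P.P_fix that by auto
      show "cv (g k) v = (if v = I k then cv (g k) (I k) else 0)"
        using coef_mult(1)[OF gens_closed(2) gk(1), of v "I k"] that gk(2) by (auto simp: coef_gens)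
      show "\<alpha> \<in> arcs Q \<Longrightarrow> tail Q \<alpha> \<noteq> I k \<Longrightarrow> ca (g k) \<alpha> = 0"
        using coef_mult(2)[OF gens_closed(2) gk(1), of \<alpha> "I k"] gk(2) by (auto simp: coef_gens)
    qed
    show "inj_on (\<Psi> I n) (carrier (PI I n))"
    proof (rule inj_onI)
      fix g h assume g: "g \<in> carrier (PI I n)" and h: "h \<in> carrier (PI I n)" and eq: "\<Psi> I n g = \<Psi> I n h"
      show "g = h"
      proof
        fix k
        show "g k = h k"
        proof (cases "k < n")
          case True
          have 1: "cv (g k) (I k) = cv (h k) (I k)" using fun_cong[OF eq, of "(k, None)"] True by (simp add: \<Psi>_simps)
          have 2: "ca (g k) \<alpha> = ca (h k) \<alpha>" if "\<alpha> \<in> arcs Q" "tail Q \<alpha> = I k" for \<alpha>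
            using fun_cong[OF eq, of "(k, Some \<alpha>)"] True that by (simp add: \<Psi>_simps)
          show ?thesis
          proof (rule coef_ext[OF P.P_closed[OF g] P.P_closed[OF h]])
            show "cv (g k) v = cv (h k) v" if "v \<in> verts Q" for v
              using c(1)[OF g True that] c(1)[OF h True that] 1 by presburger
            show "ca (g k) \<alpha> = ca (h k) \<alpha>" if "\<alpha> \<in> arcs Q" for \<alpha>
              using c(2)[OF g True I[OF True] that] c(2)[OF h True I[OF True] that] 2[OF that] by metis
          qed
        next
          case False
          then show ?thesis using P.P_out[OF g False] P.P_out[OF h False] by (simp only:)
        qed
      qed
    qed
    show "\<Psi> I n ` carrier (PI I n) = fspace (BP I n)"
    proof
      show "\<Psi> I n ` carrier (PI I n) \<subseteq> fspace (BP I n)" using in_W by auto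
      show "fspace (BP I n) \<subseteq> \<Psi> I n ` carrier (PI I n)"
      proof
        fix c :: "nat \<times> 'e option \<Rightarrow> 'k" assume c: "c \<in> fspace (BP I n)"
        define g where "g k = (if k < n then el (\<lambda>u. if u = I k then c (k, None) else 0)
            (\<lambda>\<alpha>. if tail Q \<alpha> = I k then c (k, Some \<alpha>) else 0) else \<zero>\<^bsub>R\<^esub>)" for k
        have "g \<in> carrier (PI I n)"
        proof (rule P.P_I)
          fix k assume "k < n"
          then show "ev (I k) \<otimes>\<^bsub>R\<^esub> g k = g k" unfolding g_def ev_def
            by (simp add: el_mult) (rule el_cong, auto)
        qed (auto simp: g_def)
        moreover have "\<Psi> I n g = c"
          by (rule fun_pair_option_eqI) (use I c in \<open>auto simp: \<Psi>_simps g_def fspace_def\<close>)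
        ultimately show "c \<in> \<Psi> I n ` carrier (PI I n)" by blast
      qed
    qed
  qed
qed

lemma PI_iso: "(\<And>k. k < n \<Longrightarrow> I k \<in> verts Q) \<Longrightarrow> mod_iso R (PI I n) (mono (BP I n) (labP I) preP)"
  unfolding mod_iso_def using \<Psi>_iso[of n I] by (auto intro!: bexI[of _ "\<Psi> I n"])

lemma bot_P: "bot preP (k, b) \<longleftrightarrow> (\<exists>\<alpha>\<in>arcs Q. b = Some \<alpha>)"
  by (auto simp: bot_def preP_def)

lemma card_BP_top: "card {b \<in> BP I n. labP I b = q \<and> \<not> bot preP b} = card {k. k < n \<and> I k = q}"
proof (rule bij_betw_same_card[of fst])
  have "{b \<in> BP I n. labP I b = q \<and> \<not> bot preP b} = (\<lambda>k. (k, None)) ` {k. k < n \<and> I k = q}"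
    by (auto elim!: BP_cases simp: bot_P labP_def image_iff)
  then show "bij_betw fst {b \<in> BP I n. labP I b = q \<and> \<not> bot preP b} {k. k < n \<and> I k = q}"
    by (auto simp: bij_betw_def inj_on_def image_image)
qed

lemma card_BP_bot: "card {b \<in> BP I n. labP I b = q \<and> bot preP b} =
    (\<Sum>\<alpha>\<in>in_arcs Q q. card {k. k < n \<and> I k = tail Q \<alpha>})"
proof -
  have "{b \<in> BP I n. labP I b = q \<and> bot preP b} =
      (\<lambda>(\<alpha>, k). (k, Some \<alpha>)) ` (SIGMA \<alpha>:in_arcs Q q. {k. k < n \<and> I k = tail Q \<alpha>})"
    by (force elim!: BP_cases simp: bot_P labP_def image_iff in_arcs_def)
  moreover have "inj_on (\<lambda>(\<alpha>, k). (k, Some \<alpha>)) (SIGMA \<alpha>:in_arcs Q q. {k. k < n \<and> I k = tail Q \<alpha>})"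
    by (auto simp: inj_on_def)
  ultimately have "card {b \<in> BP I n. labP I b = q \<and> bot preP b} =
      card (SIGMA \<alpha>:in_arcs Q q. {k. k < n \<and> I k = tail Q \<alpha>})" by (simp only: card_image)
  also have "\<dots> = (\<Sum>\<alpha>\<in>in_arcs Q q. card {k. k < n \<and> I k = tail Q \<alpha>})"
    by (rule card_SigmaI) auto
  finally show ?thesis .
qed

text \<open>Each arrow leaving a generator produces exactly one bottom element, so the two counts in
  \<open>omr_mono\<close> agree.\<close>

lemma omr_P:
  assumes "\<And>k. k < n \<Longrightarrow> I k \<in> verts Q"
  shows "omr (fspace (BP I n)) (mE (labP I)) (mY (BP I n) preP) p = 0"
proof -
  have m: "mono_rep (BP I n) (labP I) preP" by (rule mono_rep_P) (rule assms)
  show ?thesis unfolding omr_mono[OF m] card_BP_top card_BP_bot by simp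
qed

text \<open>The arrow \<gamma> sends a generator at p to the basis element
  \<open>(k, Some \<gamma>)\<close>, so no generator there is killed by \<open>C\<close>.\<close>

lemma nur_P:
  assumes I: "\<And>k. k < n \<Longrightarrow> I k \<in> verts Q" and C: "C \<subseteq> arcs Q" and \<gamma>: "\<gamma> \<in> C" "tail Q \<gamma> = p"
  shows "nur C (fspace (BP I n)) (mE (labP I)) (mY (BP I n) preP) p = 0"
proof -
  have "{b \<in> BP I n. labP I b = p \<and> \<not> bot preP b \<and> (\<forall>\<gamma>\<in>C. \<forall>c\<in>BP I n. preP \<gamma> c \<noteq> Some b)} = {}"
  proof (intro equals0I)
    fix b assume b: "b \<in> {b \<in> BP I n. labP I b = p \<and> \<not> bot preP b \<and> (\<forall>\<gamma>\<in>C. \<forall>c\<in>BP I n. preP \<gamma> c \<noteq> Some b)}"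
    then obtain k where k: "b = (k, None)" "k < n" "I k = p" by (auto elim!: BP_cases simp: bot_P labP_def)
    then have "(k, Some \<gamma>) \<in> BP I n" "preP \<gamma> (k, Some \<gamma>) = Some b" using \<gamma> C by (auto simp: preP_def)
    then show False using b \<gamma> by auto
  qed
  moreover have m: "mono_rep (BP I n) (labP I) preP" by (rule mono_rep_P) (rule I)
  ultimately show ?thesis unfolding nur_mono[OF m C] by (simp only: card.empty of_nat_0)
qed

lemma sub_rep:
  assumes r: "rep V E Y" and K: "K \<subseteq> V" "fv.subspace K"
    and "\<And>v x. v \<in> verts Q \<Longrightarrow> x \<in> K \<Longrightarrow> E v x \<in> K" "\<And>\<alpha> x. \<alpha> \<in> arcs Q \<Longrightarrow> x \<in> K \<Longrightarrow> Y \<alpha> x \<in> K"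
  shows "rep K E Y"
  unfolding rep_def
proof (intro conjI ballI)
  fix x assume "x \<in> K"
  then have x: "x \<in> V" using K by auto
  show "(\<Sum>v\<in>verts Q. E v x) = x" by (rule repD(7)[OF r x])
  show "E u (E v x) = (if u = v then E v x else 0)" if "u \<in> verts Q" "v \<in> verts Q" for u v
    by (rule repD(8)[OF r that x])
  show "Y \<alpha> (E u x) = (if u = tail Q \<alpha> then Y \<alpha> x else 0)" if "\<alpha> \<in> arcs Q" "u \<in> verts Q" for \<alpha> u
    by (rule repD(9)[OF r that x])
  show "E u (Y \<alpha> x) = (if u = head Q \<alpha> then Y \<alpha> x else 0)" if "\<alpha> \<in> arcs Q" "u \<in> verts Q" for \<alpha> u
    by (rule repD(10)[OF r that x])
  show "Y \<alpha> (Y \<beta> x) = 0" if "\<alpha> \<in> arcs Q" "\<beta> \<in> arcs Q" for \<alpha> \<beta>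
    by (rule repD(11)[OF r that x])
qed (use assms fin_dim_subset[OF repD(2)[OF r] K(1)] repD(3,5)[OF r] in auto)

end

section \<open>Invariants of abstract modules and construction of projective covers\<close>

context quiver_alg
begin

lemma labP_simps: "labP I (k, None) = I k" "labP I (k, Some \<alpha>) = head Q \<alpha>"
  by (simp_all add: labP_def)

lemma in_arcs_verts: "\<alpha> \<in> in_arcs Q p \<Longrightarrow> tail Q \<alpha> \<in> verts Q"
  by (auto simp: in_arcs_def)

lemma omr_iso:
  assumes r: "rep V E Y" "rep V' E' Y'" and iso: "mod_iso R (rmod V E Y) (rmod V' E' Y')"
  shows "omr V E Y p = omr V' E' Y' p"
  unfolding omr_def inv_iso(2)[OF assms] using inv_iso(1)[OF assms] in_arcs_verts by simp

lemma nur_iso: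
  assumes r: "rep V E Y" "rep V' E' Y'" and iso: "mod_iso R (rmod V E Y) (rmod V' E' Y')"
    and "p \<in> verts Q" "C \<subseteq> arcs Q"
  shows "nur C V E Y p = nur C V' E' Y' p"
  unfolding nur_def inv_iso(2)[OF assms(1-3)] inv_iso(3)[OF assms] ..

text \<open>The invariant of an abstract module is read off from some representation of it;
  invariance under isomorphism makes the choice harmless.\<close>

definition omM :: "(('v \<times> 'e list \<Rightarrow> 'k) set) umodule \<Rightarrow> 'v \<Rightarrow> int" where
  "omM M p = (SOME z. \<exists>(V :: ((nat \<Rightarrow> ('v \<times> 'e list \<Rightarrow> 'k) set) \<Rightarrow> 'k) set) E Y.
     rep V E Y \<and> mod_iso R (rmod V E Y) M \<and> z = omr V E Y p)"
definition nuM :: "'e set \<Rightarrow> (('v \<times> 'e list \<Rightarrow> 'k) set) umodule \<Rightarrow> 'v \<Rightarrow> int" where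
  "nuM C M p = (SOME z. \<exists>(V :: ((nat \<Rightarrow> ('v \<times> 'e list \<Rightarrow> 'k) set) \<Rightarrow> 'k) set) E Y.
     rep V E Y \<and> mod_iso R (rmod V E Y) M \<and> z = nur C V E Y p)"

lemma fgD: "M \<in> fg_modules R \<Longrightarrow> right_module R M" "M \<in> fg_modules R \<Longrightarrow> fin_gen R M"
  by (simp_all add: fg_modules_def)

lemma rep_iso_trans:
  assumes "rep V E Y" "mod_iso R (rmod V E Y) M" "rep V' E' Y'" "mod_iso R (rmod V' E' Y') M"
  shows "mod_iso R (rmod V E Y) (rmod V' E' Y')"
  using mod_iso_trans[OF assms(2) mod_iso_sym[OF right_module_rmod[OF assms(3)] assms(4)]] .

lemma omM_eq:
  assumes M: "M \<in> fg_modules R" and r: "rep V E Y" and iso: "mod_iso R (rmod V E Y) M"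
  shows "omM M p = omr V E Y p"
proof -
  have "\<exists>z. \<exists>(V :: ((nat \<Rightarrow> ('v \<times> 'e list \<Rightarrow> 'k) set) \<Rightarrow> 'k) set) E Y.
     rep V E Y \<and> mod_iso R (rmod V E Y) M \<and> z = omr V E Y p"
    using normal_form[OF fgD[OF M]] by metis
  from someI_ex[OF this] obtain V' :: "((nat \<Rightarrow> ('v \<times> 'e list \<Rightarrow> 'k) set) \<Rightarrow> 'k) set" and E' Y'
    where *: "rep V' E' Y'" "mod_iso R (rmod V' E' Y') M" "omM M p = omr V' E' Y' p"
    unfolding omM_def[symmetric] by blast
  show ?thesis unfolding *(3) by (rule omr_iso[OF *(1) r rep_iso_trans[OF *(1,2) r iso]])
qed

lemma nuM_eq:
  assumes M: "M \<in> fg_modules R" and r: "rep V E Y" and iso: "mod_iso R (rmod V E Y) M"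
    and p: "p \<in> verts Q" "C \<subseteq> arcs Q"
  shows "nuM C M p = nur C V E Y p"
proof -
  have "\<exists>z. \<exists>(V :: ((nat \<Rightarrow> ('v \<times> 'e list \<Rightarrow> 'k) set) \<Rightarrow> 'k) set) E Y.
     rep V E Y \<and> mod_iso R (rmod V E Y) M \<and> z = nur C V E Y p"
    using normal_form[OF fgD[OF M]] by metis
  from someI_ex[OF this] obtain V' :: "((nat \<Rightarrow> ('v \<times> 'e list \<Rightarrow> 'k) set) \<Rightarrow> 'k) set" and E' Y'
    where *: "rep V' E' Y'" "mod_iso R (rmod V' E' Y') M" "nuM C M p = nur C V' E' Y' p"
    unfolding nuM_def[symmetric] by blast
  show ?thesis unfolding *(3) by (rule nur_iso[OF *(1) r rep_iso_trans[OF *(1,2) r iso] p])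
qed

lemma inv_additive:
  assumes M: "M \<in> fg_modules R" "M' \<in> fg_modules R" "M'' \<in> fg_modules R"
    and iso: "mod_iso R M (direct_sum M' M'')" and p: "p \<in> verts Q"
  shows "omM M p = omM M' p + omM M'' p"
    "C \<subseteq> arcs Q \<Longrightarrow> nuM C M p = nuM C M' p + nuM C M'' p"
proof -
  obtain V :: "((nat \<Rightarrow> ('v \<times> 'e list \<Rightarrow> 'k) set) \<Rightarrow> 'k) set" and E Y where V: "rep V E Y" "mod_iso R (rmod V E Y) M"
    using normal_form[OF fgD[OF M(1)]] by blast
  obtain V' :: "((nat \<Rightarrow> ('v \<times> 'e list \<Rightarrow> 'k) set) \<Rightarrow> 'k) set" and E' Y' where V': "rep V' E' Y'" "mod_iso R (rmod V' E' Y') M'"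
    using normal_form[OF fgD[OF M(2)]] by blast
  obtain V'' :: "((nat \<Rightarrow> ('v \<times> 'e list \<Rightarrow> 'k) set) \<Rightarrow> 'k) set" and E'' Y'' where V'': "rep V'' E'' Y''" "mod_iso R (rmod V'' E'' Y'') M''"
    using normal_form[OF fgD[OF M(3)]] by blast
  have "mod_iso R (direct_sum M' M'') (direct_sum (rmod V' E' Y') (rmod V'' E'' Y''))"
    by (rule direct_sum_cong[OF mod_iso_sym[OF right_module_rmod[OF V'(1)] V'(2)]
          mod_iso_sym[OF right_module_rmod[OF V''(1)] V''(2)]])
  from mod_iso_trans[OF mod_iso_trans[OF V(2) iso] this]
  have i: "mod_iso R (rmod V E Y) (direct_sum (rmod V' E' Y') (rmod V'' E'' Y''))" .
  note d = inv_direct_sum[OF V(1) V'(1) V''(1) i]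
  have "omr V E Y p = omr V' E' Y' p + omr V'' E'' Y'' p"
    unfolding omr_def using d(1)[OF in_arcs_verts] by (simp add: d(2) sum.distrib sum_subtractf)
  then show "omM M p = omM M' p + omM M'' p"
    by (simp only: omM_eq[OF M(1) V] omM_eq[OF M(2) V'] omM_eq[OF M(3) V''])
  show "nuM C M p = nuM C M' p + nuM C M'' p" if C: "C \<subseteq> arcs Q"
    by (simp add: nuM_eq[OF M(1) V p C] nuM_eq[OF M(2) V' p C] nuM_eq[OF M(3) V'' p C] nur_def d(2) d(3)[OF p C])
qed

lemma right_module_PI: "right_module R (PI I n)"
proof -
  interpret P: idempotents R "\<lambda>k. ev (I k)" n by (rule idempotents_ev)
  show ?thesis by (rule P.right_module_P)
qed

lemma PI_fg:
  assumes I: "\<And>k. k < n \<Longrightarrow> I k \<in> verts Q" shows "PI I n \<in> fg_modules R"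
proof -
  have m: "mono_rep (BP I n) (labP I) preP" by (rule mono_rep_P) (rule I)
  note r = rep_mono[OF m]
  have "mod_iso R (mono (BP I n) (labP I) preP) (PI I n)"
    using mod_iso_sym[OF right_module_PI PI_iso] I by blast
  then have "fin_gen R (PI I n)"
    by (rule fin_gen_iso[OF right_module_rmod[OF r] right_module_PI _ fin_gen_rmod[OF r]])
  then show ?thesis using right_module_PI by (simp add: fg_modules_def)
qed

lemma cover_exists:
  assumes M: "M \<in> fg_modules R"
  obtains I n f K where "\<forall>k<n. I k \<in> verts Q" "projective_cover R (PI I n) f M"
    "rep K (mE (labP I)) (mY (BP I n) preP)"
    "mod_iso R (rmod K (mE (labP I)) (mY (BP I n) preP)) (PI I n\<lparr>carrier := mod_ker (PI I n) M f\<rparr>)"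
    "\<forall>\<alpha>\<in>arcs Q. \<forall>x\<in>K. mY (BP I n) preP \<alpha> x = 0"
    "\<forall>p\<in>verts Q. int (fv.dim (Sd p K (mE (labP I)))) = omM M p"
proof -
  have rM: "right_module R M" by (rule fgD[OF M])
  obtain V :: "((nat \<Rightarrow> ('v \<times> 'e list \<Rightarrow> 'k) set) \<Rightarrow> 'k) set" and E Y where r: "rep V E Y" and iso: "mod_iso R (rmod V E Y) M"
    using normal_form[OF fgD[OF M]] by blast
  obtain \<theta> where \<theta>: "\<theta> \<in> mod_hom R (rmod V E Y) M" "bij_betw \<theta> V (carrier M)"
    using iso by (auto simp: mod_iso_def)
  note rV = right_module_rmod[OF r]
  have Vs: "fv.subspace (Sd i V E)" if "i \<in> verts Q" for i
    unfolding Sd_def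
    by (rule fv.subspaceI) (simp_all add: flinD[OF repD(3)[OF r that]] fv.subspace_0[OF repD(1)[OF r]]
        fv.subspace_add[OF repD(1)[OF r]] fv.subspace_scale[OF repD(1)[OF r]])
  have Vfd: "fin_dim (Sd i V E)" for i by (rule fin_dim_subset[OF repD(2)[OF r]]) (auto simp: Sd_def)
  have SrV: "Sr i V Y \<subseteq> Sd i V E" if "i \<in> verts Q" for i
    using that repD(6,10)[OF r] by (auto simp: Sr_def Sd_def)
  have UV: "fv.span (Sr i V Y) \<subseteq> Sd i V E" if "i \<in> verts Q" for i
    by (rule fv.span_minimal[OF SrV[OF that] Vs[OF that]])
  have "\<exists>C. finite C \<and> C \<subseteq> Sd i V E \<and> fv.independent C \<and> fv.dim (Sd i V E) = fv.dim (Sr i V Y) + card C \<and>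
      Sd i V E = fv.span (fv.span (Sr i V Y) \<union> C) \<and> fv.span (Sr i V Y) \<inter> fv.span C \<subseteq> {0}" if i: "i \<in> verts Q" for i
  proof -
    obtain C where "finite C" "C \<subseteq> Sd i V E" "fv.independent C" "fv.dim (Sd i V E) = fv.dim (fv.span (Sr i V Y)) + card C"
      "Sd i V E = fv.span (fv.span (Sr i V Y) \<union> C)" "fv.span (Sr i V Y) \<inter> fv.span C \<subseteq> {0}"
      by (rule complement_basis[OF Vs[OF i] Vfd UV[OF i] fv.subspace_span])
    then show ?thesis unfolding fv.dim_span by blast
  qed
  then have "\<forall>i\<in>verts Q. \<exists>C. finite C \<and> C \<subseteq> Sd i V E \<and> fv.independent C \<and> fv.dim (Sd i V E) = fv.dim (Sr i V Y) + card C \<and>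
      Sd i V E = fv.span (fv.span (Sr i V Y) \<union> C) \<and> fv.span (Sr i V Y) \<inter> fv.span C \<subseteq> {0}" by (rule ballI)
  then obtain C where "\<forall>i\<in>verts Q. finite (C i) \<and> C i \<subseteq> Sd i V E \<and> fv.independent (C i) \<and> fv.dim (Sd i V E) = fv.dim (Sr i V Y) + card (C i) \<and>
      Sd i V E = fv.span (fv.span (Sr i V Y) \<union> C i) \<and> fv.span (Sr i V Y) \<inter> fv.span (C i) \<subseteq> {0}" by (rule exE[OF bchoice])
  note C0 = bspec[OF this]
  note C = C0[THEN conjunct1] C0[THEN conjunct2, THEN conjunct1] C0[THEN conjunct2, THEN conjunct2, THEN conjunct1]
    C0[THEN conjunct2, THEN conjunct2, THEN conjunct2, THEN conjunct1]
    C0[THEN conjunct2, THEN conjunct2, THEN conjunct2, THEN conjunct2, THEN conjunct1]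
    C0[THEN conjunct2, THEN conjunct2, THEN conjunct2, THEN conjunct2, THEN conjunct2]
  \<comment> \<open>One index for each pair of a vertex and a basis vector of the complement
    there.\<close>
  define n where "n = card (Sigma (verts Q) C)"
  have "finite (Sigma (verts Q) C)" using C(1) by auto
  from ex_bij_betw_nat_finite[OF this] obtain e where e: "bij_betw e {0..<n} (Sigma (verts Q) C)" unfolding n_def ..
  define I where "I k = fst (e k)" for k
  define x where "x k = snd (e k)" for k
  have ek: "e k \<in> Sigma (verts Q) C" if "k < n" for k using bij_betwE[OF e] that by auto
  have I: "I k \<in> verts Q" "x k \<in> C (I k)" if "k < n" for k
    using ek[OF that] by (auto simp: I_def x_def)
  have ex_k: "\<exists>k<n. I k = i \<and> x k = c" if "i \<in> verts Q" "c \<in> C i" for i c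
  proof -
    have "(i, c) \<in> e ` {0..<n}" using e that by (simp add: bij_betw_def)
    then obtain k where "k < n" "(i, c) = e k" by auto
    then show ?thesis unfolding I_def x_def by (metis fst_conv snd_conv)
  qed
  have inj_k: "k = l" if "k < n" "l < n" "I k = I l" "x k = x l" for k l
  proof -
    have "e k = e l" using that(3,4) unfolding I_def x_def by (rule prod_eqI)
    then show ?thesis using e that(1,2) by (auto simp: bij_betw_def inj_on_def)
  qed
  have xC: "bij_betw x {k. k < n \<and> I k = i} (C i)" if "i \<in> verts Q" for i
    unfolding bij_betw_def inj_on_def using inj_k ex_k[OF that] I by (auto simp: image_iff) (metis+)?
  have cardI: "card {k. k < n \<and> I k = i} = card (C i)" if "i \<in> verts Q" for i
    by (rule bij_betw_same_card[OF xC[OF that]])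
  have xV: "x k \<in> V" "E (I k) (x k) = x k" if "k < n" for k
    using C(2)[OF I(1)[OF that]] I(2)[OF that] by (auto simp: Sd_def)
  interpret P: idempotents R "\<lambda>k. ev (I k)" n by (rule idempotents_ev)
  define f' where "f' = P.extend (rmod V E Y) x"
  have f': "f' \<in> mod_hom R (PI I n) (rmod V E Y)" unfolding f'_def
    by (rule P.extend_hom[OF rV]) (simp add: xV)
  have f'_gen: "f' (P.gen k) = x k" if "k < n" for k
    unfolding f'_def by (rule P.extend_gen[OF rV]) (use that xV I in \<open>simp_all add: rmod_ev\<close>)
  have m: "mono_rep (BP I n) (labP I) preP" by (rule mono_rep_P) (rule I)
  note rW = rep_mono[OF m]
  let ?W = "fspace (BP I n) :: (nat \<times> 'e option \<Rightarrow> 'k) set"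
  let ?E = "mE (labP I) :: 'v \<Rightarrow> (nat \<times> 'e option \<Rightarrow> 'k) \<Rightarrow> (nat \<times> 'e option \<Rightarrow> 'k)"
  let ?Y = "mY (BP I n) preP :: 'e \<Rightarrow> (nat \<times> 'e option \<Rightarrow> 'k) \<Rightarrow> (nat \<times> 'e option \<Rightarrow> 'k)"
  have \<Psi>: "\<Psi> I n \<in> mod_hom R (PI I n) (mono (BP I n) (labP I) preP)"
    "bij_betw (\<Psi> I n) (carrier (PI I n)) ?W" using \<Psi>_iso[of n I] I by blast+
  define G where "G = inv_into (carrier (PI I n)) (\<Psi> I n)"
  have G: "G \<in> mod_hom R (mono (BP I n) (labP I) preP) (PI I n)"
    unfolding G_def by (rule mod_hom_inv[OF right_module_PI \<Psi>(1)]) (simp add: \<Psi>(2))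
  have G\<Psi>: "G (\<Psi> I n g) = g" if "g \<in> carrier (PI I n)" for g
    using \<Psi>(2) that by (simp add: G_def bij_betw_def)
  have \<Psi>G: "\<Psi> I n (G c) = c" "G c \<in> carrier (PI I n)" if "c \<in> ?W" for c
    using \<Psi>(2) that by (auto simp: G_def bij_betw_def f_inv_into_f inv_into_into)
  have F0: "(\<lambda>c. f' (G c)) \<in> mod_hom R (mono (BP I n) (labP I) preP) (rmod V E Y)"
    by (rule mod_hom_comp[OF G f'])
  note F0D = rmod_homD[OF rW r F0]
  obtain F where F: "flin F" "\<And>c. c \<in> ?W \<Longrightarrow> F c = f' (G c)"
    using lin_on_extend[OF repD(1)[OF rW] F0D(1)] by blast
  have FV: "F c \<in> V" if "c \<in> ?W" for c using F0D(2) F(2)[OF that] that by auto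
  have FE: "F (?E i c) = E i (F c)" if "i \<in> verts Q" "c \<in> ?W" for i c
    using F0D(3)[OF that] F(2)[OF that(2)] F(2)[OF repD(4)[OF rW that]] by simp
  have FY: "F (?Y \<alpha> c) = Y \<alpha> (F c)" if "\<alpha> \<in> arcs Q" "c \<in> ?W" for \<alpha> c
    using F0D(4)[OF that] F(2)[OF that(2)] F(2)[OF repD(6)[OF rW that]] by simp
  have F\<Psi>: "F (\<Psi> I n g) = f' g" if "g \<in> carrier (PI I n)" for g
  proof -
    have "\<Psi> I n g \<in> ?W" using \<Psi>(2) that by (auto simp: bij_betw_def)
    then show ?thesis using F(2) G\<Psi>[OF that] by simp
  qed
  have \<Psi>_gen: "\<Psi> I n (P.gen k) = unitf (k, None)" if k: "k < n" for k
  proof (rule fun_pair_option_eqI)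
    have cz: "v \<in> verts Q \<Longrightarrow> cv \<zero>\<^bsub>R\<^esub> v = 0" "\<alpha> \<in> arcs Q \<Longrightarrow> ca \<zero>\<^bsub>R\<^esub> \<alpha> = 0" for v \<alpha>
      unfolding el_zero by simp_all
    show "\<Psi> I n (P.gen k) (j, None) = unitf (k, None) (j, None)" for j
      using I(1) k by (auto simp: \<Psi>_simps P.gen_def unitf_def coef_gens cz)
    show "\<Psi> I n (P.gen k) (j, Some \<alpha>) = unitf (k, None) (j, Some \<alpha>)" for j \<alpha>
      using I(1) k by (auto simp: \<Psi>_simps P.gen_def unitf_def coef_gens cz)
  qed
  have F_unit: "F (unitf (k, None)) = x k" if "k < n" for k
    using F\<Psi>[OF P.gen_closed[OF that]] \<Psi>_gen[OF that] f'_gen[OF that] by simp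
  have Im: "fv.subspace (F ` ?W)" by (rule fp.linear_subspace_image[OF F(1)]) simp
  have xIm: "c \<in> F ` ?W" if ic: "i \<in> verts Q" "c \<in> C i" for i c
  proof -
    obtain k where "k < n" "x k = c" using ex_k[OF ic] by blast
    then show ?thesis using F_unit[of k] by (intro image_eqI[of _ _ "unitf (k, None)"]) auto
  qed
  \<comment> \<open>Arrows kill the radical, so at the tail of \<alpha> only the chosen complement
    matters, and that lies in the image of \<open>F\<close>.\<close>
  have YIm: "Y \<alpha> z \<in> F ` ?W" if \<alpha>: "\<alpha> \<in> arcs Q" and z: "z \<in> V" for \<alpha> z
  proof -
    let ?t = "tail Q \<alpha>" have t: "?t \<in> verts Q" using \<alpha> by auto
    note Y\<alpha> = flinD[OF repD(5)[OF r \<alpha>]]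
    have sub: "fv.subspace {z. Y \<alpha> z \<in> F ` ?W}"
      by (rule fv.subspaceI) (simp_all add: Y\<alpha> fv.subspace_0[OF Im] fv.subspace_add[OF Im] fv.subspace_scale[OF Im])
    have "Sr ?t V Y \<subseteq> {z. Y \<alpha> z \<in> F ` ?W}"
      using repD(11)[OF r \<alpha>] fv.subspace_0[OF Im] by (auto simp: Sr_def)
    then have "fv.span (Sr ?t V Y) \<subseteq> {z. Y \<alpha> z \<in> F ` ?W}" by (rule fv.span_minimal[OF _ sub])
    moreover have "C ?t \<subseteq> {z. Y \<alpha> z \<in> F ` ?W}"
    proof
      fix c assume "c \<in> C ?t"
      then obtain d where "d \<in> ?W" "c = F d" using xIm[OF t] by blast
      then have "Y \<alpha> c = F (?Y \<alpha> d)" "?Y \<alpha> d \<in> ?W" using FY[OF \<alpha>, of d] repD(6)[OF rW \<alpha>] by simp_all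
      then show "c \<in> {z. Y \<alpha> z \<in> F ` ?W}" by blast
    qed
    ultimately have "Sd ?t V E \<subseteq> {z. Y \<alpha> z \<in> F ` ?W}"
      unfolding C(5)[OF t] by (intro fv.span_minimal[OF _ sub]) auto
    moreover have "E ?t z \<in> Sd ?t V E" using repD(4)[OF r t z] repD(8)[OF r t t z] by (simp add: Sd_def)
    ultimately have "Y \<alpha> (E ?t z) \<in> F ` ?W" by blast
    then show ?thesis unfolding repD(9)[OF r \<alpha> t z] by simp
  qed
  have VIm: "Sd i V E \<subseteq> F ` ?W" if i: "i \<in> verts Q" for i
  proof -
    have "Sr i V Y \<subseteq> F ` ?W" using YIm by (auto simp: Sr_def)
    then have "fv.span (Sr i V Y) \<subseteq> F ` ?W" by (rule fv.span_minimal[OF _ Im])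
    then show ?thesis unfolding C(5)[OF i] using xIm[OF i] by (intro fv.span_minimal[OF _ Im]) auto
  qed
  have surj: "F ` ?W = V"
  proof
    show "F ` ?W \<subseteq> V" using FV by auto
    show "V \<subseteq> F ` ?W"
    proof
      fix z assume z: "z \<in> V"
      have "E i z \<in> F ` ?W" if "i \<in> verts Q" for i
      proof -
        have "E i z \<in> Sd i V E" using repD(4)[OF r that z] repD(8)[OF r that that z] by (simp add: Sd_def)
        then show ?thesis using VIm[OF that] by blast
      qed
      then have "(\<Sum>i\<in>verts Q. E i z) \<in> F ` ?W" by (rule fv.subspace_sum[OF Im])
      then show "z \<in> F ` ?W" unfolding repD(7)[OF r z] .
    qed
  qed
  define K where "K = {c \<in> ?W. F c = 0}"
  \<comment> \<open>Split the component at \<open>I k\<close> of a kernel element into its generator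
    part \<open>t\<close> and a bottom part \<open>b\<close>. Then \<open>F t = - F b\<close> lies
    both in the radical and in the span of the complement, so it is zero, and independence of the
    complement removes all coefficients of \<open>t\<close>.\<close>
  have Kbot: "c (k, None) = 0" if c: "c \<in> K" for k and c :: "nat \<times> 'e option \<Rightarrow> 'k"
  proof (cases "k < n")
    case False
    then show ?thesis using c by (simp add: K_def fspace_def)
  next
    case True
    let ?i = "I k" let ?L = "{l. l < n \<and> I l = ?i}"
    have i: "?i \<in> verts Q" by (rule I(1)[OF True])
    have cW: "c \<in> ?W" "F c = 0" using c by (auto simp: K_def)
    define t :: "nat \<times> 'e option \<Rightarrow> 'k" where "t = (\<Sum>l\<in>?L. fs (c (l, None)) (unitf (l, None)))"
    define b where "b = ?E ?i c - t"
    have Ft: "F t = (\<Sum>l\<in>?L. fs (c (l, None)) (x l))"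
      unfolding t_def flinD(4)[OF F(1)] by (rule sum.cong) (auto simp: flinD(2)[OF F(1)] F_unit)
    have t_None: "t (l, None) = (if l \<in> ?L then c (l, None) else 0)" for l
    proof -
      have "t (l, None) = (\<Sum>j\<in>?L. if l = j then c (j, None) else 0)"
        unfolding t_def sum_apply by (rule sum.cong) (auto simp: fs_apply unitf_def)
      then show ?thesis by simp
    qed
    have t_Some: "t (l, Some \<alpha>) = 0" for l \<alpha>
      unfolding t_def sum_apply by (rule sum.neutral) (auto simp: fs_apply unitf_def)
    have "b \<in> fspace {b \<in> BP I n. labP I b = ?i \<and> bot preP b}" unfolding fspace_def
    proof (intro CollectI allI impI)
      fix y assume y: "y \<notin> {b \<in> BP I n. labP I b = ?i \<and> bot preP b}"
      show "b y = 0"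
      proof (cases y)
        case (Pair l o')
        show ?thesis
        proof (cases o')
          case None
          have "b y = ?E ?i c (l, None) - t (l, None)" by (simp add: b_def Pair None)
          then show ?thesis using cW(1) by (auto simp: mE_P t_None fspace_def)
        next
          case (Some \<alpha>)
          have "b y = ?E ?i c (l, Some \<alpha>) - t (l, Some \<alpha>)" by (simp add: b_def Pair Some)
          then show ?thesis using cW(1) y by (auto simp: mE_P t_Some fspace_def Pair Some labP_simps bot_P)
        qed
      qed
    qed
    then have "b \<in> fv.span (Sr ?i ?W ?Y)" unfolding span_Sr_mono[OF m] .
    then have "F b \<in> fv.span (F ` Sr ?i ?W ?Y)" using fp.linear_span_image[OF F(1)] by blast
    moreover have "F ` Sr ?i ?W ?Y \<subseteq> Sr ?i V Y"
    proof
      fix z assume "z \<in> F ` Sr ?i ?W ?Y"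
      then obtain \<alpha> d where "z = F (?Y \<alpha> d)" "\<alpha> \<in> arcs Q" "head Q \<alpha> = ?i" "d \<in> ?W" by (auto simp: Sr_def)
      then show "z \<in> Sr ?i V Y" using FY[of \<alpha> d] FV[of d] unfolding Sr_def by blast
    qed
    ultimately have Fb: "F b \<in> fv.span (Sr ?i V Y)" using fv.span_mono by blast
    have "F (?E ?i c) = 0" using FE[OF i cW(1)] cW(2) flinD(3)[OF repD(3)[OF r i]] by simp
    then have "F b = - F t" by (simp add: b_def flinD(5)[OF F(1)])
    then have "F t = - F b" by simp
    then have "F t \<in> fv.span (Sr ?i V Y)" using Fb fv.span_neg by simp
    moreover have "F t \<in> fv.span (C ?i)"
      unfolding Ft
    proof (intro fv.span_sum fv.span_scale fv.span_base)
      fix l assume "l \<in> ?L"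
      then have l: "l < n" and il: "I l = ?i" by simp_all
      show "x l \<in> C ?i" using I(2)[OF l] unfolding il .
    qed
    ultimately have Ft0: "F t = 0" using C(6)[OF i] by blast
    let ?inv = "inv_into ?L x"
    have bx: "inj_on x ?L" "x ` ?L = C ?i" using xC[OF i] by (auto simp: bij_betw_def)
    have "(\<Sum>y\<in>C ?i. fs (c (?inv y, None)) y) = (\<Sum>l\<in>?L. fs (c (?inv (x l), None)) (x l))"
      unfolding bx(2)[symmetric] by (subst sum.reindex[OF bx(1)]) simp
    also have "\<dots> = F t" unfolding Ft by (rule sum.cong) (use bx(1) in \<open>simp_all add: inv_into_f_f\<close>)
    finally have s0: "(\<Sum>y\<in>C ?i. fs (c (?inv y, None)) y) = 0" unfolding Ft0 .
    have "c (?inv (x k), None) = 0"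
      by (rule fv.independentD[OF C(3)[OF i] C(1)[OF i] subset_refl s0]) (rule I(2)[OF True])
    moreover have "?inv (x k) = k" by (rule inv_into_f_f[OF bx(1)]) (use True in simp)
    ultimately show ?thesis by simp
  qed
  have KW: "K \<subseteq> ?W" by (auto simp: K_def)
  have Ks: "fv.subspace K" unfolding K_def
    by (rule fv.subspaceI) (simp_all add: flinD[OF F(1)] fv.subspace_add fv.subspace_scale fv.subspace_0)
  have KE: "?E v c \<in> K" if "v \<in> verts Q" "c \<in> K" for v c
    using that repD(4)[OF rW that(1)] FE[OF that(1)] flinD(3)[OF repD(3)[OF r that(1)]] by (auto simp: K_def)
  have KY: "?Y \<alpha> c = 0" if "c \<in> K" for \<alpha> c
    by (rule fun_pair_option_eqI) (auto simp: mY_P Kbot[OF that])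
  have rK: "rep K ?E ?Y"
    by (rule sub_rep[OF rW KW Ks KE]) (use KY fv.subspace_0[OF Ks] in auto)
  define f where "f g = \<theta> (f' g)" for g
  have f: "f \<in> mod_hom R (PI I n) M" unfolding f_def by (rule mod_hom_comp[OF f' \<theta>(1)])
  have \<theta>0: "\<theta> z = \<zero>\<^bsub>M\<^esub> \<longleftrightarrow> z = 0" if "z \<in> V" for z
    using \<theta>(2) that mod_hom_zero[OF rV rM \<theta>(1)] fv.subspace_0[OF repD(1)[OF r]] by (auto simp: bij_betw_def inj_on_def)
  have f'V: "f' g \<in> V" if "g \<in> carrier (PI I n)" for g using mod_homD(1)[OF f' that] by simp
  have ker: "mod_ker (PI I n) M f = G ` K"
  proof
    show "mod_ker (PI I n) M f \<subseteq> G ` K"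
    proof
      fix g assume "g \<in> mod_ker (PI I n) M f"
      then have g: "g \<in> carrier (PI I n)" "\<theta> (f' g) = \<zero>\<^bsub>M\<^esub>" by (auto simp: mod_ker_def f_def)
      then have "F (\<Psi> I n g) = 0" using \<theta>0[OF f'V] F\<Psi> by simp
      then have "\<Psi> I n g \<in> K" using \<Psi>(2) g(1) by (auto simp: K_def bij_betw_def)
      then show "g \<in> G ` K" using G\<Psi>[OF g(1)] by (metis image_eqI)
    qed
    show "G ` K \<subseteq> mod_ker (PI I n) M f"
    proof clarify
      fix c assume "c \<in> K"
      then have c: "c \<in> ?W" "F c = 0" by (auto simp: K_def)
      then show "G c \<in> mod_ker (PI I n) M f"
        using \<Psi>G(2)[OF c(1)] F(2)[OF c(1)] \<theta>0[of 0] fv.subspace_0[OF repD(1)[OF r]] by (simp add: mod_ker_def f_def)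
    qed
  qed
  have cover: "projective_cover R (PI I n) f M" unfolding projective_cover_def
  proof (intro conjI PI_fg P.projective_P f allI impI)
    show "I k \<in> verts Q" if "k < n" for k by (rule I(1)[OF that])
    show "f ` carrier (PI I n) = carrier M"
    proof
      show "f ` carrier (PI I n) \<subseteq> carrier M" using mod_homD(1)[OF f] by auto
      show "carrier M \<subseteq> f ` carrier (PI I n)"
      proof
        fix y assume "y \<in> carrier M"
        then obtain z where z: "z \<in> V" "y = \<theta> z" using \<theta>(2) by (auto simp: bij_betw_def)
        then obtain c where c: "c \<in> ?W" "z = F c" using surj by blast
        then have "y = f (G c)" using F(2) z by (simp add: f_def)
        then show "y \<in> f ` carrier (PI I n)" using \<Psi>G(2)[OF c(1)] by blast
      qed
    qed
    fix H assume H: "submodule H R (PI I n) \<and> H <+>\<^bsub>PI I n\<^esub> mod_ker (PI I n) M f = carrier (PI I n)"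
    have "mod_ker (PI I n) M f \<subseteq> jrad (PI I n)" unfolding ker
    proof clarify
      fix c assume c: "c \<in> K"
      have "c \<in> fspace {b \<in> BP I n. bot preP b}" unfolding fspace_def
      proof (intro CollectI allI impI)
        fix y assume y: "y \<notin> {b \<in> BP I n. bot preP b}"
        have "c y = 0" if "y \<notin> BP I n" using c that fspaceD[of c "BP I n" y] by (simp add: K_def)
        then show "c y = 0" using y Kbot[OF c] by (cases "y \<in> BP I n") (auto elim!: BP_cases simp: bot_P)
      qed
      from bottom_in_jrad[OF m this] show "G c \<in> jrad (PI I n)"
        by (rule jrad_hom[OF right_module_rmod[OF rW] right_module_PI G])
    qed
    then show "H = carrier (PI I n)" using jrad_superfluous[OF right_module_PI] H by blast
  qed
  have Gh: "G \<in> mod_hom R (rmod K ?E ?Y) (PI I n\<lparr>carrier := mod_ker (PI I n) M f\<rparr>)"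
    unfolding mod_hom_def
  proof (intro CollectI conjI ballI funcsetI)
    fix y assume "y \<in> carrier (rmod K ?E ?Y)"
    then have yK: "y \<in> K" by simp
    then have y: "y \<in> carrier (mono (BP I n) (labP I) preP)" using KW by auto
    show "G y \<in> carrier (PI I n\<lparr>carrier := mod_ker (PI I n) M f\<rparr>)" using yK by (simp add: ker)
    show "G (y \<oplus>\<^bsub>rmod K ?E ?Y\<^esub> z) = G y \<oplus>\<^bsub>PI I n\<lparr>carrier := mod_ker (PI I n) M f\<rparr>\<^esub> G z"
      if "z \<in> carrier (rmod K ?E ?Y)" for z
    proof -
      have z: "z \<in> carrier (mono (BP I n) (labP I) preP)" using that KW by auto
      show ?thesis using mod_homD(2)[OF G y z] by simp
    qed
    show "G (a \<odot>\<^bsub>rmod K ?E ?Y\<^esub> y) = a \<odot>\<^bsub>PI I n\<lparr>carrier := mod_ker (PI I n) M f\<rparr>\<^esub> G y"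
      if a: "a \<in> carrier R" for a
      using mod_homD(3)[OF G a y] by (simp add: rmod_def fun_module_def)
  qed
  have "inj_on G K" using \<Psi>G(1) KW by (metis inj_onI subsetD)
  then have Giso: "mod_iso R (rmod K ?E ?Y) (PI I n\<lparr>carrier := mod_ker (PI I n) M f\<rparr>)"
    unfolding mod_iso_def by (intro bexI[OF _ Gh]) (simp add: bij_betw_def ker)
  \<comment> \<open>The kernel has the dimension of the projective minus that of M at p. Both have
    the same top at every vertex, and \<open>omr\<close> vanishes on the projective, so the
    difference is \<open>omr\<close> of M.\<close>
  have dim: "int (fv.dim (Sd p K ?E)) = omM M p" if p: "p \<in> verts Q" for p
  proof -
    have WS: "fv.subspace (Sd p ?W ?E)" "fin_dim (Sd p ?W ?E)"
      using mono_repD(1)[OF m] unfolding Sd_mono by simp_all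
    have "{c \<in> Sd p ?W ?E. F c = 0} = Sd p K ?E" by (auto simp: Sd_def K_def)
    moreover have "F ` Sd p ?W ?E = Sd p V E"
    proof
      show "F ` Sd p ?W ?E \<subseteq> Sd p V E"
      proof clarify
        fix c assume "c \<in> Sd p ?W ?E"
        then have c: "c \<in> ?W" "?E p c = c" by (simp_all add: Sd_def)
        then show "F c \<in> Sd p V E" using FE[OF p c(1)] FV[OF c(1)] by (simp add: Sd_def)
      qed
      show "Sd p V E \<subseteq> F ` Sd p ?W ?E"
      proof
        fix z assume z: "z \<in> Sd p V E"
        then obtain c where c: "c \<in> ?W" "z = F c" using surj by (auto simp: Sd_def)
        have "z = F (?E p c)" using z c FE[OF p c(1)] by (simp add: Sd_def)
        moreover have "?E p c \<in> Sd p ?W ?E" using repD(4)[OF rW p c(1)] repD(8)[OF rW p p c(1)] by (simp add: Sd_def)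
        ultimately show "z \<in> F ` Sd p ?W ?E" by blast
      qed
    qed
    ultimately have rn: "fv.dim (Sd p ?W ?E) = fv.dim (Sd p K ?E) + fv.dim (Sd p V E)"
      using rank_nullity[OF F(1) WS] by simp
    have omW: "omr ?W ?E ?Y p = 0" by (rule omr_P) (rule I)
    have top: "int (fv.dim (Sd q ?W ?E)) - int (fv.dim (Sr q ?W ?Y)) = int (fv.dim (Sd q V E)) - int (fv.dim (Sr q V Y))"
      if q: "q \<in> verts Q" for q
    proof -
      have "card {b \<in> BP I n. labP I b = q} =
          card ({b \<in> BP I n. labP I b = q \<and> bot preP b} \<union> {b \<in> BP I n. labP I b = q \<and> \<not> bot preP b})"
        by (rule arg_cong[where f = card]) auto
      also have "\<dots> = card {b \<in> BP I n. labP I b = q \<and> bot preP b} + card {b \<in> BP I n. labP I b = q \<and> \<not> bot preP b}"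
        by (rule card_Un_disjoint) (use mono_repD(1)[OF m] in auto)
      finally show ?thesis unfolding dim_mono[OF m] using card_BP_top cardI[OF q] C(4)[OF q] by simp
    qed
    have "(\<Sum>\<alpha>\<in>in_arcs Q p. int (fv.dim (Sd (tail Q \<alpha>) ?W ?E)) - int (fv.dim (Sr (tail Q \<alpha>) ?W ?Y))) =
        (\<Sum>\<alpha>\<in>in_arcs Q p. int (fv.dim (Sd (tail Q \<alpha>) V E)) - int (fv.dim (Sr (tail Q \<alpha>) V Y)))"
      by (rule sum.cong[OF refl top]) (rule in_arcs_verts)
    then have "omr V E Y p = int (fv.dim (Sr p ?W ?Y)) - int (fv.dim (Sr p V Y))"
      using omW unfolding omr_def by simp
    then show ?thesis unfolding omM_eq[OF M r iso] using top[OF p] rn by simp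
  qed
  show thesis by (rule that[OF _ cover rK Giso]) (use I(1) KY dim in blast)+
qed

end

section \<open>Uniqueness of projective covers\<close>

lemma submodule_image:
  assumes M: "right_module R M" and N: "right_module R N" and f: "f \<in> mod_hom R M N"
  shows "submodule (f ` carrier M) R N"
proof -
  interpret M: right_module R M by fact
  interpret N: right_module R N by fact
  have "subgroup (f ` carrier M) (add_monoid N)"
  proof (rule N.M.add.subgroupI)
    fix y assume "y \<in> f ` carrier M"
    then obtain x where x: "x \<in> carrier M" "y = f x" by blast
    have "f (\<ominus>\<^bsub>M\<^esub> x) \<oplus>\<^bsub>N\<^esub> f x = \<zero>\<^bsub>N\<^esub>"
      using mod_homD(2)[OF f, of "\<ominus>\<^bsub>M\<^esub> x" x] x mod_hom_zero[OF M N f] by (simp add: M.M.l_neg)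
    then have "\<ominus>\<^bsub>N\<^esub> y = f (\<ominus>\<^bsub>M\<^esub> x)"
      using x mod_homD(1)[OF f] by (intro N.M.minus_equality) auto
    then show "\<ominus>\<^bsub>N\<^esub> y \<in> f ` carrier M" using x by simp
  next
    fix y z assume "y \<in> f ` carrier M" "z \<in> f ` carrier M"
    then obtain a b where "a \<in> carrier M" "y = f a" "b \<in> carrier M" "z = f b" by blast
    then show "y \<oplus>\<^bsub>N\<^esub> z \<in> f ` carrier M"
      using mod_homD(2)[OF f, of a b] by (intro image_eqI[of _ _ "a \<oplus>\<^bsub>M\<^esub> b"]) auto
  qed (use mod_homD(1)[OF f] M.M.zero_closed in auto)
  moreover have "r \<odot>\<^bsub>N\<^esub> y \<in> f ` carrier M" if ry: "r \<in> carrier R" "y \<in> f ` carrier M" for r y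
  proof -
    obtain x where "x \<in> carrier M" "y = f x" using ry by blast
    then show ?thesis using mod_homD(3)[OF f ry(1), of x] ry(1)
      by (intro image_eqI[of _ _ "r \<odot>\<^bsub>M\<^esub> x"]) auto
  qed
  ultimately show ?thesis by (intro submodule.intro submodule_axioms.intro)
qed

lemma submodule_ker_eq:
  assumes M: "right_module R M" and N: "right_module R N" and f: "f \<in> mod_hom R M N"
    and h: "h \<in> mod_hom R L M" and L: "right_module R L"
    and hit: "\<And>x. x \<in> carrier M \<Longrightarrow> \<exists>y\<in>carrier L. f (h y) = f x"
    and sup: "\<forall>H. submodule H R M \<and> H <+>\<^bsub>M\<^esub> mod_ker M N f = carrier M \<longrightarrow> H = carrier M"
  shows "h ` carrier L = carrier M"
proof -
  interpret M: right_module R M by fact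
  interpret N: right_module R N by fact
  have *: "h ` carrier L <+>\<^bsub>M\<^esub> mod_ker M N f = carrier M"
  proof
    show "h ` carrier L <+>\<^bsub>M\<^esub> mod_ker M N f \<subseteq> carrier M"
      unfolding set_add_def' using mod_homD(1)[OF h] by (auto simp: mod_ker_def)
    show "carrier M \<subseteq> h ` carrier L <+>\<^bsub>M\<^esub> mod_ker M N f"
    proof
      fix x assume x: "x \<in> carrier M"
      obtain y where y: "y \<in> carrier L" "f (h y) = f x" using hit[OF x] by blast
      have hy: "h y \<in> carrier M" using mod_homD(1)[OF h y(1)] .
      define k where "k = \<ominus>\<^bsub>M\<^esub> h y \<oplus>\<^bsub>M\<^esub> x"
      have k: "k \<in> carrier M" using hy x by (simp add: k_def)
      have "h y \<oplus>\<^bsub>M\<^esub> k = x" using hy x by (simp add: k_def M.M.a_assoc[symmetric] M.M.r_neg)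
      moreover have "f x = f (h y) \<oplus>\<^bsub>N\<^esub> f k"
        using mod_homD(2)[OF f hy k] \<open>h y \<oplus>\<^bsub>M\<^esub> k = x\<close> by simp
      then have "f k = \<zero>\<^bsub>N\<^esub>"
        using mod_homD(1)[OF f hy] mod_homD(1)[OF f k] y(2) by simp
      then have "k \<in> mod_ker M N f" using k by (simp add: mod_ker_def)
      ultimately show "x \<in> h ` carrier L <+>\<^bsub>M\<^esub> mod_ker M N f"
        unfolding set_add_def' using y(1) by blast
    qed
  qed
  show ?thesis by (rule sup[rule_format, OF conjI[OF submodule_image[OF L M h] *]])
qed

text \<open>A lift \<open>h\<close> of one cover through the other is onto, hence split by
  projectivity. The section \<open>s\<close> is onto for the same reason, so \<open>h\<close> and
  \<open>s\<close> are mutually inverse and exchange the kernels. Thus the choice inside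
  \<open>syzygy\<close> matters only up to isomorphism.\<close>

lemma cover_ker_iso:
  assumes M: "right_module R M" and P: "projective_cover R P f M" and P': "projective_cover R P' f' M"
  shows "mod_iso R (P\<lparr>carrier := mod_ker P M f\<rparr>) (P'\<lparr>carrier := mod_ker P' M f'\<rparr>)"
proof -
  have p: "right_module R P" "projective R P" "f \<in> mod_hom R P M" "f ` carrier P = carrier M"
    and sup: "\<forall>H. submodule H R P \<and> H <+>\<^bsub>P\<^esub> mod_ker P M f = carrier P \<longrightarrow> H = carrier P"
    using P by (auto simp: projective_cover_def fg_modules_def)
  have p': "right_module R P'" "projective R P'" "f' \<in> mod_hom R P' M" "f' ` carrier P' = carrier M"
    and sup': "\<forall>H. submodule H R P' \<and> H <+>\<^bsub>P'\<^esub> mod_ker P' M f' = carrier P' \<longrightarrow> H = carrier P'"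
    using P' by (auto simp: projective_cover_def fg_modules_def)
  have "\<exists>h\<in>mod_hom R P P'. \<forall>x\<in>carrier P. f' (h x) = f x"
    using p(2) p'(1,3,4) M p(3) unfolding projective_def by blast
  then obtain h where h: "h \<in> mod_hom R P P'" "\<And>x. x \<in> carrier P \<Longrightarrow> f' (h x) = f x" by blast
  have "h ` carrier P = carrier P'"
  proof (rule submodule_ker_eq[OF p'(1) M p'(3) h(1) p(1) _ sup'])
    fix x assume "x \<in> carrier P'"
    then have "f' x \<in> f ` carrier P" using mod_homD(1)[OF p'(3)] p(4) by simp
    then show "\<exists>y\<in>carrier P. f' (h y) = f' x" using h(2) by auto
  qed
  then have "\<exists>s\<in>mod_hom R P' P. \<forall>x\<in>carrier P'. h (s x) = x"
    using p'(2) p(1) p'(1) h(1) mod_hom_id[of R P'] unfolding projective_def by blast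
  then obtain s where s: "s \<in> mod_hom R P' P" "\<And>x. x \<in> carrier P' \<Longrightarrow> h (s x) = x" by blast
  have "s ` carrier P' = carrier P"
  proof (rule submodule_ker_eq[OF p(1) M p(3) s(1) p'(1) _ sup])
    fix x assume x: "x \<in> carrier P"
    have hx: "h x \<in> carrier P'" using mod_homD(1)[OF h(1) x] .
    have "f (s (h x)) = f' (h (s (h x)))" using h(2) mod_homD(1)[OF s(1) hx] by simp
    also have "\<dots> = f x" using s(2)[OF hx] h(2)[OF x] by simp
    finally show "\<exists>y\<in>carrier P'. f (s y) = f x" using hx by blast
  qed
  have sh: "s (h x) = x" if x: "x \<in> carrier P" for x
  proof -
    obtain y where "y \<in> carrier P'" "x = s y" using x \<open>s ` carrier P' = carrier P\<close> by blast
    then show ?thesis using s(2) by simp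
  qed
  have "h \<in> mod_hom R (P\<lparr>carrier := mod_ker P M f\<rparr>) (P'\<lparr>carrier := mod_ker P' M f'\<rparr>)"
    using h by (auto simp: mod_hom_def mod_ker_def Pi_iff)
  moreover have "bij_betw h (mod_ker P M f) (mod_ker P' M f')"
  proof (rule bij_betw_byWitness[of _ s])
    show "\<forall>x\<in>mod_ker P M f. s (h x) = x" using sh by (simp add: mod_ker_def)
    show "\<forall>x\<in>mod_ker P' M f'. h (s x) = x" using s(2) by (simp add: mod_ker_def)
    show "h ` mod_ker P M f \<subseteq> mod_ker P' M f'" using h mod_homD(1)[OF h(1)] by (auto simp: mod_ker_def)
    show "s ` mod_ker P' M f' \<subseteq> mod_ker P M f"
    proof clarify
      fix x assume "x \<in> mod_ker P' M f'"
      then have x: "x \<in> carrier P'" "f' x = \<zero>\<^bsub>M\<^esub>" by (simp_all add: mod_ker_def)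
      then show "s x \<in> mod_ker P M f" using mod_homD(1)[OF s(1) x(1)] h(2)[of "s x"] s(2)[OF x(1)] by (simp add: mod_ker_def)
    qed
  qed
  ultimately show ?thesis unfolding mod_iso_def by (intro bexI[of _ h]) simp_all
qed

lemma right_module_ker:
  assumes M: "right_module R M" and N: "right_module R N" and f: "f \<in> mod_hom R M N"
  shows "right_module R (M\<lparr>carrier := mod_ker M N f\<rparr>)"
proof -
  interpret M: right_module R M by fact
  interpret N: right_module R N by fact
  note d = mod_homD[OF f] mod_hom_zero[OF M N f]
  have "abelian_group (M\<lparr>carrier := mod_ker M N f\<rparr>)"
  proof (rule abelian_groupI)
    fix x assume "x \<in> carrier (M\<lparr>carrier := mod_ker M N f\<rparr>)"
    then have x: "x \<in> carrier M" "f x = \<zero>\<^bsub>N\<^esub>" by (simp_all add: mod_ker_def)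
    have "f (\<ominus>\<^bsub>M\<^esub> x) = \<zero>\<^bsub>N\<^esub>" using d(2)[of "\<ominus>\<^bsub>M\<^esub> x" x] x d by (simp add: M.M.l_neg)
    then show "\<exists>y\<in>carrier (M\<lparr>carrier := mod_ker M N f\<rparr>). y \<oplus>\<^bsub>M\<lparr>carrier := mod_ker M N f\<rparr>\<^esub> x = \<zero>\<^bsub>M\<lparr>carrier := mod_ker M N f\<rparr>\<^esub>"
      using x by (intro bexI[of _ "\<ominus>\<^bsub>M\<^esub> x"]) (auto simp: mod_ker_def M.M.l_neg)
  qed (auto simp: mod_ker_def d M.M.a_ac)
  then show ?thesis
    by (intro right_module.intro right_module_axioms.intro M.R.ring_axioms)
      (auto simp: mod_ker_def d M.smult_l_distr M.smult_r_distr M.smult_assoc)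
qed

section \<open>Relations of \<open>K0\<close> and additive functions\<close>

lemma K0_rels_closed:
  "0 \<in> K0_rels R" "x \<in> K0_rels R \<Longrightarrow> y \<in> K0_rels R \<Longrightarrow> x + y \<in> K0_rels R"
  "x \<in> K0_rels R \<Longrightarrow> - x \<in> K0_rels R" "x \<in> K0_rels R \<Longrightarrow> y \<in> K0_rels R \<Longrightarrow> x - y \<in> K0_rels R"
  "x \<in> K0_rels R \<Longrightarrow> x \<in> carrier (free_K0 R)" "subgroup (K0_rels R) (free_K0 R)"
  "M \<in> fg_modules R \<Longrightarrow> M' \<in> fg_modules R \<Longrightarrow> M'' \<in> fg_modules R \<Longrightarrow> mod_iso R M (direct_sum M' M'') \<Longrightarrow>
     frag_of M - frag_of M' - frag_of M'' \<in> K0_rels R"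
  "P \<in> fg_modules R \<Longrightarrow> projective R P \<Longrightarrow> frag_of P \<in> K0_rels R"
proof -
  let ?G = "{frag_of M - frag_of M' - frag_of M'' | M M' M''.
         M \<in> fg_modules R \<and> M' \<in> fg_modules R \<and> M'' \<in> fg_modules R \<and>
         mod_iso R M (direct_sum M' M'')} \<union> {frag_of P | P. P \<in> fg_modules R \<and> projective R P}"
  have kd: "Poly_Mapping.keys (a - b) \<subseteq> S" if "Poly_Mapping.keys a \<subseteq> S" "Poly_Mapping.keys b \<subseteq> S"
    for a b :: "'a umodule \<Rightarrow>\<^sub>0 int" and S using keys_diff[of a b] that by blast
  have "?G \<subseteq> carrier (free_K0 R)"
  proof
    fix x assume "x \<in> ?G"
    then consider M M' M'' where "x = frag_of M - frag_of M' - frag_of M''" "M \<in> fg_modules R" "M' \<in> fg_modules R" "M'' \<in> fg_modules R"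
      | P where "x = frag_of P" "P \<in> fg_modules R" by blast
    then show "x \<in> carrier (free_K0 R)" unfolding carrier_free_Abelian_group_iff
    proof cases
      case 1
      show "Poly_Mapping.keys x \<subseteq> fg_modules R" unfolding 1(1)
        by (intro kd) (simp_all add: 1(2-4))
    next
      case 2
      then show "Poly_Mapping.keys x \<subseteq> fg_modules R" by simp
    qed
  qed
  then have sg: "subgroup (K0_rels R) (free_K0 R)"
    unfolding K0_rels_def by (intro group.generate_is_subgroup) simp_all
  then show "subgroup (K0_rels R) (free_K0 R)" .
  show c: "x \<in> carrier (free_K0 R)" if "x \<in> K0_rels R" for x using subgroup.subset[OF sg] that by blast
  show "0 \<in> K0_rels R" using subgroup.one_closed[OF sg] by simp
  show a: "x + y \<in> K0_rels R" if "x \<in> K0_rels R" "y \<in> K0_rels R" for x y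
    using subgroup.m_closed[OF sg that] by simp
  show m: "- x \<in> K0_rels R" if "x \<in> K0_rels R" for x
    using subgroup.m_inv_closed[OF sg that] c[OF that] by simp
  show "x - y \<in> K0_rels R" if "x \<in> K0_rels R" "y \<in> K0_rels R" for x y
    using a[OF that(1) m[OF that(2)]] by simp
  show "frag_of M - frag_of M' - frag_of M'' \<in> K0_rels R"
    if "M \<in> fg_modules R" "M' \<in> fg_modules R" "M'' \<in> fg_modules R" "mod_iso R M (direct_sum M' M'')"
    unfolding K0_rels_def by (rule generate.incl) (use that in blast)
  show "frag_of P \<in> K0_rels R" if "P \<in> fg_modules R" "projective R P"
    unfolding K0_rels_def by (rule generate.incl) (use that in blast)
qed

lemma K0_rels_induct [consumes 1, case_names zero sum proj add minus]:
  assumes "x \<in> K0_rels R" and "P 0"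
    and "\<And>M M' M''. M \<in> fg_modules R \<Longrightarrow> M' \<in> fg_modules R \<Longrightarrow> M'' \<in> fg_modules R \<Longrightarrow>
       mod_iso R M (direct_sum M' M'') \<Longrightarrow> P (frag_of M - frag_of M' - frag_of M'')"
    and "\<And>M. M \<in> fg_modules R \<Longrightarrow> projective R M \<Longrightarrow> P (frag_of M)"
    and "\<And>x y. P x \<Longrightarrow> P y \<Longrightarrow> P (x + y)" and "\<And>x. P x \<Longrightarrow> P (- x)"
  shows "P x"
proof -
  have kd: "Poly_Mapping.keys (a - b) \<subseteq> S" if "Poly_Mapping.keys a \<subseteq> S" "Poly_Mapping.keys b \<subseteq> S"
    for a b :: "'a umodule \<Rightarrow>\<^sub>0 int" and S using keys_diff[of a b] that by blast
  show ?thesis using assms(1) unfolding K0_rels_def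
  proof (induction rule: generate.induct)
    case one
    then show ?case using assms(2) by simp
  next
    case (incl h)
    then show ?case using assms(3,4) by blast
  next
    case (inv h)
    then have "P h" using assms(3,4) by blast
    moreover have "h \<in> K0_rels R" unfolding K0_rels_def using inv by (rule generate.incl)
    then have "inv\<^bsub>free_K0 R\<^esub> h = - h" using K0_rels_closed(5) by (intro inv_free_Abelian_group) simp
    ultimately show ?case using assms(6) by simp
  next
    case (eng h1 h2)
    then show ?case using assms(5) by simp
  qed
qed

text \<open>The linear extension of an integer-valued function. \<open>frag_extend\<close> has
  values in a free Abelian group, so the integers are realised as the free group on one
  point.\<close>

definition ext :: "('c \<Rightarrow> int) \<Rightarrow> ('c \<Rightarrow>\<^sub>0 int) \<Rightarrow> int" where
  "ext w p = Poly_Mapping.lookup (frag_extend (\<lambda>M. frag_cmul (w M) (frag_of ())) p) ()"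

lemma ext_simps: "ext w 0 = 0" "ext w (p + q) = ext w p + ext w q" "ext w (p - q) = ext w p - ext w q"
  "ext w (- p) = - ext w p" "ext w (frag_of M) = w M" "ext w (frag_cmul c p) = c * ext w p"
  "ext w (sum f S) = (\<Sum>s\<in>S. ext w (f s))"
proof -
  show 1: "ext w 0 = 0" by (simp add: ext_def)
  show 2: "ext w (p + q) = ext w p + ext w q" for p q by (simp add: ext_def frag_extend_add lookup_add)
  show "ext w (p - q) = ext w p - ext w q" by (simp add: ext_def frag_extend_diff lookup_minus)
  show "ext w (- p) = - ext w p" by (simp add: ext_def frag_extend_minus)
  show "ext w (frag_of M) = w M" by (simp add: ext_def)
  show "ext w (frag_cmul c p) = c * ext w p" by (simp add: ext_def frag_extend_cmul)
  show "ext w (sum f S) = (\<Sum>s\<in>S. ext w (f s))" by (induction S rule: infinite_finite_induct) (simp_all add: 1 2)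
qed

text \<open>The universal property of \<open>K0\<close>: an additive function vanishing on
  projectives descends. Distinct classes are separated through it.\<close>

lemma ext_rels:
  assumes "x \<in> K0_rels R"
    and "\<And>M M' M''. M \<in> fg_modules R \<Longrightarrow> M' \<in> fg_modules R \<Longrightarrow> M'' \<in> fg_modules R \<Longrightarrow>
       mod_iso R M (direct_sum M' M'') \<Longrightarrow> w M = w M' + w M''"
    and "\<And>M. M \<in> fg_modules R \<Longrightarrow> projective R M \<Longrightarrow> w M = 0"
  shows "ext w x = 0"
  using assms(1) by (induction rule: K0_rels_induct) (simp_all add: ext_simps assms(2,3))

context quiver_alg
begin

lemma cover_ex:
  assumes "M \<in> fg_modules R"
  shows "\<exists>I n f K. (\<forall>k<n. I k \<in> verts Q) \<and> projective_cover R (PI I n) f M \<and>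
    rep K (mE (labP I)) (mY (BP I n) preP) \<and>
    mod_iso R (rmod K (mE (labP I)) (mY (BP I n) preP)) (PI I n\<lparr>carrier := mod_ker (PI I n) M f\<rparr>) \<and>
    (\<forall>\<alpha>\<in>arcs Q. \<forall>x\<in>K. mY (BP I n) preP \<alpha> x = 0) \<and>
    (\<forall>p\<in>verts Q. int (fv.dim (Sd p K (mE (labP I)))) = omM M p)"
  by (rule cover_exists[OF assms]) (intro exI conjI; assumption)

lemma projective_PI_iso:
  assumes P: "P \<in> fg_modules R" "projective R P"
  shows "\<exists>I n. (\<forall>k<n. I k \<in> verts Q) \<and> mod_iso R (mono (BP I n) (labP I) preP) P"
proof -
  obtain I n f where c0: "\<forall>k<n. I k \<in> verts Q" "projective_cover R (PI I n) f P"
    using cover_ex[OF P(1)] by blast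
  then have c: "\<And>k. k < n \<Longrightarrow> I k \<in> verts Q" "projective_cover R (PI I n) f P" by simp_all
  have rP: "right_module R P" by (rule fgD[OF P(1)])
  have f: "f \<in> mod_hom R (PI I n) P" "f ` carrier (PI I n) = carrier P"
    and sup: "\<forall>H. submodule H R (PI I n) \<and> H <+>\<^bsub>PI I n\<^esub> mod_ker (PI I n) P f = carrier (PI I n) \<longrightarrow> H = carrier (PI I n)"
    using c(2) by (simp_all add: projective_cover_def)
  have "\<exists>h\<in>mod_hom R P (PI I n). \<forall>x\<in>carrier P. f (h x) = x"
    using P(2) right_module_PI rP f mod_hom_id[of R P] unfolding projective_def by blast
  then obtain h where h: "h \<in> mod_hom R P (PI I n)" "\<And>x. x \<in> carrier P \<Longrightarrow> f (h x) = x" by blast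
  have "h ` carrier P = carrier (PI I n)"
    by (rule submodule_ker_eq[OF right_module_PI rP f(1) h(1) rP _ sup]) (use h(2) mod_homD(1)[OF f(1)] in auto)
  moreover have "inj_on h (carrier P)" by (rule inj_on_inverseI[of _ f]) (rule h(2))
  ultimately have "mod_iso R P (PI I n)" unfolding mod_iso_def by (intro bexI[OF _ h(1)]) (simp add: bij_betw_def)
  from mod_iso_trans[OF this PI_iso] c(1) have "mod_iso R P (mono (BP I n) (labP I) preP)" by blast
  from c0(1) mod_iso_sym[OF rP this] show ?thesis by blast
qed

lemma inv_projective:
  assumes P: "P \<in> fg_modules R" "projective R P"
  shows "omM P p = 0" "C \<subseteq> arcs Q \<Longrightarrow> \<gamma> \<in> C \<Longrightarrow> tail Q \<gamma> = p \<Longrightarrow> nuM C P p = 0"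
proof -
  obtain I n where c0: "\<forall>k<n. I k \<in> verts Q" "mod_iso R (mono (BP I n) (labP I) preP) P"
    using projective_PI_iso[OF P] by blast
  then have c: "\<And>k. k < n \<Longrightarrow> I k \<in> verts Q" "mod_iso R (mono (BP I n) (labP I) preP) P" by simp_all
  have m: "mono_rep (BP I n) (labP I) preP" by (rule mono_rep_P) (rule c(1))
  show "omM P p = 0" unfolding omM_eq[OF P(1) rep_mono[OF m] c(2)] by (rule omr_P) (rule c(1))
  show "nuM C P p = 0" if C: "C \<subseteq> arcs Q" "\<gamma> \<in> C" "tail Q \<gamma> = p"
  proof -
    have p: "p \<in> verts Q" using C by auto
    show ?thesis unfolding nuM_eq[OF P(1) rep_mono[OF m] c(2) p C(1)]
      by (intro nur_P[OF _ C]) (rule c(1))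
  qed
qed

text \<open>Moves a module from an arbitrary carrier type into the universe over which
  \<open>K0\<close> is formed.\<close>

definition um :: "(('v \<times> 'e list \<Rightarrow> 'k) set, 'b) module \<Rightarrow> (('v \<times> 'e list \<Rightarrow> 'k) set) umodule" where
  "um M = (SOME N. N \<in> fg_modules R \<and> mod_iso R M N)"

lemma um:
  assumes "right_module R M" "fin_gen R M" shows "um M \<in> fg_modules R" "mod_iso R M (um M)"
proof -
  have "\<exists>N. N \<in> fg_modules R \<and> mod_iso R M N" using fg_modules_universe[OF assms] by blast
  from someI_ex[OF this] show "um M \<in> fg_modules R" "mod_iso R M (um M)" by (simp_all add: um_def)
qed

lemma um_rep:
  assumes r: "rep V E Y" shows "um (rmod V E Y) \<in> fg_modules R" "mod_iso R (rmod V E Y) (um (rmod V E Y))"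
  using um[OF right_module_rmod[OF r] fin_gen_rmod[OF r]] .

text \<open>A zero module is isomorphic to the sum of two copies of itself, so the relation reads
  [N] = [N] + [N].\<close>

lemma zero_rels:
  assumes N: "N \<in> fg_modules R" and z: "carrier N = {\<zero>\<^bsub>N\<^esub>}" shows "frag_of N \<in> K0_rels R"
proof -
  interpret N: right_module R N by (rule fgD[OF N])
  have "(\<lambda>x. (x, x)) \<in> mod_hom R N (direct_sum N N)" by (auto simp: mod_hom_def)
  moreover have "bij_betw (\<lambda>x. (x, x)) (carrier N) (carrier (direct_sum N N))" by (auto simp: bij_betw_def z)
  ultimately have "mod_iso R N (direct_sum N N)" by (auto simp: mod_iso_def)
  from K0_rels_closed(3)[OF K0_rels_closed(7)[OF N N N this]] show ?thesis by simp
qed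

text \<open>Isomorphism by itself is not among the generating relations; it is the case of a direct
  sum with a zero module.\<close>

lemma iso_rels:
  assumes M: "M \<in> fg_modules R" and N: "N \<in> fg_modules R" and iso: "mod_iso R M N"
  shows "frag_of M - frag_of N \<in> K0_rels R"
proof -
  let ?Z = "PI (\<lambda>_. undefined) 0"
  have Z: "?Z \<in> fg_modules R" by (rule PI_fg) simp
  have cZ: "carrier ?Z = {\<zero>\<^bsub>?Z\<^esub>}" by (auto simp: proj_mod_def)
  interpret Z: right_module R ?Z by (rule right_module_PI)
  have "(\<lambda>x. (x, \<zero>\<^bsub>?Z\<^esub>)) \<in> mod_hom R N (direct_sum N ?Z)" by (auto simp: mod_hom_def)
  moreover have "bij_betw (\<lambda>x. (x, \<zero>\<^bsub>?Z\<^esub>)) (carrier N) (carrier (direct_sum N ?Z))"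
    unfolding direct_sum_simps cZ by (auto simp: bij_betw_def inj_on_def)
  ultimately have "mod_iso R N (direct_sum N ?Z)" unfolding mod_iso_def by blast
  then have "frag_of M - frag_of N - frag_of ?Z \<in> K0_rels R"
    using K0_rels_closed(7)[OF M N Z mod_iso_trans[OF iso]] by blast
  from K0_rels_closed(2)[OF this zero_rels[OF Z cZ]] show ?thesis by simp
qed

section \<open>Classes of semisimple modules and of syzygies\<close>

definition simp_mod :: "'v \<Rightarrow> (('v \<times> 'e list \<Rightarrow> 'k) set) umodule" where
  "simp_mod v = um (mono {v} (\<lambda>u. u) (\<lambda>_ _. None))"

lemma mono_rep_simple: "v \<in> verts Q \<Longrightarrow> mono_rep {v} (\<lambda>u. u) (\<lambda>_ _. None)"
  by (simp add: mono_rep_def)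

lemma simp_mod:
  assumes v: "v \<in> verts Q"
  shows "simp_mod v \<in> fg_modules R" "mod_iso R (mono {v} (\<lambda>u. u) (\<lambda>_ _. None)) (simp_mod v)"
    "omM (simp_mod v) p = (\<Sum>\<alpha>\<in>in_arcs Q p. if tail Q \<alpha> = v then 1 else 0)"
    "p \<in> verts Q \<Longrightarrow> nuM (out_arcs Q p) (simp_mod v) p = (if p = v then 1 else 0)"
proof -
  note m = mono_rep_simple[OF v] and r = rep_mono[OF mono_rep_simple[OF v]]
  show s: "simp_mod v \<in> fg_modules R" "mod_iso R (mono {v} (\<lambda>u. u) (\<lambda>_ _. None)) (simp_mod v)"
    unfolding simp_mod_def by (rule um_rep[OF r])+
  have b: "\<not> bot (\<lambda>_ _. None) u" for u :: 'v by (simp add: bot_def)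
  show "omM (simp_mod v) p = (\<Sum>\<alpha>\<in>in_arcs Q p. if tail Q \<alpha> = v then 1 else 0)"
    unfolding omM_eq[OF s(1) r s(2)] omr_mono[OF m] using b
    by (auto intro!: sum.cong arg_cong[where f = card] simp: card_1_singleton_iff Collect_conv_if)
  show "nuM (out_arcs Q p) (simp_mod v) p = (if p = v then 1 else 0)" if p: "p \<in> verts Q"
  proof -
    have C: "out_arcs Q p \<subseteq> arcs Q" by auto
    show ?thesis unfolding nuM_eq[OF s(1) r s(2) p C] nur_mono[OF m C] using b by (auto simp: Collect_conv_if)
  qed
qed

lemma rep_span:
  assumes r: "rep K E Y" and B: "B \<subseteq> K" and lab: "\<And>b. b \<in> B \<Longrightarrow> lab b \<in> verts Q \<and> E (lab b) b = b"
    and Y0: "\<And>\<alpha> x. \<alpha> \<in> arcs Q \<Longrightarrow> x \<in> K \<Longrightarrow> Y \<alpha> x = 0"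
  shows "rep (fv.span B) E Y"
proof (rule sub_rep[OF r])
  show sp: "fv.span B \<subseteq> K" by (rule fv.span_minimal[OF B repD(1)[OF r]])
  show "Y \<alpha> x \<in> fv.span B" if "\<alpha> \<in> arcs Q" "x \<in> fv.span B" for \<alpha> x
  proof -
    have "Y \<alpha> x = 0" by (rule Y0) (use that sp in auto)
    then show ?thesis by (simp only: fv.span_zero)
  qed
  show "E v x \<in> fv.span B" if v: "v \<in> verts Q" and x: "x \<in> fv.span B" for v x
  proof -
    have "E v b \<in> fv.span B" if b: "b \<in> B" for b
    proof -
      have l: "lab b \<in> verts Q" "E (lab b) b = b" using lab[OF b] by auto
      have "E v (E (lab b) b) = (if v = lab b then E (lab b) b else 0)"
        by (rule repD(8)[OF r v l(1)]) (use b B in auto)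
      then have "E v b = (if v = lab b then b else 0)" unfolding l(2) .
      then show ?thesis using fv.span_base[OF b] fv.span_zero[of B] by (cases "v = lab b") simp_all
    qed
    then have "E v ` B \<subseteq> fv.span B" by auto
    then have "fv.span (E v ` B) \<subseteq> fv.span B" by (rule fv.span_minimal) (rule fv.subspace_span)
    moreover have "E v x \<in> fv.span (E v ` B)"
      unfolding fp.linear_span_image[OF repD(3)[OF r v]] using x by blast
    ultimately show ?thesis by blast
  qed
qed (rule fv.subspace_span)

text \<open>One basis vector is split off at a time: the span is the direct sum of a line,
  isomorphic to the simple module at its label, and the span of the others.\<close>

lemma semisimple_class:
  assumes r: "rep K E Y" and Y0: "\<And>\<alpha> x. \<alpha> \<in> arcs Q \<Longrightarrow> x \<in> K \<Longrightarrow> Y \<alpha> x = 0"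
    and "finite B" "fv.independent B" "B \<subseteq> K" "\<And>b. b \<in> B \<Longrightarrow> lab b \<in> verts Q \<and> E (lab b) b = b"
  shows "frag_of (um (rmod (fv.span B) E Y)) - (\<Sum>b\<in>B. frag_of (simp_mod (lab b))) \<in> K0_rels R"
  using assms(3-6)
proof (induction B)
  case empty
  have r0: "rep (fv.span {}) E Y" by (rule rep_span[OF r _ _ Y0]) simp_all
  note u = um_rep[OF r0]
  obtain g where g: "g \<in> mod_hom R (rmod (fv.span {}) E Y) (um (rmod (fv.span {}) E Y))"
    "bij_betw g (fv.span {}) (carrier (um (rmod (fv.span {}) E Y)))"
    using u(2) by (auto simp: mod_iso_def)
  have g0: "g ` fv.span {} = {g 0}" unfolding fv.span_empty by blast
  have "g 0 = \<zero>\<^bsub>um (rmod (fv.span {}) E Y)\<^esub>"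
    using mod_hom_zero[OF right_module_rmod[OF r0] fgD(1)[OF u(1)] g(1)] unfolding rmod_simps .
  then have "carrier (um (rmod (fv.span {}) E Y)) = {\<zero>\<^bsub>um (rmod (fv.span {}) E Y)\<^esub>}"
    using bij_betw_imp_surj_on[OF g(2)] g0 by simp
  from zero_rels[OF u(1) this] show ?case by (simp only: sum.empty diff_0_right)
next
  case (insert b B)
  have B: "fv.independent B" "b \<notin> fv.span B"
    using insert.prems(1) insert.hyps(2) unfolding fv.independent_insert by auto
  have b0: "b \<noteq> 0" using B(2) fv.span_zero by blast
  have IH: "frag_of (um (rmod (fv.span B) E Y)) - (\<Sum>b\<in>B. frag_of (simp_mod (lab b))) \<in> K0_rels R"
    by (rule insert.IH[OF B(1)]) (use insert.prems in auto)
  have lb: "lab b \<in> verts Q" "E (lab b) b = b" "b \<in> K" using insert.prems by auto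
  have r1: "rep (fv.span {b}) E Y" by (rule rep_span[where lab = lab, OF r _ _ Y0]) (use insert.prems in auto)
  have r2: "rep (fv.span B) E Y" by (rule rep_span[where lab = lab, OF r _ _ Y0]) (use insert.prems in auto)
  have r3: "rep (fv.span (insert b B)) E Y" by (rule rep_span[where lab = lab, OF r _ _ Y0]) (use insert.prems in auto)
  let ?D = "direct_sum (rmod (fv.span {b}) E Y) (rmod (fv.span B) E Y)"
  have D: "right_module R ?D" by (intro right_module_direct_sum right_module_rmod r1 r2)
  have mem: "x + y \<in> fv.span (insert b B)" if "x \<in> fv.span {b}" "y \<in> fv.span B" for x y
  proof (rule fv.span_add)
    show "x \<in> fv.span (insert b B)" using that(1) fv.span_mono[of "{b}" "insert b B"] by blast
    show "y \<in> fv.span (insert b B)" using that(2) fv.span_mono[of B "insert b B"] by blast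
  qed
  have "(\<lambda>(x, y). x + y) \<in> mod_hom R ?D (rmod (fv.span (insert b B)) E Y)"
  proof (rule mod_homI_gens[OF D right_module_rmod[OF r3]])
    fix x assume "x \<in> carrier ?D"
    then obtain x1 x2 where x: "x = (x1, x2)" "x1 \<in> fv.span {b}" "x2 \<in> fv.span B" by auto
    show "(\<lambda>(x, y). x + y) (sc c \<odot>\<^bsub>?D\<^esub> x) = sc c \<odot>\<^bsub>rmod (fv.span (insert b B)) E Y\<^esub> ((\<lambda>(x, y). x + y) x)" for c
      by (simp add: x rmod_sc[OF r1] rmod_sc[OF r2] rmod_sc[OF r3 mem] fv.scale_right_distrib)
    show "(\<lambda>(x, y). x + y) (ev v \<odot>\<^bsub>?D\<^esub> x) = ev v \<odot>\<^bsub>rmod (fv.span (insert b B)) E Y\<^esub> ((\<lambda>(x, y). x + y) x)"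
      if v: "v \<in> verts Q" for v
      by (simp only: x direct_sum_simps prod.case rmod_ev[OF v] flinD(1)[OF repD(3)[OF r v]])
    show "(\<lambda>(x, y). x + y) (ar \<alpha> \<odot>\<^bsub>?D\<^esub> x) = ar \<alpha> \<odot>\<^bsub>rmod (fv.span (insert b B)) E Y\<^esub> ((\<lambda>(x, y). x + y) x)"
      if \<alpha>: "\<alpha> \<in> arcs Q" for \<alpha>
      by (simp only: x direct_sum_simps prod.case rmod_ar[OF \<alpha>] flinD(1)[OF repD(5)[OF r \<alpha>]])
    show "(\<lambda>(x, y). x + y) (x \<oplus>\<^bsub>?D\<^esub> y) = (\<lambda>(x, y). x + y) x \<oplus>\<^bsub>rmod (fv.span (insert b B)) E Y\<^esub> (\<lambda>(x, y). x + y) y"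
      if "y \<in> carrier ?D" for y
      using x by (cases y) simp
  qed (use mem in auto)
  moreover have "bij_betw (\<lambda>(x, y). x + y) (fv.span {b} \<times> fv.span B) (fv.span (insert b B))"
    unfolding bij_betw_def
  proof
    show "inj_on (\<lambda>(x, y). x + y) (fv.span {b} \<times> fv.span B)"
    proof (rule inj_onI, clarify)
      fix x y x' y' assume a: "x \<in> fv.span {b}" "y \<in> fv.span B" "x' \<in> fv.span {b}" "y' \<in> fv.span B" "x + y = x' + y'"
      obtain c c' where c: "x = fs c b" "x' = fs c' b" using a unfolding fv.span_singleton by blast
      have "fs (c - c') b = y' - y" using a(5) unfolding c fv.scale_left_diff_distrib by (simp add: algebra_simps)
      then have "fs (c - c') b \<in> fv.span B" using fv.span_diff[OF a(4,2)] by simp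
      then have "fs (inverse (c - c')) (fs (c - c') b) \<in> fv.span B" by (rule fv.span_scale)
      then have "c = c'" using B(2) by (cases "c = c'") simp_all
      then show "x = x' \<and> y = y'" using a(5) c by simp
    qed
    show "(\<lambda>(x, y). x + y) ` (fv.span {b} \<times> fv.span B) = fv.span (insert b B)"
      using fv.span_Un[of "{b}" B] by auto
  qed
  ultimately have "mod_iso R ?D (rmod (fv.span (insert b B)) E Y)" unfolding mod_iso_def by (intro bexI) simp_all
  then have i1: "mod_iso R ?D (um (rmod (fv.span (insert b B)) E Y))"
    using mod_iso_trans um_rep(2)[OF r3] by blast
  have sm: "mono_rep {lab b} (\<lambda>u. u) (\<lambda>_ _. None)" by (rule mono_rep_simple[OF lb(1)])
  note rs = rep_mono[OF sm]
  have Eb: "E v b = (if v = lab b then b else 0)" if "v \<in> verts Q" for v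
    using repD(8)[OF r that lb(1) lb(3)] lb(2) by simp
  have "(\<lambda>x. fs (x (lab b)) b) \<in> mod_hom R (mono {lab b} (\<lambda>u. u) (\<lambda>_ _. None)) (rmod (fv.span {b}) E Y)"
  proof (rule rmod_homI[OF rs r1])
    show "lin_on (fspace {lab b}) (\<lambda>x. fs (x (lab b)) b)"
      by (auto simp: lin_on_def fv.scale_left_distrib fs_apply)
    show "(\<lambda>x. fs (x (lab b)) b) ` fspace {lab b} \<subseteq> fv.span {b}" by (auto simp: fv.span_singleton)
    show "fs (mE (\<lambda>u. u) v x (lab b)) b = E v (fs (x (lab b)) b)" if "v \<in> verts Q" for v x
      using that by (auto simp: mE_def flinD(2)[OF repD(3)[OF r]] Eb)
    show "fs (mY {lab b} (\<lambda>_ _. None) \<alpha> x (lab b)) b = Y \<alpha> (fs (x (lab b)) b)" if "\<alpha> \<in> arcs Q" for \<alpha> x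
      using that by (simp add: mY_def flinD(2)[OF repD(5)[OF r]] Y0 lb(3))
  qed
  moreover have "bij_betw (\<lambda>x. fs (x (lab b)) b) (fspace {lab b}) (fv.span {b})"
    unfolding bij_betw_def
  proof
    show "inj_on (\<lambda>x. fs (x (lab b)) b) (fspace {lab b})"
    proof (rule inj_onI)
      fix x y :: "'v \<Rightarrow> 'k" assume xy: "x \<in> fspace {lab b}" "y \<in> fspace {lab b}" and e: "fs (x (lab b)) b = fs (y (lab b)) b"
      have e': "x (lab b) = y (lab b)" using e b0 by simp
      show "x = y"
      proof
        fix u
        show "x u = y u" using e' fspaceD[OF xy(1), of u] fspaceD[OF xy(2), of u] by (cases "u = lab b") simp_all
      qed
    qed
    have "fs c b \<in> (\<lambda>x. fs (x (lab b)) b) ` fspace {lab b}" for c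
      by (rule image_eqI[of _ _ "\<lambda>u. if u = lab b then c else 0"]) (auto simp: fspace_def)
    then show "(\<lambda>x. fs (x (lab b)) b) ` fspace {lab b} = fv.span {b}" by (auto simp: fv.span_singleton)
  qed
  ultimately have "mod_iso R (mono {lab b} (\<lambda>u. u) (\<lambda>_ _. None)) (rmod (fv.span {b}) E Y)"
    unfolding mod_iso_def by (intro bexI) simp_all
  then have "mod_iso R (rmod (fv.span {b}) E Y) (simp_mod (lab b))"
    using mod_iso_trans[OF mod_iso_sym[OF right_module_rmod[OF rs]] simp_mod(2)[OF lb(1)]] by blast
  from direct_sum_cong[OF this um_rep(2)[OF r2]]
  have "mod_iso R ?D (direct_sum (simp_mod (lab b)) (um (rmod (fv.span B) E Y)))" .
  from mod_iso_trans[OF mod_iso_sym[OF D i1] this]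
  have "frag_of (um (rmod (fv.span (insert b B)) E Y)) - frag_of (simp_mod (lab b)) - frag_of (um (rmod (fv.span B) E Y)) \<in> K0_rels R"
    by (rule K0_rels_closed(7)[OF um_rep(1)[OF r3] simp_mod(1)[OF lb(1)] um_rep(1)[OF r2]])
  from K0_rels_closed(2)[OF this IH] show ?case
    unfolding sum.insert[OF insert.hyps] by (simp add: algebra_simps)
qed

definition sg :: "('v \<Rightarrow> int) \<Rightarrow> ((('v \<times> 'e list \<Rightarrow> 'k) set) umodule \<Rightarrow>\<^sub>0 int)" where
  "sg z = (\<Sum>v\<in>verts Q. frag_cmul (z v) (frag_of (simp_mod v)))"

text \<open>The kernel of the constructed cover is semisimple, and bases of its vertex components
  combine to a basis with \<open>omM M v\<close> vectors labelled v. Uniqueness of covers carries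
  this over to the chosen syzygy.\<close>

lemma syzygy_props:
  assumes M: "M \<in> fg_modules R"
  shows "syzygy R M \<in> fg_modules R" "frag_of (syzygy R M) - sg (omM M) \<in> K0_rels R"
proof -
  obtain I n f and K :: "(nat \<times> 'e option \<Rightarrow> 'k) set" where cov: "projective_cover R (PI I n) f M"
    and r: "rep K (mE (labP I)) (mY (BP I n) preP)"
    and iso: "mod_iso R (rmod K (mE (labP I)) (mY (BP I n) preP)) (PI I n\<lparr>carrier := mod_ker (PI I n) M f\<rparr>)"
    and Y0': "\<forall>\<alpha>\<in>arcs Q. \<forall>x\<in>K. mY (BP I n) preP \<alpha> x = 0"
    and dim': "\<forall>p\<in>verts Q. int (fv.dim (Sd p K (mE (labP I)))) = omM M p"
    using cover_ex[OF M] by blast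
  have Y0: "mY (BP I n) preP \<alpha> x = 0" if "\<alpha> \<in> arcs Q" "x \<in> K" for \<alpha> x
    by (rule Y0'[rule_format, OF that])
  have dim: "int (fv.dim (Sd p K (mE (labP I)))) = omM M p" if "p \<in> verts Q" for p
    by (rule dim'[rule_format, OF that])
  let ?E = "mE (labP I)" and ?Y = "mY (BP I n) preP"
  have "\<exists>L. \<exists>P f. projective_cover R P f M \<and> L = P\<lparr>carrier := mod_ker P M f\<rparr>" using cov by blast
  from someI_ex[OF this] obtain P' f' where P': "projective_cover R P' f' M"
    "syzygy R M = P'\<lparr>carrier := mod_ker P' M f'\<rparr>" unfolding syzygy_def[symmetric] by blast
  note rM = fgD(1)[OF M]
  have s: "mod_iso R (rmod K ?E ?Y) (syzygy R M)"
    unfolding P'(2) by (rule mod_iso_trans[OF iso cover_ker_iso[OF rM cov P'(1)]])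
  have rs: "right_module R (syzygy R M)" unfolding P'(2)
    using P'(1) rM by (intro right_module_ker) (auto simp: projective_cover_def fg_modules_def)
  have "fin_gen R (syzygy R M)" by (rule fin_gen_iso[OF right_module_rmod[OF r] rs s fin_gen_rmod[OF r]])
  then show fg: "syzygy R M \<in> fg_modules R" using rs by (simp add: fg_modules_def)
  have Ks: "fv.subspace (Sd v K ?E)" "fin_dim (Sd v K ?E)" if v: "v \<in> verts Q" for v
  proof -
    show "fv.subspace (Sd v K ?E)" unfolding Sd_def
      by (rule fv.subspaceI) (simp_all add: flinD[OF mE_flin] fv.subspace_0[OF repD(1)[OF r]]
        fv.subspace_add[OF repD(1)[OF r]] fv.subspace_scale[OF repD(1)[OF r]])
    show "fin_dim (Sd v K ?E)" by (rule fin_dim_subset[OF repD(2)[OF r]]) (auto simp: Sd_def)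
  qed
  have "\<forall>v\<in>verts Q. \<exists>B. finite B \<and> B \<subseteq> Sd v K ?E \<and> fv.independent B \<and> Sd v K ?E = fv.span B \<and> card B = fv.dim (Sd v K ?E)"
  proof
    fix v assume v: "v \<in> verts Q"
    obtain B where "finite B" "B \<subseteq> Sd v K ?E" "fv.independent B" "Sd v K ?E = fv.span B" "card B = fv.dim (Sd v K ?E)"
      by (rule finite_basis[OF Ks[OF v]])
    then show "\<exists>B. finite B \<and> B \<subseteq> Sd v K ?E \<and> fv.independent B \<and> Sd v K ?E = fv.span B \<and> card B = fv.dim (Sd v K ?E)" by blast
  qed
  from bchoice[OF this] obtain B where B0: "\<forall>v\<in>verts Q. finite (B v) \<and> B v \<subseteq> Sd v K ?E \<and> fv.independent (B v) \<and>
    Sd v K ?E = fv.span (B v) \<and> card (B v) = fv.dim (Sd v K ?E)" ..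
  note B1 = bspec[OF B0]
  note B = B1[THEN conjunct1] B1[THEN conjunct2, THEN conjunct1] B1[THEN conjunct2, THEN conjunct2, THEN conjunct1]
    B1[THEN conjunct2, THEN conjunct2, THEN conjunct2, THEN conjunct1]
    B1[THEN conjunct2, THEN conjunct2, THEN conjunct2, THEN conjunct2]
  have disj: "Sd u K ?E \<inter> Sd v K ?E \<subseteq> {0}" if "u \<in> verts Q" "v \<in> verts Q" "u \<noteq> v" for u v
  proof
    fix x assume "x \<in> Sd u K ?E \<inter> Sd v K ?E"
    then have "x \<in> K" "?E u x = x" "?E v x = x" by (simp_all add: Sd_def)
    then show "x \<in> {0}" using repD(8)[OF r that(1,2), of x] that(3) by simp
  qed
  have B_ne: "0 \<notin> B v" if "v \<in> verts Q" for v using B(3)[OF that] fv.dependent_zero by blast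
  define BB where "BB = (\<Union>v\<in>verts Q. B v)"
  have BBd: "B u \<inter> B v = {}" if "u \<in> verts Q" "v \<in> verts Q" "u \<noteq> v" for u v
    using disj[OF that] B(2)[OF that(1)] B(2)[OF that(2)] B_ne[OF that(1)] by blast
  define lab where "lab b = (THE v. v \<in> verts Q \<and> b \<in> B v)" for b
  have lab: "lab b = v" if "v \<in> verts Q" "b \<in> B v" for v b
    unfolding lab_def using BBd that by (intro the_equality) auto
  have ind: "fv.independent BB"
  proof (rule fv.independent_if_scalars_zero)
    show "finite BB" unfolding BB_def by (rule finite_UN_I[OF finite_verts B(1)])
    fix g b assume s0: "(\<Sum>x\<in>BB. fs (g x) x) = 0" and b: "b \<in> BB"
    obtain v where v: "v \<in> verts Q" "b \<in> B v" using b by (auto simp: BB_def)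
    \<comment> \<open>The projection to v removes the vectors of all other components.\<close>
    have "0 = ?E v (\<Sum>x\<in>BB. fs (g x) x)" unfolding s0 flinD(3)[OF mE_flin] ..
    also have "\<dots> = (\<Sum>x\<in>BB. fs (g x) (?E v x))" by (simp add: flinD[OF mE_flin])
    also have "\<dots> = (\<Sum>x\<in>B v. fs (g x) x)"
    proof (rule sum.mono_neutral_cong_right)
      show "finite BB" unfolding BB_def by (rule finite_UN_I[OF finite_verts B(1)])
      show "B v \<subseteq> BB" using v by (auto simp: BB_def)
      show "fs (g x) (?E v x) = fs (g x) x" if "x \<in> B v" for x
        using B(2)[OF v(1)] that by (auto simp: Sd_def)
      show "\<forall>x\<in>BB - B v. fs (g x) (?E v x) = 0"
      proof
        fix x assume "x \<in> BB - B v"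
        then obtain u where u: "u \<in> verts Q" "x \<in> B u" "u \<noteq> v" by (auto simp: BB_def)
        then have "x \<in> K" "?E u x = x" using B(2)[OF u(1)] by (auto simp: Sd_def)
        then have "?E v x = 0" using repD(8)[OF r v(1) u(1), of x] u(3) by simp
        then show "fs (g x) (?E v x) = 0" by (simp only: fv.scale_zero_right)
      qed
    qed
    finally have "(\<Sum>x\<in>B v. fs (g x) x) = 0" by simp
    then show "g b = 0" by (rule fv.independentD[OF B(3)[OF v(1)] B(1)[OF v(1)] subset_refl _ v(2)])
  qed
  have BK: "BB \<subseteq> K" unfolding BB_def using B(2) by (auto simp: Sd_def)
  have sp: "fv.span BB = K"
  proof
    show "fv.span BB \<subseteq> K" by (rule fv.span_minimal[OF BK repD(1)[OF r]])
    show "K \<subseteq> fv.span BB"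
    proof
      fix x assume x: "x \<in> K"
      have "?E v x \<in> fv.span BB" if v: "v \<in> verts Q" for v
      proof -
        have "?E v x \<in> Sd v K ?E" using repD(4)[OF r v x] repD(8)[OF r v v x] by (simp add: Sd_def)
        then have "?E v x \<in> fv.span (B v)" unfolding B(4)[OF v, symmetric] .
        moreover have "B v \<subseteq> BB" using v by (auto simp: BB_def)
        ultimately show ?thesis using fv.span_mono by blast
      qed
      then have "(\<Sum>v\<in>verts Q. ?E v x) \<in> fv.span BB" by (rule fv.span_sum)
      then show "x \<in> fv.span BB" unfolding repD(7)[OF r x] .
    qed
  qed
  have fBB: "finite BB" unfolding BB_def by (rule finite_UN_I[OF finite_verts B(1)])
  have c: "frag_of (um (rmod (fv.span BB) ?E ?Y)) - (\<Sum>b\<in>BB. frag_of (simp_mod (lab b))) \<in> K0_rels R"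
  proof (rule semisimple_class[OF r Y0 fBB ind BK])
    fix b assume "b \<in> BB"
    then obtain v where v: "v \<in> verts Q" "b \<in> B v" by (auto simp: BB_def)
    then show "lab b \<in> verts Q \<and> ?E (lab b) b = b" using lab[OF v] B(2)[OF v(1)] by (auto simp: Sd_def)
  qed
  have "(\<Sum>b\<in>BB. frag_of (simp_mod (lab b))) = (\<Sum>v\<in>verts Q. \<Sum>b\<in>B v. frag_of (simp_mod (lab b)))"
    unfolding BB_def by (rule sum.UNION_disjoint) (use B(1) BBd in auto)
  also have "\<dots> = sg (omM M)" unfolding sg_def
  proof (rule sum.cong[OF refl])
    fix v assume v: "v \<in> verts Q"
    have rep: "(\<Sum>b\<in>C. x) = frag_cmul (int (card C)) x" if "finite C" for C :: "(nat \<times> 'e option \<Rightarrow> 'k) set" and x :: "(('v \<times> 'e list \<Rightarrow> 'k) set) umodule \<Rightarrow>\<^sub>0 int"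
      using that by (induction C) (simp_all add: frag_cmul_distrib algebra_simps)
    have "(\<Sum>b\<in>B v. frag_of (simp_mod (lab b))) = (\<Sum>b\<in>B v. frag_of (simp_mod v))"
      by (rule sum.cong) (simp_all add: lab[OF v])
    also have "\<dots> = frag_cmul (omM M v) (frag_of (simp_mod v))"
      unfolding rep[OF B(1)[OF v]] B(5)[OF v] dim[OF v] ..
    finally show "(\<Sum>b\<in>B v. frag_of (simp_mod (lab b))) = frag_cmul (omM M v) (frag_of (simp_mod v))" .
  qed
  finally have c': "frag_of (um (rmod K ?E ?Y)) - sg (omM M) \<in> K0_rels R" using c unfolding sp by simp
  have "mod_iso R (syzygy R M) (um (rmod K ?E ?Y))"
    by (rule mod_iso_trans[OF mod_iso_sym[OF right_module_rmod[OF r] s] um_rep(2)[OF r]])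
  from K0_rels_closed(2)[OF iso_rels[OF fg um_rep(1)[OF r] this] c']
  show "frag_of (syzygy R M) - sg (omM M) \<in> K0_rels R" by simp
qed

end

section \<open>The action of the syzygy on \<open>K\<^sub>0\<close>\<close>

text \<open>The class in \<open>K0\<close> of an element of the free group;
  \<open>kap R (frag_of M)\<close> is \<open>K0_class R M\<close>.\<close>

abbreviation kap :: "('a, 'c) ring_scheme \<Rightarrow> ('a umodule \<Rightarrow>\<^sub>0 int) \<Rightarrow> ('a umodule \<Rightarrow>\<^sub>0 int) set" where
  "kap R p \<equiv> K0_rels R #>\<^bsub>free_K0 R\<^esub> p"

lemma kap_image: "kap R p = (\<lambda>h. h + p) ` K0_rels R"
  by (auto simp: r_coset_def)

lemma kap_eq: "kap R p = kap R q \<longleftrightarrow> p - q \<in> K0_rels R"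
proof
  assume "kap R p = kap R q"
  moreover have "p \<in> kap R p" unfolding kap_image using K0_rels_closed(1) by (intro image_eqI[of _ _ 0]) simp_all
  ultimately obtain h where "h \<in> K0_rels R" "p = h + q" unfolding kap_image by blast
  then show "p - q \<in> K0_rels R" by simp
next
  assume d: "p - q \<in> K0_rels R"
  show "kap R p = kap R q" unfolding kap_image
  proof (intro equalityI subsetI)
    fix x assume "x \<in> (\<lambda>h. h + p) ` K0_rels R"
    then obtain h where h: "h \<in> K0_rels R" "x = h + p" by blast
    then show "x \<in> (\<lambda>h. h + q) ` K0_rels R"
      using K0_rels_closed(2)[OF h(1) d] by (intro image_eqI[of _ _ "h + (p - q)"]) simp_all
  next
    fix x assume "x \<in> (\<lambda>h. h + q) ` K0_rels R"
    then obtain h where h: "h \<in> K0_rels R" "x = h + q" by blast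
    then show "x \<in> (\<lambda>h. h + p) ` K0_rels R"
      using K0_rels_closed(4)[OF h(1) d] by (intro image_eqI[of _ _ "h - (p - q)"]) simp_all
  qed
qed

lemma K0_rels_normal: "K0_rels R \<lhd> free_K0 R"
  using comm_group.subgroup_imp_normal[OF abelian_free_Abelian_group K0_rels_closed(6)] .

lemma kap_group_hom: "group_hom (free_K0 R) (K0 R) (kap R)"
  unfolding K0_def
  by (intro group_hom.intro group_hom_axioms.intro group_free_Abelian_group
      normal.factorgroup_is_group[OF K0_rels_normal] normal.r_coset_hom_Mod[OF K0_rels_normal])

lemma generate_kap:
  assumes "F \<subseteq> carrier (free_K0 R)"
  shows "generate (K0 R) (kap R ` F) = kap R ` generate (free_K0 R) F"
  using group_hom.generate_img[OF kap_group_hom assms] by simp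

lemma generate_pair:
  assumes "M \<in> fg_modules R" "N \<in> fg_modules R"
    and "x \<in> generate (free_K0 R) {frag_of M, frag_of N}"
  shows "\<exists>a b. x = frag_cmul a (frag_of M) + frag_cmul b (frag_of N)"
  using assms(3)
proof (induction rule: generate.induct)
  case one
  then show ?case by (intro exI[of _ 0]) simp
next
  case (incl h)
  then consider "h = frag_of M" | "h = frag_of N" by blast
  then show ?case
  proof cases
    case 1
    then show ?thesis by (intro exI[of _ 1] exI[of _ 0]) simp
  next
    case 2
    then show ?thesis by (intro exI[of _ 0] exI[of _ 1]) simp
  qed
next
  case (inv h)
  then consider "h = frag_of M" | "h = frag_of N" by blast
  then show ?case
  proof cases
    case 1
    then show ?thesis using assms(1) by (intro exI[of _ "-1"] exI[of _ 0]) simp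
  next
    case 2
    then show ?thesis using assms(2) by (intro exI[of _ 0] exI[of _ "-1"]) simp
  qed
next
  case (eng x y)
  then obtain a b c d where "x = frag_cmul a (frag_of M) + frag_cmul b (frag_of N)"
    "y = frag_cmul c (frag_of M) + frag_cmul d (frag_of N)" by blast
  then have "x \<otimes>\<^bsub>free_K0 R\<^esub> y = frag_cmul (a + c) (frag_of M) + frag_cmul (b + d) (frag_of N)"
    by (simp add: frag_cmul_distrib algebra_simps)
  then show ?case by blast
qed

text \<open>An arrow leaving v makes the multiplicity of the simple module at v visible to
  \<open>nuM\<close>. Arrows leaving every vertex also keep \<open>Tm\<close> from killing a
  nonnegative nonzero vector.\<close>

locale quiver_alg_nosink = quiver_alg Q R for Q :: "('v, 'e) pre_digraph"
  and R :: "('v \<times> 'e list \<Rightarrow> 'k::field) set ring" +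
  assumes nosink: "v \<in> verts Q \<Longrightarrow> out_arcs Q v \<noteq> {}"
begin

definition om :: "((('v \<times> 'e list \<Rightarrow> 'k) set) umodule \<Rightarrow>\<^sub>0 int) \<Rightarrow> 'v \<Rightarrow> int" where
  "om p v = ext (\<lambda>M. omM M v) p"

lemma sg_cong: "(\<And>v. v \<in> verts Q \<Longrightarrow> z v = w v) \<Longrightarrow> sg z = sg w"
  unfolding sg_def by (rule sum.cong) auto

lemma sg_diff: "sg (\<lambda>v. z v - w v) = sg z - sg w"
  unfolding sg_def by (simp add: frag_cmul_diff_distrib sum_subtractf)

lemma sg_keys: "Poly_Mapping.keys (sg z) \<subseteq> fg_modules R"
proof -
  have "sg z \<in> carrier (free_K0 R)" unfolding sg_def
  proof (rule sum_closed_free_Abelian_group)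
    fix v assume "v \<in> verts Q"
    then have "simp_mod v \<in> fg_modules R" by (rule simp_mod(1))
    then show "frag_cmul (z v) (frag_of (simp_mod v)) \<in> carrier (free_K0 R)" by auto
  qed
  then show ?thesis by simp
qed

lemma om_rels: "r \<in> K0_rels R \<Longrightarrow> v \<in> verts Q \<Longrightarrow> om r v = 0"
  unfolding om_def by (rule ext_rels) (auto intro: inv_additive(1) inv_projective(1))

lemma syz_ext:
  assumes "Poly_Mapping.keys p \<subseteq> fg_modules R"
  shows "frag_extend (\<lambda>M. frag_of (syzygy R M)) p - sg (om p) \<in> K0_rels R"
  using assms
proof (induction p rule: frag_induction)
  case zero
  have "sg (om 0) = 0" unfolding sg_def om_def by (simp add: ext_simps)
  then show ?case using K0_rels_closed(1) by simp
next
  case (one M)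
  have "om (frag_of M) = omM M" by (rule ext) (simp add: om_def ext_simps)
  then show ?case using syzygy_props(2)[OF one] by simp
next
  case (diff a b)
  have "om (a - b) = (\<lambda>v. om a v - om b v)" by (rule ext) (simp add: om_def ext_simps)
  then show ?case using K0_rels_closed(4)[OF diff] by (simp add: sg_diff frag_extend_diff algebra_simps)
qed

text \<open>\<open>om\<close> vanishes on relations, so the class of the linearly extended syzygy is
  constant on a coset and \<open>the_elem\<close> picks a genuine value.\<close>

lemma Omega_kap:
  assumes p: "Poly_Mapping.keys p \<subseteq> fg_modules R"
  shows "Omega_bar R (kap R p) = kap R (sg (om p))"
proof -
  let ?\<Phi> = "frag_extend (\<lambda>M. frag_of (syzygy R M))"
  have "kap R (?\<Phi> (h + p)) = kap R (sg (om p))" if h: "h \<in> K0_rels R" for h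
  proof -
    have "Poly_Mapping.keys (h + p) \<subseteq> fg_modules R"
      using keys_add[of h p] K0_rels_closed(5)[OF h] p by auto
    then have "kap R (?\<Phi> (h + p)) = kap R (sg (om (h + p)))" unfolding kap_eq by (rule syz_ext)
    also have "sg (om (h + p)) = sg (om p)"
      by (rule sg_cong) (use om_rels[OF h] in \<open>simp add: om_def ext_simps\<close>)
    finally show ?thesis .
  qed
  then have "(\<lambda>q. kap R (?\<Phi> q)) ` kap R p = {kap R (sg (om p))}"
    unfolding kap_image[of R p] using K0_rels_closed(1) by (auto simp: image_image)
  then show ?thesis unfolding Omega_bar_def by simp
qed

text \<open>The adjacency operator in its transposed form: a simple module at the tail of an arrow
  contributes one at the head.\<close>

definition Tm :: "('v \<Rightarrow> int) \<Rightarrow> 'v \<Rightarrow> int" where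
  "Tm z p = (\<Sum>\<alpha>\<in>in_arcs Q p. z (tail Q \<alpha>))"

lemma Tm_cong: "(\<And>v. v \<in> verts Q \<Longrightarrow> z v = w v) \<Longrightarrow> Tm z = Tm w"
  unfolding Tm_def by (intro ext sum.cong) (auto dest: in_arcs_verts)

lemma Tm_lin: "Tm (\<lambda>v. a * z v + b * w v) = (\<lambda>v. a * Tm z v + b * Tm w v)"
  unfolding Tm_def by (simp add: sum.distrib sum_distrib_left)

lemma Tm_pow_lin: "(Tm ^^ n) (\<lambda>v. a * z v + b * w v) = (\<lambda>v. a * (Tm ^^ n) z v + b * (Tm ^^ n) w v)"
  by (induction n) (simp_all add: Tm_lin)

lemma Tm_pow_cong:
  assumes "\<And>v. v \<in> verts Q \<Longrightarrow> z v = w v" "v \<in> verts Q"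
  shows "(Tm ^^ n) z v = (Tm ^^ n) w v"
proof (cases n)
  case (Suc m)
  show ?thesis unfolding Suc funpow_Suc_right comp_def using Tm_cong[of z w] assms(1) by simp
qed (use assms in simp)

lemma om_sg: assumes "v \<in> verts Q" shows "om (sg z) v = Tm z v"
proof -
  have "om (sg z) v = (\<Sum>u\<in>verts Q. z u * omM (simp_mod u) v)"
    unfolding om_def sg_def by (simp add: ext_simps)
  also have "\<dots> = (\<Sum>u\<in>verts Q. \<Sum>\<alpha>\<in>in_arcs Q v. if tail Q \<alpha> = u then z u else 0)"
    by (rule sum.cong) (auto simp: simp_mod(3) sum_distrib_left intro!: sum.cong)
  also have "\<dots> = (\<Sum>\<alpha>\<in>in_arcs Q v. \<Sum>u\<in>verts Q. if tail Q \<alpha> = u then z u else 0)"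
    by (rule sum.swap)
  also have "\<dots> = Tm z v" unfolding Tm_def
    by (rule sum.cong) (use in_arcs_verts in auto)
  finally show ?thesis .
qed

lemma Omega_sg: "Omega_bar R (kap R (sg z)) = kap R (sg (Tm z))"
  unfolding Omega_kap[OF sg_keys] using sg_cong[OF om_sg] by simp

lemma Omega_pow_sg: "(Omega_bar R ^^ n) (kap R (sg z)) = kap R (sg ((Tm ^^ n) z))"
  by (induction n) (simp_all add: Omega_sg)

lemma Omega_pow:
  assumes "Poly_Mapping.keys p \<subseteq> fg_modules R"
  shows "(Omega_bar R ^^ Suc n) (kap R p) = kap R (sg ((Tm ^^ n) (om p)))"
  unfolding funpow_Suc_right comp_def Omega_kap[OF assms] Omega_pow_sg ..

text \<open>With all arrows leaving v as \<open>C\<close>, \<open>nuM\<close> is 1 at the simple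
  module of v and 0 at the other simples, and it vanishes on projectives because some arrow leaves
  v. So it reads off the coefficient at v.\<close>

lemma sg_inj:
  assumes eq: "kap R (sg z) = kap R (sg w)" and v: "v \<in> verts Q"
  shows "z v = w v"
proof -
  obtain \<gamma> where \<gamma>: "\<gamma> \<in> out_arcs Q v" using nosink[OF v] by blast
  have C: "out_arcs Q v \<subseteq> arcs Q" by auto
  have "ext (\<lambda>M. nuM (out_arcs Q v) M v) (sg z - sg w) = 0"
    by (rule ext_rels[OF eq[unfolded kap_eq]])
      (use inv_additive(2)[OF _ _ _ _ v C] inv_projective(2)[OF _ _ C \<gamma>] \<gamma> in auto)
  moreover have "ext (\<lambda>M. nuM (out_arcs Q v) M v) (sg y) = y v" for y
  proof -
    have "ext (\<lambda>M. nuM (out_arcs Q v) M v) (sg y) = (\<Sum>u\<in>verts Q. if v = u then y u else 0)"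
      unfolding sg_def ext_simps by (rule sum.cong) (use v in \<open>auto simp: simp_mod(4)\<close>)
    then show ?thesis using v by simp
  qed
  ultimately show ?thesis by (simp add: ext_simps)
qed

lemma sg_eq_iff: "kap R (sg z) = kap R (sg w) \<longleftrightarrow> (\<forall>v\<in>verts Q. z v = w v)"
proof
  assume eq: "kap R (sg z) = kap R (sg w)"
  show "\<forall>v\<in>verts Q. z v = w v" by (intro ballI sg_inj[OF eq])
next
  assume "\<forall>v\<in>verts Q. z v = w v"
  then have "sg z = sg w" by (intro sg_cong) simp
  then show "kap R (sg z) = kap R (sg w)" by simp
qed

section \<open>Upper bound and realisation criterion for \<open>phi\<close>\<close>

definition stable :: "nat \<Rightarrow> bool" where
  "stable n \<longleftrightarrow> (\<forall>z. (\<forall>v\<in>verts Q. (Tm ^^ Suc n) z v = 0) \<longrightarrow> (\<forall>v\<in>verts Q. (Tm ^^ n) z v = 0))"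

lemma stable_mono: assumes "stable n" shows "stable (n + s)"
  unfolding stable_def
proof (intro allI impI)
  fix z assume a: "\<forall>v\<in>verts Q. (Tm ^^ Suc (n + s)) z v = 0"
  have "\<forall>v\<in>verts Q. (Tm ^^ Suc n) ((Tm ^^ s) z) v = 0"
    using a unfolding funpow_add[symmetric, THEN fun_cong, unfolded comp_def] add_Suc .
  then have "\<forall>v\<in>verts Q. (Tm ^^ n) ((Tm ^^ s) z) v = 0" using assms unfolding stable_def by blast
  then show "\<forall>v\<in>verts Q. (Tm ^^ (n + s)) z v = 0"
    unfolding funpow_add[symmetric, THEN fun_cong, unfolded comp_def] .
qed

lemma add_span_kap: "c \<in> add_span R M \<Longrightarrow> \<exists>p. Poly_Mapping.keys p \<subseteq> fg_modules R \<and> c = kap R p"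
proof -
  let ?F = "frag_of ` {N. N \<in> fg_modules R \<and> indecomposable R N \<and>
        (\<exists>N'\<in>fg_modules R. mod_iso R M (direct_sum N N'))}"
  have F: "?F \<subseteq> carrier (free_K0 R)" by auto
  have "add_span R M = generate (K0 R) (kap R ` ?F)"
    unfolding add_span_def K0_class_def by (rule arg_cong[where f = "generate (K0 R)"]) blast
  also have "\<dots> = kap R ` generate (free_K0 R) ?F" by (rule generate_kap[OF F])
  also have "\<dots> \<subseteq> kap R ` carrier (free_K0 R)"
    using group.generate_incl[OF group_free_Abelian_group F] by blast
  finally have sub: "add_span R M \<subseteq> kap R ` carrier (free_K0 R)" .
  assume "c \<in> add_span R M"
  then obtain p where "p \<in> carrier (free_K0 R)" "c = kap R p" using sub by blast
  then show ?thesis by auto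
qed

text \<open>The first application of \<open>Omega_bar\<close> lands in the span of the simples,
  where it acts as \<open>Tm\<close>; by stability no new kernel appears from \<open>Tm ^^ n\<close>
  on. The extra first application accounts for \<open>Suc n\<close>.\<close>

lemma phi_le:
  assumes st: "stable n" shows "phi R M \<le> Suc n"
  unfolding phi_def
proof (intro Least_le allI)
  fix s
  show "inj_on (Omega_bar R) ((Omega_bar R ^^ (Suc n + s)) ` add_span R M)"
  proof (rule inj_onI)
    fix x y assume x: "x \<in> (Omega_bar R ^^ (Suc n + s)) ` add_span R M"
      and y: "y \<in> (Omega_bar R ^^ (Suc n + s)) ` add_span R M" and eq: "Omega_bar R x = Omega_bar R y"
    obtain p where p: "Poly_Mapping.keys p \<subseteq> fg_modules R" "x = (Omega_bar R ^^ Suc (n + s)) (kap R p)"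
      using x add_span_kap by auto
    obtain q where q: "Poly_Mapping.keys q \<subseteq> fg_modules R" "y = (Omega_bar R ^^ Suc (n + s)) (kap R q)"
      using y add_span_kap by auto
    have xp: "x = kap R (sg ((Tm ^^ (n + s)) (om p)))" unfolding p(2) by (rule Omega_pow[OF p(1)])
    have yq: "y = kap R (sg ((Tm ^^ (n + s)) (om q)))" unfolding q(2) by (rule Omega_pow[OF q(1)])
    let ?d = "\<lambda>v. 1 * om p v + (-1) * om q v"
    have "\<forall>v\<in>verts Q. (Tm ^^ Suc (n + s)) (om p) v = (Tm ^^ Suc (n + s)) (om q) v"
      using eq unfolding xp yq Omega_sg sg_eq_iff by simp
    then have "\<forall>v\<in>verts Q. (Tm ^^ Suc (n + s)) ?d v = 0" unfolding Tm_pow_lin by simp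
    then have "\<forall>v\<in>verts Q. (Tm ^^ (n + s)) ?d v = 0" using stable_mono[OF st] unfolding stable_def by blast
    then show "x = y" unfolding xp yq sg_eq_iff Tm_pow_lin by simp
  qed
qed

definition pos :: "('v \<Rightarrow> int) \<Rightarrow> bool" where
  "pos u \<longleftrightarrow> (\<forall>v\<in>verts Q. 0 \<le> u v) \<and> (\<exists>v\<in>verts Q. 0 < u v)"

text \<open>A positive entry is passed on along an arrow leaving its vertex, and nonnegativity
  excludes cancellation at the head.\<close>

lemma pos_Tm: assumes "pos u" shows "pos (Tm u)"
proof -
  obtain v where v: "v \<in> verts Q" "0 < u v" using assms by (auto simp: pos_def)
  obtain \<alpha> where "\<alpha> \<in> out_arcs Q v" using nosink[OF v(1)] by blast
  then have \<alpha>: "\<alpha> \<in> arcs Q" "tail Q \<alpha> = v" by auto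
  have nn: "0 \<le> u (tail Q \<beta>)" if "\<beta> \<in> in_arcs Q p" for \<beta> p
    using assms in_arcs_verts[OF that] by (simp add: pos_def)
  have "u v \<le> Tm u (head Q \<alpha>)" unfolding Tm_def \<alpha>(2)[symmetric]
    by (rule member_le_sum) (use \<alpha> nn in auto)
  then have "0 < Tm u (head Q \<alpha>)" using v by simp
  moreover have "0 \<le> Tm u p" for p unfolding Tm_def by (rule sum_nonneg) (rule nn)
  ultimately show ?thesis using \<alpha>(1) by (auto simp: pos_def)
qed

lemma pos_Tm_pow: "pos u \<Longrightarrow> pos ((Tm ^^ n) u)"
  by (induction n) (simp_all add: pos_Tm)

text \<open>After \<open>Suc k\<close> applications the two classes agree, so the image of the span
  lies in the multiples of one vector \<open>w\<close>. It is nonnegative and nonzero, hence so is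
  \<open>Tm w\<close>, and \<open>Omega_bar\<close> is injective there. One application earlier the
  classes still differ but have the same image. For \<open>k = 0\<close> the difference concerns the
  classes themselves, which \<open>omM\<close> need not detect; hence the case distinction in
  \<open>ne\<close>.\<close>

lemma phi_pair:
  assumes fg: "M1 \<in> fg_modules R" "M2 \<in> fg_modules R"
    and span: "add_span R M = generate (K0 R) {kap R (frag_of M1), kap R (frag_of M2)}"
    and pos: "pos (omM M1)"
    and eq: "\<And>v. v \<in> verts Q \<Longrightarrow> (Tm ^^ k) (omM M1) v = (Tm ^^ k) (omM M2) v"
    and ne: "case k of 0 \<Rightarrow> kap R (frag_of M1) \<noteq> kap R (frag_of M2)
      | Suc j \<Rightarrow> \<exists>v\<in>verts Q. (Tm ^^ j) (omM M1) v \<noteq> (Tm ^^ j) (omM M2) v"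
  shows "phi R M = Suc k"
  unfolding phi_def
proof (rule Least_equality)
  let ?F = "{frag_of M1, frag_of M2}"
  have F: "?F \<subseteq> carrier (free_K0 R)" using fg by auto
  have sp: "add_span R M = kap R ` generate (free_K0 R) ?F"
    unfolding span using generate_kap[OF F] by simp
  have o: "om (frag_of M1) = omM M1" "om (frag_of M2) = omM M2"
    by (rule ext, simp add: om_def ext_simps)+
  have keys: "Poly_Mapping.keys (frag_of M1) \<subseteq> fg_modules R" "Poly_Mapping.keys (frag_of M2) \<subseteq> fg_modules R"
    using fg by simp_all
  show "\<forall>s. inj_on (Omega_bar R) ((Omega_bar R ^^ (Suc k + s)) ` add_span R M)"
  proof
    fix s
    define w where "w = (Tm ^^ (k + s)) (omM M1)"
    have w2: "(Tm ^^ (k + s)) (omM M2) v = w v" if "v \<in> verts Q" for v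
    proof -
      have "(Tm ^^ s) ((Tm ^^ k) (omM M2)) v = (Tm ^^ s) ((Tm ^^ k) (omM M1)) v"
        by (rule Tm_pow_cong) (use eq that in simp_all)
      then show ?thesis unfolding w_def by (simp add: funpow_add add.commute[of k s])
    qed
    have form: "\<exists>c. x = kap R (sg (\<lambda>v. c * w v))" if xin: "x \<in> (Omega_bar R ^^ (Suc k + s)) ` add_span R M" for x
    proof -
      obtain p where p: "p \<in> generate (free_K0 R) ?F" "x = (Omega_bar R ^^ Suc (k + s)) (kap R p)"
        using xin unfolding sp by auto
      obtain a b where ab: "p = frag_cmul a (frag_of M1) + frag_cmul b (frag_of M2)"
        using generate_pair[OF fg p(1)] by blast
      have "p \<in> carrier (free_K0 R)" using group.generate_incl[OF group_free_Abelian_group F] p(1) by blast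
      then have x: "x = kap R (sg ((Tm ^^ (k + s)) (om p)))" unfolding p(2) by (intro Omega_pow) simp
      have omp: "om p = (\<lambda>v. a * omM M1 v + b * omM M2 v)"
        by (rule ext) (simp add: ab om_def ext_simps)
      have "x = kap R (sg (\<lambda>v. (a + b) * w v))"
        unfolding x omp Tm_pow_lin sg_eq_iff using w2 by (simp add: w_def distrib_right)
      then show ?thesis by blast
    qed
    obtain u where u: "u \<in> verts Q" "0 < Tm w u"
      using pos_Tm[OF pos_Tm_pow[OF pos, of "k + s"]] unfolding w_def pos_def by blast
    show "inj_on (Omega_bar R) ((Omega_bar R ^^ (Suc k + s)) ` add_span R M)"
    proof (rule inj_onI)
      fix x y assume x: "x \<in> (Omega_bar R ^^ (Suc k + s)) ` add_span R M" and y: "y \<in> (Omega_bar R ^^ (Suc k + s)) ` add_span R M"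
        and e: "Omega_bar R x = Omega_bar R y"
      from form[OF x] obtain c where c: "x = kap R (sg (\<lambda>v. c * w v))" ..
      from form[OF y] obtain d where d: "y = kap R (sg (\<lambda>v. d * w v))" ..
      have T: "Tm (\<lambda>v. c * w v) = (\<lambda>v. c * Tm w v)" for c using Tm_lin[of c w 0 w] by simp
      have "c * Tm w u = d * Tm w u" using e u(1) unfolding c d Omega_sg sg_eq_iff T by blast
      then have "c = d" using u(2) by simp
      then show "x = y" unfolding c d by simp
    qed
  qed
  fix l assume l: "\<forall>s. inj_on (Omega_bar R) ((Omega_bar R ^^ (l + s)) ` add_span R M)"
  show "Suc k \<le> l"
  proof (rule ccontr)
    assume "\<not> Suc k \<le> l"
    \<comment> \<open>Injectivity at all stages from \<open>l\<close> on includes stage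
      \<open>k\<close>.\<close>
    then have "l + (k - l) = k" by simp
    then have inj: "inj_on (Omega_bar R) ((Omega_bar R ^^ k) ` add_span R M)" using l by metis
    have mem: "kap R (frag_of M1) \<in> add_span R M" "kap R (frag_of M2) \<in> add_span R M"
      unfolding span by (auto intro: generate.incl)
    have "Omega_bar R ((Omega_bar R ^^ k) (kap R (frag_of M1))) = Omega_bar R ((Omega_bar R ^^ k) (kap R (frag_of M2)))"
      using Omega_pow[OF keys(1), of k] Omega_pow[OF keys(2), of k] eq unfolding o by (simp add: sg_eq_iff)
    then have same: "(Omega_bar R ^^ k) (kap R (frag_of M1)) = (Omega_bar R ^^ k) (kap R (frag_of M2))"
      using inj mem by (auto dest: inj_onD)
    show False
    proof (cases k)
      case 0
      then show ?thesis using same ne by simp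
    next
      case (Suc j)
      then have "\<forall>v\<in>verts Q. (Tm ^^ j) (omM M1) v = (Tm ^^ j) (omM M2) v"
        using same unfolding Suc Omega_pow[OF keys(1)] Omega_pow[OF keys(2)] o sg_eq_iff by simp
      then show ?thesis using ne Suc by auto
    qed
  qed
qed

text \<open>The zero module has no indecomposable summand, so its span is trivial.\<close>

lemma phi_zero: "\<exists>M\<in>fg_modules R. phi R M = 0"
proof -
  let ?Z = "PI (\<lambda>_. undefined) 0"
  have Z: "?Z \<in> fg_modules R" by (rule PI_fg) simp
  have cZ: "carrier ?Z = {\<zero>\<^bsub>?Z\<^esub>}" by (auto simp: proj_mod_def)
  have no: "\<not> (indecomposable R N \<and> (\<exists>N'\<in>fg_modules R. mod_iso R ?Z (direct_sum N N')))" for N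
  proof
    assume "indecomposable R N \<and> (\<exists>N'\<in>fg_modules R. mod_iso R ?Z (direct_sum N N'))"
    then obtain N' where N: "right_module R N" "carrier N \<noteq> {\<zero>\<^bsub>N\<^esub>}" "N' \<in> fg_modules R" "mod_iso R ?Z (direct_sum N N')"
      unfolding indecomposable_def by blast
    interpret N: right_module R N by (rule N(1))
    interpret N': right_module R N' by (rule fgD(1)[OF N(3)])
    obtain f where "f ` carrier ?Z = carrier N \<times> carrier N'" using N(4) by (auto simp: mod_iso_def bij_betw_def)
    then have "carrier N \<times> carrier N' = {f \<zero>\<^bsub>?Z\<^esub>}" unfolding cZ by simp
    then have "x = \<zero>\<^bsub>N\<^esub>" if "x \<in> carrier N" for x
      using that N.M.zero_closed N'.M.zero_closed by (metis SigmaI fst_conv singletonD)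
    then show False using N(2) N.M.zero_closed by blast
  qed
  have S: "add_span R ?Z = generate (K0 R) {}"
    unfolding add_span_def by (rule arg_cong[where f = "generate (K0 R)"]) (use no in blast)
  have "x = \<one>\<^bsub>K0 R\<^esub>" if "x \<in> generate (K0 R) {}" for x
    using that
  proof (induction rule: generate.induct)
    case (eng x y)
    have "group (K0 R)" using group_hom.axioms(2)[OF kap_group_hom] .
    then show ?case using eng group.is_monoid monoid.one_closed by (metis monoid.l_one)
  qed auto
  then have "inj_on (Omega_bar R) ((Omega_bar R ^^ n) ` add_span R ?Z)" for n
    unfolding S by (auto simp: inj_on_def)
  then have "phi R ?Z = 0" unfolding phi_def by (intro Least_equality) simp_all
  then show ?thesis using Z by blast
qed

text \<open>Zero is a value. If \<open>Suc k\<close> is not one, then \<open>stable k\<close> holds,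
  all values are at most \<open>Suc k\<close> and hence at most k, and \<open>Suc k\<close> exceeds
  the supremum.\<close>

lemma no_gap_if:
  assumes "\<And>k. \<not> stable k \<Longrightarrow> \<exists>M\<in>fg_modules R. phi R M = Suc k"
  shows "\<not> (\<exists>t. is_gap R t)"
proof
  assume "\<exists>t. is_gap R t"
  then obtain t where t: "enat t \<le> phi_dim R" "\<not> (\<exists>M\<in>fg_modules R. phi R M = t)" unfolding is_gap_def by blast
  then obtain k where k: "t = Suc k" using phi_zero by (cases t) auto
  then have st: "stable k" using assms t(2) by blast
  have "enat (phi R M) \<le> enat k" if "M \<in> fg_modules R" for M
    using phi_le[OF st, of M] t(2) that k by (auto simp: le_Suc_eq)
  then have "phi_dim R \<le> enat k" unfolding phi_dim_def by (rule SUP_least)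
  then have "enat t \<le> enat k" by (rule order_trans[OF t(1)])
  then show False using k by simp
qed

end

context quiver_alg
begin

section \<open>Modules whose endomorphisms are scalars modulo the radical\<close>

text \<open>Maps into the radical square to zero, so for nonzero M this says that the endomorphism
  ring is local with the given field as residue field. Indecomposability and the uniqueness of
  summands both follow from it.\<close>

definition brick_mod :: "(('v \<times> 'e list \<Rightarrow> 'k) set, 'b) module \<Rightarrow> bool" where
  "brick_mod M \<longleftrightarrow> (\<forall>f\<in>mod_hom R M M. \<exists>c. \<forall>x\<in>carrier M. f x \<ominus>\<^bsub>M\<^esub> sc c \<odot>\<^bsub>M\<^esub> x \<in> jrad M)"

lemma right_module_minus_hom:
  assumes M: "right_module R M" and f: "f \<in> mod_hom R M M"
  shows "(\<lambda>x. f x \<ominus>\<^bsub>M\<^esub> sc c \<odot>\<^bsub>M\<^esub> x) \<in> mod_hom R M M"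
proof -
  interpret M: right_module R M by (rule M)
  have comm: "sc c \<otimes>\<^bsub>R\<^esub> r = r \<otimes>\<^bsub>R\<^esub> sc c" if "r \<in> carrier R" for r
    using that
  proof (rule el_exhaust)
    fix g h assume "r = el g h"
    then show ?thesis by (simp add: sc_def el_mult) (rule el_cong, auto)
  qed
  have m: "r \<odot>\<^bsub>M\<^esub> (\<ominus>\<^bsub>M\<^esub> x) = \<ominus>\<^bsub>M\<^esub> (r \<odot>\<^bsub>M\<^esub> x)" if "r \<in> carrier R" "x \<in> carrier M" for r x
    using that M.smult_r_distr[of r "\<ominus>\<^bsub>M\<^esub> x" x] by (intro M.M.minus_equality[symmetric]) (auto simp: M.M.l_neg)
  note d = mod_homD[OF f]
  show ?thesis unfolding mod_hom_def
  proof (intro CollectI conjI ballI funcsetI)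
    fix x assume x: "x \<in> carrier M"
    show "f x \<ominus>\<^bsub>M\<^esub> sc c \<odot>\<^bsub>M\<^esub> x \<in> carrier M" using x d(1) by simp
    show "f (x \<oplus>\<^bsub>M\<^esub> y) \<ominus>\<^bsub>M\<^esub> sc c \<odot>\<^bsub>M\<^esub> (x \<oplus>\<^bsub>M\<^esub> y) = f x \<ominus>\<^bsub>M\<^esub> sc c \<odot>\<^bsub>M\<^esub> x \<oplus>\<^bsub>M\<^esub> (f y \<ominus>\<^bsub>M\<^esub> sc c \<odot>\<^bsub>M\<^esub> y)"
      if y: "y \<in> carrier M" for y
      using x y d(1) by (simp add: d(2) M.smult_r_distr a_minus_def M.M.minus_add M.M.a_ac)
    show "f (r \<odot>\<^bsub>M\<^esub> x) \<ominus>\<^bsub>M\<^esub> sc c \<odot>\<^bsub>M\<^esub> (r \<odot>\<^bsub>M\<^esub> x) = r \<odot>\<^bsub>M\<^esub> (f x \<ominus>\<^bsub>M\<^esub> sc c \<odot>\<^bsub>M\<^esub> x)"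
      if r: "r \<in> carrier R" for r
      using x r d(1) by (simp add: d(3) a_minus_def M.smult_r_distr m M.smult_assoc[symmetric] comm)
  qed
qed

lemma right_module_minus_zero:
  assumes M: "right_module R M" and x: "x \<in> carrier M" shows "x \<ominus>\<^bsub>M\<^esub> \<zero>\<^bsub>M\<^esub> = x"
proof -
  interpret M: right_module R M by (rule M)
  have "\<ominus>\<^bsub>M\<^esub> \<zero>\<^bsub>M\<^esub> = \<zero>\<^bsub>M\<^esub>" by (rule M.M.minus_equality) simp_all
  then show ?thesis using x by (simp add: a_minus_def)
qed

text \<open>In \<open>f = c + n\<close> the part \<open>n\<close> maps into the radical and
  therefore kills the radical; it squares to zero, and a nonzero scalar plus such a map is
  invertible.\<close>

lemma brick_bij:
  assumes M: "right_module R M" and f: "f \<in> mod_hom R M M" and c: "c \<noteq> 0"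
    and near: "\<And>x. x \<in> carrier M \<Longrightarrow> f x \<ominus>\<^bsub>M\<^esub> sc c \<odot>\<^bsub>M\<^esub> x \<in> jrad M"
  shows "bij_betw f (carrier M) (carrier M)"
proof -
  interpret M: right_module R M by (rule M)
  define n where "n x = f x \<ominus>\<^bsub>M\<^esub> sc c \<odot>\<^bsub>M\<^esub> x" for x
  have n: "n \<in> mod_hom R M M" unfolding n_def[abs_def] by (rule right_module_minus_hom[OF M f])
  note nd = mod_homD[OF n] and fd = mod_homD[OF f]
  have nj: "n x = \<zero>\<^bsub>M\<^esub>" if "x \<in> jrad M" for x
    using jrad_annihilate[OF M M n _ that] near by (simp add: n_def)
  have nn: "n (n x) = \<zero>\<^bsub>M\<^esub>" if "x \<in> carrier M" for x using nj near[OF that] by (simp add: n_def)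
  have split: "f x = n x \<oplus>\<^bsub>M\<^esub> sc c \<odot>\<^bsub>M\<^esub> x" if "x \<in> carrier M" for x
    using that fd(1) by (simp add: n_def a_minus_def M.M.a_assoc M.M.l_neg)
  have inv: "sc (inverse c) \<odot>\<^bsub>M\<^esub> (sc c \<odot>\<^bsub>M\<^esub> x) = x" "sc c \<odot>\<^bsub>M\<^esub> (sc (inverse c) \<odot>\<^bsub>M\<^esub> x) = x" if "x \<in> carrier M" for x
    using that c by (simp_all add: M.smult_assoc[symmetric] sc_mult sc_1)
  have ker: "x = \<zero>\<^bsub>M\<^esub>" if x: "x \<in> carrier M" "f x = \<zero>\<^bsub>M\<^esub>" for x
  proof -
    have "n (f x) = n (n x) \<oplus>\<^bsub>M\<^esub> sc c \<odot>\<^bsub>M\<^esub> n x"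
      unfolding split[OF x(1)] using x nd by simp
    then have "sc c \<odot>\<^bsub>M\<^esub> n x = \<zero>\<^bsub>M\<^esub>" using x nn mod_hom_zero[OF M M n] nd(1) by simp
    then have "n x = \<zero>\<^bsub>M\<^esub>" using inv(1)[OF nd(1)[OF x(1)]] by simp
    then have "sc c \<odot>\<^bsub>M\<^esub> x = \<zero>\<^bsub>M\<^esub>" using split[OF x(1)] x by simp
    then show ?thesis using inv(1)[OF x(1)] by simp
  qed
  show ?thesis unfolding bij_betw_def
  proof
    show "inj_on f (carrier M)"
    proof (rule inj_onI)
      fix x y assume xy: "x \<in> carrier M" "y \<in> carrier M" "f x = f y"
      have "f (x \<ominus>\<^bsub>M\<^esub> y) \<oplus>\<^bsub>M\<^esub> f y = f x" using xy fd(2)[of "x \<ominus>\<^bsub>M\<^esub> y" y]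
        by (simp add: a_minus_def M.M.a_assoc M.M.l_neg)
      then have "f (x \<ominus>\<^bsub>M\<^esub> y) \<oplus>\<^bsub>M\<^esub> f y = f y" unfolding xy(3) .
      then have 0: "f (x \<ominus>\<^bsub>M\<^esub> y) = \<zero>\<^bsub>M\<^esub>"
        using M.M.add.r_cancel_one[OF fd(1)[OF xy(2)] fd(1)[OF M.M.minus_closed[OF xy(1,2)]]] by simp
      have "x \<ominus>\<^bsub>M\<^esub> y = \<zero>\<^bsub>M\<^esub>" by (rule ker[OF M.M.minus_closed[OF xy(1,2)] 0])
      then have "x \<ominus>\<^bsub>M\<^esub> y \<oplus>\<^bsub>M\<^esub> y = y" using xy(2) by simp
      then show "x = y" using xy(1,2) by (simp add: a_minus_def M.M.a_assoc M.M.l_neg)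
    qed
    show "f ` carrier M = carrier M"
    proof
      show "f ` carrier M \<subseteq> carrier M" using fd(1) by auto
      show "carrier M \<subseteq> f ` carrier M"
      proof
        fix y assume y: "y \<in> carrier M"
        \<comment> \<open>The preimage of y is (c - n) y / c^2, the geometric series cut off after
          the linear term; \<open>a\<close> and \<open>b\<close> are its two parts.\<close>
        define a where "a = sc (inverse c) \<odot>\<^bsub>M\<^esub> y"
        define b where "b = sc (inverse c) \<odot>\<^bsub>M\<^esub> n a"
        have a: "a \<in> carrier M" "sc c \<odot>\<^bsub>M\<^esub> a = y" using y inv(2) by (simp_all add: a_def)
        have b: "b \<in> carrier M" "sc c \<odot>\<^bsub>M\<^esub> b = n a" "n b = \<zero>\<^bsub>M\<^esub>" using a inv(2) nd nn by (simp_all add: b_def)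
        have fa: "f a = n a \<oplus>\<^bsub>M\<^esub> y" "f b = n a" using split[OF a(1)] split[OF b(1)] a b nd(1) by simp_all
        have "f (a \<ominus>\<^bsub>M\<^esub> b) \<oplus>\<^bsub>M\<^esub> f b = f a" using a b fd(2)[of "a \<ominus>\<^bsub>M\<^esub> b" b]
          by (simp add: a_minus_def M.M.a_assoc M.M.l_neg)
        then have "n a \<oplus>\<^bsub>M\<^esub> f (a \<ominus>\<^bsub>M\<^esub> b) = n a \<oplus>\<^bsub>M\<^esub> y"
          unfolding fa using a b nd(1) fd(1) by (simp add: M.M.a_comm)
        then have "f (a \<ominus>\<^bsub>M\<^esub> b) = y" using a b y nd(1) fd(1) by simp
        then show "y \<in> f ` carrier M" using a b by (intro image_eqI[of _ _ "a \<ominus>\<^bsub>M\<^esub> b"]) simp_all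
      qed
    qed
  qed
qed

lemma direct_sum_maps:
  assumes M: "right_module R M" and N: "right_module R N"
  shows "fst \<in> mod_hom R (direct_sum M N) M" "snd \<in> mod_hom R (direct_sum M N) N"
    "(\<lambda>x. (x, \<zero>\<^bsub>N\<^esub>)) \<in> mod_hom R M (direct_sum M N)" "(\<lambda>x. (\<zero>\<^bsub>M\<^esub>, x)) \<in> mod_hom R N (direct_sum M N)"
proof -
  interpret M: right_module R M by (rule M)
  interpret N: right_module R N by (rule N)
  show "fst \<in> mod_hom R (direct_sum M N) M" "snd \<in> mod_hom R (direct_sum M N) N"
    "(\<lambda>x. (x, \<zero>\<^bsub>N\<^esub>)) \<in> mod_hom R M (direct_sum M N)" "(\<lambda>x. (\<zero>\<^bsub>M\<^esub>, x)) \<in> mod_hom R N (direct_sum M N)"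
    by (auto simp: mod_hom_def)
qed

lemma summand_maps:
  assumes D: "right_module R D" and N: "right_module R N" and N': "right_module R N'"
    and iso: "mod_iso R D (direct_sum N N')"
  shows "\<exists>p q. p \<in> mod_hom R D N \<and> q \<in> mod_hom R N D \<and> (\<forall>x\<in>carrier N. p (q x) = x)"
proof -
  obtain g where g: "g \<in> mod_hom R D (direct_sum N N')" "bij_betw g (carrier D) (carrier (direct_sum N N'))"
    using iso by (auto simp: mod_iso_def)
  note m = direct_sum_maps[OF N N']
  let ?q = "\<lambda>x. inv_into (carrier D) g (x, \<zero>\<^bsub>N'\<^esub>)"
  interpret N': right_module R N' by (rule N')
  have "g (?q x) = (x, \<zero>\<^bsub>N'\<^esub>)" if "x \<in> carrier N" for x
  proof -
    have "(x, \<zero>\<^bsub>N'\<^esub>) \<in> g ` carrier D" using g(2) that by (simp add: bij_betw_def)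
    then show ?thesis by (rule f_inv_into_f)
  qed
  then have "\<forall>x\<in>carrier N. fst (g (?q x)) = x" by simp
  then show ?thesis using mod_hom_comp[OF g(1) m(1)] mod_hom_comp[OF m(3) mod_hom_inv[OF D g]] by blast
qed

text \<open>Since the composite is bijective, N is the direct sum of the image of \<open>a\<close>
  and the kernel of \<open>b\<close>; indecomposability of N leaves no kernel.\<close>

lemma brick_split_mono:
  assumes M: "M \<in> fg_modules R" and ne: "carrier M \<noteq> {\<zero>\<^bsub>M\<^esub>}"
    and N: "right_module R N" and ind: "indecomposable R N"
    and a: "a \<in> mod_hom R M N" and b: "b \<in> mod_hom R N M"
    and bij: "bij_betw (\<lambda>x. b (a x)) (carrier M) (carrier M)"
  shows "mod_iso R M N"
proof -
  have rM: "right_module R M" by (rule fgD[OF M])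
  interpret M: right_module R M by (rule rM)
  interpret N: right_module R N by (rule N)
  note ad = mod_homD[OF a] and bd = mod_homD[OF b]
  let ?K = "N\<lparr>carrier := mod_ker N M b\<rparr>"
  have K: "right_module R ?K" by (rule right_module_ker[OF N rM b])
  have D: "right_module R (direct_sum M ?K)" by (rule right_module_direct_sum[OF rM K])
  have b0: "b \<zero>\<^bsub>N\<^esub> = \<zero>\<^bsub>M\<^esub>" by (rule mod_hom_zero[OF N rM b])
  have ba: "x = y" if "x \<in> carrier M" "y \<in> carrier M" "b (a x) = b (a y)" for x y
    using bij that by (auto simp: bij_betw_def inj_on_def)
  let ?h = "\<lambda>(m, k). a m \<oplus>\<^bsub>N\<^esub> k"
  have h: "?h \<in> mod_hom R (direct_sum M ?K) N"
    unfolding mod_hom_def by (auto simp: mod_ker_def ad N.smult_r_distr N.M.a_ac)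
  have bh: "b (?h (m, k)) = b (a m)" if "m \<in> carrier M" "k \<in> mod_ker N M b" for m k
    using that ad bd by (simp add: mod_ker_def)
  have "bij_betw ?h (carrier (direct_sum M ?K)) (carrier N)"
    unfolding bij_betw_def
  proof
    show "inj_on ?h (carrier (direct_sum M ?K))"
    proof (rule inj_onI)
      fix x y assume "x \<in> carrier (direct_sum M ?K)" "y \<in> carrier (direct_sum M ?K)" and e: "?h x = ?h y"
      then obtain m k m' k' where x: "x = (m, k)" "m \<in> carrier M" "k \<in> mod_ker N M b"
        and y: "y = (m', k')" "m' \<in> carrier M" "k' \<in> mod_ker N M b" by auto
      have "b (a m) = b (a m')" using e bh[OF x(2,3)] bh[OF y(2,3)] unfolding x(1) y(1) by simp
      then have "m = m'" by (rule ba[OF x(2) y(2)])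
      then show "x = y" using e x y ad(1) by (simp add: mod_ker_def)
    qed
    show "?h ` carrier (direct_sum M ?K) = carrier N"
    proof
      show "?h ` carrier (direct_sum M ?K) \<subseteq> carrier N" using ad(1) by (auto simp: mod_ker_def)
      show "carrier N \<subseteq> ?h ` carrier (direct_sum M ?K)"
      proof
        fix y assume y: "y \<in> carrier N"
        have "b y \<in> (\<lambda>x. b (a x)) ` carrier M" using bij bd(1)[OF y] by (simp add: bij_betw_def)
        then obtain m where m: "m \<in> carrier M" "b y = b (a m)" by blast
        define k where "k = \<ominus>\<^bsub>N\<^esub> a m \<oplus>\<^bsub>N\<^esub> y"
        have am: "a m \<in> carrier N" using ad(1) m by simp
        have k: "k \<in> carrier N" "a m \<oplus>\<^bsub>N\<^esub> k = y" using am y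
          by (simp_all add: k_def N.M.a_assoc[symmetric] N.M.r_neg)
        have "b (a m) \<oplus>\<^bsub>M\<^esub> b k = b (a m)" using bd(2)[OF am k(1)] k(2) m(2) by simp
        then have "b k = \<zero>\<^bsub>M\<^esub>" using bd(1) am k(1) by simp
        then show "y \<in> ?h ` carrier (direct_sum M ?K)"
          using m k by (intro image_eqI[of _ _ "(m, k)"]) (simp_all add: mod_ker_def)
      qed
    qed
  qed
  then have "mod_iso R (direct_sum M ?K) N" using h unfolding mod_iso_def by blast
  then have iso: "mod_iso R N (direct_sum M ?K)" by (rule mod_iso_sym[OF D])
  have "carrier M = {\<zero>\<^bsub>M\<^esub>} \<or> carrier ?K = {\<zero>\<^bsub>?K\<^esub>}"
    using ind rM K iso unfolding indecomposable_def by blast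
  then have K0: "mod_ker N M b = {\<zero>\<^bsub>N\<^esub>}" using ne by simp
  have "bij_betw a (carrier M) (carrier N)" unfolding bij_betw_def
  proof
    show "inj_on a (carrier M)" by (rule inj_onI) (use ba in auto)
    show "a ` carrier M = carrier N"
    proof
      show "a ` carrier M \<subseteq> carrier N" using ad(1) by auto
      show "carrier N \<subseteq> a ` carrier M"
      proof
        fix y assume y: "y \<in> carrier N"
        have "y \<in> ?h ` carrier (direct_sum M ?K)"
          using \<open>bij_betw ?h (carrier (direct_sum M ?K)) (carrier N)\<close> y by (simp add: bij_betw_def)
        then obtain m k where "m \<in> carrier M" "k \<in> mod_ker N M b" "y = a m \<oplus>\<^bsub>N\<^esub> k" by auto
        then show "y \<in> a ` carrier M" using K0 ad(1) by simp
      qed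
    qed
  qed
  then show ?thesis using a unfolding mod_iso_def by blast
qed

text \<open>A decomposition yields an idempotent \<open>e\<close> that is a scalar c modulo the
  radical. If c = 0, it maps into the radical, so \<open>e = e e = 0\<close>; otherwise it is
  bijective and hence the identity. In either case one summand is zero.\<close>

lemma brick_indecomposable:
  assumes M: "right_module R M" and br: "brick_mod M" and ne: "carrier M \<noteq> {\<zero>\<^bsub>M\<^esub>}"
  shows "indecomposable R M"
  unfolding indecomposable_def
proof (intro conjI M ne allI impI)
  fix N N' :: "(('v \<times> 'e list \<Rightarrow> 'k) set) umodule"
  assume a: "right_module R N \<and> right_module R N' \<and> mod_iso R M (direct_sum N N')"
  then have N: "right_module R N" and N': "right_module R N'" and iso: "mod_iso R M (direct_sum N N')" by auto
  interpret M: right_module R M by (rule M)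
  interpret N: right_module R N by (rule N)
  interpret N': right_module R N' by (rule N')
  obtain g where g: "g \<in> mod_hom R M (direct_sum N N')" "bij_betw g (carrier M) (carrier (direct_sum N N'))"
    using iso by (auto simp: mod_iso_def)
  define h where "h = inv_into (carrier M) g"
  have h: "h \<in> mod_hom R (direct_sum N N') M" unfolding h_def by (rule mod_hom_inv[OF M g])
  have gh: "g (h y) = y" if "y \<in> carrier N \<times> carrier N'" for y
  proof -
    have "y \<in> g ` carrier M" using g(2) that by (simp add: bij_betw_def)
    then show ?thesis unfolding h_def by (rule f_inv_into_f)
  qed
  note m = direct_sum_maps[OF N N']
  define e where "e x = h (fst (g x), \<zero>\<^bsub>N'\<^esub>)" for x
  have e: "e \<in> mod_hom R M M" unfolding e_def[abs_def]
    by (rule mod_hom_comp[OF mod_hom_comp[OF mod_hom_comp[OF g(1) m(1)] m(3)] h])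
  have gN: "g x \<in> carrier N \<times> carrier N'" if "x \<in> carrier M" for x using mod_homD(1)[OF g(1) that] by simp
  have ge: "g (e x) = (fst (g x), \<zero>\<^bsub>N'\<^esub>)" if "x \<in> carrier M" for x
    unfolding e_def by (rule gh) (use gN[OF that] in auto)
  have ee: "e (e x) = e x" if "x \<in> carrier M" for x
    using ge[OF that] by (simp add: e_def)
  obtain c where c: "\<And>x. x \<in> carrier M \<Longrightarrow> e x \<ominus>\<^bsub>M\<^esub> sc c \<odot>\<^bsub>M\<^esub> x \<in> jrad M"
    using br e unfolding brick_mod_def by blast
  show "carrier N = {\<zero>\<^bsub>N\<^esub>} \<or> carrier N' = {\<zero>\<^bsub>N'\<^esub>}"
  proof (cases "c = 0")
    case True
    have ej: "e x \<in> jrad M" if "x \<in> carrier M" for x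
      using c[OF that] that mod_homD(1)[OF e that] by (simp add: True sc_0 right_module_minus_zero[OF M])
    have e0: "e x = \<zero>\<^bsub>M\<^esub>" if "x \<in> carrier M" for x
      using jrad_annihilate[OF M M e ej ej[OF that]] ee[OF that] by simp
    have "y = \<zero>\<^bsub>N\<^esub>" if y: "y \<in> carrier N" for y
    proof -
      have hy: "h (y, \<zero>\<^bsub>N'\<^esub>) \<in> carrier M" using mod_homD(1)[OF h, of "(y, \<zero>\<^bsub>N'\<^esub>)"] y by simp
      have "g (e (h (y, \<zero>\<^bsub>N'\<^esub>))) = (y, \<zero>\<^bsub>N'\<^esub>)" using ge[OF hy] gh[of "(y, \<zero>\<^bsub>N'\<^esub>)"] y by simp
      moreover have "g \<zero>\<^bsub>M\<^esub> = (\<zero>\<^bsub>N\<^esub>, \<zero>\<^bsub>N'\<^esub>)"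
        using mod_hom_zero[OF M right_module_direct_sum[OF N N'] g(1)] by simp
      ultimately show ?thesis using e0[OF hy] by simp
    qed
    then show ?thesis using N.M.zero_closed by blast
  next
    case False
    have inj: "inj_on e (carrier M)" using brick_bij[OF M e False c] by (simp add: bij_betw_def)
    have id: "e x = x" if "x \<in> carrier M" for x
      using inj_onD[OF inj ee[OF that] mod_homD(1)[OF e that] that] .
    have "y = \<zero>\<^bsub>N'\<^esub>" if y: "y \<in> carrier N'" for y
    proof -
      have hy: "h (\<zero>\<^bsub>N\<^esub>, y) \<in> carrier M" using mod_homD(1)[OF h, of "(\<zero>\<^bsub>N\<^esub>, y)"] y by simp
      have "g (e (h (\<zero>\<^bsub>N\<^esub>, y))) = (\<zero>\<^bsub>N\<^esub>, \<zero>\<^bsub>N'\<^esub>)" using ge[OF hy] gh[of "(\<zero>\<^bsub>N\<^esub>, y)"] y by simp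
      then show ?thesis using id[OF hy] gh[of "(\<zero>\<^bsub>N\<^esub>, y)"] y by simp
    qed
    then show ?thesis using N'.M.zero_closed by blast
  qed
qed

text \<open>If one of the composites M1 to N to M1 and M2 to N to M2 has a nonzero scalar, N is
  isomorphic to that module. Otherwise the idempotent \<open>e\<close> through N has its diagonal
  entries in the radical, then all its entries, so \<open>e = e e = 0\<close> and N would be
  zero.\<close>

lemma brick_pair_summand:
  assumes M1: "M1 \<in> fg_modules R" "brick_mod M1" "carrier M1 \<noteq> {\<zero>\<^bsub>M1\<^esub>}"
    and M2: "M2 \<in> fg_modules R" "brick_mod M2" "carrier M2 \<noteq> {\<zero>\<^bsub>M2\<^esub>}"
    and N: "right_module R N" "indecomposable R N" and N': "right_module R N'"
    and iso: "mod_iso R (direct_sum M1 M2) (direct_sum N N')"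
  shows "mod_iso R M1 N \<or> mod_iso R M2 N"
proof -
  have r1: "right_module R M1" and r2: "right_module R M2" using fgD M1(1) M2(1) by auto
  interpret M1: right_module R M1 by (rule r1)
  interpret M2: right_module R M2 by (rule r2)
  interpret N: right_module R N by (rule N(1))
  let ?D = "direct_sum M1 M2"
  have D: "right_module R ?D" by (rule right_module_direct_sum[OF r1 r2])
  interpret D: right_module R ?D by (rule D)
  obtain p q where p: "p \<in> mod_hom R ?D N" and q: "q \<in> mod_hom R N ?D" and "\<forall>x\<in>carrier N. p (q x) = x"
    using summand_maps[OF D N(1) N' iso] by blast
  then have pq: "p (q x) = x" if "x \<in> carrier N" for x using that by blast
  note m = direct_sum_maps[OF r1 r2]
  note pi = mod_hom_comp[OF m(3) p] mod_hom_comp[OF m(4) p]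
  note iq = mod_hom_comp[OF q m(1)] mod_hom_comp[OF q m(2)]
  have "\<exists>c1. \<forall>x\<in>carrier M1. fst (q (p (x, \<zero>\<^bsub>M2\<^esub>))) \<ominus>\<^bsub>M1\<^esub> sc c1 \<odot>\<^bsub>M1\<^esub> x \<in> jrad M1"
    by (rule bspec[OF M1(2)[unfolded brick_mod_def] mod_hom_comp[OF pi(1) iq(1)]])
  then obtain c1 where "\<forall>x\<in>carrier M1. fst (q (p (x, \<zero>\<^bsub>M2\<^esub>))) \<ominus>\<^bsub>M1\<^esub> sc c1 \<odot>\<^bsub>M1\<^esub> x \<in> jrad M1" ..
  note c1 = bspec[OF this]
  have "\<exists>c2. \<forall>x\<in>carrier M2. snd (q (p (\<zero>\<^bsub>M1\<^esub>, x))) \<ominus>\<^bsub>M2\<^esub> sc c2 \<odot>\<^bsub>M2\<^esub> x \<in> jrad M2"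
    by (rule bspec[OF M2(2)[unfolded brick_mod_def] mod_hom_comp[OF pi(2) iq(2)]])
  then obtain c2 where "\<forall>x\<in>carrier M2. snd (q (p (\<zero>\<^bsub>M1\<^esub>, x))) \<ominus>\<^bsub>M2\<^esub> sc c2 \<odot>\<^bsub>M2\<^esub> x \<in> jrad M2" ..
  note c2 = bspec[OF this]
  consider "c1 \<noteq> 0" | "c2 \<noteq> 0" | "c1 = 0" "c2 = 0" by blast
  then show ?thesis
  proof cases
    case 1
    from brick_split_mono[OF M1(1,3) N pi(1) iq(1) brick_bij[OF r1 mod_hom_comp[OF pi(1) iq(1)] 1 c1]]
    show ?thesis by simp
  next
    case 2
    from brick_split_mono[OF M2(1,3) N pi(2) iq(2) brick_bij[OF r2 mod_hom_comp[OF pi(2) iq(2)] 2 c2]]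
    show ?thesis by simp
  next
    case 3
    define e where "e x = q (p x)" for x
    have e: "e \<in> mod_hom R ?D ?D" unfolding e_def[abs_def] by (rule mod_hom_comp[OF p q])
    have ec: "e x \<in> carrier M1 \<times> carrier M2" if "x \<in> carrier M1 \<times> carrier M2" for x
      using mod_homD(1)[OF e, of x] that by simp
    have ee: "e (e x) = e x" if "x \<in> carrier M1 \<times> carrier M2" for x
      using pq[of "p x"] mod_homD(1)[OF p, of x] that by (simp add: e_def)
    have j1: "fst (e (x, \<zero>\<^bsub>M2\<^esub>)) \<in> jrad M1" if x: "x \<in> carrier M1" for x
    proof -
      have "fst (e (x, \<zero>\<^bsub>M2\<^esub>)) \<in> carrier M1" using ec[of "(x, \<zero>\<^bsub>M2\<^esub>)"] x by auto
      then show ?thesis using c1[OF x] x by (simp add: 3 sc_0 right_module_minus_zero[OF r1] e_def)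
    qed
    have j2: "snd (e (\<zero>\<^bsub>M1\<^esub>, x)) \<in> jrad M2" if x: "x \<in> carrier M2" for x
    proof -
      have "snd (e (\<zero>\<^bsub>M1\<^esub>, x)) \<in> carrier M2" using ec[of "(\<zero>\<^bsub>M1\<^esub>, x)"] x by auto
      then show ?thesis using c2[OF x] x by (simp add: 3 sc_0 right_module_minus_zero[OF r2] e_def)
    qed
    have add: "e (x, y) = e (x, \<zero>\<^bsub>M2\<^esub>) \<oplus>\<^bsub>?D\<^esub> e (\<zero>\<^bsub>M1\<^esub>, y)" if "x \<in> carrier M1" "y \<in> carrier M2" for x y
      using mod_homD(2)[OF e, of "(x, \<zero>\<^bsub>M2\<^esub>)" "(\<zero>\<^bsub>M1\<^esub>, y)"] that by simp
    have fs_add: "fst (u \<oplus>\<^bsub>?D\<^esub> v) = fst u \<oplus>\<^bsub>M1\<^esub> fst v" "snd (u \<oplus>\<^bsub>?D\<^esub> v) = snd u \<oplus>\<^bsub>M2\<^esub> snd v" for u v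
      by (cases u; cases v; simp)+
    \<comment> \<open>From \<open>e e = e\<close>, the off-diagonal entry e21 equals e21 e11 + e22
      e21, and the diagonal factors put both terms into the radical. The other entry is treated
      symmetrically.\<close>
    have eS: "snd (e (x, \<zero>\<^bsub>M2\<^esub>)) \<in> jrad M2" if x: "x \<in> carrier M1" for x
    proof -
      obtain r z where rz: "e (x, \<zero>\<^bsub>M2\<^esub>) = (r, z)" by (cases "e (x, \<zero>\<^bsub>M2\<^esub>)")
      have rzc: "r \<in> carrier M1" "z \<in> carrier M2" using ec[of "(x, \<zero>\<^bsub>M2\<^esub>)"] x rz by auto
      have "(r, z) = e (r, z)" using ee[of "(x, \<zero>\<^bsub>M2\<^esub>)"] x rz by simp
      then have zeq: "z = snd (e (r, \<zero>\<^bsub>M2\<^esub>)) \<oplus>\<^bsub>M2\<^esub> snd (e (\<zero>\<^bsub>M1\<^esub>, z))"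
        using add[OF rzc] fs_add by (metis snd_conv)
      have "r \<in> jrad M1" using j1[OF x] rz by simp
      then have "snd (e (r, \<zero>\<^bsub>M2\<^esub>)) \<in> jrad M2"
        by (rule jrad_hom[OF r1 r2 mod_hom_comp[OF mod_hom_comp[OF m(3) e] m(2)]])
      from jrad_add[OF r2 this j2[OF rzc(2)]]
      have "z \<in> jrad M2" by (rule ssubst[where P = "\<lambda>u. u \<in> jrad M2", OF zeq])
      then show ?thesis using rz by simp
    qed
    have eF: "fst (e (\<zero>\<^bsub>M1\<^esub>, x)) \<in> jrad M1" if x: "x \<in> carrier M2" for x
    proof -
      obtain z r where rz: "e (\<zero>\<^bsub>M1\<^esub>, x) = (z, r)" by (cases "e (\<zero>\<^bsub>M1\<^esub>, x)")
      have rzc: "z \<in> carrier M1" "r \<in> carrier M2" using ec[of "(\<zero>\<^bsub>M1\<^esub>, x)"] x rz by auto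
      have "(z, r) = e (z, r)" using ee[of "(\<zero>\<^bsub>M1\<^esub>, x)"] x rz by simp
      then have zeq: "z = fst (e (z, \<zero>\<^bsub>M2\<^esub>)) \<oplus>\<^bsub>M1\<^esub> fst (e (\<zero>\<^bsub>M1\<^esub>, r))"
        using add[OF rzc] fs_add by (metis fst_conv)
      have "r \<in> jrad M2" using j2[OF x] rz by simp
      then have "fst (e (\<zero>\<^bsub>M1\<^esub>, r)) \<in> jrad M1"
        by (rule jrad_hom[OF r2 r1 mod_hom_comp[OF mod_hom_comp[OF m(4) e] m(1)]])
      from jrad_add[OF r1 j1[OF rzc(1)] this]
      have "z \<in> jrad M1" by (rule ssubst[where P = "\<lambda>u. u \<in> jrad M1", OF zeq])
      then show ?thesis using rz by simp
    qed
    have pairJ: "u \<in> jrad ?D" if "fst u \<in> jrad M1" "snd u \<in> jrad M2" for u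
    proof -
      have "(fst u, \<zero>\<^bsub>M2\<^esub>) \<in> jrad ?D" by (rule jrad_hom[OF r1 D m(3) that(1)])
      moreover have "(\<zero>\<^bsub>M1\<^esub>, snd u) \<in> jrad ?D" by (rule jrad_hom[OF r2 D m(4) that(2)])
      ultimately have "(fst u, \<zero>\<^bsub>M2\<^esub>) \<oplus>\<^bsub>?D\<^esub> (\<zero>\<^bsub>M1\<^esub>, snd u) \<in> jrad ?D" by (rule jrad_add[OF D])
      then show ?thesis using jrad_carrier[OF r1 that(1)] jrad_carrier[OF r2 that(2)] by simp
    qed
    have eJ: "e x \<in> jrad ?D" if "x \<in> carrier ?D" for x
    proof -
      obtain u v where x: "x = (u, v)" "u \<in> carrier M1" "v \<in> carrier M2" using \<open>x \<in> carrier ?D\<close> by auto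
      have "e (u, \<zero>\<^bsub>M2\<^esub>) \<in> jrad ?D" by (rule pairJ[OF j1[OF x(2)] eS[OF x(2)]])
      moreover have "e (\<zero>\<^bsub>M1\<^esub>, v) \<in> jrad ?D" by (rule pairJ[OF eF[OF x(3)] j2[OF x(3)]])
      ultimately show ?thesis unfolding x(1) add[OF x(2,3)] by (rule jrad_add[OF D])
    qed
    have "n = \<zero>\<^bsub>N\<^esub>" if n: "n \<in> carrier N" for n
    proof -
      have qn: "q n \<in> carrier ?D" using mod_homD(1)[OF q n] .
      have "e (q n) = q n" using pq[OF n] by (simp add: e_def)
      then have qj: "q n \<in> jrad ?D" using eJ[OF qn] by simp
      have "e (q n) = \<zero>\<^bsub>?D\<^esub>" by (rule jrad_annihilate[OF D D e _ qj]) (rule eJ)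
      then have "q n = \<zero>\<^bsub>?D\<^esub>" using \<open>e (q n) = q n\<close> by simp
      then show ?thesis using pq[OF n] mod_hom_zero[OF D N(1) p] by simp
    qed
    then have "carrier N = {\<zero>\<^bsub>N\<^esub>}" using N.M.zero_closed by blast
    then show ?thesis using N(2) by (simp add: indecomposable_def)
  qed
qed

text \<open>By the preceding result the indecomposable summands are the two given modules up to
  isomorphism, and isomorphic modules have the same class.\<close>

lemma add_span_brick_pair:
  assumes M1: "M1 \<in> fg_modules R" "brick_mod M1" "carrier M1 \<noteq> {\<zero>\<^bsub>M1\<^esub>}"
    and M2: "M2 \<in> fg_modules R" "brick_mod M2" "carrier M2 \<noteq> {\<zero>\<^bsub>M2\<^esub>}"
    and M: "M \<in> fg_modules R" "mod_iso R M (direct_sum M1 M2)"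
  shows "add_span R M = generate (K0 R) {K0_class R M1, K0_class R M2}"
proof -
  have r1: "right_module R M1" and r2: "right_module R M2" and rM: "right_module R M"
    using fgD M1(1) M2(1) M(1) by auto
  have ind: "indecomposable R M1" "indecomposable R M2"
    using brick_indecomposable[OF r1 M1(2,3)] brick_indecomposable[OF r2 M2(2,3)] .
  have "(\<lambda>(x, y). (y, x)) \<in> mod_hom R (direct_sum M1 M2) (direct_sum M2 M1)"
    by (auto simp: mod_hom_def)
  moreover have "bij_betw (\<lambda>(x, y). (y, x)) (carrier (direct_sum M1 M2)) (carrier (direct_sum M2 M1))"
    by (auto simp: bij_betw_def inj_on_def)
  ultimately have "mod_iso R (direct_sum M1 M2) (direct_sum M2 M1)" unfolding mod_iso_def by blast
  then have M': "mod_iso R M (direct_sum M2 M1)" by (rule mod_iso_trans[OF M(2)])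
  have cls: "K0_class R N = K0_class R L" if "N \<in> fg_modules R" "L \<in> fg_modules R" "mod_iso R N L" for N L
  proof -
    have d: "frag_of N - frag_of L \<in> K0_rels R" using iso_rels[OF that] .
    have "\<exists>k\<in>K0_rels R. h + frag_of N = k + frag_of L" if "h \<in> K0_rels R" for h
      using K0_rels_closed(2)[OF that d] by (intro bexI[of _ "h + (frag_of N - frag_of L)"]) simp_all
    moreover have "\<exists>k\<in>K0_rels R. h + frag_of L = k + frag_of N" if "h \<in> K0_rels R" for h
      using K0_rels_closed(4)[OF that d] by (intro bexI[of _ "h - (frag_of N - frag_of L)"]) simp_all
    ultimately show ?thesis unfolding K0_class_def r_coset_def mult_free_Abelian_group by fast
  qed
  have "{K0_class R N | N. N \<in> fg_modules R \<and> indecomposable R N \<and>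
        (\<exists>N'\<in>fg_modules R. mod_iso R M (direct_sum N N'))} = {K0_class R M1, K0_class R M2}"
  proof (intro equalityI subsetI)
    fix y assume "y \<in> {K0_class R N | N. N \<in> fg_modules R \<and> indecomposable R N \<and>
        (\<exists>N'\<in>fg_modules R. mod_iso R M (direct_sum N N'))}"
    then obtain N N' where N: "y = K0_class R N" "N \<in> fg_modules R" "indecomposable R N" "N' \<in> fg_modules R"
      "mod_iso R M (direct_sum N N')" by blast
    have "mod_iso R (direct_sum M1 M2) (direct_sum N N')"
      by (rule mod_iso_trans[OF mod_iso_sym[OF rM M(2)] N(5)])
    from brick_pair_summand[OF M1 M2 fgD(1)[OF N(2)] N(3) fgD(1)[OF N(4)] this]
    show "y \<in> {K0_class R M1, K0_class R M2}"
      using cls[OF M1(1) N(2)] cls[OF M2(1) N(2)] N(1) by auto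
  next
    fix y assume "y \<in> {K0_class R M1, K0_class R M2}"
    then show "y \<in> {K0_class R N | N. N \<in> fg_modules R \<and> indecomposable R N \<and>
        (\<exists>N'\<in>fg_modules R. mod_iso R M (direct_sum N N'))}"
      using M1(1) M2(1) ind M(2) M' by blast
  qed
  then show ?thesis unfolding add_span_def by (rule arg_cong[where f = "generate (K0 R)"])
qed

end

section \<open>Endomorphisms of basis modules\<close>

context quiver_alg
begin

text \<open>Transports the property from a concrete basis module to its copy in the universe of
  \<open>K0\<close>.\<close>

lemma brick_iso:
  assumes M: "right_module R M" and N: "right_module R N" and iso: "mod_iso R M N"
    and br: "\<And>f. f \<in> mod_hom R M M \<Longrightarrow>
      \<exists>c. \<forall>x\<in>carrier M. \<exists>n\<in>jrad M. f x = n \<oplus>\<^bsub>M\<^esub> sc c \<odot>\<^bsub>M\<^esub> x"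
  shows "brick_mod N"
  unfolding brick_mod_def
proof
  fix h assume h: "h \<in> mod_hom R N N"
  interpret M: right_module R M by (rule M)
  interpret N: right_module R N by (rule N)
  obtain \<phi> where \<phi>: "\<phi> \<in> mod_hom R M N" "bij_betw \<phi> (carrier M) (carrier N)"
    using iso by (auto simp: mod_iso_def)
  let ?\<psi> = "inv_into (carrier M) \<phi>"
  have \<psi>: "?\<psi> \<in> mod_hom R N M" by (rule mod_hom_inv[OF M \<phi>])
  have \<phi>\<psi>: "\<phi> (?\<psi> y) = y" if "y \<in> carrier N" for y
  proof -
    have "y \<in> \<phi> ` carrier M" using \<phi>(2) that by (simp add: bij_betw_def)
    then show ?thesis by (rule f_inv_into_f)
  qed
  have "(\<lambda>x. ?\<psi> (h (\<phi> x))) \<in> mod_hom R M M"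
    by (rule mod_hom_comp[OF mod_hom_comp[OF \<phi>(1) h] \<psi>])
  from br[OF this] obtain c where
    c: "\<forall>x\<in>carrier M. \<exists>n\<in>jrad M. ?\<psi> (h (\<phi> x)) = n \<oplus>\<^bsub>M\<^esub> sc c \<odot>\<^bsub>M\<^esub> x" by (elim exE)
  have "h y \<ominus>\<^bsub>N\<^esub> sc c \<odot>\<^bsub>N\<^esub> y \<in> jrad N" if y: "y \<in> carrier N" for y
  proof -
    have x: "?\<psi> y \<in> carrier M" by (rule mod_homD(1)[OF \<psi> y])
    obtain n where n: "n \<in> jrad M" "?\<psi> (h y) = n \<oplus>\<^bsub>M\<^esub> sc c \<odot>\<^bsub>M\<^esub> ?\<psi> y"
      using bspec[OF c x] unfolding \<phi>\<psi>[OF y] by (elim bexE)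
    have nc: "n \<in> carrier M" by (rule jrad_carrier[OF M n(1)])
    have "h y = \<phi> (?\<psi> (h y))" using \<phi>\<psi>[OF mod_homD(1)[OF h y]] by simp
    also have "\<dots> = \<phi> n \<oplus>\<^bsub>N\<^esub> sc c \<odot>\<^bsub>N\<^esub> y"
      unfolding n(2) using mod_homD(2)[OF \<phi>(1) nc, of "sc c \<odot>\<^bsub>M\<^esub> ?\<psi> y"] mod_homD(3)[OF \<phi>(1) gens_closed(1) x]
        x \<phi>\<psi>[OF y] by simp
    finally have hy: "h y = \<phi> n \<oplus>\<^bsub>N\<^esub> sc c \<odot>\<^bsub>N\<^esub> y" .
    have "h y \<ominus>\<^bsub>N\<^esub> sc c \<odot>\<^bsub>N\<^esub> y = \<phi> n"
      unfolding hy using mod_homD(1)[OF \<phi>(1) nc] y by (simp add: a_minus_def N.M.a_assoc N.M.r_neg)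
    then show ?thesis using jrad_hom[OF M N \<phi>(1) n(1)] by simp
  qed
  then show "\<exists>c. \<forall>y\<in>carrier N. h y \<ominus>\<^bsub>N\<^esub> sc c \<odot>\<^bsub>N\<^esub> y \<in> jrad N" by blast
qed

text \<open>If \<alpha> sends u to b, then f(b) is f(u) moved by \<alpha>, so its coefficient at c
  is that of f(u) at the preimage of c. A bottom element reached by two arrows thus yields equations
  between matrix entries.\<close>

lemma mono_hom_coeff:
  assumes m: "mono_rep B lab pre" and f: "f \<in> mod_hom R (mono B lab pre) (mono B lab pre)"
    and \<alpha>: "\<alpha> \<in> arcs Q" and b: "b \<in> B" "pre \<alpha> b = Some u" and c: "c \<in> B"
  shows "f (unitf b) c = (case pre \<alpha> c of None \<Rightarrow> 0 | Some v \<Rightarrow> f (unitf u) v)"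
proof -
  have "unitf u \<in> fspace B" using mono_repD(3)[OF m \<alpha> b] by simp
  from rmod_homD(4)[OF rep_mono[OF m] rep_mono[OF m] f \<alpha> this]
  have "f (unitf b) = mY B pre \<alpha> (f (unitf u))" unfolding mY_unit[OF m \<alpha> b] .
  then show ?thesis using c by (simp add: mY_def)
qed

lemma mono_hom_lab:
  assumes m: "mono_rep B lab pre" and f: "f \<in> mod_hom R (mono B lab pre) (mono B lab pre)"
    and b: "b \<in> B" "lab c \<noteq> lab b"
  shows "f (unitf b) c = 0"
proof -
  have "mE lab (lab b) (unitf b) = unitf b" by (rule ext) (auto simp: mE_def unitf_def)
  then have "f (unitf b) = mE lab (lab b) (f (unitf b))"
    using rmod_homD(3)[OF rep_mono[OF m] rep_mono[OF m] f mono_repD(2)[OF m b(1)], of "unitf b"] b(1) by simp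
  then have "f (unitf b) c = mE lab (lab b) (f (unitf b)) c" by (rule fun_cong)
  then show ?thesis using b(2) by (simp add: mE_def)
qed

text \<open>The matrix on top elements decides: bottom elements have images with bottom coefficients
  only, and combinations of bottom elements lie in the radical.\<close>

lemma mono_scalar:
  assumes m: "mono_rep B lab pre" and f: "f \<in> mod_hom R (mono B lab pre) (mono B lab pre)"
    and s: "\<And>u v. u \<in> B \<Longrightarrow> v \<in> B \<Longrightarrow> \<not> bot pre u \<Longrightarrow> \<not> bot pre v \<Longrightarrow> f (unitf u) v = (if u = v then c else 0)"
    and x: "x \<in> fspace B"
  shows "\<exists>n\<in>jrad (mono B lab pre). f x = n \<oplus>\<^bsub>mono B lab pre\<^esub> sc c \<odot>\<^bsub>mono B lab pre\<^esub> x"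
proof -
  note r = rep_mono[OF m]
  have fin: "finite B" by (rule mono_repD(1)[OF m])
  have s': "f (unitf u) v = (if u = v then c else 0)" if "u \<in> B" "v \<in> B" "\<not> bot pre v" for u v
  proof (cases "bot pre u")
    case True
    then obtain \<alpha> u' where a: "\<alpha> \<in> arcs Q" "pre \<alpha> u = Some u'" by (auto simp: bot_def)
    have "pre \<alpha> v = None" using that(3) a(1) by (auto simp: bot_def)
    then show ?thesis using mono_hom_coeff[OF m f a(1) that(1) a(2) that(2)] True that(3) by auto
  qed (rule s[OF that(1,2) _ that(3)])
  obtain g where g: "flin g" "\<And>y. y \<in> fspace B \<Longrightarrow> g y = f y"
    using lin_on_extend[OF _ rmod_homD(1)[OF r r f]] subspace_fspace by blast
  have fx: "f x v = c * x v" if v: "v \<in> B" "\<not> bot pre v" for v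
  proof -
    have "f x = g (\<Sum>b\<in>B. fs (x b) (unitf b))" using g(2)[OF x] fspace_expand[OF fin x] by simp
    also have "\<dots> = (\<Sum>b\<in>B. fs (x b) (f (unitf b)))"
      unfolding flinD(4)[OF g(1)] by (rule sum.cong) (simp_all add: flinD(2)[OF g(1)] g(2))
    finally have "f x v = (\<Sum>b\<in>B. x b * f (unitf b) v)" by (simp add: sum_apply fs_apply)
    also have "\<dots> = (\<Sum>b\<in>B. if b = v then c * x v else 0)" by (rule sum.cong) (use s' v in auto)
    finally show ?thesis using fin v by simp
  qed
  have fB: "f x \<in> fspace B" using rmod_homD(2)[OF r r f] x by blast
  have n: "f x - fs c x \<in> fspace {b \<in> B. bot pre b}"
    unfolding fspace_def
  proof (intro CollectI allI impI)
    fix b assume "b \<notin> {b \<in> B. bot pre b}"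
    then show "(f x - fs c x) b = 0"
      using fx fspaceD[OF fB] fspaceD[OF x] by (cases "b \<in> B") (auto simp: fs_apply)
  qed
  show ?thesis
  proof (rule bexI)
    show "f x - fs c x \<in> jrad (mono B lab pre)" by (rule bottom_in_jrad[OF m n])
    show "f x = (f x - fs c x) \<oplus>\<^bsub>mono B lab pre\<^esub> sc c \<odot>\<^bsub>mono B lab pre\<^esub> x"
      unfolding rmod_simps rmod_sc[OF r x] by (simp only: diff_add_cancel)
  qed
qed

end

section \<open>Realising the values of the Igusa-Todorov function\<close>

lemma card_interval_compl: "a + b \<le> n \<Longrightarrow> card {k. k < n \<and> \<not> (a \<le> k \<and> k < a + b)} = n - b" for a b n :: nat
proof -
  assume a: "a + b \<le> n"
  have "{k. k < n \<and> \<not> (a \<le> k \<and> k < a + b)} = {..<n} - {a..<a + b}" by auto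
  also have "card \<dots> = card {..<n} - card {a..<a + b}" by (rule card_Diff_subset) (use a in auto)
  finally show ?thesis by simp
qed

text \<open>For a function \<open>g\<close> on the vertices the locale constructs a module with \<open>m = m0 + g i + g w\<close> top
  elements at \<open>i\<close> and at \<open>w\<close> and \<open>g p\<close> of them at every other vertex \<open>p\<close>.  The pair \<open>a1, b1\<close> identifies
  \<open>v\<^sub>k a1\<close> with \<open>w\<^sub>k b1\<close>, and \<open>a2, b2\<close> identifies \<open>v\<^sub>k\<^sub>+\<^sub>1 a2\<close> with \<open>w\<^sub>k b2\<close>, so an endomorphism acts
  on the tops at \<open>i\<close> and \<open>w\<close> by one matrix that commutes with a shift and is therefore a scalar; the
  identification of \<open>v\<^sub>k sh p\<close> with \<open>p\<^sub>k ow p\<close> transports that scalar to \<open>p\<close>.  The remaining arrows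
  at \<open>i\<close> and \<open>w\<close> kill exactly \<open>g i\<close> and \<open>g w\<close> of the tops, which makes \<open>g\<close> visible in \<open>K\<^sub>0\<close>, whereas the
  shared arrows make the syzygy depend on \<open>g\<close> only through \<open>Tm g\<close>.\<close>

locale brick_quiver = quiver_alg_nosink Q R for Q :: "('v, 'e) pre_digraph"
  and R :: "('v \<times> 'e list \<Rightarrow> 'k::field) set ring" +
  fixes i w :: 'v and a1 a2 b1 b2 :: 'e and sh ow :: "'v \<Rightarrow> 'e" and m0 :: nat
  assumes iw: "i \<in> verts Q" "w \<in> verts Q" "i \<noteq> w"
    and ab: "a1 \<in> arcs Q" "a2 \<in> arcs Q" "b1 \<in> arcs Q" "b2 \<in> arcs Q" "a1 \<noteq> a2" "b1 \<noteq> b2"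
      "tail Q a1 = i" "tail Q a2 = i" "tail Q b1 = w" "tail Q b2 = w" "head Q a1 = head Q b1" "head Q a2 = head Q b2"
    and so: "p \<in> verts Q \<Longrightarrow> p \<noteq> i \<Longrightarrow> p \<noteq> w \<Longrightarrow> sh p \<in> arcs Q \<and> ow p \<in> arcs Q \<and>
      tail Q (sh p) = i \<and> tail Q (ow p) = p \<and> head Q (sh p) = head Q (ow p)"
    and m0: "1 \<le> m0"
    and deg: "p \<in> verts Q \<Longrightarrow> 3 \<le> card (out_arcs Q p)"
begin

definition mm :: "('v \<Rightarrow> nat) \<Rightarrow> nat" where "mm g = m0 + g i + g w"

definition ntop :: "('v \<Rightarrow> nat) \<Rightarrow> 'v \<Rightarrow> nat" where
  "ntop g p = (if p = i \<or> p = w then mm g else g p)"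

text \<open>Marks the bottom basis elements, indexed by an arrow \<gamma> from i or w and the index
  k of a top element. The intervals from m0 on are the tops killed by the unshared arrows. At w,
  \<open>b1\<close> owns no element and \<open>b2\<close> only the last one, as the others are
  identified with elements of \<open>a1\<close> and \<open>a2\<close>.\<close>

definition isb :: "('v \<Rightarrow> nat) \<Rightarrow> 'e \<Rightarrow> nat \<Rightarrow> bool" where
  "isb g \<gamma> k \<longleftrightarrow> \<gamma> \<in> arcs Q \<and> k < mm g \<and>
     (tail Q \<gamma> = i \<and> (\<gamma> = a1 \<or> \<gamma> = a2 \<or> \<not> (m0 \<le> k \<and> k < m0 + g i)) \<or>
      tail Q \<gamma> = w \<and> (\<gamma> = b2 \<and> Suc k = mm g \<or> \<gamma> \<noteq> b1 \<and> \<gamma> \<noteq> b2 \<and> \<not> (m0 \<le> k \<and> k < m0 + g w)))"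

definition BS :: "('v \<Rightarrow> nat) \<Rightarrow> (('v \<times> nat) + ('e \<times> nat)) set" where
  "BS g = {Inl (p, k) | p k. p \<in> verts Q \<and> k < ntop g p} \<union> {Inr (\<gamma>, k) | \<gamma> k. isb g \<gamma> k}"

definition lb :: "('v \<times> nat) + ('e \<times> nat) \<Rightarrow> 'v" where
  "lb = case_sum fst (\<lambda>b. head Q (fst b))"

text \<open>The chain tying the tops together has two loose ends: the element of \<open>a2\<close>
  with index 0 is not reached by \<open>b2\<close>, and the last element of \<open>b2\<close> is not
  reached by \<open>a2\<close>. They are what makes endomorphisms scalar.\<close>

definition pr :: "('v \<Rightarrow> nat) \<Rightarrow> 'e \<Rightarrow> ('v \<times> nat) + ('e \<times> nat) \<Rightarrow> (('v \<times> nat) + ('e \<times> nat)) option" where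
  "pr g \<delta> = case_sum (\<lambda>_. None) (\<lambda>(\<gamma>, k). (if \<delta> = \<gamma> then Some (Inl (tail Q \<gamma>, k))
     else if \<delta> = b1 \<and> \<gamma> = a1 then Some (Inl (w, k))
     else if \<delta> = b2 \<and> \<gamma> = a2 \<and> 0 < k then Some (Inl (w, k - 1))
     else if tail Q \<delta> \<noteq> i \<and> tail Q \<delta> \<noteq> w \<and> \<delta> = ow (tail Q \<delta>) \<and> \<gamma> = sh (tail Q \<delta>) \<and> k < g (tail Q \<delta>)
     then Some (Inl (tail Q \<delta>, k)) else None))"

lemma pr_simps [simp]:
  "pr g \<delta> (Inl x) = None"
  "pr g \<delta> (Inr (\<gamma>, k)) =
    (if \<delta> = \<gamma> then Some (Inl (tail Q \<gamma>, k))
     else if \<delta> = b1 \<and> \<gamma> = a1 then Some (Inl (w, k))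
     else if \<delta> = b2 \<and> \<gamma> = a2 \<and> 0 < k then Some (Inl (w, k - 1))
     else if tail Q \<delta> \<noteq> i \<and> tail Q \<delta> \<noteq> w \<and> \<delta> = ow (tail Q \<delta>) \<and> \<gamma> = sh (tail Q \<delta>) \<and> k < g (tail Q \<delta>)
     then Some (Inl (tail Q \<delta>, k)) else None)"
  by (simp_all add: pr_def)

lemma BS_iff [simp]: "Inl (p, k) \<in> BS g \<longleftrightarrow> p \<in> verts Q \<and> k < ntop g p" "Inr (\<gamma>, k) \<in> BS g \<longleftrightarrow> isb g \<gamma> k"
  by (auto simp: BS_def)

lemma lb_simps [simp]: "lb (Inl (p, k)) = p" "lb (Inr (\<gamma>, k)) = head Q \<gamma>"
  by (simp_all add: lb_def)

lemma isbD: "isb g \<gamma> k \<Longrightarrow> \<gamma> \<in> arcs Q \<and> k < mm g \<and> (tail Q \<gamma> = i \<or> tail Q \<gamma> = w)"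
  by (auto simp: isb_def)

lemma pr_cases:
  assumes \<delta>: "\<delta> \<in> arcs Q" and p: "pr g \<delta> b = Some b'" "b \<in> BS g"
  obtains (own) k where "b = Inr (\<delta>, k)" "b' = Inl (tail Q \<delta>, k)" "tail Q \<delta> = i \<or> tail Q \<delta> = w"
  | (one) k where "\<delta> = b1" "b = Inr (a1, k)" "b' = Inl (w, k)"
  | (two) k where "\<delta> = b2" "b = Inr (a2, Suc k)" "b' = Inl (w, k)"
  | (oth) q k where "q \<in> verts Q" "q \<noteq> i" "q \<noteq> w" "\<delta> = ow q" "b = Inr (sh q, k)" "b' = Inl (q, k)" "k < g q"
proof (cases b)
  case (Inl x)
  then show thesis using p by simp
next
  case (Inr x)
  then obtain \<gamma> k where b: "b = Inr (\<gamma>, k)" by (cases x) auto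
  have i: "isb g \<gamma> k" using p(2) b by simp
  consider "\<delta> = \<gamma>" | "\<delta> \<noteq> \<gamma>" "\<delta> = b1" "\<gamma> = a1" | "\<delta> \<noteq> \<gamma>" "\<not> (\<delta> = b1 \<and> \<gamma> = a1)" "\<delta> = b2" "\<gamma> = a2" "0 < k"
    | "\<delta> \<noteq> \<gamma>" "\<not> (\<delta> = b1 \<and> \<gamma> = a1)" "\<not> (\<delta> = b2 \<and> \<gamma> = a2 \<and> 0 < k)" by blast
  then show thesis
  proof cases
    case 1 then show thesis using own[of k] b p(1) isbD[OF i] by simp
  next
    case 2 then show thesis using one[of k] b p(1) by simp
  next
    case 3 then show thesis using two[of "k - 1"] b p(1) by (simp split: if_splits)
  next
    case 4
    have "tail Q \<delta> \<in> verts Q" using \<delta> by simp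
    with 4 show thesis using oth[of "tail Q \<delta>" k] b p(1) by (simp split: if_splits)
  qed
qed

lemma finite_BS: "finite (BS g)"
proof -
  have "BS g \<subseteq> Inl ` (SIGMA p:verts Q. {..<ntop g p}) \<union> Inr ` (arcs Q \<times> {..<mm g})"
    using isbD unfolding BS_def by auto
  then show ?thesis by (rule finite_subset) simp
qed

lemma mono_rep_BS: "mono_rep (BS g) lb (pr g)"
  unfolding mono_rep_def
proof (intro conjI ballI allI impI)
  show "finite (BS g)" by (rule finite_BS)
  show "lb ` BS g \<subseteq> verts Q" by (auto simp: BS_def isb_def)
  fix \<delta> b b' assume \<delta>: "\<delta> \<in> arcs Q" and b: "b \<in> BS g" and p: "pr g \<delta> b = Some b'"
  show "b' \<in> BS g"
    using \<delta> p b
  proof (cases rule: pr_cases)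
    case (oth q k) then show ?thesis by (simp add: ntop_def)
  qed (use b iw \<delta> in \<open>auto simp: ntop_def isb_def\<close>)
  show "lb b' = tail Q \<delta>" "lb b = head Q \<delta>"
    using pr_cases[OF \<delta> p b] so ab by (cases; auto)+
  show "pr g \<beta> b' = None" for \<beta> using pr_cases[OF \<delta> p b] by cases auto
  fix c assume c: "c \<in> BS g" and pc: "pr g \<delta> c = Some b'"
  have nb1: "\<not> isb g b1 k" for k using ab iw by (auto simp: isb_def)
  have nb2: "Suc k = mm g" if "isb g b2 k" for k using that ab iw by (auto simp: isb_def)
  have na: "k < mm g" if "isb g a2 k" for k using that by (auto simp: isb_def)
  show "c = b"
  proof -
    \<comment> \<open>Injectivity: the target is recovered from \<delta> and b'. For
      \<open>b2\<close> the last index goes to its own element and smaller ones to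
      \<open>a2\<close>, so the two options do not overlap.\<close>
    have "\<exists>k. b' = Inl (tail Q \<delta>, k) \<and>
      (d = Inr (\<delta>, k) \<and> \<delta> \<noteq> b1 \<and> (tail Q \<delta> = i \<or> tail Q \<delta> = w) \<and> (\<delta> = b2 \<longrightarrow> Suc k = mm g) \<or>
       d = Inr (a1, k) \<and> \<delta> = b1 \<or> d = Inr (a2, Suc k) \<and> \<delta> = b2 \<and> Suc k < mm g \<or>
       d = Inr (sh (tail Q \<delta>), k) \<and> tail Q \<delta> \<noteq> i \<and> tail Q \<delta> \<noteq> w)" if d: "d \<in> BS g" "pr g \<delta> d = Some b'" for d
      using \<delta> d(2,1)
    proof (cases rule: pr_cases)
      case (own k)
      then have "\<delta> \<noteq> b1" "\<delta> = b2 \<longrightarrow> Suc k = mm g" using d(1) nb1 nb2 by auto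
      then show ?thesis using own by blast
    next
      case (two k)
      then have "Suc k < mm g" using d(1) na by auto
      then show ?thesis using two ab by auto
    next
      case (oth q k)
      then show ?thesis using so by auto
    qed (use ab in auto)
    from this[OF b p] this[OF c pc] show ?thesis using ab iw by fastforce
  qed
qed

lemma bot_BS: "bot (pr g) (Inl x) \<longleftrightarrow> False" "isb g \<gamma> k \<Longrightarrow> bot (pr g) (Inr (\<gamma>, k))"
  unfolding bot_def using isbD[of g \<gamma> k] by auto

definition MM :: "('v \<Rightarrow> nat) \<Rightarrow> (('v \<times> 'e list \<Rightarrow> 'k) set, ('v \<times> nat) + ('e \<times> nat) \<Rightarrow> 'k) module" where
  "MM g = mono (BS g) lb (pr g)"

text \<open>The entries \<open>c k l\<close> on the tops at i govern everything. The pair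
  \<open>a1\<close>, \<open>b1\<close> copies them to w, the pair \<open>a2\<close>,
  \<open>b2\<close> makes them constant along diagonals, and the loose ends annihilate the first and
  the last column off the diagonal. The bound on g at other vertices keeps the indices there below
  the interval that starts at m0.\<close>

lemma brick_MM:
  assumes f: "f \<in> mod_hom R (MM g) (MM g)" and g: "\<And>p. p \<in> verts Q \<Longrightarrow> p \<noteq> i \<Longrightarrow> p \<noteq> w \<Longrightarrow> g p \<le> m0"
  shows "\<exists>c. \<forall>x\<in>carrier (MM g). \<exists>n\<in>jrad (MM g). f x = n \<oplus>\<^bsub>MM g\<^esub> sc c \<odot>\<^bsub>MM g\<^esub> x"
proof -
  note m = mono_rep_BS[of g] and f' = f[unfolded MM_def]
  note co = mono_hom_coeff[OF m f']
  define F where "F u v = f (unitf u) v" for u v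
  define c where "c k l = F (Inl (i, k)) (Inl (i, l))" for k l
  have e1: "F (Inr (a1, k)) (Inr (a1, l)) = c k l" if "k < mm g" "l < mm g" for k l
    using co[of a1 "Inr (a1, k)" "Inl (i, k)" "Inr (a1, l)"] that ab by (simp add: F_def c_def isb_def)
  have cw: "F (Inl (w, k)) (Inl (w, l)) = c k l" if "k < mm g" "l < mm g" for k l
    using co[of b1 "Inr (a1, k)" "Inl (w, k)" "Inr (a1, l)"] e1[OF that] that ab iw by (auto simp: F_def isb_def)
  have e2: "F (Inr (a2, k)) (Inr (a2, l)) = c k l" if "k < mm g" "l < mm g" for k l
    using co[of a2 "Inr (a2, k)" "Inl (i, k)" "Inr (a2, l)"] that ab by (simp add: F_def c_def isb_def)
  have e3: "F (Inr (a2, Suc k)) (Inr (a2, l)) = (if l = 0 then 0 else F (Inl (w, k)) (Inl (w, l - 1)))"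
    if "Suc k < mm g" "l < mm g" for k l
  proof -
    have "tail Q b2 \<noteq> tail Q a2" using ab iw by simp
    then have "b2 \<noteq> a2" by blast
    moreover have "isb g a2 (Suc k)" "isb g a2 l" using that ab by (simp_all add: isb_def)
    ultimately show ?thesis
      using co[of b2 "Inr (a2, Suc k)" "Inl (w, k)" "Inr (a2, l)"] ab by (auto simp: F_def)
  qed
  have sh1: "c (Suc k) (Suc l) = c k l" if "Suc k < mm g" "Suc l < mm g" for k l
    using e2[OF that] e3[OF that] cw[of k l] that by simp
  \<comment> \<open>First loose end: \<open>b2\<close> does not reach the element of
    \<open>a2\<close> with index 0.\<close>
  have sh2: "c (Suc k) 0 = 0" if "Suc k < mm g" for k
    using e2[of "Suc k" 0] e3[of k 0] that by simp
  \<comment> \<open>Second loose end: \<open>a2\<close> does not reach the last element of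
    \<open>b2\<close>.\<close>
  have sh3: "c k (mm g - 1) = 0" if k: "Suc k < mm g" for k
  proof -
    have t: "tail Q b2 \<noteq> tail Q a2" "tail Q b2 \<noteq> tail Q a1" using ab iw by auto
    then have n: "b2 \<noteq> a2" "a1 \<noteq> b2" by blast+
    have b: "isb g a2 (Suc k)" "isb g b2 (mm g - 1)" using k ab by (auto simp: isb_def)
    have "F (Inr (a2, Suc k)) (Inr (b2, mm g - 1)) = F (Inl (w, k)) (Inl (w, mm g - 1))"
      using co[of b2 "Inr (a2, Suc k)" "Inl (w, k)" "Inr (b2, mm g - 1)"] b n ab by (simp add: F_def)
    moreover have "F (Inr (a2, Suc k)) (Inr (b2, mm g - 1)) = 0"
      using co[of a2 "Inr (a2, Suc k)" "Inl (i, Suc k)" "Inr (b2, mm g - 1)"] b n ab t by (simp add: F_def)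
    ultimately show ?thesis using cw[of k "mm g - 1"] k by simp
  qed
  have diag: "c (k + s) (l + s) = c k l" if "k + s < mm g" "l + s < mm g" for k l s
    using that by (induction s) (use sh1 in auto)
  \<comment> \<open>An entry is moved along its diagonal to the first column if l < k and to the
    last column if k < l.\<close>
  have cs: "c k l = (if k = l then c 0 0 else 0)" if kl: "k < mm g" "l < mm g" for k l
  proof -
    consider "k = l" | "l < k" | "k < l" by linarith
    then show ?thesis
    proof cases
      case 1 then show ?thesis using diag[of 0 k 0] kl by simp
    next
      case 2
      then have "c k l = c (k - l) 0" using diag[of "k - l" l 0] kl by simp
      also have "\<dots> = 0" using sh2[of "k - Suc l"] 2 kl by (simp add: Suc_diff_Suc)
      finally show ?thesis using 2 by simp
    next
      case 3
      then have "c k l = c (k + (mm g - 1 - l)) (mm g - 1)" using diag[of k "mm g - 1 - l" l] kl by simp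
      also have "\<dots> = 0" by (rule sh3) (use 3 kl in linarith)
      finally show ?thesis using 3 by simp
    qed
  qed
  have cp: "F (Inl (p, k)) (Inl (p, l)) = c k l" if p: "p \<in> verts Q" "p \<noteq> i" "p \<noteq> w" and kl: "k < g p" "l < g p" for p k l
  proof -
    note s = so[OF p]
    have le: "k < m0" "l < m0" using kl g[OF p] by auto
    then have km: "k < mm g" "l < mm g" by (auto simp: mm_def)
    \<comment> \<open>\<open>sh p\<close> may be an unshared arrow of i; it has bottom elements at
      both indices because these are below m0.\<close>
    have b: "isb g (sh p) k" "isb g (sh p) l" using s le km by (auto simp: isb_def)
    have "ow p \<noteq> sh p" "ow p \<noteq> b1" "ow p \<noteq> b2" using s p ab by auto
    then have "F (Inr (sh p, k)) (Inr (sh p, l)) = F (Inl (p, k)) (Inl (p, l))"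
      using co[of "ow p" "Inr (sh p, k)" "Inl (p, k)" "Inr (sh p, l)"] b s p kl by (simp add: F_def)
    moreover have "F (Inr (sh p, k)) (Inr (sh p, l)) = c k l"
      using co[of "sh p" "Inr (sh p, k)" "Inl (i, k)" "Inr (sh p, l)"] b s by (simp add: F_def c_def)
    ultimately show ?thesis by simp
  qed
  have "f (unitf u) v = (if u = v then c 0 0 else 0)"
    if uv: "u \<in> BS g" "v \<in> BS g" "\<not> bot (pr g) u" "\<not> bot (pr g) v" for u v
  proof -
    obtain p k where u: "u = Inl (p, k)" using uv(1,3) bot_BS(2) by (cases u) auto
    obtain q l where v: "v = Inl (q, l)" using uv(2,4) bot_BS(2) by (cases v) auto
    show ?thesis
    proof (cases "p = q")
      case False
      then show ?thesis using mono_hom_lab[OF m f' uv(1), of v] u v by simp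
    next
      case True
      have k: "k < ntop g p" "l < ntop g p" "p \<in> verts Q" using uv(1,2) u v True by auto
      have g': "ntop g p \<le> mm g" using g[OF k(3)] by (auto simp: ntop_def mm_def)
      consider "p = i" | "p = w" | "p \<noteq> i" "p \<noteq> w" by blast
      then have "F u v = c k l"
      proof cases
        case 1
        then show ?thesis unfolding u v True[symmetric] c_def by simp
      next
        case 2
        then have "k < mm g" "l < mm g" using k by (simp_all add: ntop_def)
        then show ?thesis unfolding u v True[symmetric] 2 by (rule cw)
      next
        case 3
        then have "k < g p" "l < g p" using k by (simp_all add: ntop_def)
        then show ?thesis unfolding u v True[symmetric] by (rule cp[OF k(3) 3])
      qed
      then show ?thesis using cs[of k l] k g' u v True by (simp add: F_def)
    qed
  qed
  then have "\<forall>x\<in>fspace (BS g). \<exists>n\<in>jrad (MM g). f x = n \<oplus>\<^bsub>MM g\<^esub> sc (c 0 0) \<odot>\<^bsub>MM g\<^esub> x"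
    unfolding MM_def by (intro ballI mono_scalar[OF m f']) auto
  then show ?thesis unfolding MM_def rmod_simps by blast
qed

lemma MM_fg: "um (MM g) \<in> fg_modules R" "mod_iso R (MM g) (um (MM g))"
  unfolding MM_def by (rule um_rep[OF rep_mono[OF mono_rep_BS]])+

lemma right_module_MM: "right_module R (MM g)"
  unfolding MM_def by (rule right_module_rmod[OF rep_mono[OF mono_rep_BS]])

lemma brick_um_MM:
  assumes "\<And>p. p \<in> verts Q \<Longrightarrow> p \<noteq> i \<Longrightarrow> p \<noteq> w \<Longrightarrow> g p \<le> m0"
  shows "brick_mod (um (MM g))"
  by (rule brick_iso[OF right_module_MM fgD(1)[OF MM_fg(1)] MM_fg(2)]) (rule brick_MM[OF _ assms])

lemma um_MM_nonzero: "carrier (um (MM g)) \<noteq> {\<zero>\<^bsub>um (MM g)\<^esub>}"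
proof
  assume z: "carrier (um (MM g)) = {\<zero>\<^bsub>um (MM g)\<^esub>}"
  obtain \<phi> where \<phi>: "\<phi> \<in> mod_hom R (MM g) (um (MM g))" "bij_betw \<phi> (carrier (MM g)) (carrier (um (MM g)))"
    using MM_fg(2) unfolding mod_iso_def by blast
  have "Inl (i, 0) \<in> BS g" using iw m0 by (simp add: ntop_def mm_def)
  then have u: "unitf (Inl (i, 0)) \<in> carrier (MM g)" and 0: "0 \<in> carrier (MM g)"
    unfolding MM_def rmod_simps using fv.subspace_0[OF subspace_fspace] by (simp_all only: unitf_in)
  have "\<phi> (unitf (Inl (i, 0))) = \<phi> 0" using mod_homD(1)[OF \<phi>(1) u] mod_homD(1)[OF \<phi>(1) 0] unfolding z by (metis singletonD)
  then have "unitf (Inl (i, 0)) = (0 :: ('v \<times> nat) + ('e \<times> nat) \<Rightarrow> 'k)" using \<phi>(2) u 0 unfolding bij_betw_def inj_on_def by blast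
  from fun_cong[OF this, of "Inl (i, 0)"] show False by (simp add: unitf_def)
qed

lemma card_tops: "card {b \<in> BS g. lb b = q \<and> \<not> bot (pr g) b} = (if q \<in> verts Q then ntop g q else 0)"
proof -
  have "{b \<in> BS g. lb b = q \<and> \<not> bot (pr g) b} = (\<lambda>k. Inl (q, k)) ` {k. q \<in> verts Q \<and> k < ntop g q}"
    using bot_BS unfolding BS_def by auto
  also have "card \<dots> = card {k. q \<in> verts Q \<and> k < ntop g q}" by (rule card_image) (auto simp: inj_on_def)
  finally show ?thesis by simp
qed

text \<open>Written as a deviation from an arrow that kills exactly g of the tops at its tail; only
  the four shared arrows need corrections.\<close>

lemma card_isb:
  assumes "\<gamma> \<in> arcs Q"
  shows "int (card {k. isb g \<gamma> k}) = int (ntop g (tail Q \<gamma>)) - int (g (tail Q \<gamma>)) +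
    (if \<gamma> = a1 then int (g i) else 0) + (if \<gamma> = a2 then int (g i) else 0) -
    (if \<gamma> = b1 then int m0 + int (g i) else 0) - (if \<gamma> = b2 then int m0 + int (g i) - 1 else 0)"
proof -
  have ne: "a1 \<noteq> b1" "a1 \<noteq> b2" "a2 \<noteq> b1" "a2 \<noteq> b2" using ab(7-10) iw(3) by auto
  consider "\<gamma> = a1 \<or> \<gamma> = a2" | "\<gamma> = b1" | "\<gamma> = b2" | "tail Q \<gamma> = i" "\<gamma> \<noteq> a1" "\<gamma> \<noteq> a2"
    | "tail Q \<gamma> = w" "\<gamma> \<noteq> b1" "\<gamma> \<noteq> b2" | "tail Q \<gamma> \<noteq> i" "tail Q \<gamma> \<noteq> w" by blast
  then show ?thesis
  proof cases
    case 1
    then have "{k. isb g \<gamma> k} = {..<mm g}" using assms ab by (auto simp: isb_def)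
    then show ?thesis using 1 ne ab by (auto simp: ntop_def)
  next
    case 2
    then have "{k. isb g \<gamma> k} = {}" using ab iw by (auto simp: isb_def)
    then show ?thesis using 2 ne ab iw by (simp add: ntop_def mm_def)
  next
    case 3
    have "1 \<le> mm g" using m0 by (simp add: mm_def)
    then have "{k. isb g \<gamma> k} = {mm g - 1}" using 3 ab iw by (auto simp: isb_def)
    then show ?thesis using 3 ne ab iw by (simp add: ntop_def mm_def)
  next
    case 4
    then have n: "\<gamma> \<noteq> b1" "\<gamma> \<noteq> b2" using ab iw by auto
    have "{k. isb g \<gamma> k} = {k. k < mm g \<and> \<not> (m0 \<le> k \<and> k < m0 + g i)}" using 4 assms iw by (auto simp: isb_def)
    then show ?thesis using 4 n card_interval_compl[of m0 "g i" "mm g"] by (simp add: ntop_def mm_def)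
  next
    case 5
    then have n: "\<gamma> \<noteq> a1" "\<gamma> \<noteq> a2" using ab iw by auto
    have "{k. isb g \<gamma> k} = {k. k < mm g \<and> \<not> (m0 \<le> k \<and> k < m0 + g w)}" using 5 assms iw by (auto simp: isb_def)
    then show ?thesis using 5 n card_interval_compl[of m0 "g w" "mm g"] by (simp add: ntop_def mm_def)
  next
    case 6
    then have n: "\<gamma> \<noteq> a1" "\<gamma> \<noteq> a2" "\<gamma> \<noteq> b1" "\<gamma> \<noteq> b2" using ab by auto
    have "{k. isb g \<gamma> k} = {}" using 6 by (auto simp: isb_def)
    then show ?thesis using 6 n by (simp add: ntop_def)
  qed
qed

lemma finite_in_arcs: "finite (in_arcs Q p)"
  by (rule finite_subset[OF _ finite_arcs]) auto

lemma card_bots: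
  "card {b \<in> BS g. lb b = p \<and> bot (pr g) b} = (\<Sum>\<gamma>\<in>in_arcs Q p. card {k. isb g \<gamma> k})"
proof -
  have "{b \<in> BS g. lb b = p \<and> bot (pr g) b} = Inr ` (SIGMA \<gamma>:in_arcs Q p. {k. isb g \<gamma> k})"
    using bot_BS isbD unfolding BS_def by fastforce
  also have "card \<dots> = card (SIGMA \<gamma>:in_arcs Q p. {k. isb g \<gamma> k})" by (rule card_image) simp
  also have "\<dots> = (\<Sum>\<gamma>\<in>in_arcs Q p. card {k. isb g \<gamma> k})"
  proof (rule card_SigmaI)
    have "{k. isb g \<gamma> k} \<subseteq> {..<mm g}" for \<gamma> using isbD by auto
    then show "\<forall>\<gamma>\<in>in_arcs Q p. finite {k. isb g \<gamma> k}" using finite_subset by blast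
  qed (rule finite_in_arcs)
  finally show ?thesis .
qed

definition u0 :: "'v \<Rightarrow> int" where
  "u0 p = (if head Q b1 = p then int m0 else 0) + (if head Q b2 = p then int m0 - 1 else 0)"

text \<open>Paired arrows have the same head, so the corrections by \<open>g i\<close> at
  \<open>a1\<close>, \<open>a2\<close> cancel against those at \<open>b1\<close>, \<open>b2\<close>;
  this is what the choice of \<open>mm\<close> achieves. The rest \<open>u0\<close> does not depend
  on g and drops out of the difference of two such modules.\<close>

lemma omM_MM: "omM (um (MM g)) p = Tm (\<lambda>v. int (g v)) p + u0 p"
proof -
  have "omM (um (MM g)) p = omr (fspace (BS g)) (mE lb) (mY (BS g) (pr g)) p"
    by (rule omM_eq[OF MM_fg(1) rep_mono[OF mono_rep_BS]]) (use MM_fg(2) in \<open>simp only: MM_def\<close>)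
  also have "\<dots> = (\<Sum>\<gamma>\<in>in_arcs Q p. int (ntop g (tail Q \<gamma>)) - int (card {k. isb g \<gamma> k}))"
    unfolding omr_mono[OF mono_rep_BS] card_tops card_bots of_nat_sum sum_subtractf
    by (rule arg_cong2[where f = minus]) (auto intro!: sum.cong)
  also have "\<dots> = (\<Sum>\<gamma>\<in>in_arcs Q p. int (g (tail Q \<gamma>)) -
      (if \<gamma> = a1 then int (g i) else 0) - (if \<gamma> = a2 then int (g i) else 0) +
      (if \<gamma> = b1 then int m0 + int (g i) else 0) + (if \<gamma> = b2 then int m0 + int (g i) - 1 else 0))"
    by (rule sum.cong) (auto simp: card_isb)
  also have "\<dots> = Tm (\<lambda>v. int (g v)) p + u0 p"
    unfolding sum_subtractf sum.distrib Tm_def u0_def using ab by (simp add: sum.delta[OF finite_in_arcs])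
  finally show ?thesis .
qed

text \<open>The arrows at p left over from the identifications: at every vertex they all kill the
  same \<open>g p\<close> tops. Outdegree at least three ensures that some arrow is left.\<close>

definition Cv :: "'v \<Rightarrow> 'e set" where
  "Cv p = out_arcs Q p - (if p = i then {a1, a2} else if p = w then {b1, b2} else {ow p})"

lemma Cv: assumes "p \<in> verts Q" shows "Cv p \<subseteq> arcs Q" "\<exists>\<gamma>. \<gamma> \<in> Cv p \<and> tail Q \<gamma> = p"
proof -
  show "Cv p \<subseteq> arcs Q" by (auto simp: Cv_def)
  let ?D = "if p = i then {a1, a2} else if p = w then {b1, b2} else {ow p}"
  have "card ?D \<le> 2" using card_insert_le_m1[of 2 "{a2}" a1] card_insert_le_m1[of 2 "{b2}" b1] by auto
  then have "card ?D < card (out_arcs Q p)" using deg[OF assms] by linarith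
  then have "\<not> out_arcs Q p \<subseteq> ?D" using card_mono[of ?D "out_arcs Q p"] by (auto simp: not_le)
  then show "\<exists>\<gamma>. \<gamma> \<in> Cv p \<and> tail Q \<gamma> = p" unfolding Cv_def by auto
qed

text \<open>This invariant sees g itself and not merely \<open>Tm g\<close>, as is required to
  separate the classes when \<open>k = 0\<close>.\<close>

lemma nuM_MM: assumes p: "p \<in> verts Q" shows "nuM (Cv p) (um (MM g)) p = int (g p)"
proof -
  have 1: "nuM (Cv p) (um (MM g)) p = nur (Cv p) (fspace (BS g)) (mE lb) (mY (BS g) (pr g)) p"
    by (rule nuM_eq[OF MM_fg(1) rep_mono[OF mono_rep_BS] _ p Cv(1)[OF p]]) (use MM_fg(2) in \<open>simp only: MM_def\<close>)
  obtain \<gamma>0 where \<gamma>0: "\<gamma>0 \<in> Cv p" "tail Q \<gamma>0 = p" using Cv(2)[OF p] by blast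
  have act: "(\<forall>\<gamma>\<in>Cv p. \<forall>c\<in>BS g. pr g \<gamma> c \<noteq> Some (Inl (p, k))) \<longleftrightarrow>
      (if p = i then m0 \<le> k \<and> k < m0 + g i else if p = w then m0 \<le> k \<and> k < m0 + g w else True)"
    (is "?L \<longleftrightarrow> ?R") if k: "k < ntop g p" for k
  proof
    assume ?L
    then have "\<not> isb g \<gamma>0 k" using \<gamma>0 by (force dest: bspec[of _ _ "Inr (\<gamma>0, k)"])
    then show ?R using \<gamma>0 k iw by (auto simp: isb_def Cv_def ntop_def split: if_splits)
  next
    assume r: ?R
    show ?L
    proof (intro ballI notI)
      fix \<gamma> c assume \<gamma>: "\<gamma> \<in> Cv p" and c: "c \<in> BS g" "pr g \<gamma> c = Some (Inl (p, k))"
      have a: "\<gamma> \<in> arcs Q" "tail Q \<gamma> = p" using \<gamma> by (auto simp: Cv_def)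
      show False
        using a(1) c(2,1)
      proof (cases rule: pr_cases)
        case (own l)
        then show ?thesis using c(1) r \<gamma> a iw by (auto simp: isb_def Cv_def)
      next
        case (one l)
        then show ?thesis using \<gamma> ab iw by (auto simp: Cv_def)
      next
        case (two l)
        then show ?thesis using \<gamma> ab iw by (auto simp: Cv_def)
      next
        case (oth q l)
        then show ?thesis using \<gamma> by (auto simp: Cv_def)
      qed
    qed
  qed
  have inj: "inj_on (\<lambda>k. Inl (p, k) :: ('v \<times> nat) + ('e \<times> nat)) A" for A
    by (simp add: inj_on_def)
  define K where "K = {k. k < ntop g p \<and> (\<forall>\<gamma>\<in>Cv p. \<forall>c\<in>BS g. pr g \<gamma> c \<noteq> Some (Inl (p, k)))}"
  have "K = {k. k < ntop g p \<and> (if p = i then m0 \<le> k \<and> k < m0 + g i else if p = w then m0 \<le> k \<and> k < m0 + g w else True)}"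
    unfolding K_def by (rule Collect_cong, rule conj_cong[OF refl]) (rule act)
  then have "K = (if p = i then {m0..<m0 + g i} else if p = w then {m0..<m0 + g w} else {..<g p})"
    by (auto simp: ntop_def mm_def)
  then have cK: "card K = g p" by simp
  have "{b \<in> BS g. lb b = p \<and> \<not> bot (pr g) b \<and> (\<forall>\<gamma>\<in>Cv p. \<forall>c\<in>BS g. pr g \<gamma> c \<noteq> Some b)} = (\<lambda>k. Inl (p, k)) ` K"
    (is "?S = _")
  proof (intro equalityI subsetI)
    fix b assume b: "b \<in> ?S"
    obtain k where "b = Inl (p, k)" "k < ntop g p" using b bot_BS(2) unfolding BS_def by fastforce
    then show "b \<in> (\<lambda>k. Inl (p, k)) ` K" using b unfolding K_def by blast
  next
    fix b :: "('v \<times> nat) + ('e \<times> nat)" assume "b \<in> (\<lambda>k. Inl (p, k)) ` K"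
    then obtain k where b: "b = Inl (p, k)" "k < ntop g p" "\<forall>\<gamma>\<in>Cv p. \<forall>c\<in>BS g. pr g \<gamma> c \<noteq> Some (Inl (p, k))"
      unfolding K_def by blast
    show "b \<in> ?S"
      unfolding b(1) by (intro CollectI conjI b(3)) (use b(2) p bot_BS(1) in simp_all)
  qed
  then have "card ?S = g p" using card_image[OF inj, of K] cK by (simp only:)
  then show ?thesis unfolding 1 nur_mono[OF mono_rep_BS Cv(1)[OF p]] by (simp only:)
qed

end

section \<open>From a kernel vector to a module with prescribed value\<close>

context brick_quiver
begin

lemma ds_fg: "um (direct_sum (MM g) (MM h)) \<in> fg_modules R" "mod_iso R (direct_sum (MM g) (MM h)) (um (direct_sum (MM g) (MM h)))"
proof -
  \<comment> \<open>finite generation comes from a basis representation on the disjoint union of the two bases\<close>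
  let ?B = "BS g <+> BS h" and ?l = "case_sum lb lb"
  let ?p = "\<lambda>\<alpha>. case_sum (\<lambda>b. map_option Inl (pr g \<alpha> b)) (\<lambda>b. map_option Inr (pr h \<alpha> b))"
  note mg = mono_rep_BS[of g] and mh = mono_rep_BS[of h]
  have m: "mono_rep ?B ?l ?p"
    unfolding mono_rep_def
  proof (intro conjI ballI allI impI)
    show "finite ?B" using finite_BS by simp
    show "?l ` ?B \<subseteq> verts Q" using mono_repD(2)[OF mg] mono_repD(2)[OF mh] by auto
    fix \<alpha> b b' assume \<alpha>: "\<alpha> \<in> arcs Q" and b: "b \<in> ?B" and p: "?p \<alpha> b = Some b'"
    show "b' \<in> ?B"
      using b p mono_repD(3)[OF mg \<alpha>] mono_repD(3)[OF mh \<alpha>] by (cases b) auto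
    show "?l b' = tail Q \<alpha>"
      using b p mono_repD(4)[OF mg \<alpha>] mono_repD(4)[OF mh \<alpha>] by (cases b) auto
    show "?l b = head Q \<alpha>"
      using b p mono_repD(5)[OF mg \<alpha>] mono_repD(5)[OF mh \<alpha>] by (cases b) auto
    show "?p \<beta> b' = None" if "\<beta> \<in> arcs Q" for \<beta>
      using b p mono_repD(6)[OF mg \<alpha> _ _ that] mono_repD(6)[OF mh \<alpha> _ _ that] by (cases b) auto
    show "c = b" if c: "c \<in> ?B" "?p \<alpha> c = Some b'" for c
    proof (cases b)
      case (Inl x)
      then obtain x' where x: "x \<in> BS g" "pr g \<alpha> x = Some x'" "b' = Inl x'" using b p by auto
      obtain y where "c = Inl y" "y \<in> BS g" "pr g \<alpha> y = Some x'" using c x(3) by (cases c) auto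
      then show ?thesis using mono_repD(7)[OF mg \<alpha> x(1,2)] Inl by blast
    next
      case (Inr x)
      then obtain x' where x: "x \<in> BS h" "pr h \<alpha> x = Some x'" "b' = Inr x'" using b p by auto
      obtain y where "c = Inr y" "y \<in> BS h" "pr h \<alpha> y = Some x'" using c x(3) by (cases c) auto
      then show ?thesis using mono_repD(7)[OF mh \<alpha> x(1,2)] Inr by blast
    qed
  qed
  note r = rep_mono[OF m] and rg = rep_mono[OF mg] and rh = rep_mono[OF mh]
  let ?M = "mono ?B ?l ?p" and ?D = "direct_sum (MM g) (MM h)"
  let ?\<Phi> = "\<lambda>x. (\<lambda>b. x (Inl b), \<lambda>b. x (Inr b))"
  have M: "right_module R ?M" by (rule right_module_rmod[OF r])
  have D: "right_module R ?D" by (rule right_module_direct_sum[OF right_module_MM right_module_MM])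
  have c: "(\<lambda>b. x (Inl b)) \<in> fspace (BS g)" "(\<lambda>b. x (Inr b)) \<in> fspace (BS h)"
    if "x \<in> fspace ?B" for x :: "_ \<Rightarrow> 'k"
    using that by (auto simp: fspace_def)
  have "?\<Phi> \<in> mod_hom R ?M ?D"
  proof (rule mod_homI_gens[OF M D])
    show "?\<Phi> \<in> carrier ?M \<rightarrow> carrier ?D" unfolding direct_sum_simps MM_def rmod_simps using c by blast
    fix x assume "x \<in> carrier ?M"
    then have x: "x \<in> fspace ?B" unfolding rmod_simps .
    show "?\<Phi> (x \<oplus>\<^bsub>?M\<^esub> y) = ?\<Phi> x \<oplus>\<^bsub>?D\<^esub> ?\<Phi> y" if "y \<in> carrier ?M" for y
      unfolding direct_sum_simps MM_def rmod_simps by (simp add: plus_fun_def)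
    show "?\<Phi> (sc c \<odot>\<^bsub>?M\<^esub> x) = sc c \<odot>\<^bsub>?D\<^esub> ?\<Phi> x" for c
      unfolding direct_sum_simps MM_def rmod_sc[OF r x] rmod_sc[OF rg c(1)[OF x]] rmod_sc[OF rh c(2)[OF x]]
      by (simp add: fs_def)
    show "?\<Phi> (ev v \<odot>\<^bsub>?M\<^esub> x) = ev v \<odot>\<^bsub>?D\<^esub> ?\<Phi> x" if "v \<in> verts Q" for v
      unfolding direct_sum_simps MM_def rmod_ev[OF that] by (simp add: mE_def)
    show "?\<Phi> (ar \<alpha> \<odot>\<^bsub>?M\<^esub> x) = ar \<alpha> \<odot>\<^bsub>?D\<^esub> ?\<Phi> x" if "\<alpha> \<in> arcs Q" for \<alpha>
    proof -
      have "mY ?B ?p \<alpha> x (Inl b) = mY (BS g) (pr g) \<alpha> (\<lambda>b. x (Inl b)) b" for b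
        by (cases "pr g \<alpha> b") (auto simp: mY_def)
      moreover have "mY ?B ?p \<alpha> x (Inr b) = mY (BS h) (pr h) \<alpha> (\<lambda>b. x (Inr b)) b" for b
        by (cases "pr h \<alpha> b") (auto simp: mY_def)
      ultimately show ?thesis unfolding direct_sum_simps MM_def rmod_ar[OF that] by presburger
    qed
  qed
  moreover have "bij_betw ?\<Phi> (carrier ?M) (carrier ?D)"
    unfolding bij_betw_def
  proof
    show "inj_on ?\<Phi> (carrier ?M)"
    proof (rule inj_onI)
      fix x y :: "_ \<Rightarrow> 'k" assume e: "?\<Phi> x = ?\<Phi> y"
      show "x = y"
      proof
        fix b show "x b = y b" using e by (cases b) (auto dest: fun_cong)
      qed
    qed
    show "?\<Phi> ` carrier ?M = carrier ?D"
    proof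
      show "?\<Phi> ` carrier ?M \<subseteq> carrier ?D" unfolding direct_sum_simps MM_def rmod_simps using c by blast
      show "carrier ?D \<subseteq> ?\<Phi> ` carrier ?M"
      proof
        fix z assume "z \<in> carrier ?D"
        then obtain x y where z: "z = (x, y)" "x \<in> fspace (BS g)" "y \<in> fspace (BS h)"
          unfolding direct_sum_simps MM_def rmod_simps by blast
        have xy: "case_sum x y \<in> fspace ?B"
          unfolding fspace_def
        proof (intro CollectI allI impI)
          fix b assume "b \<notin> ?B"
          then show "case_sum x y b = 0" using fspaceD[OF z(2)] fspaceD[OF z(3)] by (cases b) auto
        qed
        show "z \<in> ?\<Phi> ` carrier ?M" unfolding rmod_simps
          by (rule image_eqI[OF _ xy]) (simp add: z(1))
      qed
    qed
  qed
  ultimately have iso: "mod_iso R ?M ?D" unfolding mod_iso_def by blast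
  have "fin_gen R ?D" by (rule fin_gen_iso[OF M D iso fin_gen_rmod[OF r]])
  from um[OF D this] show "um ?D \<in> fg_modules R" "mod_iso R ?D (um ?D)" .
qed

text \<open>For y = g - h the syzygies of the two modules differ by \<open>Tm\<close> of y, so stage
  k of \<open>phi_pair\<close> is about \<open>Tm ^^ Suc k\<close> of y. When \<open>k = 0\<close>,
  the nonzero entry of y at v0 separates the classes through \<open>nuM\<close>.\<close>

lemma phi_attained:
  fixes g h :: "'v \<Rightarrow> nat"
  assumes bd: "\<And>p. g p \<le> m0" "\<And>p. h p \<le> m0"
    and eq: "\<And>v. v \<in> verts Q \<Longrightarrow> (Tm ^^ Suc k) (\<lambda>p. int (g p) - int (h p)) v = 0"
    and ne: "v0 \<in> verts Q" "(Tm ^^ k) (\<lambda>p. int (g p) - int (h p)) v0 \<noteq> 0"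
  shows "\<exists>M\<in>fg_modules R. phi R M = Suc k"
proof
  let ?D = "direct_sum (MM g) (MM h)" and ?g = "um (MM g)" and ?h = "um (MM h)"
  show fg: "um ?D \<in> fg_modules R" by (rule ds_fg(1))
  have D: "right_module R ?D" by (rule right_module_direct_sum[OF right_module_MM right_module_MM])
  have "mod_iso R (um ?D) ?D" by (rule mod_iso_sym[OF D ds_fg(2)])
  then have iso: "mod_iso R (um ?D) (direct_sum ?g ?h)"
    by (rule mod_iso_trans) (rule direct_sum_cong[OF MM_fg(2) MM_fg(2)])
  have br: "brick_mod ?g" "brick_mod ?h" using bd by (auto intro: brick_um_MM)
  have d: "(Tm ^^ n) (omM ?g) v - (Tm ^^ n) (omM ?h) v = (Tm ^^ Suc n) (\<lambda>p. int (g p) - int (h p)) v" for n v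
  proof -
    have "(\<lambda>v. 1 * omM ?g v + (-1) * omM ?h v) = Tm (\<lambda>p. 1 * int (g p) + (-1) * int (h p))"
      unfolding Tm_lin by (rule ext) (simp add: omM_MM)
    then have e: "(Tm ^^ n) (\<lambda>v. 1 * omM ?g v + (-1) * omM ?h v) = (Tm ^^ n) (Tm (\<lambda>p. int (g p) - int (h p)))"
      by simp
    have "(Tm ^^ n) (omM ?g) v - (Tm ^^ n) (omM ?h) v = (Tm ^^ n) (\<lambda>v. 1 * omM ?g v + (-1) * omM ?h v) v"
      unfolding Tm_pow_lin by simp
    then show ?thesis unfolding e funpow_Suc_right comp_def .
  qed
  show "phi R (um ?D) = Suc k"
  proof (rule phi_pair[OF MM_fg(1)[of g] MM_fg(1)[of h]])
    show "add_span R (um ?D) = generate (K0 R) {kap R (frag_of ?g), kap R (frag_of ?h)}"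
      using add_span_brick_pair[OF MM_fg(1) br(1) um_MM_nonzero MM_fg(1) br(2) um_MM_nonzero fg iso]
      unfolding K0_class_def .
    show "pos (omM ?g)"
    proof -
      have u: "0 \<le> u0 v" for v using m0 by (simp add: u0_def)
      have t: "0 \<le> Tm (\<lambda>v. int (g v)) v" for v unfolding Tm_def by (rule sum_nonneg) simp
      have "0 < u0 (head Q b1)" using m0 by (simp add: u0_def)
      then have "0 < omM ?g (head Q b1)" using t[of "head Q b1"] by (simp add: omM_MM)
      moreover have "head Q b1 \<in> verts Q" using ab by simp
      moreover have "0 \<le> omM ?g v" for v using t[of v] u[of v] by (simp add: omM_MM)
      ultimately show ?thesis unfolding pos_def by blast
    qed
    show "(Tm ^^ k) (omM ?g) v = (Tm ^^ k) (omM ?h) v" if "v \<in> verts Q" for v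
      using d[of k v] eq[OF that] by simp
    show "case k of 0 \<Rightarrow> kap R (frag_of ?g) \<noteq> kap R (frag_of ?h)
      | Suc j \<Rightarrow> \<exists>v\<in>verts Q. (Tm ^^ j) (omM ?g) v \<noteq> (Tm ^^ j) (omM ?h) v"
    proof (cases k)
      case 0
      have "kap R (frag_of ?g) \<noteq> kap R (frag_of ?h)"
      proof
        assume e: "kap R (frag_of ?g) = kap R (frag_of ?h)"
        obtain \<gamma> where \<gamma>: "\<gamma> \<in> Cv v0" "tail Q \<gamma> = v0" using Cv(2)[OF ne(1)] by blast
        have "ext (\<lambda>M. nuM (Cv v0) M v0) (frag_of ?g - frag_of ?h) = 0"
          by (rule ext_rels[OF e[unfolded kap_eq]])
            (use inv_additive(2)[OF _ _ _ _ ne(1) Cv(1)[OF ne(1)]] inv_projective(2)[OF _ _ Cv(1)[OF ne(1)] \<gamma>] in auto)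
        then show False using ne by (simp add: ext_simps nuM_MM 0)
      qed
      then show ?thesis using 0 by simp
    next
      case (Suc j)
      then show ?thesis using d[of j v0] ne by auto
    qed
  qed
qed

end

text \<open>A vector witnessing instability is split into its positive and negative parts, which
  serve as g and h. Its vertex \<open>v0\<close> takes the role of i. The outdegree bound leaves an
  arrow at each vertex besides two shared ones.\<close>

lemma no_gap_two_vertices:
  fixes Q :: "('v, 'e) pre_digraph"
  assumes quiver: "fin_digraph Q"
    and pairs: "\<And>v w. \<lbrakk>v \<in> verts Q; w \<in> verts Q; v \<noteq> w\<rbrakk> \<Longrightarrow>
      \<exists>\<alpha>\<^sub>1\<in>arcs Q. \<exists>\<alpha>\<^sub>2\<in>arcs Q. \<exists>\<beta>\<^sub>1\<in>arcs Q. \<exists>\<beta>\<^sub>2\<in>arcs Q.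
        card {\<alpha>\<^sub>1, \<alpha>\<^sub>2, \<beta>\<^sub>1, \<beta>\<^sub>2} = 4 \<and>
        tail Q \<alpha>\<^sub>1 = v \<and> tail Q \<alpha>\<^sub>2 = v \<and> tail Q \<beta>\<^sub>1 = w \<and> tail Q \<beta>\<^sub>2 = w \<and>
        head Q \<alpha>\<^sub>1 = head Q \<beta>\<^sub>1 \<and> head Q \<alpha>\<^sub>2 = head Q \<beta>\<^sub>2"
    and deg: "\<And>v. v \<in> verts Q \<Longrightarrow> 3 \<le> out_degree Q v"
  shows "\<not> (\<exists>t. is_gap (rad_sq_zero_algebra Q :: ('v \<times> 'e list \<Rightarrow> 'k::field) set ring) t)"
proof -
  interpret fin_digraph Q by (rule quiver)
  let ?R = "rad_sq_zero_algebra Q :: ('v \<times> 'e list \<Rightarrow> 'k) set ring"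
  interpret quiver_alg_nosink Q ?R
  proof unfold_locales
    show "out_arcs Q v \<noteq> {}" if "v \<in> verts Q" for v
      using deg[OF that] by (auto simp: out_degree_def)
  qed rule
  show ?thesis
  proof (rule no_gap_if)
    fix k assume "\<not> stable k"
    then obtain z v0 where z: "\<forall>v\<in>verts Q. (Tm ^^ Suc k) z v = 0" and v0: "v0 \<in> verts Q" "(Tm ^^ k) z v0 \<noteq> 0"
      unfolding stable_def by blast
    \<comment> \<open>On a single vertex T is multiplication by the number of loops, which is not
      zero, so every stage would be stable.\<close>
    have "verts Q \<noteq> {v0}"
    proof
      assume V: "verts Q = {v0}"
      have arcs: "in_arcs Q v0 = arcs Q" "out_arcs Q v0 = arcs Q"
        using tail_in_verts head_in_verts V by (auto simp: in_arcs_def out_arcs_def)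
      have "Tm ((Tm ^^ k) z) v0 = (\<Sum>\<alpha>\<in>arcs Q. (Tm ^^ k) z v0)"
        unfolding Tm_def arcs by (rule sum.cong) (use tail_in_verts V in auto)
      also have "\<dots> = int (card (arcs Q)) * (Tm ^^ k) z v0" by simp
      finally have "card (arcs Q) = 0" using z v0 by simp
      then show False using deg[OF v0(1)] arcs by (simp add: out_degree_def)
    qed
    then obtain w where w: "w \<in> verts Q" "w \<noteq> v0" using v0(1) by blast
    obtain a1 a2 b1 b2 where ab: "a1 \<in> arcs Q" "a2 \<in> arcs Q" "b1 \<in> arcs Q" "b2 \<in> arcs Q"
      "card {a1, a2, b1, b2} = 4" "tail Q a1 = v0" "tail Q a2 = v0" "tail Q b1 = w" "tail Q b2 = w"
      "head Q a1 = head Q b1" "head Q a2 = head Q b2"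
      using pairs[OF v0(1) w(1)] w(2) by blast
    have abn: "a1 \<noteq> a2" "b1 \<noteq> b2" using ab(5) by (auto simp: card_insert_if split: if_splits)
    have "\<exists>s r. s \<in> arcs Q \<and> r \<in> arcs Q \<and> tail Q s = v0 \<and> tail Q r = p \<and> head Q s = head Q r"
      if "p \<in> verts Q" "p \<noteq> v0" for p
      using pairs[OF v0(1) that(1)] that(2) by blast
    then obtain sh ow where so: "\<And>p. p \<in> verts Q \<Longrightarrow> p \<noteq> v0 \<Longrightarrow>
        sh p \<in> arcs Q \<and> ow p \<in> arcs Q \<and> tail Q (sh p) = v0 \<and> tail Q (ow p) = p \<and> head Q (sh p) = head Q (ow p)"
      by metis
    \<comment> \<open>Positive, as the locale demands, and at least as large as every entry of z in
      absolute value, which bounds both g and h.\<close>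
    define m0 where "m0 = Suc (\<Sum>v\<in>verts Q. nat \<bar>z v\<bar>)"
    define g where "g p = (if p \<in> verts Q then nat (z p) else 0)" for p
    define h where "h p = (if p \<in> verts Q then nat (- z p) else 0)" for p
    interpret brick_quiver Q ?R v0 w a1 a2 b1 b2 sh ow m0
    proof unfold_locales
      show "3 \<le> card (out_arcs Q p)" if "p \<in> verts Q" for p using deg[OF that] by (simp add: out_degree_def)
    qed (use v0 w ab abn so in \<open>auto simp: m0_def\<close>)
    have zm: "nat \<bar>z p\<bar> \<le> m0" if "p \<in> verts Q" for p
      unfolding m0_def by (rule le_SucI, rule member_le_sum) (use that finite_verts in auto)
    have gh: "int (g p) - int (h p) = z p" if "p \<in> verts Q" for p using that by (simp add: g_def h_def)
    show "\<exists>M\<in>fg_modules ?R. phi ?R M = Suc k"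
    proof (rule phi_attained[of g h k v0])
      show "g p \<le> m0" "h p \<le> m0" for p using zm[of p] by (auto simp: g_def h_def)
      show "(Tm ^^ Suc k) (\<lambda>p. int (g p) - int (h p)) v = 0" if "v \<in> verts Q" for v
        using z that Tm_pow_cong[of "\<lambda>p. int (g p) - int (h p)" z v "Suc k", OF gh that] by simp
      show "(Tm ^^ k) (\<lambda>p. int (g p) - int (h p)) v0 \<noteq> 0"
        using v0 Tm_pow_cong[of "\<lambda>p. int (g p) - int (h p)" z v0 k, OF gh v0(1)] by simp
    qed (rule v0(1))
  qed
qed

theorem theorem4p19:
  fixes Q :: "('v, 'e) pre_digraph"
  assumes quiver: "fin_digraph Q"
    and pairs: "\<And>v w. \<lbrakk>v \<in> verts Q; w \<in> verts Q; v \<noteq> w\<rbrakk> \<Longrightarrow>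
      \<exists>\<alpha>\<^sub>1\<in>arcs Q. \<exists>\<alpha>\<^sub>2\<in>arcs Q. \<exists>\<beta>\<^sub>1\<in>arcs Q. \<exists>\<beta>\<^sub>2\<in>arcs Q.
        card {\<alpha>\<^sub>1, \<alpha>\<^sub>2, \<beta>\<^sub>1, \<beta>\<^sub>2} = 4 \<and>
        tail Q \<alpha>\<^sub>1 = v \<and> tail Q \<alpha>\<^sub>2 = v \<and> tail Q \<beta>\<^sub>1 = w \<and> tail Q \<beta>\<^sub>2 = w \<and>
        head Q \<alpha>\<^sub>1 = head Q \<beta>\<^sub>1 \<and> head Q \<alpha>\<^sub>2 = head Q \<beta>\<^sub>2"
    and degrees:
      "(\<forall>v\<in>verts Q. 6 \<le> out_degree Q v) \<or>
       (\<forall>v\<in>verts Q. 4 \<le> out_degree Q v \<and>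
          (\<exists>\<alpha>\<in>arcs Q. \<exists>\<beta>\<in>arcs Q. \<alpha> \<noteq> \<beta> \<and>
             tail Q \<alpha> = v \<and> tail Q \<beta> = v \<and> head Q \<alpha> = head Q \<beta>))"
  shows "\<not> (\<exists>t. is_gap (rad_sq_zero_algebra Q :: ('v \<times> 'e list \<Rightarrow> 'k::field) set ring) t)"
  by (rule no_gap_two_vertices[OF quiver pairs]) (use degrees in fastforce)+

end
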